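(* Let $b:[0,T]\times\mathbb{R}\times\mathcal{P}_1(\mathbb{R})\to\mathbb{R}$ be such that: (1) (decomposable form) $b=\hat b+\tilde b$ with $\hat b,\tilde b:[0,T]\times\mathbb{R}\times\mathcal{P}_1(\mathbb{R})\to\mathbb{R}$ measurable, $\hat b$ bounded, and for some constant $C>0$ and all $t\in[0,T]$, $y,y_1,y_2\in\mathbb{R}$, $\mu\in\mathcal{P}_1(\mathbb{R})$: $|\tilde b(t,y,\mu)|\le C(1+|y|+\mathcal{K}(\mu,\delta_0))$ and $|\tilde b(t,y_1,\mu)-\tilde b(t,y_2,\mu)|\le C|y_1-y_2|$; (2) (uniform Lipschitz continuity in the third variable) there is a constant $C>0$ with $|b(t,y,\mu)-b(t,y,\nu)|\le C\,\mathcal{K}(\mu,\nu)$ for all $t\in[0,T]$, $y\in\mathbb{R}$, $\mu,\nu\in\mathcal{P}_1(\mathbb{R})$. For $x\in\mathbb{R}$ let $(X_t^x)_{t\in[0,T]}$ be the unique strong solution of $$dX_t^x=b(t,X_t^x,\mathbb{P}_{X_t^x})\,dt+dB_t,\quad X_0^x=x,\quad t\in[0,T],$$ and let $U\subset\mathbb{R}$ be an open and bounded subset. Then for every $t\in[0,T]$, $$(x\mapsto X_t^x)\in L^2\big(\Omega,W^{1,2}(U)\big).$$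
   Context: $T>0$ is a fixed time horizon. $\mathcal{P}_1(\mathbb{R})$ is the set of Borel probability measures $\mu$ on $\mathbb{R}$ with $\int|x|\,\mu(dx)<\infty$, endowed with the Kantorovich metric $\mathcal{K}(\lambda,\nu)=\sup\{|\int_{\mathbb{R}}h\,d(\lambda-\nu)| : h:\mathbb{R}\to\mathbb{R}\text{ Lipschitz with constant }1\}$; $\delta_0$ is the Dirac measure at $0$. $(\Omega,\mathcal{F},\mathbb{P})$ is a complete probability space carrying a one-dimensional Brownian motion $B=(B_t)_{t\in[0,T]}$, the same for all $x$. A strong solution of the mean-field SDE is a continuous real-valued process $X^x$, adapted to the $\mathbb{P}$-augmented filtration generated by $B$, whose laws $\mathbb{P}_{X_t^x}$ lie in $\mathcal{P}_1(\mathbb{R})$ for all $t$, and such that $\mathbb{P}$-a.s. $X_t^x=x+\int_0^t b(s,X_s^x,\mathbb{P}_{X_s^x})\,ds+B_t$ for $t\in[0,T]$; "unique" means pathwise unique (equivalently here, unique in law). $W^{1,2}(U)$ is the Sobolev space of $u\in L^2(U)$ with weak derivative $u'\in L^2(U)$, with norm $\|u\|_{W^{1,2}(U)}=\|u\|_{L^2(U)}+\|u'\|_{L^2(U)}$. *)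

theory Defs
  imports "HOL-Probability.Probability"
begin

section \<open>The space of Borel probability measures with finite first moment\<close>

definition P1 :: "real measure set" where
  "P1 = {\<mu>. sets \<mu> = sets borel \<and> prob_space \<mu> \<and> integrable \<mu> (\<lambda>x. \<bar>x\<bar>)}"

definition kantorovich :: "real measure \<Rightarrow> real measure \<Rightarrow> real" where
  "kantorovich \<mu> \<nu> =
     (if \<mu> \<in> P1 \<and> \<nu> \<in> P1
      then (SUP h\<in>{h :: real \<Rightarrow> real. 1-lipschitz_on UNIV h}. \<bar>(\<integral>x. h x \<partial>\<mu>) - (\<integral>x. h x \<partial>\<nu>)\<bar>)
      else 0)"

text \<open>
  The value 0 off \<^const>\<open>P1\<close> is only there because \<^locale>\<open>Metric_space\<close> asks for symmetry
  and nonnegativity everywhere. On \<^const>\<open>P1\<close> the supremum is over a bounded set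
  (\<open>kantorovich_bdd_above\<close>).
\<close>

lemma P1_integrable_lipschitz:
  assumes "\<mu> \<in> P1" "C-lipschitz_on UNIV (h :: real \<Rightarrow> real)"
  shows "integrable \<mu> h"
proof -
  interpret prob_space \<mu> using assms by (simp add: P1_def)
  have s [measurable_cong]: "sets \<mu> = sets borel" using assms by (simp add: P1_def)
  have "continuous_on UNIV h" using assms(2) by (rule lipschitz_on_continuous_on)
  then have m [measurable]: "h \<in> borel_measurable \<mu>"
    using borel_measurable_continuous_onI s measurable_cong_sets by blast
  have "integrable \<mu> (\<lambda>x. \<bar>h 0\<bar> + C * \<bar>x\<bar>)"
    using assms by (auto simp: P1_def)
  then show ?thesis
  proof (rule Bochner_Integration.integrable_bound)
    have "\<bar>h x\<bar> \<le> \<bar>\<bar>h 0\<bar> + C * \<bar>x\<bar>\<bar>" for x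
      using lipschitz_onD[OF assms(2), of x 0] by (simp add: dist_real_def)
    then show "AE x in \<mu>. norm (h x) \<le> norm (\<bar>h 0\<bar> + C * \<bar>x\<bar>)"
      by simp
  qed (rule m)
qed

lemma kantorovich_bdd_above:
  assumes "\<mu> \<in> P1" "\<nu> \<in> P1"
  shows "bdd_above ((\<lambda>h. \<bar>(\<integral>x. h x \<partial>\<mu>) - (\<integral>x. h x \<partial>\<nu>)\<bar>) ` {h :: real \<Rightarrow> real. 1-lipschitz_on UNIV h})"
proof (rule bdd_aboveI2)
  fix h :: "real \<Rightarrow> real" assume "h \<in> {h. 1-lipschitz_on UNIV h}"
  then have h: "1-lipschitz_on UNIV h" by simp
  have *: "\<bar>(\<integral>x. h x \<partial>\<rho>) - h 0\<bar> \<le> (\<integral>x. \<bar>x\<bar> \<partial>\<rho>)" if "\<rho> \<in> P1" for \<rho>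
  proof -
    interpret prob_space \<rho> using that by (simp add: P1_def)
    note i = P1_integrable_lipschitz[OF that h]
    have ix: "integrable \<rho> (\<lambda>x. \<bar>x\<bar>)" using that by (simp add: P1_def)
    have "(\<integral>x. h x \<partial>\<rho>) - h 0 = (\<integral>x. h x - h 0 \<partial>\<rho>)"
      using i by (simp add: prob_space)
    also have "\<bar>\<dots>\<bar> \<le> (\<integral>x. \<bar>h x - h 0\<bar> \<partial>\<rho>)"
      by (rule integral_abs_bound)
    also have "\<dots> \<le> (\<integral>x. \<bar>x\<bar> \<partial>\<rho>)"
      using lipschitz_onD[OF h, of _ 0] i ix
      by (intro integral_mono) (auto simp: dist_real_def)
    finally show ?thesis .
  qed
  show "\<bar>(\<integral>x. h x \<partial>\<mu>) - (\<integral>x. h x \<partial>\<nu>)\<bar> \<le> (\<integral>x. \<bar>x\<bar> \<partial>\<mu>) + (\<integral>x. \<bar>x\<bar> \<partial>\<nu>)"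
    using *[OF assms(1)] *[OF assms(2)] by linarith
qed

lemma kantorovich_upper:
  assumes "\<mu> \<in> P1" "\<nu> \<in> P1" "1-lipschitz_on UNIV (h :: real \<Rightarrow> real)"
  shows "\<bar>(\<integral>x. h x \<partial>\<mu>) - (\<integral>x. h x \<partial>\<nu>)\<bar> \<le> kantorovich \<mu> \<nu>"
  using cSUP_upper[OF _ kantorovich_bdd_above[OF assms(1,2)], of h] assms
  by (simp add: kantorovich_def)

lemma kantorovich_eq_0D:
  assumes P: "\<mu> \<in> P1" "\<nu> \<in> P1" and "kantorovich \<mu> \<nu> = 0"
  shows "\<mu> = \<nu>"
proof -
  have eq: "(\<integral>x. h x \<partial>\<mu>) = (\<integral>x. h x \<partial>\<nu>)" if "C-lipschitz_on UNIV h" for C and h :: "real \<Rightarrow> real"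
  proof -
    define D where "D = max C 1"
    have D: "D > 0" "D-lipschitz_on UNIV h"
      using that by (auto simp: D_def intro: lipschitz_on_le)
    then have "1-lipschitz_on UNIV (\<lambda>x. h x / D)"
      by (auto simp: lipschitz_on_def dist_real_def field_simps simp flip: diff_divide_distrib)
    from kantorovich_upper[OF P this] assms(3) D(1) show ?thesis by simp
  qed
  have rd: "real_distribution \<rho>" if "\<rho> \<in> P1" for \<rho>
    using that sets_eq_imp_space_eq[of \<rho> borel]
    by (auto simp: P1_def real_distribution_def real_distribution_axioms_def)
  have lip: "\<bar>t\<bar>-lipschitz_on UNIV (\<lambda>x::real. cos (t * x))"
            "\<bar>t\<bar>-lipschitz_on UNIV (\<lambda>x::real. sin (t * x))" for t :: real
  proof -
    have c: "1-lipschitz_on UNIV (cos :: real \<Rightarrow> real)"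
      by (rule bounded_derivative_imp_lipschitz[where f' = "\<lambda>x h. h * - sin x"])
         (auto intro!: derivative_eq_intros onorm_le simp: has_field_derivative_def abs_mult mult_left_le)
    have s: "1-lipschitz_on UNIV (sin :: real \<Rightarrow> real)"
      by (rule bounded_derivative_imp_lipschitz[where f' = "\<lambda>x h. h * cos x"])
         (auto intro!: derivative_eq_intros onorm_le simp: has_field_derivative_def abs_mult mult_left_le)
    have "dist (t * x) (t * y) = \<bar>t\<bar> * dist x y" for x y :: real
      by (simp add: dist_real_def abs_mult flip: right_diff_distrib)
    then show "\<bar>t\<bar>-lipschitz_on UNIV (\<lambda>x::real. cos (t * x))"
              "\<bar>t\<bar>-lipschitz_on UNIV (\<lambda>x::real. sin (t * x))"
      using lipschitz_onD[OF c, of "t * _" "t * _"] lipschitz_onD[OF s, of "t * _" "t * _"]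
      by (auto intro!: lipschitz_onI)
  qed
  have ch: "char \<rho> t = complex_of_real (\<integral>x. cos (t * x) \<partial>\<rho>) + \<i> * complex_of_real (\<integral>x. sin (t * x) \<partial>\<rho>)"
    if "\<rho> \<in> P1" for \<rho> t
  proof -
    have "char \<rho> t = (\<integral>x. complex_of_real (cos (t * x)) + \<i> * complex_of_real (sin (t * x)) \<partial>\<rho>)"
      unfolding char_def by (intro Bochner_Integration.integral_cong) (auto simp: exp_Euler sin_of_real cos_of_real simp flip: of_real_mult)
    also have "\<dots> = complex_of_real (\<integral>x. cos (t * x) \<partial>\<rho>) + \<i> * complex_of_real (\<integral>x. sin (t * x) \<partial>\<rho>)"
      using P1_integrable_lipschitz[OF that lip(1)] P1_integrable_lipschitz[OF that lip(2)]
      by simp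
    finally show ?thesis .
  qed
  have "char \<mu> = char \<nu>"
    unfolding fun_eq_iff ch[OF P(1)] ch[OF P(2)] using eq[OF lip(1)] eq[OF lip(2)] by simp
  then show ?thesis using Levy_uniqueness rd P by blast
qed

lemma Metric_space_P1: "Metric_space P1 kantorovich"
proof
  have nonempty: "{h :: real \<Rightarrow> real. 1-lipschitz_on UNIV h} \<noteq> {}"
    by (auto intro!: exI[of _ "\<lambda>_. 0"] lipschitz_onI)
  have sym: "kantorovich \<mu> \<nu> = kantorovich \<nu> \<mu>" for \<mu> \<nu>
    unfolding kantorovich_def by (auto simp: abs_minus_commute)
  have zero: "kantorovich \<mu> \<mu> = 0" for \<mu>
    unfolding kantorovich_def using nonempty by simp
  show "kantorovich \<mu> \<nu> = kantorovich \<nu> \<mu>" for \<mu> \<nu> by (rule sym)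
  show "0 \<le> kantorovich \<mu> \<nu>" for \<mu> \<nu>
  proof (cases "\<mu> \<in> P1 \<and> \<nu> \<in> P1")
    case True
    then show ?thesis
      using kantorovich_upper[of \<mu> \<nu> "\<lambda>_. 0"] by (simp add: lipschitz_on_def)
  qed (auto simp: kantorovich_def)
  show "kantorovich \<mu> \<nu> = 0 \<longleftrightarrow> \<mu> = \<nu>" if "\<mu> \<in> P1" "\<nu> \<in> P1" for \<mu> \<nu>
    using kantorovich_eq_0D that zero by auto
  show "kantorovich \<mu> \<rho> \<le> kantorovich \<mu> \<nu> + kantorovich \<nu> \<rho>"
    if P: "\<mu> \<in> P1" "\<nu> \<in> P1" "\<rho> \<in> P1" for \<mu> \<nu> \<rho>
  proof -
    have "\<bar>(\<integral>x. h x \<partial>\<mu>) - (\<integral>x. h x \<partial>\<rho>)\<bar> \<le> kantorovich \<mu> \<nu> + kantorovich \<nu> \<rho>"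
      if "1-lipschitz_on UNIV h" for h
      using kantorovich_upper[OF P(1,2) that] kantorovich_upper[OF P(2,3) that] by linarith
    then show ?thesis
      using nonempty P by (auto simp: kantorovich_def[of \<mu> \<rho>] intro!: cSUP_least)
  qed
qed

definition P1_borel :: "real measure measure" where
  "P1_borel = sigma P1 {G. openin (Metric_space.mtopology P1 kantorovich) G}"

section \<open>Assumptions on the drift\<close>

definition drift_space :: "real \<Rightarrow> (real \<times> real \<times> real measure) measure" where
  "drift_space T = restrict_space borel {0..T} \<Otimes>\<^sub>M borel \<Otimes>\<^sub>M P1_borel"

text \<open>
  A drift is a curried function of which only the values on
  \<open>{0..T} \<times> UNIV \<times> P1\<close> are meaningful.
\<close>

definition decomposable :: "real \<Rightarrow> (real \<Rightarrow> real \<Rightarrow> real measure \<Rightarrow> real) \<Rightarrow> bool" where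
  "decomposable T b \<longleftrightarrow>
     (\<exists>bh bt :: real \<Rightarrow> real \<Rightarrow> real measure \<Rightarrow> real.
        (\<forall>t\<in>{0..T}. \<forall>y. \<forall>\<mu>\<in>P1. b t y \<mu> = bh t y \<mu> + bt t y \<mu>) \<and>
        (\<lambda>(t, y, \<mu>). bh t y \<mu>) \<in> borel_measurable (drift_space T) \<and>
        (\<lambda>(t, y, \<mu>). bt t y \<mu>) \<in> borel_measurable (drift_space T) \<and>
        (\<exists>K. \<forall>t\<in>{0..T}. \<forall>y. \<forall>\<mu>\<in>P1. \<bar>bh t y \<mu>\<bar> \<le> K) \<and>
        (\<exists>C>0.
           (\<forall>t\<in>{0..T}. \<forall>y. \<forall>\<mu>\<in>P1.
              \<bar>bt t y \<mu>\<bar> \<le> C * (1 + \<bar>y\<bar> + kantorovich \<mu> (return borel 0))) \<and>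
           (\<forall>t\<in>{0..T}. \<forall>y1 y2. \<forall>\<mu>\<in>P1. \<bar>bt t y1 \<mu> - bt t y2 \<mu>\<bar> \<le> C * \<bar>y1 - y2\<bar>)))"

definition lipschitz_in_law :: "real \<Rightarrow> (real \<Rightarrow> real \<Rightarrow> real measure \<Rightarrow> real) \<Rightarrow> bool" where
  "lipschitz_in_law T b \<longleftrightarrow>
     (\<exists>C>0. \<forall>t\<in>{0..T}. \<forall>y. \<forall>\<mu>\<in>P1. \<forall>\<nu>\<in>P1. \<bar>b t y \<mu> - b t y \<nu>\<bar> \<le> C * kantorovich \<mu> \<nu>)"

section \<open>Brownian motion and strong solutions of the mean-field equation\<close>

definition brownian_motion :: "'w measure \<Rightarrow> real \<Rightarrow> (real \<Rightarrow> 'w \<Rightarrow> real) \<Rightarrow> bool" where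
  "brownian_motion M T B \<longleftrightarrow>
     (\<forall>t\<in>{0..T}. B t \<in> borel_measurable M) \<and>
     (AE \<omega> in M. B 0 \<omega> = 0) \<and>
     (AE \<omega> in M. continuous_on {0..T} (\<lambda>t. B t \<omega>)) \<and>
     (\<forall>s\<in>{0..T}. \<forall>t\<in>{0..T}. s < t \<longrightarrow>
        distributed M lborel (\<lambda>\<omega>. B t \<omega> - B s \<omega>) (normal_density 0 (sqrt (t - s)))) \<and>
     (\<forall>(n::nat) \<tau>. mono_on {..n} \<tau> \<and> \<tau> ` {..n} \<subseteq> {0..T} \<longrightarrow>
        prob_space.indep_vars M (\<lambda>_. borel) (\<lambda>i \<omega>. B (\<tau> (Suc i)) \<omega> - B (\<tau> i) \<omega>) {..<n})"

definition augmented_filtration :: "'w measure \<Rightarrow> (real \<Rightarrow> 'w \<Rightarrow> real) \<Rightarrow> real \<Rightarrow> 'w measure" where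
  "augmented_filtration M B t =
     sigma (space M) ({B s -` A \<inter> space M | s A. 0 \<le> s \<and> s \<le> t \<and> A \<in> sets borel} \<union> null_sets M)"

text \<open>
  Path properties are required almost surely. Integrability of the drift along the path is
  required explicitly since the Bochner integral of a non-integrable function is 0.
\<close>

definition strong_solution ::
  "'w measure \<Rightarrow> real \<Rightarrow> (real \<Rightarrow> 'w \<Rightarrow> real) \<Rightarrow> (real \<Rightarrow> real \<Rightarrow> real measure \<Rightarrow> real) \<Rightarrow>
   real \<Rightarrow> (real \<Rightarrow> 'w \<Rightarrow> real) \<Rightarrow> bool" where
  "strong_solution M T B b x X \<longleftrightarrow>
     (\<forall>t\<in>{0..T}. X t \<in> borel_measurable (augmented_filtration M B t)) \<and>
     (AE \<omega> in M. continuous_on {0..T} (\<lambda>t. X t \<omega>)) \<and>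
     (\<forall>t\<in>{0..T}. distr M borel (X t) \<in> P1) \<and>
     (AE \<omega> in M.
        set_integrable lborel {0..T} (\<lambda>s. b s (X s \<omega>) (distr M borel (X s))) \<and>
        (\<forall>t\<in>{0..T}.
           X t \<omega> = x + (LINT s:{0..t}|lborel. b s (X s \<omega>) (distr M borel (X s))) + B t \<omega>))"

section \<open>The Sobolev space on an open subset of the line\<close>

definition L2_on :: "real set \<Rightarrow> (real \<Rightarrow> real) \<Rightarrow> bool" where
  "L2_on U u \<longleftrightarrow> u \<in> borel_measurable (lebesgue_on U) \<and> integrable (lebesgue_on U) (\<lambda>x. (u x)\<^sup>2)"

definition L2_norm :: "real set \<Rightarrow> (real \<Rightarrow> real) \<Rightarrow> real" where
  "L2_norm U u = sqrt (\<integral>x. (u x)\<^sup>2 \<partial>lebesgue_on U)"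

definition test_function :: "real set \<Rightarrow> (real \<Rightarrow> real) \<Rightarrow> bool" where
  "test_function U \<phi> \<longleftrightarrow>
     (\<forall>k x. (deriv ^^ k) \<phi> differentiable at x) \<and>
     compact (closure {x. \<phi> x \<noteq> 0}) \<and> closure {x. \<phi> x \<noteq> 0} \<subseteq> U"

definition L2_weak_deriv :: "real set \<Rightarrow> (real \<Rightarrow> real) \<Rightarrow> (real \<Rightarrow> real) \<Rightarrow> bool" where
  "L2_weak_deriv U u v \<longleftrightarrow>
     L2_on U v \<and>
     (\<forall>\<phi>. test_function U \<phi> \<longrightarrow>
        (\<integral>x. u x * deriv \<phi> x \<partial>lebesgue_on U) = - (\<integral>x. v x * \<phi> x \<partial>lebesgue_on U))"

text \<open>
  Elements of the Sobolev space are given by representatives. The weak derivative is unique up to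
  null sets, so the norm below does not depend on the choice.
\<close>

definition W12 :: "real set \<Rightarrow> (real \<Rightarrow> real) set" where
  "W12 U = {u. L2_on U u \<and> (\<exists>v. L2_weak_deriv U u v)}"

definition W12_norm :: "real set \<Rightarrow> (real \<Rightarrow> real) \<Rightarrow> real" where
  "W12_norm U u = L2_norm U u + L2_norm U (SOME v. L2_weak_deriv U u v)"

section \<open>Square-integrable Sobolev-valued random variables\<close>

text \<open>
  The Bochner space \<open>L\<^sup>2(\<Omega>, W\<^sup>1\<^sup>,\<^sup>2(U))\<close>: strong measurability means being an almost
  sure limit, in the Sobolev norm, of Sobolev-valued simple functions.
\<close>

definition bochner_L2_W12 :: "'w measure \<Rightarrow> real set \<Rightarrow> ('w \<Rightarrow> real \<Rightarrow> real) \<Rightarrow> bool" where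
  "bochner_L2_W12 M U Z \<longleftrightarrow>
     (\<forall>\<omega>\<in>space M. Z \<omega> \<in> W12 U) \<and>
     (\<exists>S :: nat \<Rightarrow> 'w \<Rightarrow> real \<Rightarrow> real.
        (\<forall>n. simple_function M (S n) \<and> (\<forall>\<omega>\<in>space M. S n \<omega> \<in> W12 U)) \<and>
        (AE \<omega> in M. (\<lambda>n. W12_norm U (\<lambda>x. S n \<omega> x - Z \<omega> x)) \<longlonglongrightarrow> 0)) \<and>
     integrable M (\<lambda>\<omega>. (W12_norm U (Z \<omega>))\<^sup>2)"

text \<open>
  In a random field \<open>Y\<close>, each random variable \<open>Y x\<close> is only determined up to a null set depending
  on \<open>x\<close>, so membership of \<open>x \<mapsto> Y x\<close> in the Bochner space is a statement about a version of the
  field. Joint measurability of the version \<open>Z\<close> cannot be omitted: by Fubini, it makes \<open>Z \<omega>\<close> unique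
  as an element of \<open>L\<^sup>2(U)\<close> for almost every \<open>\<omega>\<close>.
\<close>

definition field_in_L2_W12 :: "'w measure \<Rightarrow> real set \<Rightarrow> (real \<Rightarrow> 'w \<Rightarrow> real) \<Rightarrow> bool" where
  "field_in_L2_W12 M U Y \<longleftrightarrow>
     (\<exists>Z :: 'w \<Rightarrow> real \<Rightarrow> real.
        (\<lambda>(\<omega>, x). Z \<omega> x) \<in> borel_measurable (M \<Otimes>\<^sub>M restrict_space borel U) \<and>
        (\<forall>x\<in>U. AE \<omega> in M. Z \<omega> x = Y x \<omega>) \<and>
        bochner_L2_W12 M U Z)"

end

theory Submission
  imports Defs "HOL-Computational_Algebra.Polynomial"
begin

text \<open>
The bounded part of the drift is only measurable in space, so the difference of two solutions \<open>X\<close> and \<open>Y\<close>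
with starting points \<open>x\<close> and \<open>y\<close> is out of reach of a pathwise Gronwall argument. If that part is replaced
by a field \<open>g\<close> with spatial derivative \<open>g'\<close>, then \<open>D = X - Y\<close> solves a linear equation \<open>D' = a D + e\<close>:
the coefficient \<open>a\<close> at time \<open>s\<close> is the mean of \<open>g' s\<close> over the segment from \<open>Y s\<close> to \<open>X s\<close>, and \<open>e\<close>
collects the error of the replacement, a Lipschitz term and the distance of the laws. Variation of
constants (\<open>perturbed_linear_ODE_bound\<close>) bounds \<open>D\<close> by \<open>\<bar>x - y\<bar>\<close> and \<open>e\<close>, weighted with exponentials of
integrals of \<open>a\<close>. Such exponentials have moments that depend on the bound of \<open>g\<close> but not on \<open>g'\<close>, and this
is the heart of the proof (\<open>exp_integral_derivative_BM\<close>, \<open>exp_integral_derivative_shifted\<close>).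

Along a Brownian motion \<open>B\<close>, the integral of \<open>g' s (z + B s)\<close> in time is the limit of the discrete
covariations of \<open>g s (z + B s)\<close> and \<open>B\<close>, which contain no derivative (\<open>covariation_sum_error\<close>). One half of such a
sum is a martingale sum; the other half evaluates \<open>g\<close> at the later end point of each cell and becomes, in
reversed time, a martingale sum plus the drift of a Brownian bridge. All three have explicit Gaussian
exponential moments (\<open>exp_forward_sum\<close>, \<open>exp_backward_sum\<close>, \<open>exp_drift_sum\<close>). A point of the segment from
\<open>Y s\<close> to \<open>X s\<close> is a Brownian motion plus a shift whose speed grows at most linearly in \<open>B\<close>
(\<open>uniform_growth\<close>); such shifts are removed by a discrete Girsanov transformation (\<open>exp_shifted_sum\<close>).

Bounded measurable fields are approximated by regular ones with the same bound, in the mean along the two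
solutions (\<open>space_smooth_approximation\<close>). Since the Kantorovich distance of the laws is at most \<open>E \<bar>D\<bar>\<close>,
squaring and taking expectations gives an integral inequality for \<open>E D\<^sup>2\<close> (\<open>mean_square_difference\<close>), and
Gronwall's inequality gives \<open>E D\<^sup>2 \<le> c \<bar>x - y\<bar>\<^sup>2\<close> (\<open>mean_square_stability\<close>).

It is a general fact that a random field on an interval which is Lipschitz in mean square lies in the Bochner
space (\<open>field_in_L2_W12I\<close>). For each outcome, the slopes of the field over the dyadic cells of \<open>{-R..R}\<close> form a
martingale in the space variable; its energies increase and have bounded expectations. Hence
for almost every outcome the slopes converge in mean square to some \<open>v\<close>, the primitive of \<open>v\<close> is a
continuous version of the field with weak derivative \<open>v\<close>, and rounding the slopes gives simple functions
that converge to it.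

The solutions and the Brownian motion have their path properties only almost surely. They are redefined on null
sets, which belong to the augmented filtration (\<open>redefined_process\<close>), and the increments of the motion are
independent of that filtration because each of its events agrees almost surely with an event generated by
the motion alone (\<open>augmented_filtration_AE_eq\<close>).
\<close>

section \<open>Nonnegative expectations\<close>

text \<open>Expectations of nonnegative variables are extended reals, since exponential moments are estimated before they are known to be finite.\<close>

abbreviation (in prob_space) EE :: "('a \<Rightarrow> real) \<Rightarrow> ennreal" where
 "EE f \<equiv> \<integral>\<^sup>+w. ennreal (f w) \<partial>M"

text \<open>Fatou's lemma: upper bounds of expectations pass to almost sure limits.\<close>

lemma nn_integral_limit_le:
 fixes f :: "nat \<Rightarrow> 'a \<Rightarrow> real"
 assumes f: "\<And>n. f n \<in> borel_measurable M" and lim: "AE x in M. (\<lambda>n. f n x) \<longlonglongrightarrow> g x"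
  and le: "\<forall>\<^sub>F n in sequentially. (\<integral>\<^sup>+x. ennreal (f n x) \<partial>M) \<le> c n" and c: "c \<longlonglongrightarrow> C"
 shows "(\<integral>\<^sup>+x. ennreal (g x) \<partial>M) \<le> C"
proof -
 note [measurable] = f
 have "AE x in M. ennreal (g x) = liminf (\<lambda>n. ennreal (f n x))"
  using lim by eventually_elim (metis lim_imp_Liminf[OF trivial_limit_sequentially] tendsto_ennrealI)
 then have "(\<integral>\<^sup>+x. ennreal (g x) \<partial>M) = (\<integral>\<^sup>+x. liminf (\<lambda>n. ennreal (f n x)) \<partial>M)" by (rule nn_integral_cong_AE)
 also have "\<dots> \<le> liminf (\<lambda>n. \<integral>\<^sup>+x. ennreal (f n x) \<partial>M)" by (rule nn_integral_liminf) measurable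
 also have "\<dots> \<le> liminf c" by (rule Liminf_mono[OF le])
 also have "\<dots> = C" by (rule lim_imp_Liminf[OF trivial_limit_sequentially c])
 finally show ?thesis .
qed

section \<open>Centred Gaussian measures\<close>

text \<open>The parameter is the variance, so that \<open>gauss h\<close> is the law of a Brownian increment over a time \<open>h\<close>.\<close>

definition gauss :: "real \<Rightarrow> real measure" where
 "gauss h = density lborel (\<lambda>x. ennreal (normal_density 0 (sqrt h) x))"

lemma sets_gauss [simp, measurable_cong]: "sets (gauss h) = sets borel"
 by (simp add: gauss_def)

lemma space_gauss [simp]: "space (gauss h) = UNIV"
 by (simp add: gauss_def)

lemma prob_space_gauss: "h > 0 \<Longrightarrow> prob_space (gauss h)"
 unfolding gauss_def by (intro prob_space_normal_density) simp

lemma nn_integral_gauss: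
 "f \<in> borel_measurable borel \<Longrightarrow>
  (\<integral>\<^sup>+v. f v \<partial>gauss h) = (\<integral>\<^sup>+v. ennreal (normal_density 0 (sqrt h) v) * f v \<partial>lborel)"
 unfolding gauss_def by (subst nn_integral_density) auto

lemma integral_gauss:
 fixes f :: "real \<Rightarrow> real"
 shows "f \<in> borel_measurable borel \<Longrightarrow>
  (\<integral>v. f v \<partial>gauss h) = (\<integral>v. normal_density 0 (sqrt h) v * f v \<partial>lborel)"
 unfolding gauss_def by (subst integral_density) auto

lemma integrable_gauss_iff:
 fixes f :: "real \<Rightarrow> real"
 shows "f \<in> borel_measurable borel \<Longrightarrow>
  integrable (gauss h) f \<longleftrightarrow> integrable lborel (\<lambda>v. normal_density 0 (sqrt h) v * f v)"
 unfolding gauss_def by (subst integrable_density) auto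

lemma gauss_moments:
 assumes "h > 0"
 shows "integrable (gauss h) (\<lambda>v. v ^ k)"
  and "(\<integral>v. v\<^sup>2 \<partial>gauss h) = h" and "(\<integral>v. v ^ 4 \<partial>gauss h) = 3 * h\<^sup>2"
proof -
 show "integrable (gauss h) (\<lambda>v. v ^ k)"
  using integrable_normal_moment[of "sqrt h" 0 k] assms by (simp add: integrable_gauss_iff)
 have "(\<integral>v. normal_density 0 (sqrt h) v * (v - 0) ^ (2 * 1) \<partial>lborel) = h"
  using integral_normal_moment_even[of "sqrt h" 0 1] assms by simp
 then show "(\<integral>v. v\<^sup>2 \<partial>gauss h) = h" by (simp add: integral_gauss)
 have "(\<integral>v. normal_density 0 (sqrt h) v * (v - 0) ^ (2 * 2) \<partial>lborel) = 3 * h\<^sup>2"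
  using integral_normal_moment_even[of "sqrt h" 0 2] assms
  by (simp add: fact_numeral power_divide field_simps power2_eq_square)
 then show "(\<integral>v. v ^ 4 \<partial>gauss h) = 3 * h\<^sup>2" by (simp add: integral_gauss)
qed

lemma gauss_Cameron_Martin:
 assumes [measurable]: "f \<in> borel_measurable borel" and h: "h > 0"
 shows "(\<integral>\<^sup>+v. ennreal (exp (- \<beta> * v - \<beta>\<^sup>2 * h / 2)) * f (v + \<beta> * h) \<partial>gauss h)
  = (\<integral>\<^sup>+v. f v \<partial>gauss h)"
proof -
 have "(\<integral>\<^sup>+v. f v \<partial>gauss h) = (\<integral>\<^sup>+v. ennreal (normal_density 0 (sqrt h) v) * f v \<partial>lborel)"
  by (rule nn_integral_gauss) simp
 also have "\<dots> = (\<integral>\<^sup>+v. ennreal (normal_density 0 (sqrt h) (\<beta> * h + 1 * v)) * f (\<beta> * h + 1 * v) \<partial>lborel)"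
  by (subst nn_integral_real_affine[where c = 1 and t = "\<beta> * h"]) auto
 also have "\<dots> = (\<integral>\<^sup>+v. ennreal (normal_density 0 (sqrt h) v) *
   (ennreal (exp (- \<beta> * v - \<beta>\<^sup>2 * h / 2)) * f (v + \<beta> * h)) \<partial>lborel)"
 proof (rule nn_integral_cong)
  fix v
  have "- (\<beta> * h + v)\<^sup>2 / (2 * h) = - v\<^sup>2 / (2 * h) + (- \<beta> * v - \<beta>\<^sup>2 * h / 2)"
   using h by (simp add: field_simps power2_eq_square)
  then have "normal_density 0 (sqrt h) (\<beta> * h + v)
    = normal_density 0 (sqrt h) v * exp (- \<beta> * v - \<beta>\<^sup>2 * h / 2)"
   using h by (simp add: normal_density_def flip: exp_add)
  then show "ennreal (normal_density 0 (sqrt h) (\<beta> * h + 1 * v)) * f (\<beta> * h + 1 * v)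
   = ennreal (normal_density 0 (sqrt h) v) * (ennreal (exp (- \<beta> * v - \<beta>\<^sup>2 * h / 2)) * f (v + \<beta> * h))"
   by (simp add: ennreal_mult mult.assoc add.commute)
 qed
 also have "\<dots> = (\<integral>\<^sup>+v. ennreal (exp (- \<beta> * v - \<beta>\<^sup>2 * h / 2)) * f (v + \<beta> * h) \<partial>gauss h)"
  by (rule nn_integral_gauss[symmetric]) simp
 finally show ?thesis by simp
qed

lemma gauss_exp_moment:
 assumes "h > 0"
 shows "(\<integral>\<^sup>+v. ennreal (exp (\<gamma> * v - \<gamma>\<^sup>2 * h / 2)) \<partial>gauss h) = 1"
 using gauss_Cameron_Martin[of "\<lambda>_. 1" h "- \<gamma>"] prob_space.emeasure_space_1[OF prob_space_gauss[OF assms]] assms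
 by simp

lemma gauss_exp_abs:
 assumes "h > 0"
 shows "(\<integral>\<^sup>+v. ennreal (exp (\<gamma> * \<bar>v\<bar>)) \<partial>gauss h) \<le> ennreal (2 * exp (\<gamma>\<^sup>2 * h / 2))"
proof -
 have 1: "(\<integral>\<^sup>+v. ennreal (exp (c * v)) \<partial>gauss h) = ennreal (exp (c\<^sup>2 * h / 2))" for c
 proof -
  have "(\<integral>\<^sup>+v. ennreal (exp (c * v)) \<partial>gauss h)
   = (\<integral>\<^sup>+v. ennreal (exp (c\<^sup>2 * h / 2)) * ennreal (exp (c * v - c\<^sup>2 * h / 2)) \<partial>gauss h)"
   by (simp flip: ennreal_mult exp_add)
  also have "\<dots> = ennreal (exp (c\<^sup>2 * h / 2))"
   by (subst nn_integral_cmult) (simp_all add: gauss_exp_moment[OF assms])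
  finally show ?thesis .
 qed
 have "(\<integral>\<^sup>+v. ennreal (exp (\<gamma> * \<bar>v\<bar>)) \<partial>gauss h)
  \<le> (\<integral>\<^sup>+v. ennreal (exp (\<gamma> * v)) + ennreal (exp (- \<gamma> * v)) \<partial>gauss h)"
  by (intro nn_integral_mono) (auto simp: abs_if)
 also have "\<dots> = ennreal (exp (\<gamma>\<^sup>2 * h / 2)) + ennreal (exp ((- \<gamma>)\<^sup>2 * h / 2))"
  by (subst nn_integral_add) (simp_all only: 1, auto)
 also have "\<dots> = ennreal (2 * exp (\<gamma>\<^sup>2 * h / 2))"
  by (simp flip: ennreal_plus)
 finally show ?thesis .
qed

text \<open>Up to a constant, the integrand times the density of variance \<open>h\<close> is the density of variance \<open>h / (1 - 2 * c * h)\<close>, which is at most \<open>2 * h\<close>.\<close>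

lemma gauss_exp_square:
 assumes "h > 0" "0 \<le> c" "c * h \<le> 1 / 4"
 shows "(\<integral>\<^sup>+v. ennreal (exp (c * v\<^sup>2)) \<partial>gauss h) \<le> 2"
proof -
 define k where "k = h / (1 - 2 * c * h)"
 have p: "1 - 2 * c * h \<ge> 1 / 2" using assms by (simp add: field_simps)
 then have k: "k > 0" "k \<le> 2 * h" using assms by (auto simp: k_def field_simps)
 have "ennreal (normal_density 0 (sqrt h) v) * ennreal (exp (c * v\<^sup>2))
   \<le> 2 * ennreal (normal_density 0 (sqrt k) v)" for v
 proof -
  have e: "- v\<^sup>2 / (2 * h) + c * v\<^sup>2 = - v\<^sup>2 / (2 * k)"
  proof -
   have "1 / k = 1 / h - 2 * c" using assms p by (simp add: k_def diff_divide_distrib)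
   then have "- (v\<^sup>2 / 2) * (1 / k) = - (v\<^sup>2 / 2) * (1 / h - 2 * c)" by simp
   then show ?thesis by (simp add: algebra_simps)
  qed
  have "k \<le> 4 * h" using k assms by linarith
  then have s: "sqrt k \<le> 2 * sqrt h"
   using real_sqrt_le_mono[of k "4 * h"] by (simp add: real_sqrt_mult)
  have "normal_density 0 (sqrt h) v * exp (c * v\<^sup>2) = 1 / sqrt (2 * pi * h) * exp (- v\<^sup>2 / (2 * k))"
   using assms unfolding e[symmetric] by (simp add: normal_density_def flip: exp_add)
  also have "\<dots> \<le> 2 * (1 / sqrt (2 * pi * k)) * exp (- v\<^sup>2 / (2 * k))"
   using s assms k by (intro mult_right_mono) (auto simp: real_sqrt_mult field_simps)
  also have "\<dots> = 2 * normal_density 0 (sqrt k) v"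
   using k by (simp add: normal_density_def)
  finally show ?thesis by (simp flip: ennreal_mult ennreal_numeral)
 qed
 then have "(\<integral>\<^sup>+v. ennreal (exp (c * v\<^sup>2)) \<partial>gauss h)
   \<le> (\<integral>\<^sup>+v. 2 * ennreal (normal_density 0 (sqrt k) v) \<partial>lborel)"
  by (subst nn_integral_gauss) (auto intro!: nn_integral_mono)
 also have "\<dots> = 2 * (\<integral>\<^sup>+v. 1 \<partial>gauss k)"
  by (subst nn_integral_cmult, simp, subst nn_integral_gauss) auto
 also have "\<dots> = 2"
  using prob_space.emeasure_space_1[OF prob_space_gauss[OF k(1)]] by simp
 finally show ?thesis .
qed

text \<open>Given the sum \<open>w\<close> of independent Gaussian variables of variances \<open>a\<close> and \<open>c\<close>, the first of them is Gaussian with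
  mean \<open>a / (a + c) * w\<close> and variance \<open>a * c / (a + c)\<close>. For a Brownian motion this is the law of an earlier value given a later one.\<close>

lemma gauss_rotate:
 assumes \<Psi> [measurable]: "case_prod \<Psi> \<in> borel_measurable (borel \<Otimes>\<^sub>M borel)" and ac: "a > 0" "c > 0"
 shows "(\<integral>\<^sup>+u. (\<integral>\<^sup>+v. \<Psi> u (u + v) \<partial>gauss c) \<partial>gauss a)
  = (\<integral>\<^sup>+w. (\<integral>\<^sup>+z. \<Psi> (a / (a + c) * w + z) w \<partial>gauss (a * c / (a + c))) \<partial>gauss (a + c))"
proof -
 let ?n = "\<lambda>h x. ennreal (normal_density 0 (sqrt h) x)"
 define k where "k = a * c / (a + c)"
 have k: "k > 0" using ac by (simp add: k_def)
 have density: "?n a u * ?n c (w - u) = ?n (a + c) w * ?n k (u - a / (a + c) * w)" for u w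
 proof -
  have 1: "- u\<^sup>2 / (2 * a) + - (w - u)\<^sup>2 / (2 * c)
    = - w\<^sup>2 / (2 * (a + c)) + - (u - a / (a + c) * w)\<^sup>2 / (2 * k)"
  proof -
   have n: "a + c \<noteq> 0" "a \<noteq> 0" "c \<noteq> 0" using ac by auto
   have "u - a / (a + c) * w = ((a + c) * u - a * w) / (a + c)"
    using n by (simp add: field_simps)
   then have "(u - a / (a + c) * w)\<^sup>2 / (2 * k) = ((a + c) * u - a * w)\<^sup>2 / (2 * a * c * (a + c))"
   proof -
    assume *: "u - a / (a + c) * w = ((a + c) * u - a * w) / (a + c)"
    define q s where "q = (a + c) * u - a * w" and "s = a + c"
    have "(q / s)\<^sup>2 / (2 * (a * c / s)) = q\<^sup>2 / (2 * a * c * s)"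
     using n unfolding s_def[symmetric] by (simp add: divide_simps) (simp add: power2_eq_square)
    then show ?thesis unfolding * k_def q_def s_def .
   qed
   moreover have "u\<^sup>2 / (2 * a) + (w - u)\<^sup>2 / (2 * c)
    = w\<^sup>2 / (2 * (a + c)) + ((a + c) * u - a * w)\<^sup>2 / (2 * a * c * (a + c))"
    using n by (simp add: divide_simps) (simp add: power2_eq_square algebra_simps)
   ultimately show ?thesis by simp
  qed
  have 2: "sqrt (2 * pi * a) * sqrt (2 * pi * c) = sqrt (2 * pi * (a + c)) * sqrt (2 * pi * k)"
   using ac by (simp add: k_def flip: real_sqrt_mult)
  have "normal_density 0 (sqrt a) u * normal_density 0 (sqrt c) (w - u)
    = 1 / (sqrt (2 * pi * a) * sqrt (2 * pi * c)) * exp (- u\<^sup>2 / (2 * a) + - (w - u)\<^sup>2 / (2 * c))"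
   using ac by (simp add: normal_density_def flip: exp_add)
  also have "\<dots> = normal_density 0 (sqrt (a + c)) w * normal_density 0 (sqrt k) (u - a / (a + c) * w)"
   unfolding 1 2 using ac k by (simp add: normal_density_def flip: exp_add)
  finally show ?thesis by (simp flip: ennreal_mult)
 qed
 have "(\<integral>\<^sup>+u. (\<integral>\<^sup>+v. \<Psi> u (u + v) \<partial>gauss c) \<partial>gauss a)
  = (\<integral>\<^sup>+u. ?n a u * (\<integral>\<^sup>+v. ?n c v * \<Psi> u (u + v) \<partial>lborel) \<partial>lborel)"
  by (simp add: nn_integral_gauss)
 also have "\<dots> = (\<integral>\<^sup>+u. (\<integral>\<^sup>+w. ?n a u * ?n c (w - u) * \<Psi> u w \<partial>lborel) \<partial>lborel)"
 proof (rule nn_integral_cong)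
  fix u
  have "?n a u * (\<integral>\<^sup>+v. ?n c v * \<Psi> u (u + v) \<partial>lborel) = (\<integral>\<^sup>+v. ?n a u * ?n c v * \<Psi> u (u + v) \<partial>lborel)"
   by (subst nn_integral_cmult[symmetric]) (auto simp: mult.assoc)
  also have "\<dots> = (\<integral>\<^sup>+w. ?n a u * ?n c (- u + 1 * w) * \<Psi> u (u + (- u + 1 * w)) \<partial>lborel)"
   by (subst nn_integral_real_affine[where c = 1 and t = "- u"]) auto
  also have "\<dots> = (\<integral>\<^sup>+w. ?n a u * ?n c (w - u) * \<Psi> u w \<partial>lborel)" by simp
  finally show "?n a u * (\<integral>\<^sup>+v. ?n c v * \<Psi> u (u + v) \<partial>lborel) = (\<integral>\<^sup>+w. ?n a u * ?n c (w - u) * \<Psi> u w \<partial>lborel)" .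
 qed
 also have "\<dots> = (\<integral>\<^sup>+w. (\<integral>\<^sup>+u. ?n (a + c) w * ?n k (u - a / (a + c) * w) * \<Psi> u w \<partial>lborel) \<partial>lborel)"
  unfolding density by (rule lborel_pair.Fubini'[symmetric]) measurable
 also have "\<dots> = (\<integral>\<^sup>+w. ?n (a + c) w * (\<integral>\<^sup>+z. ?n k z * \<Psi> (a / (a + c) * w + z) w \<partial>lborel) \<partial>lborel)"
 proof (rule nn_integral_cong)
  fix w
  have "(\<integral>\<^sup>+u. ?n (a + c) w * ?n k (u - a / (a + c) * w) * \<Psi> u w \<partial>lborel)
   = (\<integral>\<^sup>+z. ?n (a + c) w * ?n k z * \<Psi> (a / (a + c) * w + z) w \<partial>lborel)"
   by (subst nn_integral_real_affine[where c = 1 and t = "a / (a + c) * w"]) auto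
  also have "\<dots> = ?n (a + c) w * (\<integral>\<^sup>+z. ?n k z * \<Psi> (a / (a + c) * w + z) w \<partial>lborel)"
   by (subst nn_integral_cmult[symmetric]) (auto simp: mult.assoc)
  finally show "(\<integral>\<^sup>+u. ?n (a + c) w * ?n k (u - a / (a + c) * w) * \<Psi> u w \<partial>lborel) = \<dots>" .
 qed
 also have "\<dots> = (\<integral>\<^sup>+w. (\<integral>\<^sup>+z. \<Psi> (a / (a + c) * w + z) w \<partial>gauss k) \<partial>gauss (a + c))"
  by (simp add: nn_integral_gauss)
 finally show ?thesis by (simp add: k_def)
qed

section \<open>Step functions, Riemann sums and absolutely continuous functions\<close>

abbreviation cell_index :: "real \<Rightarrow> real \<Rightarrow> real \<Rightarrow> nat" where
 "cell_index a h s \<equiv> nat \<lfloor>(s - a) / h\<rfloor>"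

lemma cell_index_iff:
 fixes h s a :: real
 assumes "h > 0"
 shows "a + real k * h \<le> s \<and> s < a + real (Suc k) * h \<longleftrightarrow> a \<le> s \<and> cell_index a h s = k"
proof -
 have "(a + real k * h \<le> s \<and> s < a + real (Suc k) * h) \<longleftrightarrow>
   (real k \<le> (s - a) / h \<and> (s - a) / h < real k + 1)"
  using assms by (simp add: field_simps)
 also have "\<dots> \<longleftrightarrow> \<lfloor>(s - a) / h\<rfloor> = int k"
  by (simp add: floor_eq_iff)
 also have "\<dots> \<longleftrightarrow> a \<le> s \<and> cell_index a h s = k"
 proof -
  have "a \<le> s" if "\<lfloor>(s - a) / h\<rfloor> = int k"
  proof -
   have "0 \<le> (s - a) / h" using that by (simp add: floor_eq_iff)
   then show ?thesis using assms by (simp add: zero_le_divide_iff)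
  qed
  moreover have "0 \<le> \<lfloor>(s - a) / h\<rfloor>" if "a \<le> s" using that assms by simp
  ultimately show ?thesis by auto
 qed
 finally show ?thesis .
qed

lemma cell_index_bounds:
 fixes h s a :: real
 assumes "h > 0" "a \<le> s"
 shows "a + real (cell_index a h s) * h \<le> s" "s < a + real (Suc (cell_index a h s)) * h"
 using cell_index_iff[OF assms(1), of a "cell_index a h s" s] assms(2) by auto

lemma step_function_eq_sum:
 fixes c :: "nat \<Rightarrow> real"
 assumes "a < b" "N > 0" and h: "h = (b - a) / real N"
 shows "indicator {a..<b} s * c (cell_index a h s)
  = (\<Sum>k<N. c k * indicator {a + real k * h..<a + real (Suc k) * h} s)"
proof -
 have h0: "h > 0" and Nh: "real N * h = b - a" using assms by auto
 have ind: "indicator {a + real k * h..<a + real (Suc k) * h} s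
   = (if a \<le> s \<and> cell_index a h s = k then 1 else 0 :: real)" for k
  using cell_index_iff[OF h0, of a k s] by (auto simp: indicator_def)
 show ?thesis
 proof (cases "a \<le> s")
  case True
  have lt: "cell_index a h s < N \<longleftrightarrow> s < b"
  proof -
   have "cell_index a h s < N \<longleftrightarrow> (s - a) / h < real N"
    using assms(2) by linarith
   also have "\<dots> \<longleftrightarrow> s < b"
    using h0 Nh by (simp add: pos_divide_less_eq)
   finally show ?thesis .
  qed
  have "(\<Sum>k<N. c k * indicator {a + real k * h..<a + real (Suc k) * h} s)
    = (\<Sum>k<N. if k = cell_index a h s then c k else 0)"
   unfolding ind using True by (intro sum.cong) auto
  also have "\<dots> = indicator {a..<b} s * c (cell_index a h s)"
   using True lt by (simp add: indicator_def)
  finally show ?thesis by simp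
 next
  case False
  then show ?thesis unfolding ind by simp
 qed
qed

lemma
 fixes c :: "nat \<Rightarrow> real"
 assumes "a < b" "N > 0" and h: "h = (b - a) / real N"
 shows set_integrable_step: "set_integrable lborel {a..<b} (\<lambda>s. c (cell_index a h s))"
  and set_integral_step: "(LINT s:{a..<b}|lborel. c (cell_index a h s)) = h * (\<Sum>k<N. c k)"
proof -
 have h0: "h > 0" using assms by auto
 have cell: "integrable lborel (\<lambda>s. c k * indicator {a + real k * h..<a + real (Suc k) * h} s)" for k
  using h0 by (intro integrable_mult_right integrable_real_indicator) (auto simp: algebra_simps)
 show "set_integrable lborel {a..<b} (\<lambda>s. c (cell_index a h s))"
  unfolding set_integrable_def real_scaleR_def step_function_eq_sum[OF assms]
  by (intro Bochner_Integration.integrable_sum cell)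
 have "(LINT s:{a..<b}|lborel. c (cell_index a h s))
   = (\<Sum>k<N. \<integral>s. c k * indicator {a + real k * h..<a + real (Suc k) * h} s \<partial>lborel)"
  unfolding set_lebesgue_integral_def real_scaleR_def step_function_eq_sum[OF assms]
  by (intro Bochner_Integration.integral_sum cell)
 also have "\<dots> = (\<Sum>k<N. c k * h)"
  using h0 by (intro sum.cong) (auto simp: algebra_simps)
 finally show "(LINT s:{a..<b}|lborel. c (cell_index a h s)) = h * (\<Sum>k<N. c k)"
  by (simp add: sum_distrib_left mult.commute)
qed

lemma set_integral_half_open:
 fixes f :: "real \<Rightarrow> real"
 shows "(LINT s:{a..<b}|lborel. f s) = (LINT s:{a..b}|lborel. f s)"
 unfolding set_lebesgue_integral_def
 by (rule integral_discrete_difference[where X = "{b}"]) (auto simp: indicator_def)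

text \<open>The sums are integrals of step functions, so dominated convergence applies. The values on the cells are arbitrary, because
  some integrands are evaluated at the two ends of a cell at once.\<close>

lemma Riemann_sums_tendsto:
 fixes \<psi> :: "nat \<Rightarrow> nat \<Rightarrow> real" and f :: "real \<Rightarrow> real"
 assumes ab: "a < b" and bound: "\<And>N k. k < N \<Longrightarrow> \<bar>\<psi> N k\<bar> \<le> L"
  and lim: "\<And>s. a \<le> s \<Longrightarrow> s < b \<Longrightarrow> (\<lambda>N. \<psi> N (cell_index a ((b - a) / real N) s)) \<longlonglongrightarrow> f s"
 shows "(\<lambda>N. (b - a) / real N * (\<Sum>k<N. \<psi> N k)) \<longlonglongrightarrow> (LINT s:{a..b}|lborel. f s)"
proof -
 let ?g = "\<lambda>N s. indicator {a..<b} s * \<psi> N (cell_index a ((b - a) / real N) s)"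
 have lim': "(\<lambda>N. ?g (Suc N) s) \<longlonglongrightarrow> indicator {a..<b} s * f s" for s
  using LIMSEQ_Suc[OF lim[of s]] by (cases "s \<in> {a..<b}") (auto simp: indicator_def)
 have meas: "?g (Suc N) \<in> borel_measurable lborel" for N
  using set_integrable_step[OF ab, of "Suc N" _ "\<psi> (Suc N)"]
  unfolding set_integrable_def by (auto dest!: borel_measurable_integrable)
 have "(\<lambda>N. integral\<^sup>L lborel (?g (Suc N))) \<longlonglongrightarrow> (\<integral>s. indicator {a..<b} s * f s \<partial>lborel)"
 proof (rule integral_dominated_convergence)
  show "(\<lambda>s. indicator {a..<b} s * f s) \<in> borel_measurable lborel"
   by (rule borel_measurable_LIMSEQ_real[OF lim' meas])
  show "integrable lborel (\<lambda>s. L * indicator {a..<b} s)"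
   using ab by (intro integrable_mult_right integrable_real_indicator) auto
  show "AE s in lborel. norm (?g (Suc N) s) \<le> L * indicator {a..<b} s" for N
  proof (intro AE_I2)
   fix s
   have "cell_index a ((b - a) / real (Suc N)) s < Suc N" if "s \<in> {a..<b}"
   proof -
    have "(s - a) / ((b - a) / real (Suc N)) < real (Suc N)"
     using that ab by (subst pos_divide_less_eq) auto
    then show ?thesis by linarith
   qed
   then show "norm (?g (Suc N) s) \<le> L * indicator {a..<b} s"
    using bound by (auto simp: indicator_def)
  qed
 qed (use lim' meas in auto)
 also have "(\<integral>s. indicator {a..<b} s * f s \<partial>lborel) = (LINT s:{a..b}|lborel. f s)"
  unfolding set_integral_half_open[symmetric] by (simp add: set_lebesgue_integral_def)
 also have "(\<lambda>N. integral\<^sup>L lborel (?g (Suc N))) = (\<lambda>N. (b - a) / real (Suc N) * (\<Sum>k<Suc N. \<psi> (Suc N) k))"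
  using set_integral_step[OF ab, of "Suc _" _ "\<psi> (Suc _)"]
  by (auto simp: set_lebesgue_integral_def simp del: of_nat_Suc sum.lessThan_Suc)
 finally show ?thesis by (rule LIMSEQ_imp_Suc)
qed

lemma grid_point_tendsto:
 fixes a b s :: real
 assumes "a < b" "a \<le> s"
 shows "(\<lambda>N. a + real (cell_index a ((b - a) / real N) s) * ((b - a) / real N)) \<longlonglongrightarrow> s" (is "?z \<longlonglongrightarrow> s")
proof (rule tendsto_sandwich[of "\<lambda>N. s - (b - a) / real N" _ _ "\<lambda>N. s"])
 show "(\<lambda>N. s - (b - a) / real N) \<longlonglongrightarrow> s"
  using tendsto_diff[OF tendsto_const[of s] lim_const_over_n[of "b - a"]] by simp
 have *: "s - (b - a) / real N \<le> ?z N \<and> ?z N \<le> s" if "N > 0" for N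
 proof -
  define h k where "h = (b - a) / real N" and "k = real (cell_index a ((b - a) / real N) s)"
  have "h > 0" using assms that by (simp add: h_def)
  from cell_index_bounds[OF this assms(2)] have "a + k * h \<le> s" "s < a + (k + 1) * h"
   by (simp_all add: k_def add.commute flip: h_def)
  then have "s - h \<le> a + k * h \<and> a + k * h \<le> s" by (simp add: distrib_right)
  then show ?thesis by (simp only: h_def k_def)
 qed
 show "\<forall>\<^sub>F N in sequentially. s - (b - a) / real N \<le> ?z N"
  using eventually_gt_at_top[of 0] by eventually_elim (use * in blast)
 show "\<forall>\<^sub>F N in sequentially. ?z N \<le> s"
  using eventually_gt_at_top[of 0] by eventually_elim (use * in blast)
qed simp

text \<open>Partial integration: the integral of \<open>f x * g y\<close> over the square is split along the diagonal, and
  each half is integrated by Fubini's theorem.\<close>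

lemma absolutely_continuous_product:
 fixes f g :: "real \<Rightarrow> real"
 assumes ab: "a \<le> b" and f: "set_integrable lborel {a..b} f" and g: "set_integrable lborel {a..b} g"
  and F: "\<And>x. x \<in> {a..b} \<Longrightarrow> F x = F0 + (LINT y:{a..x}|lborel. f y)"
  and G: "\<And>x. x \<in> {a..b} \<Longrightarrow> G x = G0 + (LINT y:{a..x}|lborel. g y)"
 shows "set_integrable lborel {a..b} (\<lambda>x. f x * G x + F x * g x)"
  and "F b * G b = F0 * G0 + (LINT x:{a..b}|lborel. f x * G x + F x * g x)"
proof -
 define f' where "f' x = indicator {a..b} x * f x" for x
 define g' where "g' x = indicator {a..b} x * g x" for x
 have f': "integrable lborel f'" and g': "integrable lborel g'"
  using f g by (simp_all add: set_integrable_def f'_def[abs_def] g'_def[abs_def])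
 note [measurable] = borel_measurable_integrable[OF f', simplified] borel_measurable_integrable[OF g', simplified]
 have prim: "(LINT y:{a..x}|lborel. f y) = (\<integral>y. f' y * indicator {..x} y \<partial>lborel)"
  "(LINT y:{a..x}|lborel. g y) = (\<integral>y. g' y * indicator {..x} y \<partial>lborel)" if "x \<in> {a..b}" for x
  using that unfolding set_lebesgue_integral_def f'_def g'_def
  by (auto intro!: Bochner_Integration.integral_cong simp: indicator_def)
 have prod: "integrable (lborel \<Otimes>\<^sub>M lborel) (\<lambda>(x, y). f' x * g' y)"
  by (intro lborel_pair.Fubini_integrable)
    (use f' g' in \<open>auto simp: abs_mult intro!: integrable_mult_left integrable_mult_right\<close>)
 have prod1: "integrable (lborel \<Otimes>\<^sub>M lborel) (\<lambda>(x, y). f' x * (g' y * indicator {..x} y))"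
  by (rule Bochner_Integration.integrable_bound[OF prod]) (auto simp: indicator_def)
 have prod2: "integrable (lborel \<Otimes>\<^sub>M lborel) (\<lambda>(x, y). g' y * (f' x * indicator {..y} x))"
  by (rule Bochner_Integration.integrable_bound[OF prod]) (auto simp: indicator_def mult.commute)
 have i1: "integrable lborel (\<lambda>x. f' x * (\<integral>y. g' y * indicator {..x} y \<partial>lborel))"
  using lborel_pair.integrable_fst'[OF prod1] by simp
 have i2: "integrable lborel (\<lambda>y. g' y * (\<integral>x. f' x * indicator {..y} x \<partial>lborel))"
  using lborel_pair.integrable_snd[OF prod2] by simp
 have e: "indicator {a..b} x * (f x * G x + F x * g x)
   = f' x * G0 + f' x * (\<integral>y. g' y * indicator {..x} y \<partial>lborel)
    + (F0 * g' x + g' x * (\<integral>y. f' y * indicator {..x} y \<partial>lborel))" for x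
  using prim[of x] F[of x] G[of x]
  by (cases "x \<in> {a..b}") (auto simp: f'_def g'_def algebra_simps)
 show "set_integrable lborel {a..b} (\<lambda>x. f x * G x + F x * g x)"
  unfolding set_integrable_def real_scaleR_def e
  using f' g' i1 i2 by (intro Bochner_Integration.integrable_add) auto
 have dbl: "(\<integral>y. g' y * (\<integral>x. f' x * indicator {..y} x \<partial>lborel) \<partial>lborel)
   = (\<integral>x. f' x * (\<integral>y. g' y * indicator {x..} y \<partial>lborel) \<partial>lborel)"
 proof -
  have "(\<integral>y. g' y * (\<integral>x. f' x * indicator {..y} x \<partial>lborel) \<partial>lborel)
    = (\<integral>y. (\<integral>x. g' y * (f' x * indicator {..y} x) \<partial>lborel) \<partial>lborel)" by simp
  also have "\<dots> = (\<integral>x. (\<integral>y. g' y * (f' x * indicator {..y} x) \<partial>lborel) \<partial>lborel)"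
   by (rule lborel_pair.Fubini_integral[OF prod2])
  also have "\<dots> = (\<integral>x. (\<integral>y. f' x * (g' y * indicator {x..} y) \<partial>lborel) \<partial>lborel)"
   by (intro Bochner_Integration.integral_cong refl) (auto simp: indicator_def)
  finally show ?thesis by simp
 qed
 have split: "f' x * (\<integral>y. g' y * indicator {..x} y \<partial>lborel) + f' x * (\<integral>y. g' y * indicator {x..} y \<partial>lborel)
   = f' x * (\<integral>y. g' y \<partial>lborel)" for x
 proof -
  have "(\<integral>y. g' y * indicator {..x} y \<partial>lborel) = (\<integral>y. g' y * indicator {..<x} y \<partial>lborel)"
   by (rule integral_discrete_difference[where X = "{x}"]) (auto simp: indicator_def)
  moreover have "(\<integral>y. g' y * indicator {..<x} y \<partial>lborel) + (\<integral>y. g' y * indicator {x..} y \<partial>lborel)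
   = (\<integral>y. g' y * indicator {..<x} y + g' y * indicator {x..} y \<partial>lborel)"
   using g' by (intro Bochner_Integration.integral_add[symmetric] integrable_real_mult_indicator) auto
  moreover have "\<dots> = (\<integral>y. g' y \<partial>lborel)"
   by (intro Bochner_Integration.integral_cong) (auto simp: indicator_def)
  ultimately show ?thesis by (simp flip: distrib_left)
 qed
 have i3: "integrable lborel (\<lambda>x. f' x * (\<integral>y. g' y * indicator {x..} y \<partial>lborel))"
 proof -
  have "integrable lborel (\<lambda>x. f' x * (\<integral>y. g' y \<partial>lborel) - f' x * (\<integral>y. g' y * indicator {..x} y \<partial>lborel))"
   using f' i1 by auto
  moreover have "f' x * (\<integral>y. g' y * indicator {x..} y \<partial>lborel)
    = f' x * (\<integral>y. g' y \<partial>lborel) - f' x * (\<integral>y. g' y * indicator {..x} y \<partial>lborel)" for x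
   using split[of x] by linarith
  ultimately show ?thesis by (simp only:)
 qed
 have "(LINT x:{a..b}|lborel. f x * G x + F x * g x)
   = (\<integral>x. f' x \<partial>lborel) * G0 + (\<integral>x. f' x * (\<integral>y. g' y * indicator {..x} y \<partial>lborel) \<partial>lborel)
    + (F0 * (\<integral>x. g' x \<partial>lborel) + (\<integral>x. f' x * (\<integral>y. g' y * indicator {x..} y \<partial>lborel) \<partial>lborel))"
  unfolding set_lebesgue_integral_def real_scaleR_def e dbl[symmetric]
  using f' g' i1 i2 by simp
 also have "\<dots> = (\<integral>x. f' x \<partial>lborel) * G0 + F0 * (\<integral>x. g' x \<partial>lborel)
   + (\<integral>x. f' x * (\<integral>y. g' y * indicator {..x} y \<partial>lborel) + f' x * (\<integral>y. g' y * indicator {x..} y \<partial>lborel) \<partial>lborel)"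
  using i1 i3 by simp
 also have "\<dots> = (\<integral>x. f' x \<partial>lborel) * G0 + F0 * (\<integral>x. g' x \<partial>lborel) + (\<integral>x. f' x \<partial>lborel) * (\<integral>x. g' x \<partial>lborel)"
  unfolding split by simp
 finally have "F0 * G0 + (LINT x:{a..b}|lborel. f x * G x + F x * g x)
   = (F0 + (\<integral>x. f' x \<partial>lborel)) * (G0 + (\<integral>x. g' x \<partial>lborel))"
  by (simp add: algebra_simps)
 moreover have "F b = F0 + (\<integral>x. f' x \<partial>lborel)" "G b = G0 + (\<integral>x. g' x \<partial>lborel)"
  using F[of b] G[of b] ab by (simp_all add: set_lebesgue_integral_def f'_def g'_def)
 ultimately show "F b * G b = F0 * G0 + (LINT x:{a..b}|lborel. f x * G x + F x * g x)"
  by simp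
qed


section \<open>Gronwall inequalities\<close>

lemma set_integral_continuous:
 fixes u :: "real \<Rightarrow> real"
 assumes "continuous_on {a..b} u"
 shows "set_integrable lborel {a..b} u" "(LINT s:{a..b}|lborel. u s) = integral {a..b} u"
proof -
 show i: "set_integrable lborel {a..b} u"
  using assms by (intro borel_integrable_compact[unfolded set_integrable_def[symmetric] real_scaleR_def]) auto
 show "(LINT s:{a..b}|lborel. u s) = integral {a..b} u"
  using i by (rule set_borel_integral_eq_integral)
qed

lemma Gronwall:
 fixes u :: "real \<Rightarrow> real"
 assumes u: "continuous_on {0..T} u" and C: "C \<ge> 0"
  and ineq: "\<And>t. t \<in> {0..T} \<Longrightarrow> u t \<le> a + C * (LINT s:{0..t}|lborel. u s)"
  and t: "t \<in> {0..T}"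
 shows "u t \<le> a * exp (C * t)"
proof -
 define v where "v s = integral {0..s} u" for s
 have LINT: "(LINT s:{0..t}|lborel. u s) = v t" if "t \<in> {0..T}" for t
  unfolding v_def using that by (intro set_integral_continuous continuous_on_subset[OF u]) auto
 have dv: "(v has_real_derivative u s) (at s within {0..T})" if "s \<in> {0..T}" for s
  using integral_has_real_derivative[OF u that] by (simp add: v_def[abs_def])
 have "exp (- C * t) * (a + C * v t) \<le> exp (- C * 0) * (a + C * v 0)"
 proof (cases "t = 0")
  case False
  show ?thesis
  proof (rule DERIV_nonpos_imp_decreasing_open[where f = "\<lambda>s. exp (- C * s) * (a + C * v s)"])
   show "0 \<le> t" using t by simp
   show "continuous_on {0..t} (\<lambda>s. exp (- C * s) * (a + C * v s))"
    using t by (intro continuous_intros continuous_on_subset[OF DERIV_continuous_on[OF dv]]) auto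
   fix s assume s: "0 < s" "s < t"
   then have "(v has_real_derivative u s) (at s)"
    using dv[of s] t at_within_interior[of s "{0..T}"] by (auto simp: interior_atLeastAtMost_real)
   then have "((\<lambda>s. exp (- C * s) * (a + C * v s)) has_real_derivative
     exp (- C * s) * (C * (u s - (a + C * v s)))) (at s)"
    by (auto intro!: derivative_eq_intros simp: algebra_simps)
   moreover have "exp (- C * s) * (C * (u s - (a + C * v s))) \<le> 0"
    using ineq[of s] LINT[of s] s t C by (intro mult_nonneg_nonpos) auto
   ultimately show "\<exists>y. ((\<lambda>s. exp (- C * s) * (a + C * v s)) has_real_derivative y) (at s) \<and> y \<le> 0"
    by blast
  qed
 qed simp
 then have "a + C * v t \<le> a * exp (C * t)"
  by (simp add: v_def exp_minus field_simps)
 then show ?thesis using ineq[OF t] LINT[OF t] by simp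
qed

text \<open>The integrating factor \<open>exp (- A)\<close> removes the linear term, after which Gronwall's inequality takes care of the
  Lipschitz term alone. No bound of \<open>a\<close> enters: only exponential moments of \<open>A\<close> will be under control.\<close>

lemma perturbed_linear_ODE_bound:
 fixes D a q p A :: "real \<Rightarrow> real"
 assumes t: "0 \<le> t" and C: "C \<ge> 0"
  and q: "set_integrable lborel {0..t} q"
  and D: "\<And>s. s \<in> {0..t} \<Longrightarrow> D s = d0 + (LINT r:{0..s}|lborel. q r)"
  and contD: "continuous_on {0..t} D"
  and a: "continuous_on {0..t} a" and p: "set_integrable lborel {0..t} p"
  and p0: "\<And>r. r \<in> {0..t} \<Longrightarrow> 0 \<le> p r"
  and bound: "\<And>r. r \<in> {0..t} \<Longrightarrow> \<bar>q r - a r * D r\<bar> \<le> p r + C * \<bar>D r\<bar>"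
  and A: "\<And>s. A s = (LINT r:{0..s}|lborel. a r)"
 shows "\<bar>D t\<bar> \<le> exp (C * t) * (exp (A t) * \<bar>d0\<bar> + (LINT s:{0..t}|lborel. exp (A t - A s) * p s))"
proof -
 define E where "E s = exp (- A s)" for s
 have AI: "A s = integral {0..s} a" if "s \<in> {0..t}" for s
  using that unfolding A by (intro set_integral_continuous continuous_on_subset[OF a]) auto
 have A0: "A 0 = 0" using AI[of 0] t by simp
 have dA: "(A has_real_derivative a s) (at s within {0..t})" if "s \<in> {0..t}" for s
 proof -
  have "((\<lambda>s. integral {0..s} a) has_real_derivative a s) (at s within {0..t})"
   by (rule integral_has_real_derivative[OF a that])
  then show ?thesis
   by (rule has_field_derivative_transform_within[where d = 1]) (use AI that in auto)
 qed
 have contA: "continuous_on {0..t} A"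
  by (rule DERIV_continuous_on[OF dA])
 have contE: "continuous_on {0..t} E" unfolding E_def by (intro continuous_intros contA)
 have E: "E s = 1 + (LINT r:{0..s}|lborel. - a r * E r)" if s: "s \<in> {0..t}" for s
 proof -
  have "((\<lambda>r. - a r * E r) has_integral (E s - E 0)) {0..s}"
  proof (rule fundamental_theorem_of_calculus)
   show "0 \<le> s" using s by simp
   fix r assume r: "r \<in> {0..s}"
   have "(A has_real_derivative a r) (at r within {0..s})"
    using dA[of r] r s by (auto intro: DERIV_subset)
   then have "(E has_real_derivative - a r * E r) (at r within {0..s})"
    unfolding E_def by (auto intro!: derivative_eq_intros)
   then show "(E has_vector_derivative - a r * E r) (at r within {0..s})"
    by (simp add: has_real_derivative_iff_has_vector_derivative)
  qed
  moreover have "continuous_on {0..s} (\<lambda>r. - a r * E r)"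
   using s by (intro continuous_intros continuous_on_subset[OF a] continuous_on_subset[OF contE]) auto
  ultimately show ?thesis
   by (simp only: set_integral_continuous(2) integral_unique) (simp add: E_def A0)
 qed
 have intE: "set_integrable lborel {0..t} (\<lambda>r. - a r * E r)"
  by (intro set_integral_continuous(1) continuous_intros a contE)
 have intEp: "set_integrable lborel {0..t} (\<lambda>r. E r * p r)"
 proof -
  obtain K where K: "\<And>r. r \<in> {0..t} \<Longrightarrow> \<bar>E r\<bar> \<le> K"
  proof -
   have "bounded (E ` {0..t})"
    by (intro compact_imp_bounded compact_continuous_image contE) simp
   then obtain K where "\<forall>x\<in>E ` {0..t}. norm x \<le> K" unfolding bounded_iff by blast
   then show ?thesis using that[of K] by auto
  qed
  have "(\<lambda>r. indicator {0..t} r * E r) \<in> borel_measurable lborel"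
   using set_integral_continuous(1)[OF contE]
   by (auto simp: set_integrable_def dest: borel_measurable_integrable)
  moreover have "(\<lambda>r. indicator {0..t} r * p r) \<in> borel_measurable lborel"
   using p by (auto simp: set_integrable_def dest: borel_measurable_integrable)
  ultimately have "(\<lambda>r. (indicator {0..t} r * E r) * (indicator {0..t} r * p r)) \<in> borel_measurable lborel"
   by (rule borel_measurable_times)
  then have m: "(\<lambda>r. indicator {0..t} r * (E r * p r)) \<in> borel_measurable lborel"
   by (rule measurable_cong[THEN iffD1, rotated]) (auto simp: indicator_def)
  show ?thesis
   unfolding set_integrable_def real_scaleR_def
  proof (rule Bochner_Integration.integrable_bound[OF _ m])
   show "integrable lborel (\<lambda>r. K * (indicator {0..t} r * p r))"
    using p by (simp add: set_integrable_def)
   show "AE r in lborel. norm (indicator {0..t} r * (E r * p r)) \<le> norm (K * (indicator {0..t} r * p r))"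
    using K p0 by (intro AE_I2) (auto simp: indicator_def abs_mult intro!: mult_right_mono order_trans[OF _ abs_ge_self])
  qed
 qed
 \<comment> \<open>The integrating factor turns the equation into an integral of the perturbation alone.\<close>
 have ED: "set_integrable lborel {0..s} (\<lambda>r. q r * E r + D r * (- a r * E r)) \<and>
   D s * E s = d0 * 1 + (LINT r:{0..s}|lborel. q r * E r + D r * (- a r * E r))" if s: "s \<in> {0..t}" for s
 proof -
  have q': "set_integrable lborel {0..s} q" and e': "set_integrable lborel {0..s} (\<lambda>r. - a r * E r)"
  proof -
   have sub: "{0..s} \<in> sets lborel" "{0..s} \<subseteq> {0..t}" using s by auto
   show "set_integrable lborel {0..s} q" by (rule set_integrable_subset[OF q sub])
   show "set_integrable lborel {0..s} (\<lambda>r. - a r * E r)" by (rule set_integrable_subset[OF intE sub])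
  qed
  have "r \<in> {0..t}" if "r \<in> {0..s}" for r using that s by auto
  with absolutely_continuous_product[of 0 s q "\<lambda>r. - a r * E r" D d0 E 1, OF _ q' e' D E] s
  show ?thesis by auto
 qed
 have contu: "continuous_on {0..t} (\<lambda>s. E s * \<bar>D s\<bar>)" by (intro continuous_intros contE contD)
 have "E s * \<bar>D s\<bar> \<le> (\<bar>d0\<bar> + (LINT r:{0..t}|lborel. E r * p r)) + C * (LINT r:{0..s}|lborel. E r * \<bar>D r\<bar>)"
  if s: "s \<in> {0..t}" for s
 proof -
  have ip: "set_integrable lborel {0..s} (\<lambda>r. E r * p r)"
   using s by (intro set_integrable_subset[OF intEp]) auto
  have iD: "set_integrable lborel {0..s} (\<lambda>r. C * (E r * \<bar>D r\<bar>))"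
   using s by (intro set_integral_continuous(1) continuous_intros continuous_on_subset[OF contu]) auto
  have "E s * \<bar>D s\<bar> = \<bar>D s * E s\<bar>" by (simp add: E_def abs_mult)
  also have "\<dots> \<le> \<bar>d0\<bar> + \<bar>LINT r:{0..s}|lborel. q r * E r + D r * (- a r * E r)\<bar>"
   using ED[OF s] by simp
  also have "\<bar>LINT r:{0..s}|lborel. q r * E r + D r * (- a r * E r)\<bar>
    \<le> (LINT r:{0..s}|lborel. \<bar>q r * E r + D r * (- a r * E r)\<bar>)"
   using set_integral_norm_bound[OF conjunct1[OF ED[OF s]]] by (simp only: real_norm_def)
  also have "\<dots> \<le> (LINT r:{0..s}|lborel. E r * p r + C * (E r * \<bar>D r\<bar>))"
  proof (rule set_integral_mono)
   show "set_integrable lborel {0..s} (\<lambda>r. \<bar>q r * E r + D r * (- a r * E r)\<bar>)"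
    using ED[OF s] by (auto intro: set_integrable_abs)
   show "set_integrable lborel {0..s} (\<lambda>r. E r * p r + C * (E r * \<bar>D r\<bar>))"
    using ip iD by (rule set_integral_add(1))
   fix r assume r: "r \<in> {0..s}"
   have "\<bar>q r * E r + D r * (- a r * E r)\<bar> = E r * \<bar>q r - a r * D r\<bar>"
   proof -
    have "q r * E r + D r * (- a r * E r) = E r * (q r - a r * D r)" by (simp add: algebra_simps)
    then show ?thesis by (simp add: abs_mult E_def)
   qed
   also have "\<dots> \<le> E r * (p r + C * \<bar>D r\<bar>)"
    using bound[of r] r s by (intro mult_left_mono) (auto simp: E_def)
   finally show "\<bar>q r * E r + D r * (- a r * E r)\<bar> \<le> E r * p r + C * (E r * \<bar>D r\<bar>)"
    by (simp add: algebra_simps)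
  qed
  also have "\<dots> = (LINT r:{0..s}|lborel. E r * p r) + C * (LINT r:{0..s}|lborel. E r * \<bar>D r\<bar>)"
   using set_integral_add(2)[OF ip iD] by simp
  also have "(LINT r:{0..s}|lborel. E r * p r) \<le> (LINT r:{0..t}|lborel. E r * p r)"
   unfolding set_lebesgue_integral_def using s p0 intEp ip
   by (intro integral_mono) (auto simp: E_def indicator_def set_integrable_def)
  finally show ?thesis by simp
 qed
 then have "E t * \<bar>D t\<bar> \<le> (\<bar>d0\<bar> + (LINT r:{0..t}|lborel. E r * p r)) * exp (C * t)"
  by (intro Gronwall[OF contu C]) (use t in auto)
 then have "\<bar>D t\<bar> \<le> exp (A t) * ((\<bar>d0\<bar> + (LINT r:{0..t}|lborel. E r * p r)) * exp (C * t))"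
  by (simp add: E_def exp_minus field_simps)
 also have "exp (A t) * (LINT r:{0..t}|lborel. E r * p r) = (LINT s:{0..t}|lborel. exp (A t - A s) * p s)"
  unfolding set_integral_mult_right[symmetric] E_def by (simp add: exp_diff exp_minus field_simps)
 then have "exp (A t) * ((\<bar>d0\<bar> + (LINT r:{0..t}|lborel. E r * p r)) * exp (C * t))
   = exp (C * t) * (exp (A t) * \<bar>d0\<bar> + (LINT s:{0..t}|lborel. exp (A t - A s) * p s))"
  by (simp add: algebra_simps)
 finally show ?thesis .
qed

section \<open>Approximation of bounded measurable functions\<close>

text \<open>One approximation has to serve all measures of the set \<open>\<M>\<close> at once, namely the laws of two solutions.\<close>

definition lipschitz_approximable :: "'a :: metric_space measure set \<Rightarrow> ('a \<Rightarrow> real) \<Rightarrow> bool" where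
 "lipschitz_approximable \<M> f \<longleftrightarrow> f \<in> borel_measurable borel \<and>
   (\<forall>e>0. \<exists>g C. C-lipschitz_on UNIV g \<and> (\<forall>m\<in>\<M>. (\<integral>\<^sup>+x. ennreal \<bar>f x - g x\<bar> \<partial>m) \<le> ennreal e))"

lemma lipschitz_borel_measurable:
 "C-lipschitz_on UNIV (g :: 'a :: metric_space \<Rightarrow> real) \<Longrightarrow> g \<in> borel_measurable borel"
 by (intro borel_measurable_continuous_onI lipschitz_on_continuous_on)

context
 fixes \<M> :: "'a :: metric_space measure set"
 assumes fin: "finite \<M>" "\<And>m. m \<in> \<M> \<Longrightarrow> finite_measure m"
  and sets_M: "\<And>m. m \<in> \<M> \<Longrightarrow> sets m = sets borel"
begin

lemma measurable_M: "m \<in> \<M> \<Longrightarrow> f \<in> borel_measurable borel \<Longrightarrow> f \<in> borel_measurable m"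
 using sets_M measurable_cong_sets by blast

lemma lipschitz_approximable_limit:
 assumes f: "f \<in> borel_measurable borel"
  and f': "\<And>e. e > 0 \<Longrightarrow> \<exists>f'. lipschitz_approximable \<M> f' \<and> (\<forall>m\<in>\<M>. (\<integral>\<^sup>+x. ennreal \<bar>f x - f' x\<bar> \<partial>m) \<le> ennreal e)"
 shows "lipschitz_approximable \<M> f"
 unfolding lipschitz_approximable_def
proof (intro conjI f allI impI)
 fix e :: real assume "e > 0"
 then obtain f' where f': "lipschitz_approximable \<M> f'"
  and 1: "\<And>m. m \<in> \<M> \<Longrightarrow> (\<integral>\<^sup>+x. ennreal \<bar>f x - f' x\<bar> \<partial>m) \<le> ennreal (e / 2)"
  using f'[of "e / 2"] by auto
 then obtain g C where g: "C-lipschitz_on UNIV g"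
  and 2: "\<And>m. m \<in> \<M> \<Longrightarrow> (\<integral>\<^sup>+x. ennreal \<bar>f' x - g x\<bar> \<partial>m) \<le> ennreal (e / 2)"
  using \<open>e > 0\<close> unfolding lipschitz_approximable_def by (meson half_gt_zero)
 have "(\<integral>\<^sup>+x. ennreal \<bar>f x - g x\<bar> \<partial>m) \<le> ennreal e" if m: "m \<in> \<M>" for m
 proof -
  note [measurable] = measurable_M[OF m f] measurable_M[OF m lipschitz_borel_measurable[OF g]]
  have [measurable]: "f' \<in> borel_measurable m"
   using f' measurable_M[OF m] by (auto simp: lipschitz_approximable_def)
  have "(\<integral>\<^sup>+x. ennreal \<bar>f x - g x\<bar> \<partial>m) \<le> (\<integral>\<^sup>+x. ennreal \<bar>f x - f' x\<bar> + ennreal \<bar>f' x - g x\<bar> \<partial>m)"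
   by (intro nn_integral_mono) (auto simp flip: ennreal_plus)
  also have "\<dots> = (\<integral>\<^sup>+x. ennreal \<bar>f x - f' x\<bar> \<partial>m) + (\<integral>\<^sup>+x. ennreal \<bar>f' x - g x\<bar> \<partial>m)"
   by (rule nn_integral_add) auto
  also have "\<dots> \<le> ennreal (e / 2) + ennreal (e / 2)" by (intro add_mono 1 2 m)
  also have "\<dots> = ennreal e" using \<open>e > 0\<close> by (simp flip: ennreal_plus)
  finally show ?thesis .
 qed
 with g show "\<exists>g C. C-lipschitz_on UNIV g \<and> (\<forall>m\<in>\<M>. (\<integral>\<^sup>+x. ennreal \<bar>f x - g x\<bar> \<partial>m) \<le> ennreal e)" by blast
qed

lemma lipschitz_approximable_limit_seq:
 assumes f': "\<And>n. lipschitz_approximable \<M> (f' n)"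
  and f: "\<And>x. (\<lambda>n. f' n x) \<longlonglongrightarrow> f x" and bound: "\<And>n x. \<bar>f x - f' n x\<bar> \<le> K"
 shows "lipschitz_approximable \<M> f"
proof (rule lipschitz_approximable_limit)
 have mf': "f' n \<in> borel_measurable borel" for n using f' by (auto simp: lipschitz_approximable_def)
 then show mf: "f \<in> borel_measurable borel" using f by (rule borel_measurable_LIMSEQ_real[rotated])
 fix e :: real assume "e > 0"
 have "\<forall>\<^sub>F n in sequentially. \<forall>m\<in>\<M>. (\<integral>\<^sup>+x. ennreal \<bar>f x - f' n x\<bar> \<partial>m) \<le> ennreal e"
  unfolding eventually_ball_finite_distrib[OF fin(1)]
 proof
  fix m assume m: "m \<in> \<M>"
  note [measurable] = measurable_M[OF m mf'] measurable_M[OF m mf]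
  interpret finite_measure m by (rule fin(2)[OF m])
  have "(\<lambda>n. \<integral>\<^sup>+x. ennreal \<bar>f x - f' n x\<bar> \<partial>m) \<longlonglongrightarrow> (\<integral>\<^sup>+x. 0 \<partial>m)"
  proof (rule nn_integral_dominated_convergence[where w = "\<lambda>_. ennreal K"])
   show "AE x in m. (\<lambda>n. ennreal \<bar>f x - f' n x\<bar>) \<longlonglongrightarrow> 0"
   proof (intro AE_I2)
    fix x
    have "(\<lambda>n. \<bar>f x - f' n x\<bar>) \<longlonglongrightarrow> \<bar>f x - f x\<bar>" by (intro tendsto_intros f)
    then show "(\<lambda>n. ennreal \<bar>f x - f' n x\<bar>) \<longlonglongrightarrow> 0"
     using tendsto_ennrealI by fastforce
   qed
   show "(\<integral>\<^sup>+x. ennreal K \<partial>m) < \<infinity>"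
    by (simp add: ennreal_mult_eq_top_iff less_top[symmetric])
  qed (auto intro!: ennreal_leI bound)
  then show "\<forall>\<^sub>F n in sequentially. (\<integral>\<^sup>+x. ennreal \<bar>f x - f' n x\<bar> \<partial>m) \<le> ennreal e"
   using \<open>e > 0\<close> by (auto dest!: order_tendstoD(2)[where a = "ennreal e"] elim: eventually_mono)
 qed
 then show "\<exists>f'. lipschitz_approximable \<M> f' \<and> (\<forall>m\<in>\<M>. (\<integral>\<^sup>+x. ennreal \<bar>f x - f' x\<bar> \<partial>m) \<le> ennreal e)"
  using f' by (auto simp: eventually_sequentially)
qed

lemma lipschitz_approximable_lipschitz:
 "C-lipschitz_on UNIV f \<Longrightarrow> lipschitz_approximable \<M> f"
 unfolding lipschitz_approximable_def
 by (auto intro!: lipschitz_borel_measurable exI[of _ f] exI[of _ C])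

lemma lipschitz_approximable_add_scaled:
 assumes f1: "lipschitz_approximable \<M> f1" and f2: "lipschitz_approximable \<M> f2"
 shows "lipschitz_approximable \<M> (\<lambda>x. f1 x + c * f2 x)"
 unfolding lipschitz_approximable_def
proof (intro conjI allI impI)
 have m1: "f1 \<in> borel_measurable borel" and m2: "f2 \<in> borel_measurable borel"
  using f1 f2 by (auto simp: lipschitz_approximable_def)
 then show "(\<lambda>x. f1 x + c * f2 x) \<in> borel_measurable borel" by measurable
 fix e :: real assume e: "e > 0"
 obtain g1 C1 where g1: "C1-lipschitz_on UNIV g1"
  and 1: "\<And>m. m \<in> \<M> \<Longrightarrow> (\<integral>\<^sup>+x. ennreal \<bar>f1 x - g1 x\<bar> \<partial>m) \<le> ennreal (e / 2)"
  using f1 e unfolding lipschitz_approximable_def by (meson half_gt_zero)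
 obtain g2 C2 where g2: "C2-lipschitz_on UNIV g2"
  and 2: "\<And>m. m \<in> \<M> \<Longrightarrow> (\<integral>\<^sup>+x. ennreal \<bar>f2 x - g2 x\<bar> \<partial>m) \<le> ennreal (e / (2 * (\<bar>c\<bar> + 1)))"
 proof -
  have "e / (2 * (\<bar>c\<bar> + 1)) > 0" using e by (intro divide_pos_pos) auto
  then show ?thesis using f2 that unfolding lipschitz_approximable_def by blast
 qed
 have "(\<bar>c\<bar> * C2)-lipschitz_on UNIV (\<lambda>x. c * g2 x)"
  using lipschitz_on_cmult_real[OF g2, of c] by simp
 with g1 have "(C1 + \<bar>c\<bar> * C2)-lipschitz_on UNIV (\<lambda>x. g1 x + c * g2 x)"
  by (rule lipschitz_on_add)
 moreover have "(\<integral>\<^sup>+x. ennreal \<bar>f1 x + c * f2 x - (g1 x + c * g2 x)\<bar> \<partial>m) \<le> ennreal e" if m: "m \<in> \<M>" for m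
 proof -
  note [measurable] = measurable_M[OF m m1] measurable_M[OF m m2]
   measurable_M[OF m lipschitz_borel_measurable[OF g1]] measurable_M[OF m lipschitz_borel_measurable[OF g2]]
  have "\<bar>f1 x + c * f2 x - (g1 x + c * g2 x)\<bar> \<le> \<bar>f1 x - g1 x\<bar> + \<bar>c\<bar> * \<bar>f2 x - g2 x\<bar>" for x
   by (simp flip: abs_mult) (simp add: algebra_simps)
  then have "(\<integral>\<^sup>+x. ennreal \<bar>f1 x + c * f2 x - (g1 x + c * g2 x)\<bar> \<partial>m)
   \<le> (\<integral>\<^sup>+x. ennreal \<bar>f1 x - g1 x\<bar> + ennreal \<bar>c\<bar> * ennreal \<bar>f2 x - g2 x\<bar> \<partial>m)"
   by (intro nn_integral_mono) (auto intro!: ennreal_leI simp flip: ennreal_plus ennreal_mult)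
  also have "\<dots> = (\<integral>\<^sup>+x. ennreal \<bar>f1 x - g1 x\<bar> \<partial>m) + ennreal \<bar>c\<bar> * (\<integral>\<^sup>+x. ennreal \<bar>f2 x - g2 x\<bar> \<partial>m)"
   by (subst nn_integral_add) (auto simp: nn_integral_cmult)
  also have "\<dots> \<le> ennreal (e / 2) + ennreal \<bar>c\<bar> * ennreal (e / (2 * (\<bar>c\<bar> + 1)))"
   by (intro add_mono mult_left_mono 1 2 m) auto
  also have "\<dots> = ennreal (e / 2 + \<bar>c\<bar> * (e / (2 * (\<bar>c\<bar> + 1))))"
   using e by (subst ennreal_mult[symmetric]) (auto intro!: divide_nonneg_nonneg simp flip: ennreal_plus)
  also have "\<dots> \<le> ennreal e"
   using e by (intro ennreal_leI) (simp add: field_simps)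
  finally show ?thesis .
 qed
 ultimately show "\<exists>g C. C-lipschitz_on UNIV g \<and>
   (\<forall>m\<in>\<M>. (\<integral>\<^sup>+x. ennreal \<bar>f1 x + c * f2 x - g x\<bar> \<partial>m) \<le> ennreal e)" by blast
qed

lemma lipschitz_approximable_sum:
 "finite I \<Longrightarrow> (\<And>i. i \<in> I \<Longrightarrow> lipschitz_approximable \<M> (f i)) \<Longrightarrow>
  lipschitz_approximable \<M> (\<lambda>x. \<Sum>i\<in>I. c i * f i x)"
proof (induction rule: finite_induct)
 case empty
 show ?case by (auto intro!: lipschitz_approximable_lipschitz[of 0] lipschitz_onI)
next
 case (insert i I)
 then show ?case
  using lipschitz_approximable_add_scaled[of "\<lambda>x. \<Sum>i\<in>I. c i * f i x" "f i" "c i"] by (simp add: add.commute)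
qed

text \<open>Truncated multiples of the distance to a closed set approximate its indicator, and the sets with this property form a Dynkin system.\<close>

lemma lipschitz_approximable_indicator:
 assumes "A \<in> sets borel"
 shows "lipschitz_approximable \<M> (indicator A)"
proof -
 have gen: "A \<in> sigma_sets UNIV {S. closed S}"
  using assms by (simp add: borel_eq_closed)
 have "Int_stable {S :: 'a set. closed S}" by (auto simp: Int_stable_def)
 moreover have "{S :: 'a set. closed S} \<subseteq> Pow UNIV" by simp
 ultimately show ?thesis using gen
 proof (induction rule: sigma_sets_induct_disjoint)
  case (basic S)
  show ?case
  proof (cases "S = {}")
   case True
   then show ?thesis by (auto intro!: lipschitz_approximable_lipschitz[of 0] lipschitz_onI)
  next
   case False
   define g where "g n x = max 0 (1 - real n * infdist x S)" for n x
   show ?thesis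
   proof (rule lipschitz_approximable_limit_seq[where f' = g and K = 1])
    show "lipschitz_approximable \<M> (g n)" for n
    proof (rule lipschitz_approximable_lipschitz[where C = "real n"], rule lipschitz_onI)
     fix x y
     have "\<bar>g n x - g n y\<bar> \<le> \<bar>real n * (infdist x S - infdist y S)\<bar>"
      unfolding g_def by (simp add: algebra_simps)
     also have "\<dots> \<le> real n * dist x y"
      using infdist_triangle_abs[of x S y] by (simp add: abs_mult mult_left_mono)
     finally show "dist (g n x) (g n y) \<le> real n * dist x y" by (simp add: dist_real_def)
    qed simp
    show "(\<lambda>n. g n x) \<longlonglongrightarrow> indicator S x" for x
    proof (cases "x \<in> S")
     case True
     then show ?thesis by (simp add: g_def)
    next
     case x: False
     then have pos: "infdist x S > 0"
      using basic False in_closed_iff_infdist_zero[of S x] infdist_nonneg[of x S] by force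
     obtain n0 where n0: "1 / infdist x S < real n0" using reals_Archimedean2 by blast
     have "g n x = 0" if "n \<ge> n0" for n
     proof -
      have "1 \<le> real n * infdist x S"
       using n0 pos that by (smt (verit) divide_less_eq mult_right_mono of_nat_mono)
      then show ?thesis by (simp add: g_def)
     qed
     then have "\<forall>\<^sub>F n in sequentially. g n x = 0"
      by (auto simp: eventually_sequentially)
     then show ?thesis using x by (simp add: tendsto_eventually)
    qed
    show "\<bar>indicator S x - g n x\<bar> \<le> 1" for n x
     using infdist_nonneg[of x S] by (auto simp: g_def indicator_def)
   qed
  qed
 next
  case empty
  show ?case by (auto intro!: lipschitz_approximable_lipschitz[of 0] lipschitz_onI)
 next
  case (compl A)
  have "indicator (UNIV - A) = (\<lambda>x. 1 + (-1) * indicator A x :: real)" by (auto simp: indicator_def)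
  then show ?case
   using lipschitz_approximable_add_scaled[OF lipschitz_approximable_lipschitz[of 0 "\<lambda>_. 1"] compl.IH, of "-1"]
   by (simp add: lipschitz_on_def)
 next
  case (union A)
  show ?case
  proof (rule lipschitz_approximable_limit_seq[where f' = "\<lambda>n x. \<Sum>i<n. 1 * indicator (A i) x" and K = 1])
   show "lipschitz_approximable \<M> (\<lambda>x. \<Sum>i<n. 1 * indicator (A i) x)" for n
    using union.IH by (intro lipschitz_approximable_sum) auto
   have eq: "(\<Sum>i<n. 1 * indicator (A i) x) = (indicator (\<Union>i<n. A i) x :: real)" for n x
    using union.hyps(1) by (subst indicator_UN_disjoint) (auto intro: disjoint_family_on_mono)
   show "(\<lambda>n. \<Sum>i<n. 1 * indicator (A i) x) \<longlonglongrightarrow> (indicator (\<Union>i. A i) x :: real)" for x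
    using LIMSEQ_indicator_UN[of A x] by (simp only: eq)
   show "\<bar>indicator (\<Union>i. A i) x - (\<Sum>i<n. 1 * indicator (A i) x)\<bar> \<le> (1 :: real)" for n x
    unfolding eq by (auto simp: indicator_def)
  qed
 qed
qed

lemma lipschitz_approximable_bounded:
 assumes [measurable]: "f \<in> borel_measurable borel" and f: "\<And>x. \<bar>f x\<bar> \<le> K"
 shows "lipschitz_approximable \<M> f"
proof (rule lipschitz_approximable_limit_seq[where K = 1])
 define J where "J n = {- \<lceil>real (Suc n) * K\<rceil> - 1 .. \<lceil>real (Suc n) * K\<rceil>}" for n
 define f' where "f' n x = (\<Sum>j\<in>J n. of_int j / real (Suc n) * indicator {x. \<lfloor>real (Suc n) * f x\<rfloor> = j} x)" for n x
 have eq: "f' n x = of_int \<lfloor>real (Suc n) * f x\<rfloor> / real (Suc n)" for n x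
 proof -
  have "\<bar>real (Suc n) * f x\<bar> \<le> real (Suc n) * K"
   using f[of x] by (simp add: abs_mult)
  then have "\<lfloor>real (Suc n) * f x\<rfloor> \<in> J n" unfolding J_def by simp linarith
  moreover have "f' n x = (\<Sum>j\<in>J n. if j = \<lfloor>real (Suc n) * f x\<rfloor> then of_int j / real (Suc n) else 0)"
   unfolding f'_def by (intro sum.cong) (auto simp: indicator_def)
  ultimately show ?thesis by (simp add: J_def)
 qed
 show "lipschitz_approximable \<M> (f' n)" for n
  unfolding f'_def by (intro lipschitz_approximable_sum lipschitz_approximable_indicator) (auto simp: J_def)
 have err: "\<bar>f x - f' n x\<bar> \<le> 1 / real (Suc n)" for n x
 proof -
  have "f x - f' n x = (real (Suc n) * f x - of_int \<lfloor>real (Suc n) * f x\<rfloor>) / real (Suc n)"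
   unfolding eq by (simp add: diff_divide_distrib)
  moreover have "\<bar>real (Suc n) * f x - of_int \<lfloor>real (Suc n) * f x\<rfloor>\<bar> \<le> 1" by linarith
  ultimately show ?thesis by (simp add: divide_right_mono)
 qed
 show "\<bar>f x - f' n x\<bar> \<le> 1" for n x
  using err[where n = n and x = x] by (rule order_trans) simp
 show "(\<lambda>n. f' n x) \<longlonglongrightarrow> f x" for x
 proof (rule LIMSEQ_I)
  fix r :: real assume "r > 0"
  then obtain n0 where "inverse (real (Suc n0)) < r" using reals_Archimedean by blast
  then have "norm (f' n x - f x) < r" if "n \<ge> n0" for n
  proof -
   have "1 / real (Suc n) \<le> 1 / real (Suc n0)" using that by (intro divide_left_mono) auto
   then show ?thesis
    using err[of x n] \<open>inverse (real (Suc n0)) < r\<close> by (simp add: inverse_eq_divide abs_minus_commute)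
  qed
  then show "\<exists>no. \<forall>n\<ge>no. norm (f' n x - f x) < r" by blast
 qed
qed

end

lemma difference_quotient_of_primitive:
 fixes H g :: "real \<Rightarrow> real"
 assumes "\<And>x. (H has_real_derivative g x) (at x)" "\<epsilon> > 0"
 obtains \<xi> where "x - \<epsilon> < \<xi>" "\<xi> < x + \<epsilon>" "(H (x + \<epsilon>) - H (x - \<epsilon>)) / (2 * \<epsilon>) = g \<xi>"
proof -
 obtain \<xi> where "x - \<epsilon> < \<xi>" "\<xi> < x + \<epsilon>" "H (x + \<epsilon>) - H (x - \<epsilon>) = (x + \<epsilon> - (x - \<epsilon>)) * g \<xi>"
  using MVT2[of "x - \<epsilon>" "x + \<epsilon>" H g] assms by auto
 then show ?thesis using that[of \<xi>] assms(2) by (simp add: field_simps)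
qed

text \<open>The bound \<open>K\<close> of the field and the bound \<open>L\<close> of its derivative are kept apart, because the final estimates may depend on \<open>K\<close>
  but not on \<open>L\<close>.\<close>

definition regular_field :: "(real \<Rightarrow> real \<Rightarrow> real) \<Rightarrow> (real \<Rightarrow> real \<Rightarrow> real) \<Rightarrow> real \<Rightarrow> real \<Rightarrow> bool" where
 "regular_field g g' K L \<longleftrightarrow>
   (\<forall>s x. (g s has_real_derivative g' s x) (at x)) \<and> (\<forall>s x. \<bar>g s x\<bar> \<le> K) \<and>
   (\<forall>s x. \<bar>g' s x\<bar> \<le> L) \<and> (\<forall>s x y. \<bar>g' s x - g' s y\<bar> \<le> L * \<bar>x - y\<bar>) \<and>
   continuous_on UNIV (\<lambda>(s, x). g s x) \<and> continuous_on UNIV (\<lambda>(s, x). g' s x)"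

text \<open>Averaging in the space variable keeps the bound \<open>K\<close>; only the derivative deteriorates with the accuracy \<open>e\<close>.\<close>

lemma space_smooth_approximation:
 fixes f :: "real \<times> real \<Rightarrow> real"
 assumes fin: "finite \<M>" "\<And>m. m \<in> \<M> \<Longrightarrow> finite_measure m" "\<And>m. m \<in> \<M> \<Longrightarrow> sets m = sets borel"
  and f [measurable]: "f \<in> borel_measurable borel" and K: "\<And>z. \<bar>f z\<bar> \<le> K" and e: "e > 0"
 obtains g g' L where "regular_field g g' K L" "\<And>m. m \<in> \<M> \<Longrightarrow> (\<integral>\<^sup>+z. ennreal \<bar>f z - case_prod g z\<bar> \<partial>m) \<le> ennreal e"
proof -
 define \<mu> where "\<mu> = (\<Sum>m\<in>\<M>. measure m UNIV) + 1"
 have \<mu>: "\<mu> > 0" by (simp add: \<mu>_def add_nonneg_pos sum_nonneg)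
 have \<mu>le: "measure m UNIV \<le> \<mu>" if "m \<in> \<M>" for m
  using member_le_sum[OF that, of "\<lambda>m. measure m UNIV"] fin(1) by (simp add: \<mu>_def)
 obtain k0 C where k0: "C-lipschitz_on UNIV k0"
  and k0e: "\<And>m. m \<in> \<M> \<Longrightarrow> (\<integral>\<^sup>+z. ennreal \<bar>f z - k0 z\<bar> \<partial>m) \<le> ennreal (e / 2)"
  using lipschitz_approximable_bounded[OF fin f K] e unfolding lipschitz_approximable_def
  by (meson half_gt_zero)
 define k where "k z = max (- K) (min K (k0 z))" for z
 have K0: "K \<ge> 0" using K[of undefined] by linarith
 have C0: "C \<ge> 0" using k0 by (auto simp: lipschitz_on_def)
 have kK: "\<bar>k z\<bar> \<le> K" for z using K0 by (auto simp: k_def)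
 have kL: "\<bar>k z - k z'\<bar> \<le> C * dist z z'" for z z'
 proof -
  have "\<bar>k z - k z'\<bar> \<le> \<bar>k0 z - k0 z'\<bar>" by (auto simp: k_def)
  also have "\<dots> \<le> C * dist z z'" using lipschitz_onD[OF k0, of z z'] by (simp add: dist_real_def)
  finally show ?thesis .
 qed
 have kx: "\<bar>k (s, x) - k (s, y)\<bar> \<le> C * \<bar>x - y\<bar>" for s x y
  using kL[of "(s, x)" "(s, y)"] by (simp add: dist_Pair_Pair dist_real_def)
 have ks: "\<bar>k (s, x) - k (s', x)\<bar> \<le> C * \<bar>s - s'\<bar>" for s s' x
  using kL[of "(s, x)" "(s', x)"] by (simp add: dist_Pair_Pair dist_real_def)
 have kc: "continuous_on UNIV k"
  using kL C0 by (intro lipschitz_on_continuous_on[of C] lipschitz_onI) (auto simp: dist_real_def)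
 define \<epsilon> where "\<epsilon> = e / (2 * (C + 1) * \<mu>)"
 have \<epsilon>: "\<epsilon> > 0" using e C0 \<mu> by (simp add: \<epsilon>_def)
 have "\<exists>H. \<forall>x. (H has_real_derivative k (s, x)) (at x)" for s
 proof -
  have "isCont (\<lambda>x. k (s, x)) x" for x
   using continuous_on_compose2[OF kc, of UNIV "\<lambda>x. (s, x)"]
   by (simp add: continuous_on_eq_continuous_at continuous_on_Pair)
  then show ?thesis
   using einterval_antiderivative[of "-\<infinity>" "\<infinity>" "\<lambda>x. k (s, x)"]
   by (auto simp: has_real_derivative_iff_has_vector_derivative)
 qed
 then obtain H where H: "\<And>s x. (H s has_real_derivative k (s, x)) (at x)" by metis
 \<comment> \<open>Averaging over intervals of length \<open>2 * \<epsilon>\<close> in the space variable: the derivative of the average is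
   a difference quotient of a Lipschitz function.\<close>
 define g where "g s x = (H s (x + \<epsilon>) - H s (x - \<epsilon>)) / (2 * \<epsilon>)" for s x
 define g' where "g' s x = (k (s, x + \<epsilon>) - k (s, x - \<epsilon>)) / (2 * \<epsilon>)" for s x
 define L where "L = max (K / \<epsilon>) (C / \<epsilon>)"
 have d: "(g s has_real_derivative g' s x) (at x)" for s x
 proof -
  have "((\<lambda>x. H s (x + c)) has_real_derivative k (s, x + c)) (at x)" for c
   using H[of s "x + c"] by (simp add: DERIV_shift)
  from DERIV_cdivide[OF DERIV_diff[OF this[of \<epsilon>] this[of "- \<epsilon>"]], of "2 * \<epsilon>"]
  show ?thesis unfolding g_def[abs_def] g'_def by simp
 qed
 have gk: "\<bar>g s x - k (s, x)\<bar> \<le> C * \<epsilon> \<and> \<bar>g s x\<bar> \<le> K" for s x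
 proof -
  obtain \<xi> where \<xi>: "x - \<epsilon> < \<xi>" "\<xi> < x + \<epsilon>" "g s x = k (s, \<xi>)"
   using difference_quotient_of_primitive[OF H \<epsilon>, of x s] unfolding g_def by blast
  have "C * \<bar>\<xi> - x\<bar> \<le> C * \<epsilon>" using \<xi> C0 by (intro mult_left_mono) auto
  then show ?thesis using kx[of s \<xi> x] kK[of "(s, \<xi>)"] \<xi>(3) by auto
 qed
 have g'L: "\<bar>g' s x\<bar> \<le> L" for s x
 proof -
  have "\<bar>k (s, x + \<epsilon>) - k (s, x - \<epsilon>)\<bar> \<le> 2 * K"
   using kK[of "(s, x + \<epsilon>)"] kK[of "(s, x - \<epsilon>)"] by linarith
  then have "\<bar>g' s x\<bar> \<le> 2 * K / (2 * \<epsilon>)"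
   using \<epsilon> divide_right_mono[of _ "2 * K" "2 * \<epsilon>"] by (simp add: g'_def abs_divide)
  then show ?thesis by (simp add: L_def)
 qed
 have g'Lip: "\<bar>g' s x - g' s y\<bar> \<le> L * \<bar>x - y\<bar>" for s x y
 proof -
  have "g' s x - g' s y = (k (s, x + \<epsilon>) - k (s, y + \<epsilon>) - (k (s, x - \<epsilon>) - k (s, y - \<epsilon>))) / (2 * \<epsilon>)"
   by (simp add: g'_def flip: diff_divide_distrib)
  moreover have "\<bar>k (s, x + \<epsilon>) - k (s, y + \<epsilon>) - (k (s, x - \<epsilon>) - k (s, y - \<epsilon>))\<bar> \<le> 2 * (C * \<bar>x - y\<bar>)"
   using kx[of s "x + \<epsilon>" "y + \<epsilon>"] kx[of s "x - \<epsilon>" "y - \<epsilon>"] by simp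
  ultimately have "\<bar>g' s x - g' s y\<bar> \<le> 2 * (C * \<bar>x - y\<bar>) / (2 * \<epsilon>)"
   using \<epsilon> divide_right_mono[of _ "2 * (C * \<bar>x - y\<bar>)" "2 * \<epsilon>"] by (simp add: abs_divide)
  also have "\<dots> = C / \<epsilon> * \<bar>x - y\<bar>" by simp
  also have "\<dots> \<le> L * \<bar>x - y\<bar>" by (intro mult_right_mono) (auto simp: L_def)
  finally show ?thesis .
 qed
 have gc: "continuous_on UNIV (\<lambda>(s, x). g s x)"
 proof (rule lipschitz_on_continuous_on[of "C + L"], rule lipschitz_onI)
  fix z z' :: "real \<times> real"
  obtain s x s' x' where z: "z = (s, x)" "z' = (s', x')" by (metis surj_pair)
  have "\<exists>\<xi>. g s x - g s' x = k (s, \<xi>) - k (s', \<xi>)"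
  proof -
   have "((\<lambda>x. H s x - H s' x) has_real_derivative k (s, x) - k (s', x)) (at x)" for x
    by (intro derivative_intros H)
   from difference_quotient_of_primitive[OF this \<epsilon>, of x] obtain \<xi>
    where "(H s (x + \<epsilon>) - H s' (x + \<epsilon>) - (H s (x - \<epsilon>) - H s' (x - \<epsilon>))) / (2 * \<epsilon>) = k (s, \<xi>) - k (s', \<xi>)"
    by metis
   then show ?thesis by (intro exI[of _ \<xi>]) (simp add: g_def diff_divide_distrib)
  qed
  then have 1: "\<bar>g s x - g s' x\<bar> \<le> C * \<bar>s - s'\<bar>" using ks by auto
  have 2: "\<bar>g s' x - g s' x'\<bar> \<le> L * \<bar>x - x'\<bar>"
   using field_differentiable_bound[of UNIV "g s'" "g' s'" L x x'] d g'L by simp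
  have "\<bar>s - s'\<bar> \<le> dist z z'" "\<bar>x - x'\<bar> \<le> dist z z'"
   using dist_fst_le[of z z'] dist_snd_le[of z z'] by (auto simp: z dist_real_def)
  moreover have "L \<ge> 0" using g'L[of 0 0] by linarith
  ultimately have "C * \<bar>s - s'\<bar> \<le> C * dist z z'" "L * \<bar>x - x'\<bar> \<le> L * dist z z'"
   using C0 by (auto intro: mult_left_mono)
  then show "dist (case_prod g z) (case_prod g z') \<le> (C + L) * dist z z'"
   using 1 2 by (simp add: z dist_real_def distrib_right)
 next
  show "0 \<le> C + L" using C0 g'L[of 0 0] by linarith
 qed
 have g'c: "continuous_on UNIV (\<lambda>(s, x). g' s x)"
  unfolding g'_def case_prod_unfold
  using \<epsilon> by (intro continuous_intros continuous_on_compose2[OF kc]) auto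
 have ge: "(\<integral>\<^sup>+z. ennreal \<bar>f z - case_prod g z\<bar> \<partial>m) \<le> ennreal e" if m: "m \<in> \<M>" for m
 proof -
  interpret finite_measure m using fin(2)[OF m] .
  have sp: "space m = UNIV" using sets_eq_imp_space_eq[OF fin(3)[OF m]] by simp
  have [measurable]: "f \<in> borel_measurable m" "k0 \<in> borel_measurable m"
   using f lipschitz_borel_measurable[OF k0] fin(3)[OF m] measurable_cong_sets by blast+
  have "\<bar>f z - case_prod g z\<bar> \<le> \<bar>f z - k0 z\<bar> + C * \<epsilon>" for z
  proof -
   have "\<bar>f z - k z\<bar> \<le> \<bar>f z - k0 z\<bar>" using K[of z] by (auto simp: k_def)
   moreover have "\<bar>k z - case_prod g z\<bar> \<le> C * \<epsilon>"
    using gk by (auto simp: abs_minus_commute split: prod.split)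
   ultimately show ?thesis by linarith
  qed
  then have "(\<integral>\<^sup>+z. ennreal \<bar>f z - case_prod g z\<bar> \<partial>m)
    \<le> (\<integral>\<^sup>+z. ennreal \<bar>f z - k0 z\<bar> + ennreal (C * \<epsilon>) \<partial>m)"
   using C0 \<epsilon> by (intro nn_integral_mono) (auto intro!: ennreal_leI simp flip: ennreal_plus)
  also have "\<dots> = (\<integral>\<^sup>+z. ennreal \<bar>f z - k0 z\<bar> \<partial>m) + ennreal (C * \<epsilon>) * emeasure m UNIV"
   by (subst nn_integral_add) (auto simp: sp)
  also have "\<dots> \<le> ennreal (e / 2) + ennreal (C * \<epsilon> * \<mu>)"
  proof (intro add_mono k0e m)
   show "ennreal (C * \<epsilon>) * emeasure m UNIV \<le> ennreal (C * \<epsilon> * \<mu>)"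
    using C0 \<epsilon> \<mu>le[OF m]
    by (auto simp: emeasure_eq_measure ennreal_mult[symmetric] intro!: ennreal_leI mult_left_mono)
  qed
  also have "C * \<epsilon> * \<mu> \<le> e / 2"
  proof -
   have "C * (e / (2 * c * \<mu>)) * \<mu> = C / c * (e / 2)" if "c \<noteq> 0" for c
    using that \<mu> by (simp add: field_simps)
   from this[of "C + 1"] have "C * \<epsilon> * \<mu> = C / (C + 1) * (e / 2)" using C0 by (simp add: \<epsilon>_def)
   also have "\<dots> \<le> 1 * (e / 2)" using C0 e by (intro mult_right_mono) auto
   finally show ?thesis by simp
  qed
  then have "ennreal (e / 2) + ennreal (C * \<epsilon> * \<mu>) \<le> ennreal (e / 2) + ennreal (e / 2)"
   by (intro add_mono ennreal_leI) auto
  also have "\<dots> = ennreal e" using e by (simp flip: ennreal_plus)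
  finally show ?thesis .
 qed
 have "regular_field g g' K L" unfolding regular_field_def using d gk g'L g'Lip gc g'c by blast
 then show ?thesis using ge by (rule that)
qed

section \<open>Exponential moments along a Brownian motion\<close>

text \<open>Independence of an increment from the past is stated as a property of its joint law with the identity map, which
  turns conditioning on the past into Fubini's theorem.\<close>

locale adapted_BM = prob_space M for M :: "'w measure" +
 fixes T :: real and B :: "real \<Rightarrow> 'w \<Rightarrow> real" and F :: "real \<Rightarrow> 'w measure"
 assumes T_pos: "T > 0"
  and space_F [simp]: "space (F t) = space M"
  and sets_F_M: "0 \<le> t \<Longrightarrow> t \<le> T \<Longrightarrow> sets (F t) \<subseteq> sets M"
  and sets_F_mono: "0 \<le> s \<Longrightarrow> s \<le> t \<Longrightarrow> t \<le> T \<Longrightarrow> sets (F s) \<subseteq> sets (F t)"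
  and B_adapted: "0 \<le> t \<Longrightarrow> t \<le> T \<Longrightarrow> B t \<in> borel_measurable (F t)"
  and B_measurable [measurable]: "B t \<in> borel_measurable M"
  and B_0: "w \<in> space M \<Longrightarrow> B 0 w = 0"
  and B_continuous: "w \<in> space M \<Longrightarrow> continuous_on UNIV (\<lambda>t. B t w)"
  and B_increment: "0 \<le> s \<Longrightarrow> s < t \<Longrightarrow> t \<le> T \<Longrightarrow>
   distr M (F s \<Otimes>\<^sub>M borel) (\<lambda>w. (w, B t w - B s w)) = distr M (F s) (\<lambda>w. w) \<Otimes>\<^sub>M gauss (t - s)"
begin

abbreviation incr :: "real \<Rightarrow> nat \<Rightarrow> 'w \<Rightarrow> real" where
 "incr h k w \<equiv> B (real (Suc k) * h) w - B (real k * h) w"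

text \<open>The mean of the motion at the \<open>k\<close>-th grid point given the next value is \<open>k / (k + 1)\<close> times that value.\<close>

abbreviation bridge :: "real \<Rightarrow> nat \<Rightarrow> 'w \<Rightarrow> real" where
 "bridge h k w \<equiv> B (real k * h) w - real k / real (Suc k) * B (real (Suc k) * h) w"

lemma measurable_F_M:
 "0 \<le> t \<Longrightarrow> t \<le> T \<Longrightarrow> f \<in> measurable (F t) N \<Longrightarrow> f \<in> measurable M N"
 using measurable_mono[OF order_refl refl sets_F_M, of t N] by auto

lemma measurable_F_mono:
 "0 \<le> s \<Longrightarrow> s \<le> t \<Longrightarrow> t \<le> T \<Longrightarrow> f \<in> measurable (F s) N \<Longrightarrow> f \<in> measurable (F t) N"
 using measurable_mono[OF order_refl refl sets_F_mono, of s t N] by auto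

text \<open>The increment is integrated out against its Gaussian law while everything known at time \<open>s\<close> is kept fixed.\<close>

lemma nn_integral_increment:
 assumes st: "0 \<le> s" "s < t" "t \<le> T"
  and f: "f \<in> borel_measurable (F s)" and b: "b \<in> measurable (F s) N"
  and \<psi> [measurable]: "(\<lambda>(x, v). \<psi> x v) \<in> borel_measurable (N \<Otimes>\<^sub>M borel)"
 shows "(\<integral>\<^sup>+w. f w * \<psi> (b w) (B t w - B s w) \<partial>M) = (\<integral>\<^sup>+w. f w * (\<integral>\<^sup>+v. \<psi> (b w) v \<partial>gauss (t - s)) \<partial>M)"
proof -
 let ?D = "\<lambda>w. B t w - B s w"
 have id: "(\<lambda>w. w) \<in> measurable M (F s)"
  using st by (intro measurable_F_M[of s]) auto
 note [measurable] = f b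
 interpret g: prob_space "gauss (t - s)" using st by (intro prob_space_gauss) simp
 have m: "(\<lambda>(w, v). f w * \<psi> (b w) v) \<in> borel_measurable (F s \<Otimes>\<^sub>M borel)"
  by measurable
 have "(\<integral>\<^sup>+w. f w * \<psi> (b w) (?D w) \<partial>M)
   = (\<integral>\<^sup>+p. (case p of (w, v) \<Rightarrow> f w * \<psi> (b w) v) \<partial>distr M (F s \<Otimes>\<^sub>M borel) (\<lambda>w. (w, ?D w)))"
  by (subst nn_integral_distr) (use id m in \<open>auto intro!: measurable_Pair\<close>)
 also have "distr M (F s \<Otimes>\<^sub>M borel) (\<lambda>w. (w, ?D w)) = distr M (F s) (\<lambda>w. w) \<Otimes>\<^sub>M gauss (t - s)"
  by (rule B_increment[OF st])
 also have "(\<integral>\<^sup>+p. (case p of (w, v) \<Rightarrow> f w * \<psi> (b w) v) \<partial>(distr M (F s) (\<lambda>w. w) \<Otimes>\<^sub>M gauss (t - s)))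
   = (\<integral>\<^sup>+w. (\<integral>\<^sup>+v. f w * \<psi> (b w) v \<partial>gauss (t - s)) \<partial>distr M (F s) (\<lambda>w. w))"
  by (subst g.nn_integral_fst[symmetric]) auto
 also have "\<dots> = (\<integral>\<^sup>+w. (\<integral>\<^sup>+v. f w * \<psi> (b w) v \<partial>gauss (t - s)) \<partial>M)"
  by (subst nn_integral_distr[OF id]) auto
 also have "\<dots> = (\<integral>\<^sup>+w. f w * (\<integral>\<^sup>+v. \<psi> (b w) v \<partial>gauss (t - s)) \<partial>M)"
 proof (rule nn_integral_cong)
  fix w assume "w \<in> space M"
  then have "b w \<in> space N" using measurable_space[OF b] by simp
  then show "(\<integral>\<^sup>+v. f w * \<psi> (b w) v \<partial>gauss (t - s)) = f w * (\<integral>\<^sup>+v. \<psi> (b w) v \<partial>gauss (t - s))"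
   by (intro nn_integral_cmult) measurable
 qed
 finally show ?thesis .
qed

lemma distr_B:
 assumes "0 < t" "t \<le> T"
 shows "distr M borel (B t) = gauss t"
proof -
 have "distr M borel (B t) = distr M borel (\<lambda>w. B t w - B 0 w)"
  by (intro distr_cong) (auto simp: B_0)
 also have "\<dots> = gauss t"
 proof (rule measure_eqI)
  fix A assume "A \<in> sets (distr M borel (\<lambda>w. B t w - B 0 w))"
  then have [measurable]: "A \<in> sets borel" by simp
  have "emeasure (distr M borel (\<lambda>w. B t w - B 0 w)) A = (\<integral>\<^sup>+w. 1 * indicator A (B t w - B 0 w) \<partial>M)"
   by (simp add: nn_integral_indicator[symmetric] nn_integral_distr del: nn_integral_indicator)
  also have "\<dots> = (\<integral>\<^sup>+w. 1 * (\<integral>\<^sup>+v. indicator A v \<partial>gauss (t - 0)) \<partial>M)"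
   using assms by (intro nn_integral_increment[where N = borel and b = "\<lambda>_. 0 :: real" and \<psi> = "\<lambda>_. indicator A"]) auto
  also have "\<dots> = emeasure (gauss t) A" by (simp add: emeasure_space_1)
  finally show "emeasure (distr M borel (\<lambda>w. B t w - B 0 w)) A = emeasure (gauss t) A" .
 qed simp
 finally show ?thesis .
qed

lemma nn_integral_B:
 assumes "0 < t" "t \<le> T" and [measurable]: "f \<in> borel_measurable borel"
 shows "(\<integral>\<^sup>+w. f (B t w) \<partial>M) = (\<integral>\<^sup>+v. f v \<partial>gauss t)"
 unfolding distr_B[OF assms(1,2), symmetric] by (subst nn_integral_distr) auto

lemma grid_point_le:
 assumes "real n * h \<le> T" "k \<le> n" "h > 0"
 shows "real k * h \<le> T"
proof -
 have "real k * h \<le> real n * h" using assms by (intro mult_right_mono) auto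
 then show ?thesis using assms by linarith
qed

lemma measurable_F_grid:
 assumes "h > 0" "real n * h \<le> T" "k \<le> n" "f \<in> borel_measurable (F (real k * h))"
 shows "f \<in> borel_measurable (F (real n * h))"
 using assms by (intro measurable_F_mono[of "real k * h" "real n * h"] mult_right_mono) auto

lemma B_grid:
 assumes "h > 0" "real n * h \<le> T" "k \<le> n"
 shows "B (real k * h) \<in> borel_measurable (F (real n * h))"
 using assms grid_point_le[of n h k] by (intro measurable_F_grid[of h n k] B_adapted) auto

lemma exp_martingale:
 assumes h: "h > 0" and n: "real n * h \<le> T"
  and \<gamma>: "\<And>k. k < n \<Longrightarrow> \<gamma> k \<in> borel_measurable (F (real k * h))"
 shows "EE (\<lambda>w. exp (\<Sum>k<n. \<gamma> k w * incr h k w - (\<gamma> k w)^2 * h / 2)) = 1"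
 using n \<gamma>
proof (induction n)
 case 0
 show ?case by (simp add: emeasure_space_1)
next
 case (Suc n)
 let ?t = "real n * h" and ?u = "real (Suc n) * h"
 let ?P = "\<lambda>w. ennreal (exp (\<Sum>k<n. \<gamma> k w * incr h k w - (\<gamma> k w)^2 * h / 2))"
 have tu: "0 \<le> ?t" "?t < ?u" "?u \<le> T" using h Suc.prems by (auto simp: algebra_simps)
 have [measurable]: "\<gamma> k \<in> borel_measurable (F ?t)" "B (real k * h) \<in> borel_measurable (F ?t)"
  "B (real (Suc k) * h) \<in> borel_measurable (F ?t)" if "k < n" for k
  using Suc.prems(2)[of k] measurable_F_grid[of h n k] B_grid[of h n k] B_grid[of h n "Suc k"] h tu that by auto
 have P: "?P \<in> borel_measurable (F ?t)" by measurable
 have "EE (\<lambda>w. exp (\<Sum>k<Suc n. \<gamma> k w * incr h k w - (\<gamma> k w)^2 * h / 2))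
   = (\<integral>\<^sup>+w. ?P w * ennreal (exp (\<gamma> n w * (B ?u w - B ?t w) - (\<gamma> n w)^2 * h / 2)) \<partial>M)"
  by (simp add: exp_add ennreal_mult)
 also have "\<dots> = (\<integral>\<^sup>+w. ?P w * (\<integral>\<^sup>+v. ennreal (exp (\<gamma> n w * v - (\<gamma> n w)^2 * h / 2)) \<partial>gauss (?u - ?t)) \<partial>M)"
  using nn_integral_increment[OF tu P Suc.prems(2)[of n], of "\<lambda>x v. ennreal (exp (x * v - x^2 * h / 2))"] by simp
 also have "\<dots> = (\<integral>\<^sup>+w. ?P w \<partial>M)"
 proof -
  have "?u - ?t = h" by (simp add: algebra_simps)
  then show ?thesis using gauss_exp_moment[OF h] by simp
 qed
 also have "\<dots> = 1" using Suc tu by simp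
 finally show ?case .
qed

lemma exp_forward_sum:
 assumes h: "h > 0" and n: "real n * h \<le> T"
  and \<gamma>: "\<And>k. k < n \<Longrightarrow> \<gamma> k \<in> borel_measurable (F (real k * h))"
  and K: "\<And>k w. k < n \<Longrightarrow> \<bar>\<gamma> k w\<bar> \<le> K"
 shows "EE (\<lambda>w. exp (\<Sum>k<n. \<gamma> k w * incr h k w))
  \<le> ennreal (exp (K^2 * T / 2))"
proof -
 have [measurable]: "\<gamma> k \<in> borel_measurable M" if "k < n" for k
  using \<gamma>[OF that] h grid_point_le[OF n, of k] that by (intro measurable_F_M[of "real k * h"]) auto
 have "(\<Sum>k<n. \<gamma> k w * incr h k w) \<le> K^2 * T / 2 + (\<Sum>k<n. \<gamma> k w * incr h k w - (\<gamma> k w)^2 * h / 2)" for w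
 proof -
  have "(\<Sum>k<n. (\<gamma> k w)^2 * h / 2) \<le> (\<Sum>k<n. K^2 * h / 2)"
  proof (intro sum_mono divide_right_mono mult_right_mono)
   fix k assume "k \<in> {..<n}"
   then have "\<bar>\<gamma> k w\<bar> \<le> \<bar>K\<bar>" using K[of k w] by auto
   then show "(\<gamma> k w)^2 \<le> K^2" by (simp add: abs_le_square_iff)
  qed (use h in auto)
  also have "\<dots> \<le> K^2 * T / 2" using mult_left_mono[OF n, of "K^2"] by (simp add: algebra_simps)
  finally show ?thesis by (simp add: sum_subtractf)
 qed
 then have "EE (\<lambda>w. exp (\<Sum>k<n. \<gamma> k w * incr h k w))
  \<le> (\<integral>\<^sup>+w. ennreal (exp (K^2 * T / 2)) * ennreal (exp (\<Sum>k<n. \<gamma> k w * incr h k w - (\<gamma> k w)^2 * h / 2)) \<partial>M)"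
  by (intro nn_integral_mono) (auto simp flip: ennreal_mult exp_add intro!: ennreal_leI)
 also have "\<dots> = ennreal (exp (K^2 * T / 2))"
  by (subst nn_integral_cmult) (simp_all add: exp_martingale[OF h n \<gamma>] del: of_nat_Suc)
 finally show ?thesis .
qed

text \<open>The \<open>k\<close>-th bridge variable is Gaussian with variance at most \<open>h\<close> and independent of the motion after the \<open>k\<close>-th grid point, so the sum is a
  martingale sum in reversed time. The induction nevertheless proceeds forward; the function \<open>\<Phi>\<close> of the last value stands for
  the later summands.\<close>

lemma exp_backward_sum:
 assumes h: "h > 0"
  and \<gamma> [measurable]: "\<And>k. \<gamma> k \<in> borel_measurable borel" and K: "\<And>k x. \<bar>\<gamma> k x\<bar> \<le> K"
 shows "real (Suc n) * h \<le> T \<Longrightarrow> \<Phi> \<in> borel_measurable borel \<Longrightarrow>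
  (\<integral>\<^sup>+w. ennreal (exp (\<Sum>k\<in>{1..n}. \<gamma> k (B (real (Suc k) * h) w) * bridge h k w)) * \<Phi> (B (real (Suc n) * h) w) \<partial>M)
  \<le> ennreal (exp (K^2 * (real n * h) / 2)) * (\<integral>\<^sup>+w. \<Phi> (B (real (Suc n) * h) w) \<partial>M)"
proof (induction n arbitrary: \<Phi>)
 case 0
 show ?case by simp
next
 case (Suc n)
 note [measurable] = Suc.prems(2)
 let ?t = "real (Suc n) * h" and ?u = "real (Suc (Suc n)) * h"
 let ?P = "\<lambda>w. ennreal (exp (\<Sum>k\<in>{1..n}. \<gamma> k (B (real (Suc k) * h) w) * bridge h k w))"
 have tu: "0 \<le> ?t" "?t < ?u" "?u \<le> T" using h Suc.prems by (auto simp: algebra_simps)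
 have t0: "0 < ?t" using h by simp
 have diff: "?u - ?t = h" by (simp add: algebra_simps)
 define c where "c = real (Suc n) / real (Suc (Suc n))"
 define \<kappa> where "\<kappa> = ?t * h / (?t + h)"
 have "t * h / (t + h) > 0 \<and> t * h / (t + h) \<le> h" if "t > 0" for t
  using that h by (simp add: pos_divide_le_eq algebra_simps)
 from this[OF t0] have \<kappa>: "\<kappa> > 0" "\<kappa> \<le> h" by (auto simp: \<kappa>_def)
 have u: "?t + h = ?u" by (simp add: algebra_simps)
 have c: "?t / (?t + h) = c" unfolding u c_def using h by (intro mult_divide_mult_cancel_right) auto
 define \<Psi> where "\<Psi> u w = ennreal (exp (\<gamma> (Suc n) w * (u - c * w))) * \<Phi> w" for u w
 have [measurable]: "case_prod \<Psi> \<in> borel_measurable (borel \<Otimes>\<^sub>M borel)"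
  unfolding \<Psi>_def by measurable
 have "?t \<le> T" using tu by linarith
 then have [measurable]: "B (real k * h) \<in> borel_measurable (F ?t)" "B (real (Suc k) * h) \<in> borel_measurable (F ?t)" if "k \<in> {1..n}" for k
  using B_grid[of h "Suc n" k] B_grid[of h "Suc n" "Suc k"] h that by auto
 have P: "?P \<in> borel_measurable (F ?t)" by measurable
 define \<Phi>' where "\<Phi>' u = (\<integral>\<^sup>+v. \<Psi> u (u + v) \<partial>gauss h)" for u
 have [measurable]: "\<Phi>' \<in> borel_measurable borel"
 proof -
  interpret g: prob_space "gauss h" using h by (rule prob_space_gauss)
  show ?thesis unfolding \<Phi>'_def by measurable
 qed
 have "(\<integral>\<^sup>+w. ennreal (exp (\<Sum>k\<in>{1..Suc n}. \<gamma> k (B (real (Suc k) * h) w) * bridge h k w)) * \<Phi> (B ?u w) \<partial>M)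
   = (\<integral>\<^sup>+w. ?P w * \<Psi> (B ?t w) (B ?t w + (B ?u w - B ?t w)) \<partial>M)"
  by (intro nn_integral_cong) (simp add: \<Psi>_def c_def exp_add ennreal_mult mult.assoc)
 also have "\<dots> = (\<integral>\<^sup>+w. ?P w * \<Phi>' (B ?t w) \<partial>M)"
  using nn_integral_increment[OF tu P B_adapted, of "\<lambda>u v. \<Psi> u (u + v)"] tu unfolding diff \<Phi>'_def by simp
 also have "\<dots> \<le> ennreal (exp (K^2 * (real n * h) / 2)) * (\<integral>\<^sup>+w. \<Phi>' (B ?t w) \<partial>M)"
  using tu by (intro Suc.IH) auto
 also have "(\<integral>\<^sup>+w. \<Phi>' (B ?t w) \<partial>M) = (\<integral>\<^sup>+u. \<Phi>' u \<partial>gauss ?t)"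
  using tu t0 by (intro nn_integral_B) auto
 \<comment> \<open>The value of the path at the earlier time is decomposed into its projection on the value at the later one and an independent remainder.\<close>
 also have "\<dots> = (\<integral>\<^sup>+w. (\<integral>\<^sup>+z. \<Psi> (c * w + z) w \<partial>gauss \<kappa>) \<partial>gauss ?u)"
  unfolding \<Phi>'_def using t0 h
  by (intro gauss_rotate[of \<Psi> ?t h, unfolded c, unfolded \<kappa>_def[symmetric], unfolded u]) auto
 also have "\<dots> = (\<integral>\<^sup>+w. ennreal (exp ((\<gamma> (Suc n) w)^2 * \<kappa> / 2)) * \<Phi> w \<partial>gauss ?u)"
 proof (rule nn_integral_cong)
  fix w
  let ?g = "\<gamma> (Suc n) w"
  have "(\<integral>\<^sup>+z. \<Psi> (c * w + z) w \<partial>gauss \<kappa>)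
   = (\<integral>\<^sup>+z. (ennreal (exp (?g^2 * \<kappa> / 2)) * \<Phi> w) * ennreal (exp (?g * z - ?g^2 * \<kappa> / 2)) \<partial>gauss \<kappa>)"
   unfolding \<Psi>_def
  proof (rule nn_integral_cong)
   fix z
   have "exp (?g * (c * w + z - c * w)) = exp (?g^2 * \<kappa> / 2) * exp (?g * z - ?g^2 * \<kappa> / 2)"
    by (simp flip: exp_add)
   then show "ennreal (exp (?g * (c * w + z - c * w))) * \<Phi> w
     = (ennreal (exp (?g^2 * \<kappa> / 2)) * \<Phi> w) * ennreal (exp (?g * z - ?g^2 * \<kappa> / 2))"
    by (simp add: ennreal_mult mult.assoc mult.commute[of "\<Phi> w"])
  qed
  also have "\<dots> = ennreal (exp (?g^2 * \<kappa> / 2)) * \<Phi> w"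
   by (subst nn_integral_cmult) (auto simp: gauss_exp_moment[OF \<kappa>(1)])
  finally show "(\<integral>\<^sup>+z. \<Psi> (c * w + z) w \<partial>gauss \<kappa>) = \<dots>" .
 qed
 also have "\<dots> \<le> (\<integral>\<^sup>+w. ennreal (exp (K^2 * h / 2)) * \<Phi> w \<partial>gauss ?u)"
 proof (intro nn_integral_mono mult_right_mono ennreal_leI)
  fix w
  have "\<bar>\<gamma> (Suc n) w\<bar> \<le> \<bar>K\<bar>" using K[of "Suc n" w] by auto
  then have "(\<gamma> (Suc n) w)^2 \<le> K^2" by (simp add: abs_le_square_iff)
  then have "(\<gamma> (Suc n) w)^2 * \<kappa> \<le> K^2 * h" using \<kappa> by (intro mult_mono) auto
  then show "exp ((\<gamma> (Suc n) w)^2 * \<kappa> / 2) \<le> exp (K^2 * h / 2)" by simp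
 qed simp
 also have "\<dots> = ennreal (exp (K^2 * h / 2)) * (\<integral>\<^sup>+w. \<Phi> (B ?u w) \<partial>M)"
  using tu t0 by (subst nn_integral_cmult) (auto simp: nn_integral_B)
 finally have "(\<integral>\<^sup>+w. ennreal (exp (\<Sum>k\<in>{1..Suc n}. \<gamma> k (B (real (Suc k) * h) w) * bridge h k w)) * \<Phi> (B ?u w) \<partial>M)
   \<le> ennreal (exp (K^2 * (real n * h) / 2)) * (ennreal (exp (K^2 * h / 2)) * (\<integral>\<^sup>+w. \<Phi> (B ?u w) \<partial>M))"
  by (simp add: mult_left_mono)
 also have "\<dots> = ennreal (exp (K^2 * (real (Suc n) * h) / 2)) * (\<integral>\<^sup>+w. \<Phi> (B ?u w) \<partial>M)"
 proof -
  have "exp (K^2 * (real n * h) / 2) * exp (K^2 * h / 2) = exp (K^2 * (real (Suc n) * h) / 2)"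
   by (simp add: algebra_simps add_divide_distrib flip: exp_add)
  then show ?thesis by (simp only: mult.assoc[symmetric] ennreal_mult[symmetric] exp_ge_zero)
 qed
 finally show ?case .
qed

lemma exp_drift_sum:
 assumes h: "h > 0" and n: "real n * h \<le> T"
 shows "EE (\<lambda>w. exp (c * (\<Sum>k<n. \<bar>B (real (Suc k) * h) w\<bar> / real (Suc k))))
  \<le> ennreal (2 * exp (2 * c^2 * T))"
proof (cases "n = 0")
 case True
 have "1 \<le> exp (2 * c^2 * T)" using T_pos by simp
 then have "1 \<le> 2 * exp (2 * c^2 * T)" by linarith
 then have "1 \<le> ennreal (2 * exp (2 * c^2 * T))" using ennreal_leI by fastforce
 then show ?thesis using True by (simp add: emeasure_space_1)
next
 case False
 \<comment> \<open>Write \<open>\<bar>B\<^sub>t\<bar> / t\<close> as \<open>t powr (-1/2)\<close> times a variable of unit variance, and use convexity with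
   respect to the weights \<open>t powr (-1/2)\<close>, which are summable near 0.\<close>
 define l where "l k = sqrt (h / real (Suc k))" for k
 define S where "S = (\<Sum>k<n. l k)"
 have w0: "l k > 0" for k using h by (simp add: l_def)
 have S0: "S > 0" unfolding S_def using False w0 by (intro sum_pos) auto
 have S: "S^2 \<le> 4 * T"
 proof -
  have "(\<Sum>k<m. l k) \<le> 2 * sqrt (h * real m)" for m
  proof (induction m)
   case (Suc m)
   have "l m \<le> 2 * (sqrt (h * real (Suc m)) - sqrt (h * real m))"
   proof -
    define a b where "a = sqrt (real m)" and "b = sqrt (real (Suc m))"
    have ab: "b^2 = a^2 + 1" "0 \<le> a" "0 < b" "a \<le> b" by (auto simp: a_def b_def)
    have "1 / b \<le> 2 * (b - a)"
    proof -
     have "1 = (b - a) * (b + a)" using ab(1) by (simp add: power2_eq_square algebra_simps)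
     also have "\<dots> \<le> (b - a) * (2 * b)" using ab by (intro mult_left_mono) auto
     finally show ?thesis using ab(3) by (simp add: field_simps)
    qed
    then have "sqrt h * (1 / b) \<le> sqrt h * (2 * (b - a))" using h by (intro mult_left_mono) auto
    then show ?thesis
     unfolding l_def real_sqrt_mult real_sqrt_divide a_def b_def by (simp add: algebra_simps del: of_nat_Suc)
   qed
   then show ?case using Suc.IH by simp
  qed simp
  then have "S \<le> 2 * sqrt (h * real n)" by (simp add: S_def)
  then have "S^2 \<le> (2 * sqrt (h * real n))^2" using S0 by (intro power_mono) auto
  also have "\<dots> = 4 * (real n * h)" using h by (simp add: power_mult_distrib)
  finally show ?thesis using n by linarith
 qed
 define a where "a k w = \<bar>B (real (Suc k) * h) w\<bar> / sqrt (real (Suc k) * h)" for k w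
 have wa: "\<bar>B (real (Suc k) * h) w\<bar> / real (Suc k) = l k * a k w" for k w
 proof -
  have "sqrt (real (Suc k)) * sqrt (real (Suc k)) = real (Suc k)" by simp
  moreover have "l k * a k w = \<bar>B (real (Suc k) * h) w\<bar> / (sqrt (real (Suc k)) * sqrt (real (Suc k)))"
   using h unfolding l_def a_def by (simp add: real_sqrt_mult real_sqrt_divide del: of_nat_Suc real_sqrt_mult_self)
  ultimately show ?thesis by simp
 qed
 have conv: "exp (c * (\<Sum>k<n. l k * a k w)) \<le> (\<Sum>k<n. l k / S * exp (c * S * a k w))" for w
 proof -
  have "exp (\<Sum>k<n. (l k / S) *\<^sub>R (c * S * a k w)) \<le> (\<Sum>k<n. l k / S * exp (c * S * a k w))"
  proof (rule convex_on_sum[OF _ _ exp_convex])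
   show "(\<Sum>k<n. l k / S) = 1" using S0 by (simp add: S_def flip: sum_divide_distrib)
  qed (use w0 S0 False in \<open>auto intro!: divide_nonneg_pos less_imp_le\<close>)
  also have "(\<Sum>k<n. (l k / S) *\<^sub>R (c * S * a k w)) = c * (\<Sum>k<n. l k * a k w)"
   using S0 by (simp add: sum_distrib_left algebra_simps)
  finally show ?thesis .
 qed
 have each: "EE (\<lambda>w. exp (c * S * a k w)) \<le> ennreal (2 * exp (2 * c^2 * T))" if k: "k < n" for k
 proof -
  let ?t = "real (Suc k) * h"
  have t: "0 < ?t" "?t \<le> T"
  proof -
   show "0 < ?t" using h by simp
   have "?t \<le> real n * h" using h k by (intro mult_right_mono) auto
   then show "?t \<le> T" using n by linarith
  qed
  have "EE (\<lambda>w. exp (c * S * a k w)) = (\<integral>\<^sup>+v. ennreal (exp (c * S / sqrt ?t * \<bar>v\<bar>)) \<partial>gauss ?t)"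
   using nn_integral_B[OF t, of "\<lambda>v. ennreal (exp (c * S / sqrt ?t * \<bar>v\<bar>))"] by (simp add: a_def)
  also have "\<dots> \<le> ennreal (2 * exp ((c * S / sqrt ?t)^2 * ?t / 2))"
   by (rule gauss_exp_abs[OF t(1)])
  also have "(c * S / sqrt ?t)^2 * ?t = c^2 * S^2"
  proof -
   have "(c * S / sqrt t)^2 * t = c^2 * S^2" if "t > 0" for t
    using that by (simp add: power_divide power_mult_distrib)
   from this[OF t(1)] show ?thesis .
  qed
  also have "ennreal (2 * exp (c^2 * S^2 / 2)) \<le> ennreal (2 * exp (2 * c^2 * T))"
   using mult_left_mono[OF S, of "c^2"] by (intro ennreal_leI) simp
  finally show ?thesis .
 qed
 have [measurable]: "a k \<in> borel_measurable M" for k unfolding a_def by measurable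
 have "EE (\<lambda>w. exp (c * (\<Sum>k<n. \<bar>B (real (Suc k) * h) w\<bar> / real (Suc k))))
   \<le> (\<integral>\<^sup>+w. (\<Sum>k<n. ennreal (l k / S) * ennreal (exp (c * S * a k w))) \<partial>M)"
  unfolding wa using conv w0 S0
  by (intro nn_integral_mono) (auto simp: less_imp_le simp flip: ennreal_mult intro!: ennreal_leI)
 also have "\<dots> = (\<Sum>k<n. ennreal (l k / S) * EE (\<lambda>w. exp (c * S * a k w)))"
  by (subst nn_integral_sum) (auto simp: nn_integral_cmult)
 also have "\<dots> \<le> (\<Sum>k<n. ennreal (l k / S) * ennreal (2 * exp (2 * c^2 * T)))"
  using each by (intro sum_mono mult_left_mono) auto
 also have "\<dots> = ennreal (\<Sum>k<n. l k / S) * ennreal (2 * exp (2 * c^2 * T))"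
  unfolding sum_distrib_right[symmetric] using w0 S0 by (subst sum_ennreal) (auto simp: less_imp_le)
 also have "(\<Sum>k<n. l k / S) = 1" using S0 by (simp add: S_def flip: sum_divide_distrib)
 finally show ?thesis by simp
qed

end

section \<open>Discrete covariations\<close>

lemma regular_field_borel:
 assumes "regular_field g g' K L"
 shows "g s \<in> borel_measurable borel" "g' s \<in> borel_measurable borel"
proof -
 have c: "continuous_on UNIV (\<lambda>(s, x). g s x)" "continuous_on UNIV (\<lambda>(s, x). g' s x)"
  using assms by (auto simp: regular_field_def)
 have "continuous_on UNIV (g s)" "continuous_on UNIV (g' s)"
  using continuous_on_compose2[OF c(1), of UNIV "\<lambda>x. (s, x)"]
   continuous_on_compose2[OF c(2), of UNIV "\<lambda>x. (s, x)"]
  by (simp_all add: continuous_on_Pair)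
 then show "g s \<in> borel_measurable borel" "g' s \<in> borel_measurable borel"
  by (auto intro: borel_measurable_continuous_onI)
qed

lemma regular_field_along_path:
 assumes "regular_field g g' K L" "continuous_on UNIV (z :: real \<Rightarrow> real)"
 shows "continuous_on UNIV (\<lambda>s. g' s (z s))"
proof -
 have "continuous_on UNIV (\<lambda>(s, x). g' s x)" using assms by (auto simp: regular_field_def)
 from continuous_on_compose2[OF this, of UNIV "\<lambda>s. (s, z s)"] assms(2)
 show ?thesis by (simp add: continuous_on_Pair)
qed

lemma Taylor_remainder_bound:
 assumes "regular_field g g' K L"
 shows "\<bar>g s (x + d) - g s x - g' s x * d\<bar> \<le> L * d^2"
proof -
 have d: "\<And>y. (g s has_real_derivative g' s y) (at y)"
  and lip: "\<And>x y. \<bar>g' s x - g' s y\<bar> \<le> L * \<bar>x - y\<bar>"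
  using assms by (auto simp: regular_field_def)
 have L0: "L \<ge> 0" using lip[of 0 1] by simp
 have d': "((\<lambda>y. g s y - g' s x * y) has_real_derivative g' s y - g' s x) (at y within S)" for y S
  by (auto intro!: derivative_eq_intros DERIV_subset[OF d])
 have "\<bar>(g s (x + d) - g' s x * (x + d)) - (g s x - g' s x * x)\<bar> \<le> (L * \<bar>d\<bar>) * \<bar>(x + d) - x\<bar>"
 proof (rule field_differentiable_bound[of "closed_segment x (x + d)" "\<lambda>y. g s y - g' s x * y" "\<lambda>y. g' s y - g' s x",
    unfolded real_norm_def])
  fix y assume "y \<in> closed_segment x (x + d)"
  then have "\<bar>y - x\<bar> \<le> \<bar>d\<bar>"
   using dist_in_closed_segment[of y x "x + d"] by (auto simp: closed_segment_eq_real_ivl split: if_splits)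
  then show "\<bar>g' s y - g' s x\<bar> \<le> L * \<bar>d\<bar>" using lip[of y x] mult_left_mono[OF _ L0] by fastforce
 qed (use d' in auto)
 then show ?thesis by (simp add: algebra_simps power2_eq_square)
qed

lemma ennreal_combination:
 "0 \<le> x \<Longrightarrow> 0 \<le> a \<Longrightarrow> 0 \<le> y \<Longrightarrow> 0 \<le> b \<Longrightarrow> 0 \<le> c \<Longrightarrow>
  ennreal x + ennreal a * ennreal y + ennreal b * ennreal c = ennreal (x + a * y + b * c)"
 by (simp add: ennreal_plus ennreal_mult)

context adapted_BM
begin

text \<open>For small \<open>h\<close> this is close to the integral of the spatial derivative of \<open>g\<close> along \<open>z + B\<close>, but no derivative occurs in it.\<close>

abbreviation covariation :: "(real \<Rightarrow> real \<Rightarrow> real) \<Rightarrow> real \<Rightarrow> real \<Rightarrow> nat \<Rightarrow> 'w \<Rightarrow> real" where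
 "covariation g z h n w \<equiv>
  \<Sum>k<n. (g (real k * h) (z + B (real (Suc k) * h) w) - g (real k * h) (z + B (real k * h) w)) * incr h k w"

text \<open>The summands are orthogonal, since a squared increment minus its mean is centred given the past.\<close>

lemma quadratic_variation_error:
 assumes h: "h > 0" and n: "real n * h \<le> T"
  and c: "\<And>k. k < n \<Longrightarrow> c k \<in> borel_measurable (F (real k * h))" and L: "\<And>k w. k < n \<Longrightarrow> \<bar>c k w\<bar> \<le> L"
 shows "EE (\<lambda>w. (\<Sum>k<n. c k w * ((incr h k w)^2 - h))^2)
  \<le> ennreal (real n * (2 * L^2 * h^2))"
 using n c L
proof (induction n)
 case 0
 show ?case by simp
next
 case (Suc n)
 let ?t = "real n * h" and ?u = "real (Suc n) * h"
 let ?S = "\<lambda>w. \<Sum>k<n. c k w * ((incr h k w)^2 - h)"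
 have diff: "?u - ?t = h" by (simp add: algebra_simps)
 have tu: "0 \<le> ?t" "?t < ?u" "?u \<le> T" "?t \<le> T" using h Suc.prems diff by auto
 have [measurable]: "c k \<in> borel_measurable (F ?t)" "B (real k * h) \<in> borel_measurable (F ?t)"
  "B (real (Suc k) * h) \<in> borel_measurable (F ?t)" if "k < n" for k
  using Suc.prems(2)[of k] measurable_F_grid[of h n k] B_grid[of h n k] B_grid[of h n "Suc k"] h tu that by auto
 have S: "?S \<in> borel_measurable (F ?t)" by measurable
 let ?\<psi> = "\<lambda>p v. ennreal ((fst p + snd p * (v^2 - h))^2)"
 interpret g: prob_space "gauss h" using h by (rule prob_space_gauss)
 have gauss: "(\<integral>\<^sup>+v. ennreal ((m + a * (v^2 - h))^2) \<partial>gauss h) = ennreal (m^2 + 2 * a^2 * h^2)" for m a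
 proof -
  have e: "(m + a * (v^2 - h))^2 = (m^2 - 2 * m * a * h + a^2 * h^2) + (2 * m * a - 2 * a^2 * h) * v^2 + a^2 * v ^ 4" for v
   by (simp add: power2_eq_square power4_eq_xxxx algebra_simps)
  have i: "integrable (gauss h) (\<lambda>v. (m + a * (v^2 - h))^2)"
   unfolding e using gauss_moments(1)[OF h] by auto
  have "(\<integral>v. (m + a * (v^2 - h))^2 \<partial>gauss h)
   = (m^2 - 2 * m * a * h + a^2 * h^2) + (2 * m * a - 2 * a^2 * h) * h + a^2 * (3 * h^2)"
   unfolding e using gauss_moments[OF h] g.prob_space by simp
  also have "\<dots> = m^2 + 2 * a^2 * h^2" by (simp add: power2_eq_square algebra_simps)
  finally show ?thesis by (subst nn_integral_eq_integral[OF i]) auto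
 qed
 have "EE (\<lambda>w. (\<Sum>k<Suc n. c k w * ((incr h k w)^2 - h))^2)
  = (\<integral>\<^sup>+w. 1 * ?\<psi> (?S w, c n w) (B ?u w - B ?t w) \<partial>M)"
  by simp
 also have "\<dots> = (\<integral>\<^sup>+w. 1 * (\<integral>\<^sup>+v. ?\<psi> (?S w, c n w) v \<partial>gauss (?u - ?t)) \<partial>M)"
 proof (rule nn_integral_increment[OF tu(1-3), where N = "borel \<Otimes>\<^sub>M borel" and \<psi> = ?\<psi>])
  show "(\<lambda>w. (?S w, c n w)) \<in> F ?t \<rightarrow>\<^sub>M borel \<Otimes>\<^sub>M borel"
   using S Suc.prems(2)[of n] by (intro measurable_Pair) auto
 qed measurable
 also have "\<dots> = EE (\<lambda>w. (?S w)^2 + 2 * (c n w)^2 * h^2)"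
  unfolding diff by (simp add: gauss del: of_nat_Suc)
 also have "\<dots> \<le> (\<integral>\<^sup>+w. ennreal ((?S w)^2) + ennreal (2 * L^2 * h^2) \<partial>M)"
 proof (intro nn_integral_mono)
  fix w
  have "\<bar>c n w\<bar> \<le> \<bar>L\<bar>" using Suc.prems(3)[of n w] by auto
  then have "(c n w)^2 \<le> L^2" by (simp add: abs_le_square_iff)
  then have "2 * (c n w)^2 * h^2 \<le> 2 * L^2 * h^2" by (intro mult_right_mono) auto
  then show "ennreal ((?S w)^2 + 2 * (c n w)^2 * h^2) \<le> ennreal ((?S w)^2) + ennreal (2 * L^2 * h^2)"
   by (simp flip: ennreal_plus)
 qed
 also have "\<dots> = EE (\<lambda>w. (?S w)^2) + ennreal (2 * L^2 * h^2)"
  using measurable_F_M[OF tu(1,4) S] by (subst nn_integral_add) (auto simp: emeasure_space_1)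
 also have "\<dots> \<le> ennreal (real n * (2 * L^2 * h^2)) + ennreal (2 * L^2 * h^2)"
  using Suc tu by (intro add_mono) auto
 also have "\<dots> = ennreal (real (Suc n) * (2 * L^2 * h^2))"
  by (simp add: distrib_right flip: ennreal_plus)
 finally show ?case .
qed

lemma increment_cube:
 assumes h: "h > 0" and n: "real (Suc k) * h \<le> T"
 shows "EE (\<lambda>w. \<bar>incr h k w\<bar> ^ 3) \<le> ennreal (2 * (h * sqrt h))"
proof -
 let ?t = "real k * h" and ?u = "real (Suc k) * h"
 have diff: "?u - ?t = h" by (simp add: algebra_simps)
 have tu: "0 \<le> ?t" "?t < ?u" "?u \<le> T" using h n diff by auto
 have "(\<integral>\<^sup>+w. 1 * ennreal (\<bar>B ?u w - B ?t w\<bar> ^ 3) \<partial>M) = (\<integral>\<^sup>+w. 1 * (\<integral>\<^sup>+v. ennreal (\<bar>v\<bar> ^ 3) \<partial>gauss (?u - ?t)) \<partial>M)"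
  using tu by (intro nn_integral_increment[where N = borel and b = "\<lambda>_. 0 :: real" and \<psi> = "\<lambda>_ v. ennreal (\<bar>v\<bar> ^ 3)"]) auto
 also have "\<dots> = (\<integral>\<^sup>+v. ennreal (\<bar>v\<bar> ^ 3) \<partial>gauss h)"
  unfolding diff by (simp add: emeasure_space_1)
 also have "\<dots> \<le> (\<integral>\<^sup>+v. ennreal ((sqrt h / 2) * v^2 + (1 / (2 * sqrt h)) * v ^ 4) \<partial>gauss h)"
 proof (intro nn_integral_mono ennreal_leI)
  fix v :: real
  have s: "sqrt h > 0" using h by simp
  have "2 * sqrt h * \<bar>v\<bar> \<le> (sqrt h)^2 + \<bar>v\<bar>^2"
   using sum_squares_bound[of "sqrt h" "\<bar>v\<bar>"] by simp
  then have "\<bar>v\<bar> \<le> sqrt h / 2 + \<bar>v\<bar>^2 / (2 * sqrt h)"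
   using s by (simp add: field_simps power2_eq_square)
  then have "\<bar>v\<bar> * \<bar>v\<bar>^2 \<le> (sqrt h / 2 + \<bar>v\<bar>^2 / (2 * sqrt h)) * \<bar>v\<bar>^2" by (rule mult_right_mono) simp
  then show "\<bar>v\<bar> ^ 3 \<le> (sqrt h / 2) * v^2 + (1 / (2 * sqrt h)) * v ^ 4"
   by (simp add: power3_eq_cube power2_eq_square power4_eq_xxxx algebra_simps)
 qed
 also have "\<dots> = ennreal (\<integral>v. (sqrt h / 2) * v^2 + (1 / (2 * sqrt h)) * v ^ 4 \<partial>gauss h)"
  using gauss_moments(1)[OF h] h by (intro nn_integral_eq_integral) auto
 also have "(\<integral>v. (sqrt h / 2) * v^2 + (1 / (2 * sqrt h)) * v ^ 4 \<partial>gauss h) = (sqrt h / 2) * h + (1 / (2 * sqrt h)) * (3 * h^2)"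
  using gauss_moments[OF h] by simp
 also have "\<dots> = 2 * (h * sqrt h)"
 proof -
  have "h^2 = h * sqrt h * sqrt h" using h by (simp add: power2_eq_square)
  then have "(1 / (2 * sqrt h)) * (3 * h^2) = 3 / 2 * (h * sqrt h)" using h by simp
  then show ?thesis by (simp add: algebra_simps)
 qed
 finally show ?thesis by simp
qed

lemma exp_add3_le: "exp (u + v + w) \<le> exp (3 * u) + exp (3 * v) + exp (3 * w :: real)"
proof -
 have "u + v + w \<le> 3 * u \<or> u + v + w \<le> 3 * v \<or> u + v + w \<le> 3 * w" by linarith
 then have "exp (u + v + w) \<le> exp (3 * u) \<or> exp (u + v + w) \<le> exp (3 * v) \<or> exp (u + v + w) \<le> exp (3 * w)"
  by (simp only: exp_le_cancel_iff)
 moreover have "exp (3 * u) > 0" "exp (3 * v) > 0" "exp (3 * w) > 0" by auto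
 ultimately show ?thesis by linarith
qed

text \<open>The summand splits into a multiple of a bridge variable, a drift term and a forward martingale term, all with coefficients
  that are bounded by \<open>\<bar>\<theta>\<bar> * K\<close>. The factors 3 from \<open>exp_add3_le\<close> enter squared into the exponential moments; the worst of these is
  that of the drift, with exponent \<open>2 * (3 * \<theta> * K)\<^sup>2 * T\<close>.\<close>

lemma exp_covariation_sum:
 assumes reg: "regular_field g g' K L" and h: "h > 0" and N: "real (Suc n) * h \<le> T"
 shows "EE (\<lambda>w. exp (\<theta> * covariation g z h (Suc n) w)) \<le> ennreal (4 * exp (18 * \<theta>^2 * K^2 * T))"
proof -
 let ?b = "\<lambda>k w. B (real k * h) w"
 let ?g = "\<lambda>k x. g (real k * h) (z + x)"
 note [measurable] = regular_field_borel[OF reg]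
 have gK: "\<bar>g s x\<bar> \<le> K" for s x using reg by (auto simp: regular_field_def)
 then have K0: "K \<ge> 0" using abs_ge_zero order_trans by blast
 define u where "u w = (\<Sum>k\<in>{1..n}. (- \<theta> * ?g k (?b (Suc k) w)) * bridge h k w)" for w
 define v where "v w = (\<Sum>k<Suc n. \<theta> * ?g k (?b (Suc k) w) * ?b (Suc k) w / real (Suc k))" for w
 define l where "l w = (\<Sum>k<Suc n. (- \<theta> * ?g k (?b k w)) * incr h k w)" for w
 have split: "\<theta> * covariation g z h (Suc n) w = u w + v w + l w"
  if w: "w \<in> space M" for w
 proof -
  have 1: "u w = (\<Sum>k<Suc n. (- \<theta> * ?g k (?b (Suc k) w)) * bridge h k w)"
  proof -
   have "{..<Suc n} = insert 0 {1..n}" by auto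
   then show ?thesis using B_0[OF w] by (simp add: u_def)
  qed
  have 2: "x / real (Suc k) = x - real k / real (Suc k) * x" for x k
   by (simp add: field_simps)
  have 3: "\<theta> * ((a - c) * (b1 - b0))
    = (- \<theta> * a) * (b0 - real k / real (Suc k) * b1) + \<theta> * a * b1 / real (Suc k) + (- \<theta> * c) * (b1 - b0)" for a c b0 b1 k
  proof -
   define q where "q = real k / real (Suc k)"
   have "\<theta> * a * b1 / real (Suc k) = \<theta> * a * (b1 - q * b1)"
    unfolding q_def 2[of b1 k, symmetric] by simp
   then show ?thesis unfolding q_def[symmetric] by (simp add: algebra_simps)
  qed
  show ?thesis
   unfolding 1 v_def l_def sum.distrib[symmetric] sum_distrib_left
   by (intro sum.cong refl 3)
 qed
 have [measurable]: "u \<in> borel_measurable M" "v \<in> borel_measurable M" "l \<in> borel_measurable M"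
  unfolding u_def v_def l_def by measurable
 define K' where "K' = 3 * \<bar>\<theta>\<bar> * K"
 have gK': "\<bar>3 * (- \<theta> * ?g k x)\<bar> \<le> K'" for k x
  using mult_left_mono[OF gK, of "3 * \<bar>\<theta>\<bar>"] by (simp add: abs_mult K'_def mult.assoc)
 have K'2: "K'^2 = 9 * \<theta>^2 * K^2" by (simp add: K'_def power_mult_distrib)
 let ?E = "exp (18 * \<theta>^2 * K^2 * T)"
 have pos: "0 \<le> \<theta>^2 * K^2 * T" using T_pos by simp
 have nhT: "real n * h \<le> T" using grid_point_le[OF N _ h, of n] by simp
 have U: "EE (\<lambda>w. exp (3 * u w)) \<le> ennreal ?E"
 proof -
  have "EE (\<lambda>w. exp (3 * u w))
   = (\<integral>\<^sup>+w. ennreal (exp (\<Sum>k\<in>{1..n}. (3 * (- \<theta> * ?g k (?b (Suc k) w))) * bridge h k w)) * 1 \<partial>M)"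
   unfolding u_def sum_distrib_left mult.assoc by simp
  also have "\<dots> \<le> ennreal (exp (K'^2 * (real n * h) / 2)) * (\<integral>\<^sup>+w. 1 \<partial>M)"
   using gK' by (intro exp_backward_sum[OF h, where \<Phi> = "\<lambda>_. 1" and \<gamma> = "\<lambda>k x. 3 * (- \<theta> * ?g k x)"] N) auto
  also have "\<dots> \<le> ennreal ?E"
  proof -
   have "K'^2 * (real n * h) \<le> K'^2 * T" using nhT by (intro mult_left_mono) auto
   moreover have "K'^2 * T = 9 * (\<theta>^2 * K^2 * T)" "18 * \<theta>^2 * K^2 * T = 18 * (\<theta>^2 * K^2 * T)"
    by (simp_all add: K'2)
   ultimately have "K'^2 * (real n * h) / 2 \<le> 18 * \<theta>^2 * K^2 * T" using pos by linarith
   then show ?thesis by (simp add: emeasure_space_1)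
  qed
  finally show ?thesis .
 qed
 have W: "EE (\<lambda>w. exp (3 * l w)) \<le> ennreal ?E"
 proof -
  have "EE (\<lambda>w. exp (3 * l w))
   = EE (\<lambda>w. exp (\<Sum>k<Suc n. (3 * (- \<theta> * ?g k (?b k w))) * incr h k w))"
   unfolding l_def sum_distrib_left mult.assoc by simp
  also have "\<dots> \<le> ennreal (exp (K'^2 * T / 2))"
  proof (rule exp_forward_sum[OF h N, where \<gamma> = "\<lambda>k w. 3 * (- \<theta> * ?g k (?b k w))"])
   fix k assume k: "k < Suc n"
   have "?b k \<in> borel_measurable (F (real k * h))"
    using h grid_point_le[OF N _ h, of k] k by (intro B_adapted) auto
   note [measurable] = this
   show "(\<lambda>w. 3 * (- \<theta> * ?g k (?b k w))) \<in> borel_measurable (F (real k * h))" by measurable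
  qed (use gK' in auto)
  also have "\<dots> \<le> ennreal ?E"
  proof -
   have "K'^2 * T = 9 * (\<theta>^2 * K^2 * T)" "18 * \<theta>^2 * K^2 * T = 18 * (\<theta>^2 * K^2 * T)"
    by (simp_all add: K'2)
   then have "K'^2 * T / 2 \<le> 18 * \<theta>^2 * K^2 * T" using pos by linarith
   then show ?thesis by (intro ennreal_leI) simp
  qed
  finally show ?thesis .
 qed
 have V: "EE (\<lambda>w. exp (3 * v w)) \<le> ennreal (2 * ?E)"
 proof -
  have "3 * v w \<le> K' * (\<Sum>k<Suc n. \<bar>?b (Suc k) w\<bar> / real (Suc k))" for w
   unfolding v_def sum_distrib_left
  proof (rule sum_mono)
   fix k
   have "3 * (\<theta> * ?g k (?b (Suc k) w) * ?b (Suc k) w / real (Suc k))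
     = (3 * \<theta> * ?g k (?b (Suc k) w)) * (?b (Suc k) w / real (Suc k))" by simp
   also have "\<dots> \<le> \<bar>3 * \<theta> * ?g k (?b (Suc k) w)\<bar> * \<bar>?b (Suc k) w / real (Suc k)\<bar>"
    by (simp only: abs_mult[symmetric] abs_ge_self)
   also have "\<dots> \<le> K' * \<bar>?b (Suc k) w / real (Suc k)\<bar>"
    using gK'[of k "?b (Suc k) w"] by (intro mult_right_mono) auto
   finally show "3 * (\<theta> * ?g k (?b (Suc k) w) * ?b (Suc k) w / real (Suc k)) \<le> K' * (\<bar>?b (Suc k) w\<bar> / real (Suc k))"
    by simp
  qed
  then have "EE (\<lambda>w. exp (3 * v w))
   \<le> EE (\<lambda>w. exp (K' * (\<Sum>k<Suc n. \<bar>?b (Suc k) w\<bar> / real (Suc k))))"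
   by (intro nn_integral_mono ennreal_leI) simp
  also have "\<dots> \<le> ennreal (2 * exp (2 * K'^2 * T))" by (rule exp_drift_sum[OF h N])
  finally show ?thesis by (simp add: K'2 mult.assoc)
 qed
 have "EE (\<lambda>w. exp (\<theta> * covariation g z h (Suc n) w))
  = EE (\<lambda>w. exp (u w + v w + l w))"
  using split by (intro nn_integral_cong) (simp only:)
 also have "\<dots> \<le> (\<integral>\<^sup>+w. ennreal (exp (3 * u w)) + ennreal (exp (3 * v w)) + ennreal (exp (3 * l w)) \<partial>M)"
  by (intro nn_integral_mono) (simp add: exp_add3_le flip: ennreal_plus)
 also have "\<dots> = EE (\<lambda>w. exp (3 * u w)) + EE (\<lambda>w. exp (3 * v w)) + EE (\<lambda>w. exp (3 * l w))"
  by (simp add: nn_integral_add)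
 also have "\<dots> \<le> ennreal ?E + ennreal (2 * ?E) + ennreal ?E"
  by (intro add_mono U V W)
 also have "\<dots> = ennreal (4 * ?E)" by (simp flip: ennreal_plus)
 finally show ?thesis .
qed

text \<open>Taylor's formula: squared increments are replaced by \<open>h\<close> at the cost of \<open>quadratic_variation_error\<close>, and the remainders
  are of the order of third powers of increments.\<close>

lemma covariation_sum_error:
 assumes reg: "regular_field g g' K L" and h: "h > 0" and N: "real n * h \<le> T"
 shows "EE (\<lambda>w. \<bar>covariation g z h n w - h * (\<Sum>k<n. g' (real k * h) (z + B (real k * h) w))\<bar>)
  \<le> ennreal (sqrt h * (1 + T * L^2 + 2 * T * L))"
proof -
 let ?b = "\<lambda>k w. B (real k * h) w"
 let ?g = "\<lambda>k x. g (real k * h) (z + x)" and ?g' = "\<lambda>k x. g' (real k * h) (z + x)"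
 note [measurable] = regular_field_borel[OF reg]
 have g'L: "\<bar>g' s x\<bar> \<le> L" for s x using reg by (auto simp: regular_field_def)
 then have L0: "L \<ge> 0" using abs_ge_zero order_trans by blast
 have s: "sqrt h > 0" "sqrt h * sqrt h = h" using h by auto
 define m where "m w = (\<Sum>k<n. ?g' k (?b k w) * ((incr h k w)^2 - h))" for w
 have [measurable]: "m \<in> borel_measurable M" unfolding m_def by measurable
 have m2: "EE (\<lambda>w. (m w)^2) \<le> ennreal (real n * (2 * L^2 * h^2))"
  unfolding m_def
 proof (rule quadratic_variation_error[OF h N, where c = "\<lambda>k w. ?g' k (?b k w)"])
  fix k assume k: "k < n"
  have "?b k \<in> borel_measurable (F (real k * h))"
   using h grid_point_le[OF N _ h, of k] k by (intro B_adapted) auto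
  note [measurable] = this
  show "(\<lambda>w. ?g' k (?b k w)) \<in> borel_measurable (F (real k * h))" by measurable
 qed (use g'L in auto)
 have point: "\<bar>covariation g z h n w - h * (\<Sum>k<n. ?g' k (?b k w))\<bar>
   \<le> sqrt h + 1 / (2 * sqrt h) * (m w)^2 + L * (\<Sum>k<n. \<bar>incr h k w\<bar> ^ 3)" for w
 proof -
  have "covariation g z h n w - h * (\<Sum>k<n. ?g' k (?b k w))
    = m w + (\<Sum>k<n. (?g k (?b k w + incr h k w) - ?g k (?b k w) - ?g' k (?b k w) * incr h k w) * incr h k w)"
   unfolding m_def sum.distrib[symmetric] sum_distrib_left sum_subtractf[symmetric]
   by (intro sum.cong refl) (simp add: algebra_simps power2_eq_square del: of_nat_Suc)
  moreover have "\<bar>\<Sum>k<n. (?g k (?b k w + incr h k w) - ?g k (?b k w) - ?g' k (?b k w) * incr h k w) * incr h k w\<bar>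
    \<le> (\<Sum>k<n. L * \<bar>incr h k w\<bar> ^ 3)"
  proof (rule order_trans[OF sum_abs sum_mono])
   fix k
   have "\<bar>?g k (?b k w + incr h k w) - ?g k (?b k w) - ?g' k (?b k w) * incr h k w\<bar> \<le> L * (incr h k w)^2"
    using Taylor_remainder_bound[OF reg, of "real k * h" "z + ?b k w" "incr h k w"] by (simp add: add.assoc)
   then have "\<bar>?g k (?b k w + incr h k w) - ?g k (?b k w) - ?g' k (?b k w) * incr h k w\<bar> * \<bar>incr h k w\<bar>
     \<le> L * (incr h k w)^2 * \<bar>incr h k w\<bar>" by (rule mult_right_mono) simp
   moreover have "(incr h k w)^2 * \<bar>incr h k w\<bar> = \<bar>incr h k w\<bar> ^ 3"
    by (simp add: power3_eq_cube power2_eq_square abs_mult[symmetric] del: of_nat_Suc)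
   ultimately show "\<bar>(?g k (?b k w + incr h k w) - ?g k (?b k w) - ?g' k (?b k w) * incr h k w) * incr h k w\<bar> \<le> L * \<bar>incr h k w\<bar> ^ 3"
    by (simp only: abs_mult mult.assoc)
  qed
  moreover have "\<bar>m w\<bar> \<le> sqrt h + 1 / (2 * sqrt h) * (m w)^2"
  proof -
   have "2 * sqrt h * \<bar>m w\<bar> \<le> (sqrt h)^2 + (m w)^2"
    using sum_squares_bound[of "sqrt h" "\<bar>m w\<bar>"] by simp
   then have "\<bar>m w\<bar> \<le> sqrt h / 2 + 1 / (2 * sqrt h) * (m w)^2"
    using s by (simp add: field_simps power2_eq_square)
   then show ?thesis using s by linarith
  qed
  ultimately show ?thesis by (simp add: sum_distrib_left)
 qed
 have "EE (\<lambda>w. \<bar>covariation g z h n w - h * (\<Sum>k<n. ?g' k (?b k w))\<bar>)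
  \<le> (\<integral>\<^sup>+w. ennreal (sqrt h) + ennreal (1 / (2 * sqrt h)) * ennreal ((m w)^2) + ennreal L * (\<Sum>k<n. ennreal (\<bar>incr h k w\<bar> ^ 3)) \<partial>M)"
 proof (intro nn_integral_mono)
  fix w
  have "ennreal (sqrt h) + ennreal (1 / (2 * sqrt h)) * ennreal ((m w)^2) + ennreal L * (\<Sum>k<n. ennreal (\<bar>incr h k w\<bar> ^ 3))
    = ennreal (sqrt h + 1 / (2 * sqrt h) * (m w)^2 + L * (\<Sum>k<n. \<bar>incr h k w\<bar> ^ 3))"
  proof -
   have "(\<Sum>k<n. ennreal (\<bar>incr h k w\<bar> ^ 3)) = ennreal (\<Sum>k<n. \<bar>incr h k w\<bar> ^ 3)"
    by (rule sum_ennreal) simp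
   then show ?thesis using s L0 by (simp only:) (intro ennreal_combination, auto intro: sum_nonneg)
  qed
  then show "ennreal \<bar>covariation g z h n w - h * (\<Sum>k<n. ?g' k (?b k w))\<bar>
   \<le> ennreal (sqrt h) + ennreal (1 / (2 * sqrt h)) * ennreal ((m w)^2) + ennreal L * (\<Sum>k<n. ennreal (\<bar>incr h k w\<bar> ^ 3))"
   using point[of w] by (simp only: ennreal_leI)
 qed
 also have "\<dots> = ennreal (sqrt h) + ennreal (1 / (2 * sqrt h)) * EE (\<lambda>w. (m w)^2)
   + ennreal L * (\<Sum>k<n. (EE (\<lambda>w. \<bar>incr h k w\<bar> ^ 3)))"
  by (simp add: nn_integral_add nn_integral_cmult nn_integral_sum emeasure_space_1 del: of_nat_Suc sum_ennreal)
 also have "\<dots> \<le> ennreal (sqrt h) + ennreal (1 / (2 * sqrt h)) * ennreal (real n * (2 * L^2 * h^2))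
   + ennreal L * (\<Sum>k<n. ennreal (2 * (h * sqrt h)))"
  using grid_point_le[OF N _ h, of "Suc _"]
  by (intro add_mono mult_left_mono m2 sum_mono increment_cube h order_refl) auto
 also have "\<dots> = ennreal (sqrt h + 1 / (2 * sqrt h) * (real n * (2 * L^2 * h^2)) + L * (real n * (2 * (h * sqrt h))))"
 proof -
  have "(\<Sum>k<n. ennreal (2 * (h * sqrt h))) = ennreal (\<Sum>k<n. 2 * (h * sqrt h))"
   using h by (intro sum_ennreal) simp
  also have "(\<Sum>k<n. 2 * (h * sqrt h)) = real n * (2 * (h * sqrt h))" by simp
  finally have sum: "(\<Sum>k<n. ennreal (2 * (h * sqrt h))) = ennreal (real n * (2 * (h * sqrt h)))" .
  show ?thesis unfolding sum using s L0 h by (intro ennreal_combination) auto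
 qed
 also have "\<dots> \<le> ennreal (sqrt h * (1 + T * L^2 + 2 * T * L))"
 proof (rule ennreal_leI)
  define r where "r = sqrt h"
  have r: "r > 0" "h = r * r" using s by (auto simp: r_def)
  have 1: "1 / (2 * r) * (real n * (2 * L^2 * h^2)) = r * ((real n * h) * L^2)"
   using r(1) unfolding r(2) by (simp add: power2_eq_square)
  have 2: "L * (real n * (2 * (h * r))) = r * (2 * ((real n * h) * L))" by simp
  have 3: "r * ((real n * h) * L^2) \<le> r * (T * L^2)"
   using mult_left_mono[OF mult_right_mono[OF N, of "L^2"], of r] r(1) by simp
  have 4: "r * (2 * ((real n * h) * L)) \<le> r * (2 * (T * L))"
   using mult_left_mono[OF mult_right_mono[OF N L0], of "r * 2"] r(1) by (simp only: mult.assoc)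
  have 5: "r * (1 + T * L^2 + 2 * T * L) = r + r * (T * L^2) + r * (2 * (T * L))"
   by (simp add: algebra_simps)
  show "sqrt h + 1 / (2 * sqrt h) * (real n * (2 * L^2 * h^2)) + L * (real n * (2 * (h * sqrt h)))
    \<le> sqrt h * (1 + T * L^2 + 2 * T * L)"
   unfolding r_def[symmetric] 1 2 5 using 3 4 by linarith
 qed
 finally show ?thesis .
qed

text \<open>The derivative-free bound of \<open>exp_covariation_sum\<close> survives in the limit of vanishing mesh. The bound \<open>L\<close> only serves the convergence.\<close>

lemma exp_integral_derivative_BM:
 assumes reg: "regular_field g g' K L" and t: "0 \<le> t" "t \<le> T"
 shows "EE (\<lambda>w. exp (\<theta> * (LINT s:{0..t}|lborel. g' s (z + B s w))))
  \<le> ennreal (4 * exp (18 * \<theta>^2 * K^2 * T))"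
proof (cases "t = 0")
 case True
 have "(LINT s:{0..t}|lborel. g' s (z + B s w)) = 0" for w
  unfolding set_integral_half_open[symmetric] True by (simp add: set_lebesgue_integral_def)
 moreover have "1 \<le> exp (18 * \<theta>^2 * K^2 * T)" using T_pos by simp
 then have "1 \<le> 4 * exp (18 * \<theta>^2 * K^2 * T)" by linarith
 then have "1 \<le> ennreal (4 * exp (18 * \<theta>^2 * K^2 * T))" using ennreal_leI by fastforce
 ultimately show ?thesis by (simp add: emeasure_space_1)
next
 case False
 then have t0: "0 < t" using t by simp
 note [measurable] = regular_field_borel[OF reg]
 have g'L: "\<bar>g' s x\<bar> \<le> L" for s x using reg by (auto simp: regular_field_def)
 let ?C = "ennreal (4 * exp (18 * \<theta>^2 * K^2 * T))"
 define h where "h N = t / real (Suc N)" for N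
 have h: "h N > 0" "real (Suc N) * h N = t" for N using t0 by (auto simp: h_def)
 define S where "S N w = covariation g z (h N) (Suc N) w" for N w
 define I where "I N w = h N * (\<Sum>k<Suc N. g' (real k * h N) (z + B (real k * h N) w))" for N w
 have [measurable]: "S N \<in> borel_measurable M" "I N \<in> borel_measurable M" for N
  unfolding S_def I_def by measurable
 let ?I = "\<lambda>w. LINT s:{0..t}|lborel. g' s (z + B s w)"
 have I: "(\<lambda>N. I N w) \<longlonglongrightarrow> ?I w" if w: "w \<in> space M" for w
 proof -
  have c: "continuous_on UNIV (\<lambda>s. g' s (z + B s w))"
   by (intro regular_field_along_path[OF reg] continuous_intros B_continuous[OF w])
  have "(\<lambda>N. (t - 0) / real N * (\<Sum>k<N. g' (real k * (t / real N)) (z + B (real k * (t / real N)) w))) \<longlonglongrightarrow> ?I w"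
  proof (rule Riemann_sums_tendsto[where L = L])
   fix s assume s: "0 \<le> s" "s < t"
   have "isCont (\<lambda>s. g' s (z + B s w)) s" using c by (simp add: continuous_on_eq_continuous_at)
   from isCont_tendsto_compose[OF this grid_point_tendsto[OF t0 s(1)]]
   show "(\<lambda>N. g' (real (cell_index 0 ((t - 0) / real N) s) * (t / real N))
       (z + B (real (cell_index 0 ((t - 0) / real N) s) * (t / real N)) w)) \<longlonglongrightarrow> g' s (z + B s w)"
    by simp
  qed (use t0 g'L in auto)
  from LIMSEQ_Suc[OF this] show ?thesis by (simp add: I_def h_def del: of_nat_Suc sum.lessThan_Suc)
 qed
 have err: "EE (\<lambda>w. \<bar>S N w - I N w\<bar>) \<le> ennreal (sqrt (h N) * (1 + T * L^2 + 2 * T * L))" for N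
  unfolding S_def I_def using h t by (intro covariation_sum_error[OF reg]) auto
 have int: "integrable M (\<lambda>w. S N w - I N w)" for N
  using err[of N] by (intro integrableI_bounded) (auto intro: le_less_trans)
 have "(\<lambda>N. \<integral>w. norm (S N w - I N w) \<partial>M) \<longlonglongrightarrow> 0"
 proof (rule tendsto_sandwich[of "\<lambda>_. 0" _ _ "\<lambda>N. sqrt (h N) * (1 + T * L^2 + 2 * T * L)"])
  have "0 \<le> L" using g'L[of 0 0] by linarith
  then have "0 \<le> sqrt (h N) * (1 + T * L^2 + 2 * T * L)" for N
   using T_pos h(1)[of N] by (intro mult_nonneg_nonneg add_nonneg_nonneg) auto
  moreover have "ennreal (\<integral>w. norm (S N w - I N w) \<partial>M) \<le> ennreal (sqrt (h N) * (1 + T * L^2 + 2 * T * L))" for N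
   using err[of N] by (subst nn_integral_eq_integral[symmetric]) (use int[of N] in auto)
  ultimately show "\<forall>\<^sub>F N in sequentially. (\<integral>w. norm (S N w - I N w) \<partial>M) \<le> sqrt (h N) * (1 + T * L^2 + 2 * T * L)"
   by (intro always_eventually allI) (simp only: ennreal_le_iff)
  have "h \<longlonglongrightarrow> 0" unfolding h_def by (rule LIMSEQ_Suc[OF lim_const_over_n])
  then have "(\<lambda>N. sqrt (h N)) \<longlonglongrightarrow> sqrt 0" by (intro tendsto_intros)
  from tendsto_mult_right[OF this, of "1 + T * L^2 + 2 * T * L"]
  show "(\<lambda>N. sqrt (h N) * (1 + T * L^2 + 2 * T * L)) \<longlonglongrightarrow> 0" by simp
 qed auto
 from tendsto_L1_AE_subseq[OF int this] obtain r
  where r: "strict_mono r" "AE w in M. (\<lambda>n. S (r n) w - I (r n) w) \<longlonglongrightarrow> 0" by blast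
 show ?thesis
 proof (rule nn_integral_limit_le[where f = "\<lambda>n w. exp (\<theta> * S (r n) w)" and c = "\<lambda>_. ?C"])
  show "AE w in M. (\<lambda>n. exp (\<theta> * S (r n) w)) \<longlonglongrightarrow> exp (\<theta> * ?I w)"
   using r(2) AE_space
  proof eventually_elim
   case (elim w)
   have "(\<lambda>n. I (r n) w) \<longlonglongrightarrow> ?I w" using LIMSEQ_subseq_LIMSEQ[OF I[OF elim(2)] r(1)] by (simp add: o_def)
   from tendsto_add[OF elim(1) this] show ?case by (intro tendsto_intros) simp
  qed
  show "\<forall>\<^sub>F n in sequentially. EE (\<lambda>w. exp (\<theta> * S (r n) w)) \<le> ?C"
   unfolding S_def using h t by (intro always_eventually allI exp_covariation_sum[OF reg]) auto
 qed auto
qed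

end

section \<open>Time integrals of continuous processes\<close>

text \<open>A continuous process is a limit of processes that are constant in time on the cells of a grid.\<close>

lemma jointly_measurable_continuous:
 fixes X :: "real \<Rightarrow> 'w \<Rightarrow> real"
 assumes X: "\<And>t. X t \<in> borel_measurable M" and cont: "\<And>w. w \<in> space M \<Longrightarrow> continuous_on UNIV (\<lambda>t. X t w)"
  and f: "f \<in> measurable N M" and g: "g \<in> borel_measurable N"
 shows "(\<lambda>x. X (g x) (f x)) \<in> borel_measurable N"
proof (rule borel_measurable_LIMSEQ_real)
 note [measurable] = f g
 let ?r = "\<lambda>n x. of_int \<lfloor>real (Suc n) * g x\<rfloor> / real (Suc n)"
 show "(\<lambda>x. X (?r n x) (f x)) \<in> borel_measurable N" for n
 proof (rule measurable_compose_countable[where g = "\<lambda>x. \<lfloor>real (Suc n) * g x\<rfloor>" and f = "\<lambda>j x. X (of_int j / real (Suc n)) (f x)"])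
  show "(\<lambda>x. X (of_int j / real (Suc n)) (f x)) \<in> borel_measurable N" for j
   by (rule measurable_compose[OF f X])
 qed measurable
 fix x assume x: "x \<in> space N"
 have "(\<lambda>n. ?r n x) \<longlonglongrightarrow> g x"
 proof (rule tendsto_sandwich[of "\<lambda>n. g x - 1 / real (Suc n)" _ _ "\<lambda>n. g x"])
  have "g x - 1 / real (Suc n) \<le> ?r n x \<and> ?r n x \<le> g x" for n
  proof -
   have "real (Suc n) * g x - 1 \<le> of_int \<lfloor>real (Suc n) * g x\<rfloor>" "of_int \<lfloor>real (Suc n) * g x\<rfloor> \<le> real (Suc n) * g x"
    by linarith+
   then show ?thesis
    using divide_right_mono[of "real (Suc n) * g x - 1" _ "real (Suc n)"]
     divide_right_mono[of _ "real (Suc n) * g x" "real (Suc n)"]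
    by (simp add: diff_divide_distrib del: of_nat_Suc)
  qed
  then show "\<forall>\<^sub>F n in sequentially. g x - 1 / real (Suc n) \<le> ?r n x" "\<forall>\<^sub>F n in sequentially. ?r n x \<le> g x"
   by simp_all
  show "(\<lambda>n. g x - 1 / real (Suc n)) \<longlonglongrightarrow> g x"
   using tendsto_diff[OF tendsto_const[of "g x"] LIMSEQ_Suc[OF lim_const_over_n[of 1]]] by simp
 qed simp
 moreover have "isCont (\<lambda>t. X t (f x)) (g x)"
  using cont[OF measurable_space[OF f x]] by (simp add: continuous_on_eq_continuous_at)
 ultimately show "(\<lambda>n. X (?r n x) (f x)) \<longlonglongrightarrow> X (g x) (f x)"
  using isCont_tendsto_compose[of "g x" "\<lambda>t. X t (f x)"] by blast
qed

lemma nn_integral_set_integral: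
 fixes f :: "'a \<Rightarrow> real"
 assumes "set_integrable M A f" "\<And>x. x \<in> A \<Longrightarrow> 0 \<le> f x"
 shows "(\<integral>\<^sup>+x\<in>A. ennreal (f x) \<partial>M) = ennreal (LINT x:A|M. f x)"
proof -
 have "(\<integral>\<^sup>+x\<in>A. ennreal (f x) \<partial>M) = (\<integral>\<^sup>+x. ennreal (indicator A x * f x) \<partial>M)"
  by (intro nn_integral_cong) (auto simp: indicator_def)
 also have "\<dots> = ennreal (\<integral>x. indicator A x * f x \<partial>M)"
  using assms by (intro nn_integral_eq_integral) (auto simp: set_integrable_def indicator_def)
 finally show ?thesis by (simp add: set_lebesgue_integral_def)
qed

text \<open>The variance of \<open>f\<close> under the uniform distribution on \<open>{a..b}\<close> is nonnegative.\<close>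

lemma square_set_integral_le:
 fixes f :: "real \<Rightarrow> real"
 assumes i: "set_integrable lborel {a..b} f" "set_integrable lborel {a..b} (\<lambda>s. (f s)^2)" and ab: "a \<le> b"
 shows "(LINT s:{a..b}|lborel. f s)^2 \<le> (b - a) * (LINT s:{a..b}|lborel. (f s)^2)"
proof (cases "a = b")
 case True
 then show ?thesis
  unfolding True set_integral_half_open[symmetric] by (simp add: set_lebesgue_integral_def)
next
 case False
 define m where "m = (LINT s:{a..b}|lborel. f s) / (b - a)"
 have m: "(LINT s:{a..b}|lborel. f s) = m * (b - a)" using False by (simp add: m_def)
 have i3: "set_integrable lborel {a..b} (\<lambda>s. m^2)"
  by (rule set_integral_continuous(1)[OF continuous_on_const])
 have i2: "set_integrable lborel {a..b} (\<lambda>s. 2 * m * f s)" using i(1) by simp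
 have "0 \<le> (LINT s:{a..b}|lborel. (f s - m)^2)"
  unfolding set_lebesgue_integral_def by (intro Bochner_Integration.integral_nonneg) auto
 also have "\<dots> = (LINT s:{a..b}|lborel. (f s)^2 - 2 * m * f s + m^2)"
  by (simp add: power2_diff algebra_simps)
 also have "\<dots> = (LINT s:{a..b}|lborel. (f s)^2) - 2 * m * (m * (b - a)) + m^2 * (b - a)"
  unfolding set_integral_add(2)[OF set_integral_diff(1)[OF i(2) i2] i3] set_integral_diff(2)[OF i(2) i2]
  using ab by (simp add: m[symmetric] set_integral_const)
 finally have "m^2 * (b - a) \<le> (LINT s:{a..b}|lborel. (f s)^2)" by (simp add: power2_eq_square)
 then have "(b - a) * (m^2 * (b - a)) \<le> (b - a) * (LINT s:{a..b}|lborel. (f s)^2)"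
  using ab by (intro mult_left_mono) auto
 then show ?thesis unfolding m by (simp add: power_mult_distrib power2_eq_square mult_ac)
qed

lemma square_set_integral_le_continuous:
 fixes f :: "real \<Rightarrow> real"
 assumes f: "continuous_on {a..b} f" and ab: "a \<le> b"
 shows "(LINT s:{a..b}|lborel. f s)^2 \<le> (b - a) * (LINT s:{a..b}|lborel. (f s)^2)"
 by (intro square_set_integral_le set_integral_continuous(1) continuous_intros f ab)

lemma exp_set_integral_le:
 fixes f :: "real \<Rightarrow> real"
 assumes f: "continuous_on {0..T} f" and T: "T > 0"
 shows "exp (LINT s:{0..T}|lborel. f s) \<le> 1 / T * (LINT s:{0..T}|lborel. exp (T * f s))"
proof -
 define m where "m = (LINT s:{0..T}|lborel. f s)"
 have i: "set_integrable lborel {0..T} f" "set_integrable lborel {0..T} (\<lambda>s. exp (T * f s))"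
  by (intro set_integral_continuous(1) continuous_intros f)+
 have i0: "set_integrable lborel {0..T} (\<lambda>s. exp m * (1 - m))"
  by (rule set_integral_continuous(1)[OF continuous_on_const])
 have i1: "set_integrable lborel {0..T} (\<lambda>s. exp m * T * f s)" using i(1) by simp
 note i2 = set_integral_add[OF i0 i1]
 \<comment> \<open>Integrate the tangent line inequality at the mean.\<close>
 have "(LINT s:{0..T}|lborel. exp m * (1 - m) + exp m * T * f s) \<le> (LINT s:{0..T}|lborel. exp (T * f s))"
 proof (intro set_integral_mono i2(1) i(2))
  fix s
  have "1 + (T * f s - m) \<le> exp (T * f s - m)" by (rule exp_ge_add_one_self)
  then have "exp m * (1 + (T * f s - m)) \<le> exp m * exp (T * f s - m)" by (intro mult_left_mono) auto
  then show "exp m * (1 - m) + exp m * T * f s \<le> exp (T * f s)"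
   by (simp add: algebra_simps flip: exp_add)
 qed
 also have "(LINT s:{0..T}|lborel. exp m * (1 - m) + exp m * T * f s) = exp m * (1 - m) * T + exp m * T * m"
  unfolding i2(2) using T by (simp add: m_def set_integral_const)
 finally show ?thesis using T by (simp add: m_def field_simps)
qed

context prob_space
begin

lemma EE_interval_integral_le:
 fixes f :: "real \<Rightarrow> 'a \<Rightarrow> real"
 assumes m: "\<And>s. f s \<in> borel_measurable M" and c: "\<And>w. w \<in> space M \<Longrightarrow> continuous_on UNIV (\<lambda>s. f s w)"
  and nn: "\<And>s w. 0 \<le> f s w" and le: "\<And>s. s \<in> {a..b} \<Longrightarrow> EE (f s) \<le> ennreal k" and k: "0 \<le> k" and ab: "a \<le> b"
 shows "EE (\<lambda>w. LINT s:{a..b}|lborel. f s w) \<le> ennreal (k * (b - a))"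
proof -
 interpret pair_sigma_finite lborel M by unfold_locales
 note [measurable] = jointly_measurable_continuous[OF m c]
 have "EE (\<lambda>w. LINT s:{a..b}|lborel. f s w) = (\<integral>\<^sup>+w. (\<integral>\<^sup>+s\<in>{a..b}. ennreal (f s w) \<partial>lborel) \<partial>M)"
  using nn by (intro nn_integral_cong nn_integral_set_integral[symmetric] set_integral_continuous(1) continuous_on_subset[OF c]) auto
 also have "\<dots> = (\<integral>\<^sup>+s. (\<integral>\<^sup>+w. ennreal (f s w) * indicator {a..b} s \<partial>M) \<partial>lborel)" by (rule Fubini') measurable
 also have "\<dots> \<le> (\<integral>\<^sup>+s\<in>{a..b}. ennreal k \<partial>lborel)" using le by (intro nn_integral_mono) (auto simp: indicator_def)
 also have "\<dots> = ennreal (k * (b - a))" using k ab by (subst nn_integral_cmult) (auto simp: ennreal_mult)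
 finally show ?thesis .
qed

text \<open>Jensen's inequality for the uniform distribution on the time interval.\<close>

lemma EE_exp_interval_integral_le:
 fixes f :: "real \<Rightarrow> 'a \<Rightarrow> real"
 assumes m: "\<And>s. f s \<in> borel_measurable M" and c: "\<And>w. w \<in> space M \<Longrightarrow> continuous_on UNIV (\<lambda>s. f s w)"
  and le: "\<And>s. s \<in> {0..t} \<Longrightarrow> EE (\<lambda>w. exp (t * f s w)) \<le> ennreal k" and k: "0 \<le> k" and t: "0 < t"
 shows "EE (\<lambda>w. exp (LINT s:{0..t}|lborel. f s w)) \<le> ennreal k"
proof -
 note [measurable] = m jointly_measurable_continuous[OF m c]
 have "EE (\<lambda>w. exp (LINT s:{0..t}|lborel. f s w)) \<le> (\<integral>\<^sup>+w. ennreal (1 / t) * ennreal (LINT s:{0..t}|lborel. exp (t * f s w)) \<partial>M)"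
 proof (rule nn_integral_mono)
  fix w assume w: "w \<in> space M"
  have "exp (LINT s:{0..t}|lborel. f s w) \<le> 1 / t * (LINT s:{0..t}|lborel. exp (t * f s w))"
   by (intro exp_set_integral_le continuous_on_subset[OF c[OF w]] t) simp
  then show "ennreal (exp (LINT s:{0..t}|lborel. f s w)) \<le> ennreal (1 / t) * ennreal (LINT s:{0..t}|lborel. exp (t * f s w))"
   using t by (subst ennreal_mult[symmetric]) (auto simp: set_lebesgue_integral_def intro!: ennreal_leI)
 qed
 also have "\<dots> = ennreal (1 / t) * EE (\<lambda>w. LINT s:{0..t}|lborel. exp (t * f s w))"
  unfolding set_lebesgue_integral_def by (rule nn_integral_cmult) measurable
 also have "\<dots> \<le> ennreal (1 / t) * ennreal (k * (t - 0))"
  using t by (intro mult_left_mono EE_interval_integral_le le k continuous_intros c) auto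
 also have "\<dots> = ennreal k" using t k by (simp flip: ennreal_mult)
 finally show ?thesis .
qed

end

context adapted_BM
begin

section \<open>Change of drift along a grid\<close>

text \<open>Under the exponential density the path shifted by \<open>h * (\<Sum>j. \<beta> j w)\<close> has the law of the motion on the grid. The last increment is
  integrated out by \<open>gauss_Cameron_Martin\<close>, which turns \<open>\<Phi>\<close> into a function of the previous value that does not depend on \<open>\<beta>\<close>.\<close>

lemma discrete_Girsanov:
 assumes h: "h > 0" and G [measurable]: "\<And>k. G k \<in> borel_measurable borel"
 shows "real n * h \<le> T \<Longrightarrow> (\<And>k. k < n \<Longrightarrow> \<beta> k \<in> borel_measurable (F (real k * h))) \<Longrightarrow> \<Phi> \<in> borel_measurable borel \<Longrightarrow>
  (\<integral>\<^sup>+w. ennreal (exp (\<Sum>k<n. - \<beta> k w * incr h k w - (\<beta> k w)^2 * h / 2))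
   * (\<Prod>k<n. G k (B (real (Suc k) * h) w + h * (\<Sum>j<Suc k. \<beta> j w))) * \<Phi> (B (real n * h) w + h * (\<Sum>j<n. \<beta> j w)) \<partial>M)
  = (\<integral>\<^sup>+w. (\<Prod>k<n. G k (B (real (Suc k) * h) w)) * \<Phi> (B (real n * h) w) \<partial>M)"
proof (induction n arbitrary: \<Phi>)
 case 0
 show ?case by simp
next
 case (Suc n)
 note [measurable] = Suc.prems(3)
 let ?t = "real n * h" and ?u = "real (Suc n) * h"
 let ?P = "\<lambda>\<beta> w. ennreal (exp (\<Sum>k<n. - \<beta> k w * incr h k w - (\<beta> k w)^2 * h / 2))
   * (\<Prod>k<n. G k (B (real (Suc k) * h) w + h * (\<Sum>j<Suc k. \<beta> j w)))"
 let ?W = "\<lambda>\<beta> w. B ?t w + h * (\<Sum>j<n. \<beta> j w)"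
 have diff: "?u - ?t = h" by (simp add: algebra_simps)
 have tu: "0 \<le> ?t" "?t < ?u" "?u \<le> T" "?t \<le> T" using h Suc.prems(1) diff by auto
 interpret g: prob_space "gauss h" using h by (rule prob_space_gauss)
 define \<Phi>' where "\<Phi>' w = (\<integral>\<^sup>+v. G n (w + v) * \<Phi> (w + v) \<partial>gauss h)" for w
 have [measurable]: "\<Phi>' \<in> borel_measurable borel" unfolding \<Phi>'_def by measurable
 have step: "(\<integral>\<^sup>+w. ennreal (exp (\<Sum>k<Suc n. - \<beta> k w * incr h k w - (\<beta> k w)^2 * h / 2))
   * (\<Prod>k<Suc n. G k (B (real (Suc k) * h) w + h * (\<Sum>j<Suc k. \<beta> j w))) * \<Phi> (B ?u w + h * (\<Sum>j<Suc n. \<beta> j w)) \<partial>M)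
  = (\<integral>\<^sup>+w. ?P \<beta> w * \<Phi>' (?W \<beta> w) \<partial>M)"
  if \<beta>: "\<And>k. k < Suc n \<Longrightarrow> \<beta> k \<in> borel_measurable (F (real k * h))" for \<beta>
 proof -
  let ?\<psi> = "\<lambda>p v. ennreal (exp (- fst p * v - (fst p)^2 * h / 2)) * (G n (snd p + v + fst p * h) * \<Phi> (snd p + v + fst p * h))"
  have m: "\<beta> k \<in> borel_measurable (F ?t)" "B (real k * h) \<in> borel_measurable (F ?t)" if "k \<le> n" for k
   using \<beta>[of k] measurable_F_grid[of h n k] B_grid[of h n k] h tu that by auto
  have [measurable]: "\<beta> k \<in> borel_measurable (F ?t)" "B (real k * h) \<in> borel_measurable (F ?t)"
    "B (real (Suc k) * h) \<in> borel_measurable (F ?t)" if "k \<in> {..<n}" for k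
   using m[of k] m[of "Suc k"] that by (auto simp del: of_nat_Suc)
  have [measurable]: "\<beta> j \<in> borel_measurable (F ?t)" if "k \<in> {..<n}" "j \<in> {..<Suc k}" for j k
   using m[of j] that by auto
  have [measurable]: "\<beta> n \<in> borel_measurable (F ?t)" "B ?t \<in> borel_measurable (F ?t)" using m[of n] by auto
  have "(\<integral>\<^sup>+w. ennreal (exp (\<Sum>k<Suc n. - \<beta> k w * incr h k w - (\<beta> k w)^2 * h / 2))
   * (\<Prod>k<Suc n. G k (B (real (Suc k) * h) w + h * (\<Sum>j<Suc k. \<beta> j w))) * \<Phi> (B ?u w + h * (\<Sum>j<Suc n. \<beta> j w)) \<partial>M)
   = (\<integral>\<^sup>+w. ?P \<beta> w * ?\<psi> (\<beta> n w, ?W \<beta> w) (B ?u w - B ?t w) \<partial>M)"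
  proof (rule nn_integral_cong)
   fix w
   have e: "B ?u w + h * (\<Sum>j<Suc n. \<beta> j w) = ?W \<beta> w + (B ?u w - B ?t w) + \<beta> n w * h"
    by (simp add: algebra_simps)
   show "ennreal (exp (\<Sum>k<Suc n. - \<beta> k w * incr h k w - (\<beta> k w)^2 * h / 2))
   * (\<Prod>k<Suc n. G k (B (real (Suc k) * h) w + h * (\<Sum>j<Suc k. \<beta> j w))) * \<Phi> (B ?u w + h * (\<Sum>j<Suc n. \<beta> j w))
    = ?P \<beta> w * ?\<psi> (\<beta> n w, ?W \<beta> w) (B ?u w - B ?t w)"
    unfolding sum.lessThan_Suc[of _ n] prod.lessThan_Suc exp_add e[unfolded sum.lessThan_Suc]
    by (simp add: ennreal_mult mult_ac del: of_nat_Suc)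
  qed
  also have "\<dots> = (\<integral>\<^sup>+w. ?P \<beta> w * (\<integral>\<^sup>+v. ?\<psi> (\<beta> n w, ?W \<beta> w) v \<partial>gauss (?u - ?t)) \<partial>M)"
  proof (rule nn_integral_increment[OF tu(1-3), where N = "borel \<Otimes>\<^sub>M borel" and \<psi> = ?\<psi>])
   show "?P \<beta> \<in> borel_measurable (F ?t)" by measurable
   show "(\<lambda>w. (\<beta> n w, ?W \<beta> w)) \<in> F ?t \<rightarrow>\<^sub>M borel \<Otimes>\<^sub>M borel" by measurable
  qed measurable
  also have "\<dots> = (\<integral>\<^sup>+w. ?P \<beta> w * \<Phi>' (?W \<beta> w) \<partial>M)"
   unfolding diff \<Phi>'_def
   using gauss_Cameron_Martin[OF _ h, of "\<lambda>v. G n (?W \<beta> _ + v) * \<Phi> (?W \<beta> _ + v)" "\<beta> n _"]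
   by (simp add: add.assoc)
  finally show ?thesis .
 qed
 \<comment> \<open>The same computation without shift identifies the right-hand side.\<close>
 have "(\<integral>\<^sup>+w. ?P \<beta> w * \<Phi>' (?W \<beta> w) \<partial>M) = (\<integral>\<^sup>+w. (\<Prod>k<n. G k (B (real (Suc k) * h) w)) * \<Phi>' (B ?t w) \<partial>M)"
  using Suc.prems(2) tu by (intro Suc.IH) auto
 also have "\<dots> = (\<integral>\<^sup>+w. (\<Prod>k<Suc n. G k (B (real (Suc k) * h) w)) * \<Phi> (B ?u w) \<partial>M)"
  using step[of "\<lambda>_ _. 0"] by simp
 finally have "(\<integral>\<^sup>+w. ?P \<beta> w * \<Phi>' (?W \<beta> w) \<partial>M) = \<dots>" .
 with step[OF Suc.prems(2)] show ?case by (rule trans)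
qed

text \<open>By Jensen's inequality it suffices that \<open>T * \<kappa> * (B s)\<^sup>2\<close> has an exponential moment for each \<open>s\<close>.\<close>

lemma exp_square_integral_B:
 assumes \<kappa>: "0 \<le> \<kappa>" "\<kappa> * T^2 \<le> 1 / 4"
 shows "EE (\<lambda>w. exp (\<kappa> * (LINT s:{0..T}|lborel. (B s w)^2))) \<le> 2"
proof -
 have "EE (\<lambda>w. exp (\<kappa> * (LINT s:{0..T}|lborel. (B s w)^2))) = EE (\<lambda>w. exp (LINT s:{0..T}|lborel. \<kappa> * (B s w)^2))" by simp
 also have "\<dots> \<le> ennreal 2"
 proof (rule EE_exp_interval_integral_le)
  show "continuous_on UNIV (\<lambda>s. \<kappa> * (B s w)^2)" if "w \<in> space M" for w
   by (intro continuous_intros B_continuous that)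
  fix s assume s: "s \<in> {0..T}"
  show "EE (\<lambda>w. exp (T * (\<kappa> * (B s w)^2))) \<le> ennreal 2"
  proof (cases "s = 0")
   case True
   have "EE (\<lambda>w. exp (T * (\<kappa> * (B s w)^2))) = (\<integral>\<^sup>+w. 1 \<partial>M)"
    by (intro nn_integral_cong) (simp add: B_0 True)
   then show ?thesis by (simp add: emeasure_space_1)
  next
   case False
   then have s': "0 < s" "s \<le> T" using s by auto
   have "EE (\<lambda>w. exp (T * (\<kappa> * (B s w)^2))) = (\<integral>\<^sup>+v. ennreal (exp (T * \<kappa> * v^2)) \<partial>gauss s)"
    using nn_integral_B[OF s', of "\<lambda>v. ennreal (exp (T * \<kappa> * v^2))"] by (simp add: mult.assoc)
   also have "\<dots> \<le> 2"
   proof (rule gauss_exp_square[OF s'(1)])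
    have "T * \<kappa> * s \<le> T * \<kappa> * T" using s' \<kappa> T_pos by (intro mult_left_mono) auto
    then show "T * \<kappa> * s \<le> 1 / 4" using \<kappa>(2) by (simp add: power2_eq_square mult_ac)
   qed (use \<kappa> T_pos in auto)
   finally show ?thesis by simp
  qed
 qed (use T_pos in auto)
 finally show ?thesis by simp
qed

end

section \<open>Exponential moments along a shifted Brownian motion\<close>

lemma exp_convex_combination_le:
 fixes u v p :: real
 assumes "0 \<le> p" "p \<le> 1"
 shows "exp (p * u + (1 - p) * v) \<le> exp u + exp v"
proof -
 have "p * u + (1 - p) * v \<le> max u v"
  using convex_bound_le[of u "max u v" v p "1 - p"] assms by auto
 then have "exp (p * u + (1 - p) * v) \<le> exp (max u v)" by simp
 also have "\<dots> \<le> exp u + exp v" by (auto simp: max_def add_increasing)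
 finally show ?thesis .
qed

context adapted_BM
begin

text \<open>The majorant of the speed of the drift part of a solution.\<close>

definition speed_bound :: "real \<Rightarrow> 'w \<Rightarrow> real \<Rightarrow> real" where
 "speed_bound a w s = a * (1 + \<bar>B s w\<bar> + (LINT r:{0..T}|lborel. \<bar>B r w\<bar>))"

lemma continuous_speed_bound:
 "w \<in> space M \<Longrightarrow> continuous_on UNIV (speed_bound a w)"
 unfolding speed_bound_def by (intro continuous_intros B_continuous)

lemma speed_bound_square:
 assumes w: "w \<in> space M"
 shows "(speed_bound a w t)^2 \<le> 3 * a^2 * (1 + (B t w)^2 + T * (LINT s:{0..T}|lborel. (B s w)^2))"
proof -
 let ?I = "LINT r:{0..T}|lborel. \<bar>B r w\<bar>" and ?B2 = "LINT s:{0..T}|lborel. (B s w)^2"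
 have "continuous_on {0..T} (\<lambda>s. B s w)" by (rule continuous_on_subset[OF B_continuous[OF w]]) simp
 then have I: "?I^2 \<le> T * ?B2"
  using square_set_integral_le_continuous[of 0 T "\<lambda>s. \<bar>B s w\<bar>"] T_pos by (simp add: continuous_intros)
 have "(1 + x + y)^2 \<le> 3 * (1 + x^2 + y^2)" for x y :: real
 proof -
  have "0 \<le> (1 - x)^2 + (1 - y)^2 + (x - y)^2" by simp
  then show ?thesis by (simp add: power2_eq_square algebra_simps)
 qed
 from this[of "\<bar>B t w\<bar>" ?I] I have "(1 + \<bar>B t w\<bar> + ?I)^2 \<le> 3 * (1 + (B t w)^2 + T * ?B2)" by simp
 from mult_left_mono[OF this, of "a^2"] show ?thesis
  unfolding speed_bound_def power_mult_distrib by (simp only: mult.left_commute[of _ 3] mult.assoc zero_le_power2)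
qed

lemma speed_bound_energy:
 assumes w: "w \<in> space M" and a: "a \<ge> 0"
  and h: "h > 0" and n: "real n * h \<le> T"
  and \<phi>: "\<And>s t. 0 \<le> s \<Longrightarrow> s \<le> t \<Longrightarrow> t \<le> T \<Longrightarrow> \<bar>\<phi> t - \<phi> s\<bar> \<le> (LINT u:{s..t}|lborel. speed_bound a w u)"
 shows "(\<Sum>k<n. ((\<phi> (real (Suc k) * h) - \<phi> (real k * h)) / h)^2 * h)
  \<le> 3 * a^2 * (T + (1 + T^2) * (LINT s:{0..T}|lborel. (B s w)^2))"
proof -
 let ?v = "speed_bound a w"
 let ?B2 = "LINT s:{0..T}|lborel. (B s w)^2"
 have cB: "continuous_on S (\<lambda>s. B s w)" for S by (rule continuous_on_subset[OF B_continuous[OF w]]) simp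
 have cv: "continuous_on S ?v" for S by (rule continuous_on_subset[OF continuous_speed_bound[OF w]]) simp
 have iv: "set_integrable lborel {s..t} (\<lambda>u. (?v u)^2)" for s t
  by (intro set_integral_continuous(1) continuous_intros cv)
 have v0: "?v u \<ge> 0" for u
  unfolding speed_bound_def using a
  by (intro mult_nonneg_nonneg add_nonneg_nonneg) (auto simp: set_lebesgue_integral_def)
 have each: "((\<phi> (real (Suc k) * h) - \<phi> (real k * h)) / h)^2 * h \<le> (LINT u:{real k * h..real (Suc k) * h}|lborel. (?v u)^2)"
  if k: "k < n" for k
 proof -
  let ?s = "real k * h" and ?t = "real (Suc k) * h"
  have st: "0 \<le> ?s" "?s \<le> ?t" "?t \<le> T" "?t - ?s = h"
   using h grid_point_le[OF n _ h, of "Suc k"] k by (auto simp: algebra_simps)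
  have "\<bar>\<phi> ?t - \<phi> ?s\<bar> \<le> (LINT u:{?s..?t}|lborel. ?v u)" by (rule \<phi>[OF st(1-3)])
  then have "\<bar>\<phi> ?t - \<phi> ?s\<bar>^2 \<le> (LINT u:{?s..?t}|lborel. ?v u)^2" by (intro power_mono) auto
  also have "\<dots> \<le> h * (LINT u:{?s..?t}|lborel. (?v u)^2)"
   using square_set_integral_le_continuous[OF cv st(2)] unfolding st(4) .
  finally have "(\<phi> ?t - \<phi> ?s)^2 / h \<le> (LINT u:{?s..?t}|lborel. (?v u)^2)"
   using h by (simp add: pos_divide_le_eq mult.commute)
  moreover have "((\<phi> ?t - \<phi> ?s) / h)^2 * h = (\<phi> ?t - \<phi> ?s)^2 / h"
   using h by (simp add: power_divide power2_eq_square)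
  ultimately show ?thesis by simp
 qed
 have "(\<Sum>k<m. (LINT u:{real k * h..real (Suc k) * h}|lborel. (?v u)^2)) = (LINT u:{0..real m * h}|lborel. (?v u)^2)" for m
 proof (induction m)
  case 0
  show ?case unfolding set_integral_half_open[symmetric] by (simp add: set_lebesgue_integral_def)
 next
  case (Suc m)
  have "(LINT u:{0..<real (Suc m) * h}|lborel. (?v u)^2)
   = (LINT u:{0..<real m * h} \<union> {real m * h..<real (Suc m) * h}|lborel. (?v u)^2)"
   using h by (simp add: ivl_disj_un algebra_simps)
  also have "\<dots> = (LINT u:{0..<real m * h}|lborel. (?v u)^2) + (LINT u:{real m * h..<real (Suc m) * h}|lborel. (?v u)^2)"
   by (intro set_integral_Un set_integrable_subset[OF iv[of 0 "real m * h"]]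
     set_integrable_subset[OF iv[of "real m * h" "real (Suc m) * h"]]) auto
  finally show ?case using Suc.IH by (simp add: set_integral_half_open)
 qed
 then have "(\<Sum>k<n. ((\<phi> (real (Suc k) * h) - \<phi> (real k * h)) / h)^2 * h) \<le> (LINT u:{0..real n * h}|lborel. (?v u)^2)"
  by (rule ord_le_eq_trans[OF sum_mono, rotated]) (use each in \<open>simp del: of_nat_Suc\<close>)
 also have "\<dots> \<le> (LINT u:{0..T}|lborel. (?v u)^2)"
  unfolding set_lebesgue_integral_def using iv n
  by (intro integral_mono) (auto simp: indicator_def set_integrable_def)
 also have "\<dots> \<le> (LINT u:{0..T}|lborel. 3 * a^2 * (1 + (B u w)^2 + T * ?B2))"
  by (intro set_integral_mono iv set_integral_continuous(1) continuous_intros cB speed_bound_square w)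
 also have "\<dots> = 3 * a^2 * ((LINT u:{0..T}|lborel. 1 + T * ?B2) + ?B2)"
 proof -
  have i1: "set_integrable lborel {0..T} (\<lambda>u. 1 + T * ?B2)" and i2: "set_integrable lborel {0..T} (\<lambda>u. (B u w)^2)"
   by (intro set_integral_continuous(1) continuous_intros cB)+
  show ?thesis
   unfolding set_integral_add(2)[OF i1 i2, symmetric] set_integral_mult_right
   by (simp add: add_ac)
 qed
 also have "(LINT u:{0..T}|lborel. 1 + T * ?B2) = T + T^2 * ?B2"
  using T_pos by (simp add: set_integral_const algebra_simps power2_eq_square)
 finally show ?thesis by (simp add: algebra_simps)
qed

text \<open>A small multiple of the integrated squared speed then has an exponential moment by \<open>exp_square_integral_B\<close>, which is what a
  change of measure needs.\<close>

definition slow_shift :: "real \<Rightarrow> (real \<Rightarrow> 'w \<Rightarrow> real) \<Rightarrow> bool" where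
 "slow_shift a \<phi> \<longleftrightarrow>
   (\<forall>s. 0 \<le> s \<longrightarrow> s \<le> T \<longrightarrow> \<phi> s \<in> borel_measurable (F s)) \<and>
   (\<forall>w\<in>space M. continuous_on UNIV (\<lambda>s. \<phi> s w)) \<and> (\<forall>w\<in>space M. \<phi> 0 w = 0) \<and>
   (AE w in M. \<forall>s t. 0 \<le> s \<longrightarrow> s \<le> t \<longrightarrow> t \<le> T \<longrightarrow> \<bar>\<phi> t w - \<phi> s w\<bar> \<le> (LINT u:{s..t}|lborel. speed_bound a w u))"

text \<open>Let \<open>\<rho>\<close> be the density that removes the shift and \<open>q = 1 + 1 / \<epsilon>\<close>. Young's inequality bounds \<open>exp (\<theta> * J)\<close> by the sum of
  \<open>\<rho> * exp (q * \<theta> * J)\<close>, whose expectation does not see the shift, and the power \<open>\<rho> powr (- \<epsilon>)\<close>. The latter is again bounded by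
  a density and an exponential of the energy of the shift times \<open>3 * \<epsilon>\<close>, which has an expectation for small \<open>\<epsilon>\<close>. The shift is read
  one grid point before the motion so that its increments are known in time.\<close>

lemma exp_shifted_sum:
 assumes a: "a > 0"
 obtains q D where "D \<ge> 0" "\<And>\<phi> g n h \<theta>. slow_shift a \<phi> \<Longrightarrow> (\<And>k. g k \<in> borel_measurable borel) \<Longrightarrow> h > 0 \<Longrightarrow> real n * h \<le> T \<Longrightarrow>
  EE (\<lambda>w. exp (\<theta> * (h * (\<Sum>k<n. g k (\<phi> (real k * h) w + B (real (Suc k) * h) w)))))
   \<le> EE (\<lambda>w. exp (q * \<theta> * (h * (\<Sum>k<n. g k (B (real (Suc k) * h) w))))) + ennreal D"
proof -
 define c where "c = 3 * a^2 * (1 + T^2)"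
 have c: "c > 0" using a by (simp add: c_def add_pos_nonneg)
 \<comment> \<open>Then \<open>3 * \<epsilon> * c * T\<^sup>2 \<le> 1 / 4\<close>, as \<open>exp_square_integral_B\<close> requires.\<close>
 define \<epsilon> where "\<epsilon> = min 1 (1 / (12 * c * T^2))"
 have \<epsilon>: "0 < \<epsilon>" "\<epsilon> \<le> 1" using c T_pos by (auto simp: \<epsilon>_def)
 define \<kappa> where "\<kappa> = 3 * \<epsilon> * c"
 have \<kappa>: "0 \<le> \<kappa>" "\<kappa> * T^2 \<le> 1 / 4"
 proof -
  show "0 \<le> \<kappa>" using \<epsilon> c by (simp add: \<kappa>_def)
  have p: "c * T^2 > 0" using c T_pos by simp
  have "\<epsilon> * (12 * (c * T^2)) \<le> 1 / (12 * c * T^2) * (12 * (c * T^2))"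
   using p by (intro mult_right_mono) (auto simp: \<epsilon>_def)
  also have "\<dots> = 1" using p by auto
  finally show "\<kappa> * T^2 \<le> 1 / 4" by (simp add: \<kappa>_def)
 qed
 define q where "q = 1 + 1 / \<epsilon>"
 define D where "D = 1 + exp (9 * a^2 * T) * 2"
 show ?thesis
 proof (rule that[of D q])
  show "D \<ge> 0" by (simp add: D_def)
  fix \<phi> h \<theta> and n :: nat and g :: "nat \<Rightarrow> real \<Rightarrow> real"
  assume shift: "slow_shift a \<phi>" and [measurable]: "\<And>k. g k \<in> borel_measurable borel" and h: "h > 0" and n: "real n * h \<le> T"
  let ?b = "\<lambda>k. B (real k * h)" and ?B2 = "\<lambda>w. LINT s:{0..T}|lborel. (B s w)^2"
  define J where "J w = h * (\<Sum>k<n. g k (\<phi> (real k * h) w + ?b (Suc k) w))" for w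
  define I where "I w = h * (\<Sum>k<n. g k (?b (Suc k) w))" for w
  \<comment> \<open>\<open>\<beta> 0 = 0\<close> by truncated subtraction; \<open>\<beta> k\<close> is known at the \<open>k\<close>-th grid point.\<close>
  define \<beta> where "\<beta> k w = (\<phi> (real k * h) w - \<phi> (real (k - 1) * h) w) / h" for k w
  define l where "l w = (\<Sum>k<n. - \<beta> k w * incr h k w - (\<beta> k w)^2 * h / 2)" for w
  define Q where "Q w = (\<Sum>k<n. (\<beta> k w)^2 * h)" for w
  define m where "m w = (\<Sum>k<n. (2 * \<epsilon> * \<beta> k w) * incr h k w - (2 * \<epsilon> * \<beta> k w)^2 * h / 2)" for w
  have kh: "0 \<le> real k * h" "real k * h \<le> T" if "k \<le> n" for k
   using h grid_point_le[OF n that h] by auto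
  have \<phi>F: "\<phi> s \<in> borel_measurable (F t)" if "0 \<le> s" "s \<le> t" "t \<le> T" for s t
   using that shift by (intro measurable_F_mono[OF that]) (auto simp: slow_shift_def)
  have \<beta>F: "\<beta> k \<in> borel_measurable (F (real k * h))" if k: "k < n" for k
  proof -
   have "0 \<le> real (k - 1) * h" "real (k - 1) * h \<le> real k * h" using h by (auto intro!: mult_right_mono)
   then have [measurable]: "\<phi> (real k * h) \<in> borel_measurable (F (real k * h))"
     "\<phi> (real (k - 1) * h) \<in> borel_measurable (F (real k * h))"
    using kh[of k] k by (auto intro: \<phi>F)
   show ?thesis unfolding \<beta>_def by measurable
  qed
  have [measurable]: "\<phi> (real k * h) \<in> borel_measurable M" "\<beta> k \<in> borel_measurable M" if "k \<in> {..<n}" for k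
   using measurable_F_M[OF kh \<phi>F[OF kh(1) order_refl kh(2)]] measurable_F_M[OF kh \<beta>F] that by auto
  have [measurable]: "l \<in> borel_measurable M" "m \<in> borel_measurable M" "Q \<in> borel_measurable M" "J \<in> borel_measurable M"
   unfolding l_def m_def Q_def J_def by measurable
  have sum\<beta>: "h * (\<Sum>j<Suc k. \<beta> j w) = \<phi> (real k * h) w" if "w \<in> space M" for k w
  proof (induction k)
   case 0
   show ?case using shift that by (simp add: \<beta>_def slow_shift_def)
  next
   case (Suc k)
   have "h * \<beta> (Suc k) w = \<phi> (real (Suc k) * h) w - \<phi> (real k * h) w" using h by (simp add: \<beta>_def)
   then show ?case using Suc.IH by (simp add: distrib_left)
  qed
  have Young: "exp (\<theta> * J w) \<le> exp (l w + q * \<theta> * J w) + exp (m w) + exp (3 * \<epsilon> * Q w)" for w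
  proof -
   have Q0: "Q w \<ge> 0" unfolding Q_def using h by (intro sum_nonneg) auto
   have "- \<epsilon> * l w = 1 / 2 * m w + (1 - 1 / 2) * ((\<epsilon> + 2 * \<epsilon>^2) * Q w)"
    unfolding l_def m_def Q_def sum_distrib_left sum.distrib[symmetric]
    by (intro sum.cong refl) (simp add: power2_eq_square field_simps)
   then have "exp (- \<epsilon> * l w) \<le> exp (m w) + exp ((\<epsilon> + 2 * \<epsilon>^2) * Q w)"
    using exp_convex_combination_le[of "1 / 2" "m w" "(\<epsilon> + 2 * \<epsilon>^2) * Q w"] by simp
   also have "exp ((\<epsilon> + 2 * \<epsilon>^2) * Q w) \<le> exp (3 * \<epsilon> * Q w)"
   proof -
    have "\<epsilon>^2 \<le> \<epsilon>" using \<epsilon> by (simp add: power2_eq_square mult_left_le)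
    then show ?thesis using Q0 by (auto intro!: mult_right_mono)
   qed
   finally have 1: "exp (- \<epsilon> * l w) \<le> exp (m w) + exp (3 * \<epsilon> * Q w)" by simp
   have q: "q > 1" "1 / q = \<epsilon> / (1 + \<epsilon>)" using \<epsilon> by (auto simp: q_def field_simps)
   have e: "\<theta> * J w = 1 / q * (l w + q * \<theta> * J w) + (1 - 1 / q) * (- \<epsilon> * l w)"
   proof -
    have "1 - 1 / q = 1 / (1 + \<epsilon>)" unfolding q(2) using \<epsilon> by (simp add: field_simps)
    then have "(1 - 1 / q) * (- \<epsilon> * l w) = - (1 / q * l w)" unfolding q(2) by simp
    moreover have "1 / q * (l w + q * \<theta> * J w) = 1 / q * l w + \<theta> * J w" using q(1) by (simp add: distrib_left)
    ultimately show ?thesis by simp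
   qed
   have "exp (1 / q * (l w + q * \<theta> * J w) + (1 - 1 / q) * (- \<epsilon> * l w)) \<le> exp (l w + q * \<theta> * J w) + exp (- \<epsilon> * l w)"
    using q(1) by (intro exp_convex_combination_le) auto
   with 1 arg_cong[OF e, of exp] show ?thesis by linarith
  qed
  have E1: "EE (\<lambda>w. exp (l w + q * \<theta> * J w)) = EE (\<lambda>w. exp (q * \<theta> * I w))"
  proof -
   define G where "G k x = ennreal (exp (q * \<theta> * h * g k x))" for k x
   have prodG: "(\<Prod>k<n. G k (x k)) = ennreal (exp (q * \<theta> * (h * (\<Sum>k<n. g k (x k)))))" for x
    unfolding G_def by (subst prod_ennreal) (auto simp: exp_sum[symmetric] sum_distrib_left mult.assoc)
   have "EE (\<lambda>w. exp (l w + q * \<theta> * J w))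
    = (\<integral>\<^sup>+w. ennreal (exp (l w)) * (\<Prod>k<n. G k (?b (Suc k) w + h * (\<Sum>j<Suc k. \<beta> j w))) * 1 \<partial>M)"
    by (intro nn_integral_cong) (simp only: sum\<beta> prodG J_def exp_add ennreal_mult exp_ge_zero add.commute mult_1_right)
   also have "\<dots> = (\<integral>\<^sup>+w. (\<Prod>k<n. G k (?b (Suc k) w)) * 1 \<partial>M)"
    unfolding l_def using \<beta>F n by (intro discrete_Girsanov[OF h, where \<Phi> = "\<lambda>_. 1"]) (auto simp: G_def)
   also have "\<dots> = EE (\<lambda>w. exp (q * \<theta> * I w))" unfolding prodG I_def by simp
   finally show ?thesis .
  qed
  have E2: "EE (\<lambda>w. exp (m w)) = 1"
   unfolding m_def using \<beta>F h n by (intro exp_martingale) auto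
  have E3: "EE (\<lambda>w. exp (3 * \<epsilon> * Q w)) \<le> ennreal (exp (9 * a^2 * T)) * 2"
  proof -
   have "AE w in M. ennreal (exp (3 * \<epsilon> * Q w)) \<le> ennreal (exp (9 * a^2 * T)) * ennreal (exp (\<kappa> * ?B2 w))"
    using shift[unfolded slow_shift_def, THEN conjunct2, THEN conjunct2, THEN conjunct2] AE_space
   proof eventually_elim
    case (elim w)
    have "Q w \<le> 3 * a^2 * (T + (1 + T^2) * ?B2 w)"
    proof (cases n)
     case (Suc N)
     have N: "real N * h \<le> T" using kh[of N] Suc by simp
     have "Q w = (\<Sum>k<N. ((\<phi> (real (Suc k) * h) w - \<phi> (real k * h) w) / h)^2 * h)"
      unfolding Q_def Suc sum.lessThan_Suc_shift by (simp add: \<beta>_def)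
     then show ?thesis
      using speed_bound_energy[OF elim(2) less_imp_le[OF a] h N, of "\<lambda>s. \<phi> s w"] elim(1) by simp
    qed (use T_pos in \<open>auto simp: Q_def set_lebesgue_integral_def\<close>)
    then have "3 * \<epsilon> * Q w \<le> 3 * \<epsilon> * (3 * a^2 * (T + (1 + T^2) * ?B2 w))"
     using \<epsilon> by (intro mult_left_mono) auto
    also have "\<dots> = \<epsilon> * (9 * a^2 * T) + \<kappa> * ?B2 w"
     by (simp add: \<kappa>_def c_def algebra_simps)
    also have "\<epsilon> * (9 * a^2 * T) \<le> 9 * a^2 * T" using \<epsilon> T_pos by (intro mult_left_le_one_le) auto
    finally have "exp (3 * \<epsilon> * Q w) \<le> exp (9 * a^2 * T) * exp (\<kappa> * ?B2 w)" by (simp flip: exp_add)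
    from ennreal_leI[OF this] show ?case by (simp add: ennreal_mult)
   qed
   then have "EE (\<lambda>w. exp (3 * \<epsilon> * Q w)) \<le> (\<integral>\<^sup>+w. ennreal (exp (9 * a^2 * T)) * ennreal (exp (\<kappa> * ?B2 w)) \<partial>M)"
    by (rule nn_integral_mono_AE)
   also have "\<dots> = ennreal (exp (9 * a^2 * T)) * EE (\<lambda>w. exp (\<kappa> * ?B2 w))"
   proof -
    note [measurable] = jointly_measurable_continuous[OF B_measurable B_continuous]
    show ?thesis unfolding set_lebesgue_integral_def by (rule nn_integral_cmult) measurable
   qed
   also have "\<dots> \<le> ennreal (exp (9 * a^2 * T)) * 2"
    by (intro mult_left_mono exp_square_integral_B \<kappa>) simp
   finally show ?thesis .
  qed
  have "EE (\<lambda>w. exp (\<theta> * J w))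
   \<le> (\<integral>\<^sup>+w. ennreal (exp (l w + q * \<theta> * J w)) + ennreal (exp (m w)) + ennreal (exp (3 * \<epsilon> * Q w)) \<partial>M)"
   using Young by (intro nn_integral_mono) (simp flip: ennreal_plus)
  also have "\<dots> = EE (\<lambda>w. exp (l w + q * \<theta> * J w)) + EE (\<lambda>w. exp (m w)) + EE (\<lambda>w. exp (3 * \<epsilon> * Q w))"
   by (simp add: nn_integral_add)
  also have "\<dots> \<le> EE (\<lambda>w. exp (q * \<theta> * I w)) + 1 + ennreal (exp (9 * a^2 * T)) * 2"
   unfolding E1 E2 by (intro add_mono E3) auto
  also have "\<dots> = EE (\<lambda>w. exp (q * \<theta> * I w)) + ennreal D"
   by (simp add: D_def ennreal_plus ennreal_mult add.assoc)
  finally show "EE (\<lambda>w. exp (\<theta> * (h * (\<Sum>k<n. g k (\<phi> (real k * h) w + ?b (Suc k) w)))))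
   \<le> EE (\<lambda>w. exp (q * \<theta> * (h * (\<Sum>k<n. g k (?b (Suc k) w))))) + ennreal D"
   unfolding J_def I_def .
 qed
qed

text \<open>Riemann sums are bounded by \<open>t * L\<close>, so their exponential moments converge and the bounds of \<open>exp_shifted_sum\<close> and \<open>exp_integral_derivative_BM\<close> combine.\<close>

lemma exp_integral_derivative_shifted:
 fixes K a :: real
 assumes a: "a > 0"
 obtains C where "\<And>\<theta>. C \<theta> \<ge> 0" "\<And>g g' L \<phi> z t \<theta>. regular_field g g' K L \<Longrightarrow> slow_shift a \<phi> \<Longrightarrow> 0 \<le> t \<Longrightarrow> t \<le> T \<Longrightarrow>
  EE (\<lambda>w. exp (\<theta> * (LINT s:{0..t}|lborel. g' s (z + (\<phi> s w + B s w))))) \<le> ennreal (C \<theta>)"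
proof -
 obtain q D where D: "D \<ge> 0" and step: "\<And>\<phi> g n h \<theta>. slow_shift a \<phi> \<Longrightarrow> (\<And>k. g k \<in> borel_measurable borel) \<Longrightarrow> h > 0 \<Longrightarrow> real n * h \<le> T \<Longrightarrow>
  EE (\<lambda>w. exp (\<theta> * (h * (\<Sum>k<n. g k (\<phi> (real k * h) w + B (real (Suc k) * h) w)))))
   \<le> EE (\<lambda>w. exp (q * \<theta> * (h * (\<Sum>k<n. g k (B (real (Suc k) * h) w))))) + ennreal D"
  by (rule exp_shifted_sum[OF a]) (rule that, assumption, blast)
 define C where "C \<theta> = 4 * exp (18 * (q * \<theta>)^2 * K^2 * T) + D" for \<theta>
 show ?thesis
 proof (rule that[of C])
  show "C \<theta> \<ge> 0" for \<theta> using D by (simp add: C_def)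
  fix g g' L \<phi> z t \<theta>
  assume reg: "regular_field g g' K L" and shift: "slow_shift a \<phi>" and t: "0 \<le> t" "t \<le> T"
  let ?J = "\<lambda>w. LINT s:{0..t}|lborel. g' s (z + (\<phi> s w + B s w))" and ?I = "\<lambda>w. LINT s:{0..t}|lborel. g' s (z + B s w)"
  have *: "EE (\<lambda>w. exp (\<theta> * ?J w)) \<le> EE (\<lambda>w. exp (q * \<theta> * ?I w)) + ennreal D"
  proof (cases "t = 0")
   case True
   have "?J w = 0" "?I w = 0" for w
    unfolding set_integral_half_open[symmetric] True by (simp_all add: set_lebesgue_integral_def)
   then show ?thesis by simp
  next
   case False
   then have t0: "0 < t" using t by simp
   note [measurable] = regular_field_borel[OF reg]
   have g'L: "\<bar>g' s x\<bar> \<le> L" for s x using reg by (auto simp: regular_field_def)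
   define h where "h N = t / real (Suc N)" for N
   have h: "h N > 0" "real (Suc N) * h N = t" for N using t0 by (auto simp: h_def)
   define R where "R \<eta> \<xi> N = h N * (\<Sum>k<Suc N. g' (real (Suc k) * h N) (z + (\<eta> (real k * h N) + \<xi> (real (Suc k) * h N))))"
    for \<eta> \<xi> :: "real \<Rightarrow> real" and N
   have lim: "R \<eta> \<xi> \<longlonglongrightarrow> (LINT s:{0..t}|lborel. g' s (z + (\<eta> s + \<xi> s)))"
    if \<eta>: "continuous_on UNIV \<eta>" and \<xi>: "continuous_on UNIV \<xi>" for \<eta> \<xi>
   proof -
    have "(\<lambda>N. (t - 0) / real N * (\<Sum>k<N. g' (real (Suc k) * (t / real N)) (z + (\<eta> (real k * (t / real N)) + \<xi> (real (Suc k) * (t / real N))))))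
      \<longlonglongrightarrow> (LINT s:{0..t}|lborel. g' s (z + (\<eta> s + \<xi> s)))"
    proof (rule Riemann_sums_tendsto[where L = L])
     fix s assume s: "0 \<le> s" "s < t"
     let ?r = "\<lambda>N. real (cell_index 0 ((t - 0) / real N) s) * (t / real N)"
      and ?r' = "\<lambda>N. real (Suc (cell_index 0 ((t - 0) / real N) s)) * (t / real N)"
     have 1: "?r \<longlonglongrightarrow> s" using grid_point_tendsto[OF t0 s(1)] by simp
     from tendsto_add[OF this lim_const_over_n[of t]]
     have 2: "?r' \<longlonglongrightarrow> s" by (simp add: algebra_simps add_divide_distrib)
     have "isCont \<eta> s" "isCont \<xi> s" using \<eta> \<xi> by (auto simp: continuous_on_eq_continuous_at)
     then have "(\<lambda>N. \<eta> (?r N)) \<longlonglongrightarrow> \<eta> s" "(\<lambda>N. \<xi> (?r' N)) \<longlonglongrightarrow> \<xi> s"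
      using 1 2 by (auto intro: isCont_tendsto_compose)
     then have 3: "(\<lambda>N. (?r' N, z + (\<eta> (?r N) + \<xi> (?r' N)))) \<longlonglongrightarrow> (s, z + (\<eta> s + \<xi> s))" by (intro tendsto_intros 2)
     have "isCont (\<lambda>(s, x). g' s x) (s, z + (\<eta> s + \<xi> s))"
      using reg by (auto simp: regular_field_def continuous_on_eq_continuous_at)
     from isCont_tendsto_compose[OF this 3]
     show "(\<lambda>N. g' (?r' N) (z + (\<eta> (?r N) + \<xi> (?r' N)))) \<longlonglongrightarrow> g' s (z + (\<eta> s + \<xi> s))"
      by (simp only: prod.case)
    qed (use t0 g'L in auto)
    from LIMSEQ_Suc[OF this] show ?thesis by (simp add: R_def[abs_def] h_def del: of_nat_Suc sum.lessThan_Suc)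
   qed
   have R_bound: "\<bar>R \<eta> \<xi> N\<bar> \<le> t * L" for \<eta> \<xi> N
   proof -
    have "\<bar>\<Sum>k<Suc N. g' (y k) (x k)\<bar> \<le> (\<Sum>k<Suc N. L)" for x y
     by (rule order_trans[OF sum_abs sum_mono]) (rule g'L)
    then have "\<bar>R \<eta> \<xi> N\<bar> \<le> h N * (real (Suc N) * L)"
     unfolding R_def abs_mult using h(1)[of N] by (intro mult_mono) auto
    also have "\<dots> = t * L" using h(2)[of N] by (simp add: mult.assoc[symmetric] mult.commute[of "h N"])
    finally show ?thesis .
   qed
   have exp_lim: "(\<lambda>N. EE (\<lambda>w. exp (p * R (\<lambda>s. \<eta> s w) (\<lambda>s. B s w) N)))
     \<longlonglongrightarrow> EE (\<lambda>w. exp (p * (LINT s:{0..t}|lborel. g' s (z + (\<eta> s w + B s w)))))"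
    if \<eta>: "\<And>s. 0 \<le> s \<Longrightarrow> s \<le> T \<Longrightarrow> \<eta> s \<in> borel_measurable M" "\<And>w. w \<in> space M \<Longrightarrow> continuous_on UNIV (\<lambda>s. \<eta> s w)"
    for \<eta> and p :: real
   proof (rule nn_integral_dominated_convergence[where w = "\<lambda>_. ennreal (exp (\<bar>p\<bar> * (t * L)))"])
    let ?R = "\<lambda>N w. R (\<lambda>s. \<eta> s w) (\<lambda>s. B s w) N"
    have [measurable]: "\<eta> (real k * h N) \<in> borel_measurable M" if "k \<in> {..<Suc N}" for k N
     using h[of N] t that grid_point_le[of "Suc N" "h N" k] by (intro \<eta>(1)) auto
    have Rm [measurable]: "?R N \<in> borel_measurable M" for N unfolding R_def by measurable
    have Rl: "(\<lambda>N. ?R N w) \<longlonglongrightarrow> (LINT s:{0..t}|lborel. g' s (z + (\<eta> s w + B s w)))" if "w \<in> space M" for w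
     by (rule lim[OF \<eta>(2)[OF that] B_continuous[OF that]])
    show "AE w in M. (\<lambda>N. ennreal (exp (p * ?R N w))) \<longlonglongrightarrow> ennreal (exp (p * (LINT s:{0..t}|lborel. g' s (z + (\<eta> s w + B s w)))))"
     by (intro AE_I2 tendsto_ennrealI tendsto_intros Rl)
    show "AE w in M. ennreal (exp (p * ?R N w)) \<le> ennreal (exp (\<bar>p\<bar> * (t * L)))" for N
    proof (intro AE_I2 ennreal_leI)
     fix w
     have "p * ?R N w \<le> \<bar>p * ?R N w\<bar>" by simp
     also have "\<dots> \<le> \<bar>p\<bar> * (t * L)" unfolding abs_mult by (intro mult_left_mono R_bound) simp
     finally show "exp (p * ?R N w) \<le> exp (\<bar>p\<bar> * (t * L))" by simp
    qed
    show "(\<lambda>w. ennreal (exp (p * ?R N w))) \<in> borel_measurable M" for N by measurable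
    have "(\<lambda>w. LINT s:{0..t}|lborel. g' s (z + (\<eta> s w + B s w))) \<in> borel_measurable M"
     by (rule borel_measurable_LIMSEQ_real[OF Rl Rm])
    then show "(\<lambda>w. ennreal (exp (p * (LINT s:{0..t}|lborel. g' s (z + (\<eta> s w + B s w)))))) \<in> borel_measurable M" by measurable
   qed (simp_all add: emeasure_space_1)
   show ?thesis
   proof (rule LIMSEQ_le)
    show "(\<lambda>N. EE (\<lambda>w. exp (\<theta> * R (\<lambda>s. \<phi> s w) (\<lambda>s. B s w) N))) \<longlonglongrightarrow> EE (\<lambda>w. exp (\<theta> * ?J w))"
     using shift by (intro exp_lim) (auto simp: slow_shift_def intro: measurable_F_M)
    show "(\<lambda>N. EE (\<lambda>w. exp (q * \<theta> * R (\<lambda>s. 0) (\<lambda>s. B s w) N)) + ennreal D) \<longlonglongrightarrow> EE (\<lambda>w. exp (q * \<theta> * ?I w)) + ennreal D"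
     using exp_lim[of "\<lambda>_ _. 0" "q * \<theta>"] by (intro tendsto_add tendsto_const) simp
    have "EE (\<lambda>w. exp (\<theta> * R (\<lambda>s. \<phi> s w) (\<lambda>s. B s w) N)) \<le> EE (\<lambda>w. exp (q * \<theta> * R (\<lambda>s. 0) (\<lambda>s. B s w) N)) + ennreal D" for N
     using step[OF shift, of "\<lambda>k x. g' (real (Suc k) * h N) (z + x)" "h N" "Suc N" \<theta>] h[of N] t
     by (simp add: R_def del: of_nat_Suc sum.lessThan_Suc)
    then show "\<exists>N. \<forall>n\<ge>N. EE (\<lambda>w. exp (\<theta> * R (\<lambda>s. \<phi> s w) (\<lambda>s. B s w) n)) \<le> EE (\<lambda>w. exp (q * \<theta> * R (\<lambda>s. 0) (\<lambda>s. B s w) n)) + ennreal D"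
     by blast
   qed
  qed
  also have "\<dots> \<le> ennreal (4 * exp (18 * (q * \<theta>)^2 * K^2 * T)) + ennreal D"
   by (intro add_mono exp_integral_derivative_BM[OF reg t] order_refl)
  also have "\<dots> = ennreal (C \<theta>)" using D by (simp add: C_def flip: ennreal_plus)
  finally show "EE (\<lambda>w. exp (\<theta> * ?J w)) \<le> ennreal (C \<theta>)" .
 qed
qed

end

section \<open>Linear growth of integral equations with additive forcing\<close>

lemma set_integral_mono_interval:
 fixes f :: "real \<Rightarrow> real"
 assumes "set_integrable lborel {0..T} f" "\<And>s. s \<in> {0..T} \<Longrightarrow> 0 \<le> f s" "r \<le> t" "t \<le> T"
 shows "(LINT s:{0..r}|lborel. f s) \<le> (LINT s:{0..t}|lborel. f s)"
proof -
 have "set_integrable lborel {0..r} f" "set_integrable lborel {0..t} f"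
  by (rule set_integrable_subset[OF assms(1)]; use assms in auto)+
 then show ?thesis
  unfolding set_lebesgue_integral_def set_integrable_def using assms
  by (intro integral_mono) (auto simp: indicator_def)
qed

text \<open>Gronwall's inequality for the integral of \<open>u\<close> in place of \<open>u\<close>, since \<open>f\<close> need not be monotone.\<close>

lemma Gronwall_forced:
 fixes u f :: "real \<Rightarrow> real"
 assumes u: "continuous_on {0..T} u" and f: "continuous_on {0..T} f" and C: "C \<ge> 0"
  and f0: "\<And>t. t \<in> {0..T} \<Longrightarrow> 0 \<le> f t" and t: "t \<in> {0..T}"
  and ineq: "\<And>s. s \<in> {0..t} \<Longrightarrow> u s \<le> f s + C * (LINT r:{0..s}|lborel. u r)"
 shows "u t \<le> f t + C * exp (C * T) * (LINT s:{0..T}|lborel. f s)"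
proof -
 define V where "V s = (LINT r:{0..s}|lborel. u r)" for s
 let ?I = "LINT s:{0..T}|lborel. f s"
 have sub: "continuous_on {0..s} u" "continuous_on {0..s} f" if "s \<in> {0..t}" for s
  using that t by (auto intro: continuous_on_subset[OF u] continuous_on_subset[OF f])
 have VI: "V s = integral {0..s} u" if "s \<in> {0..t}" for s
  unfolding V_def by (rule set_integral_continuous(2)[OF sub(1)[OF that]])
 have cV: "continuous_on {0..t} V"
  by (rule continuous_on_eq[OF indefinite_integral_continuous_1[OF integrable_continuous_real[OF sub(1)[of t]]]])
    (use t VI in auto)
 have If: "0 \<le> ?I"
  unfolding set_lebesgue_integral_def using f0
  by (intro Bochner_Integration.integral_nonneg) (auto simp: indicator_def)
 have "V s \<le> ?I + C * (LINT r:{0..s}|lborel. V r)" if s: "s \<in> {0..t}" for s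
 proof -
  have iV: "set_integrable lborel {0..s} V" "set_integrable lborel {0..s} f" "set_integrable lborel {0..s} u"
   using s by (auto intro!: set_integral_continuous(1) sub intro: continuous_on_subset[OF cV])
  have iCV: "set_integrable lborel {0..s} (\<lambda>r. C * V r)" using iV(1) by simp
  have "V s \<le> (LINT r:{0..s}|lborel. f r + C * V r)"
   unfolding V_def[of s]
  proof (intro set_integral_mono set_integral_add(1) iV iCV)
   show "u r \<le> f r + C * V r" if "r \<in> {0..s}" for r using ineq[of r] that s by (simp add: V_def)
  qed
  also have "\<dots> = (LINT r:{0..s}|lborel. f r) + C * (LINT r:{0..s}|lborel. V r)"
   unfolding set_integral_add(2)[OF iV(2) iCV] by simp
  also have "(LINT r:{0..s}|lborel. f r) \<le> ?I"
   using s t by (intro set_integral_mono_interval[OF set_integral_continuous(1)[OF f] f0]) auto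
  finally show ?thesis by simp
 qed
 then have "V t \<le> ?I * exp (C * t)" using t by (intro Gronwall[OF cV C]) auto
 also have "\<dots> \<le> ?I * exp (C * T)"
  using t C If by (intro mult_left_mono) (auto intro: mult_left_mono)
 finally have "C * V t \<le> C * (?I * exp (C * T))" using C by (intro mult_left_mono)
 then show ?thesis using ineq[of t] t by (simp add: V_def mult_ac)
qed

text \<open>The constant is wasteful, but the bound has the form of \<open>speed_bound\<close>.\<close>

lemma linear_growth_bound:
 fixes X W \<beta> q :: "real \<Rightarrow> real"
 assumes T: "T \<ge> 0" and C: "C \<ge> 0" and X: "continuous_on {0..T} X" and W: "continuous_on {0..T} W"
  and \<beta>: "set_integrable lborel {0..T} \<beta>" and q: "set_integrable lborel {0..T} q"
  and bound: "\<And>s. s \<in> {0..T} \<Longrightarrow> \<bar>\<beta> s\<bar> \<le> q s + C * \<bar>X s\<bar>" and q0: "\<And>s. s \<in> {0..T} \<Longrightarrow> 0 \<le> q s"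
  and eq: "\<And>t. t \<in> {0..T} \<Longrightarrow> X t = x + (LINT s:{0..t}|lborel. \<beta> s) + W t"
  and A: "\<bar>x\<bar> + (LINT s:{0..t}|lborel. q s) \<le> A" and t: "t \<in> {0..T}"
 shows "\<bar>X t\<bar> \<le> (1 + A + C * exp (C * T) * (1 + A * T)) * (1 + \<bar>W t\<bar> + (LINT s:{0..T}|lborel. \<bar>W s\<bar>))"
proof -
 let ?W = "LINT s:{0..T}|lborel. \<bar>W s\<bar>"
 have "0 \<le> (LINT s:{0..t}|lborel. q s)"
  unfolding set_lebesgue_integral_def using q0 t
  by (intro Bochner_Integration.integral_nonneg) (auto simp: indicator_def)
 then have A0: "A \<ge> 0" using A by linarith
 have "\<bar>X s\<bar> \<le> (A + \<bar>W s\<bar>) + C * (LINT r:{0..s}|lborel. \<bar>X r\<bar>)" if s: "s \<in> {0..t}" for s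
 proof -
  have i\<beta>: "set_integrable lborel {0..s} \<beta>" by (rule set_integrable_subset[OF \<beta>]) (use s t in auto)
  have iq: "set_integrable lborel {0..s} q" by (rule set_integrable_subset[OF q]) (use s t in auto)
  have iX: "set_integrable lborel {0..s} (\<lambda>r. C * \<bar>X r\<bar>)"
   using s t by (intro set_integral_continuous(1) continuous_intros continuous_on_subset[OF X]) auto
  have "\<bar>LINT r:{0..s}|lborel. \<beta> r\<bar> \<le> (LINT r:{0..s}|lborel. \<bar>\<beta> r\<bar>)"
   using set_integral_norm_bound[OF i\<beta>] by simp
  also have "\<dots> \<le> (LINT r:{0..s}|lborel. q r + C * \<bar>X r\<bar>)"
   using bound s t by (intro set_integral_mono set_integral_add set_integrable_abs i\<beta> iq iX) auto
  also have "\<dots> = (LINT r:{0..s}|lborel. q r) + C * (LINT r:{0..s}|lborel. \<bar>X r\<bar>)"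
   unfolding set_integral_add(2)[OF iq iX] by simp
  also have "(LINT r:{0..s}|lborel. q r) \<le> (LINT r:{0..t}|lborel. q r)"
   using s t by (intro set_integral_mono_interval[OF q q0]) auto
  finally show ?thesis using eq[of s] A s t by auto
 qed
 then have "\<bar>X t\<bar> \<le> (A + \<bar>W t\<bar>) + C * exp (C * T) * (LINT s:{0..T}|lborel. A + \<bar>W s\<bar>)"
  using A0 by (intro Gronwall_forced[OF _ _ C _ t] continuous_intros X W) auto
 also have "(LINT s:{0..T}|lborel. A + \<bar>W s\<bar>) = A * T + ?W"
 proof -
  have "set_integrable lborel {0..T} (\<lambda>s. A)" "set_integrable lborel {0..T} (\<lambda>s. \<bar>W s\<bar>)"
   by (intro set_integral_continuous(1) continuous_intros W)+
  from set_integral_add(2)[OF this] show ?thesis using T by (simp add: set_integral_const)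
 qed
 also have "(A + w) + e * (A * T + I) \<le> (1 + A + e * (1 + A * T)) * (1 + w + I)"
  if "0 \<le> w" "0 \<le> e" "0 \<le> I" for w e I
 proof -
  have "(1 + A + e * (1 + A * T)) * (1 + w + I) - ((A + w) + e * (A * T + I))
   = 1 + I + A * (w + I) + e * (1 + w + A * T * (w + I))"
   by (simp add: algebra_simps)
  moreover have "0 \<le> A * (w + I)" "0 \<le> e * (1 + w + A * T * (w + I))" using that A0 T by auto
  ultimately show ?thesis using that by linarith
 qed
 from this[of "\<bar>W t\<bar>" "C * exp (C * T)" ?W]
 have "(A + \<bar>W t\<bar>) + C * exp (C * T) * (A * T + ?W) \<le> (1 + A + C * exp (C * T) * (1 + A * T)) * (1 + \<bar>W t\<bar> + ?W)"
  using C by (simp add: set_lebesgue_integral_def)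
 finally show ?thesis .
qed

section \<open>Solutions of the mean-field equation\<close>

lemma (in prob_space) distr_in_P1_iff:
 assumes [measurable]: "X \<in> borel_measurable M"
 shows "distr M borel X \<in> P1 \<longleftrightarrow> integrable M X"
proof -
 have "integrable (distr M borel X) (\<lambda>x. \<bar>x\<bar>) \<longleftrightarrow> integrable M X"
  by (subst integrable_distr_eq) (simp_all add: integrable_abs_iff)
 then show ?thesis using prob_space_distr[of X borel] by (simp add: P1_def)
qed

lemma (in prob_space) return_in_P1: "return borel (0 :: real) \<in> P1"
proof -
 have "distr M borel (\<lambda>_. 0 :: real) \<in> P1" by (subst distr_in_P1_iff) auto
 then show ?thesis by (simp add: distr_const)
qed

text \<open>The pair \<open>(X, Y)\<close> is a coupling of the two laws.\<close>

lemma (in prob_space) kantorovich_distr_le: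
 assumes [measurable]: "X \<in> borel_measurable M" "Y \<in> borel_measurable M"
  and P: "distr M borel X \<in> P1" "distr M borel Y \<in> P1"
 shows "kantorovich (distr M borel X) (distr M borel Y) \<le> (\<integral>w. \<bar>X w - Y w\<bar> \<partial>M)"
proof -
 have i: "integrable M X" "integrable M Y" using P by (auto simp: distr_in_P1_iff)
 have "\<bar>(\<integral>x. h x \<partial>distr M borel X) - (\<integral>x. h x \<partial>distr M borel Y)\<bar> \<le> (\<integral>w. \<bar>X w - Y w\<bar> \<partial>M)"
  if h: "1-lipschitz_on UNIV h" for h :: "real \<Rightarrow> real"
 proof -
  have [measurable]: "h \<in> borel_measurable borel" by (rule lipschitz_borel_measurable[OF h])
  have ih: "integrable M (\<lambda>w. h (X w))" "integrable M (\<lambda>w. h (Y w))"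
   using P1_integrable_lipschitz[OF P(1) h] P1_integrable_lipschitz[OF P(2) h]
   by (simp_all add: integrable_distr_eq)
  have "(\<integral>x. h x \<partial>distr M borel X) - (\<integral>x. h x \<partial>distr M borel Y) = (\<integral>w. h (X w) - h (Y w) \<partial>M)"
   using ih by (simp add: integral_distr)
  also have "\<bar>\<dots>\<bar> \<le> (\<integral>w. \<bar>h (X w) - h (Y w)\<bar> \<partial>M)" by (rule integral_abs_bound)
  also have "\<dots> \<le> (\<integral>w. \<bar>X w - Y w\<bar> \<partial>M)"
   using ih i lipschitz_onD[OF h, of "X _" "Y _"] by (intro integral_mono) (auto simp: dist_real_def)
  finally show ?thesis .
 qed
 moreover have "{h :: real \<Rightarrow> real. 1-lipschitz_on UNIV h} \<noteq> {}"
  by (auto intro!: exI[of _ "\<lambda>_. 0"] lipschitz_onI)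
 ultimately show ?thesis using P by (auto simp: kantorovich_def intro!: cSUP_least)
qed

context adapted_BM
begin

lemma integral_square_B:
 assumes "0 \<le> t" "t \<le> T"
 shows "EE (\<lambda>w. (B t w)^2) \<le> ennreal T"
proof (cases "t = 0")
 case True
 have "EE (\<lambda>w. (B t w)^2) = (\<integral>\<^sup>+w. 0 \<partial>M)"
  by (intro nn_integral_cong) (simp add: B_0 True)
 then show ?thesis by simp
next
 case False
 then have t: "0 < t" "t \<le> T" using assms by auto
 have "EE (\<lambda>w. (B t w)^2) = ennreal (\<integral>v. v^2 \<partial>gauss t)"
  using nn_integral_B[OF t, of "\<lambda>v. ennreal (v^2)"] gauss_moments(1)[OF t(1), of 2]
  by (simp add: nn_integral_eq_integral)
 then show ?thesis using gauss_moments(2)[OF t(1)] t by simp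
qed

lemma integral_abs_increment:
 assumes "0 \<le> s" "s < t" "t \<le> T"
 shows "EE (\<lambda>w. \<bar>B t w - B s w\<bar>) \<le> ennreal (sqrt (t - s))"
proof -
 define r where "r = sqrt (t - s)"
 have r: "r > 0" "r^2 = t - s" using assms by (auto simp: r_def)
 have g: "t - s > 0" using assms by simp
 have "(\<integral>\<^sup>+w. 1 * ennreal \<bar>B t w - B s w\<bar> \<partial>M) = (\<integral>\<^sup>+w. 1 * (\<integral>\<^sup>+v. ennreal \<bar>v\<bar> \<partial>gauss (t - s)) \<partial>M)"
  by (intro nn_integral_increment[OF assms, where N = borel and b = "\<lambda>_. 0 :: real" and \<psi> = "\<lambda>_ v. ennreal \<bar>v\<bar>"]) auto
 also have "\<dots> = (\<integral>\<^sup>+v. ennreal \<bar>v\<bar> \<partial>gauss (t - s))" by (simp add: emeasure_space_1)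
 also have "\<dots> \<le> (\<integral>\<^sup>+v. ennreal (r / 2 + 1 / (2 * r) * v^2) \<partial>gauss (t - s))"
 proof (intro nn_integral_mono ennreal_leI)
  fix v :: real
  have "2 * r * \<bar>v\<bar> \<le> r^2 + \<bar>v\<bar>^2" by (rule sum_squares_bound)
  then show "\<bar>v\<bar> \<le> r / 2 + 1 / (2 * r) * v^2" using r(1) by (simp add: field_simps power2_eq_square)
 qed
 also have "\<dots> = ennreal (\<integral>v. r / 2 + 1 / (2 * r) * v^2 \<partial>gauss (t - s))"
 proof (rule nn_integral_eq_integral)
  interpret g: prob_space "gauss (t - s)" by (rule prob_space_gauss[OF g])
  show "integrable (gauss (t - s)) (\<lambda>v. r / 2 + 1 / (2 * r) * v^2)"
   using gauss_moments(1)[OF g, of 2] by simp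
  show "AE v in gauss (t - s). 0 \<le> r / 2 + 1 / (2 * r) * v^2"
   using r(1) by (intro AE_I2 add_nonneg_nonneg mult_nonneg_nonneg) auto
 qed
 also have "(\<integral>v. r / 2 + 1 / (2 * r) * v^2 \<partial>gauss (t - s)) = r / 2 + 1 / (2 * r) * r^2"
 proof -
  interpret g: prob_space "gauss (t - s)" by (rule prob_space_gauss[OF g])
  show ?thesis using gauss_moments(1,2)[OF g] r(2) g.prob_space by simp
 qed
 also have "\<dots> = r" using r(1) by (simp add: power2_eq_square)
 finally show ?thesis by (simp add: r_def)
qed

lemma measurable_speed_bound [measurable]: "(\<lambda>w. speed_bound a w t) \<in> borel_measurable M"
proof -
 note [measurable] = jointly_measurable_continuous[OF B_measurable B_continuous]
 show ?thesis unfolding speed_bound_def set_lebesgue_integral_def by measurable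
qed

lemma speed_bound_nonneg: "a \<ge> 0 \<Longrightarrow> 0 \<le> speed_bound a w t"
 unfolding speed_bound_def
 by (intro mult_nonneg_nonneg add_nonneg_nonneg) (auto simp: set_lebesgue_integral_def)

lemma speed_bound_mono: "a \<le> a' \<Longrightarrow> speed_bound a w t \<le> speed_bound a' w t"
 unfolding speed_bound_def
 by (intro mult_right_mono add_nonneg_nonneg) (auto simp: set_lebesgue_integral_def)

lemma speed_bound_second_moment:
 assumes t: "0 \<le> t" "t \<le> T"
 shows "EE (\<lambda>w. (speed_bound a w t)^2) \<le> ennreal (3 * a^2 * (1 + T + T ^ 3))"
proof -
 note [measurable] = jointly_measurable_continuous[OF B_measurable B_continuous]
 let ?B2 = "\<lambda>w. LINT r:{0..T}|lborel. (B r w)^2"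
 have cB: "continuous_on S (\<lambda>s. B s w)" if "w \<in> space M" for S w
  by (rule continuous_on_subset[OF B_continuous[OF that]]) simp
 have B2: "EE (\<lambda>w. ?B2 w) \<le> ennreal (T * T)"
  using EE_interval_integral_le[of "\<lambda>r w. (B r w)^2" 0 T T] integral_square_B B_continuous T_pos by (simp add: continuous_on_power)
 have "EE (\<lambda>w. (speed_bound a w t)^2)
  \<le> (\<integral>\<^sup>+w. ennreal (3 * a^2) * (1 + ennreal ((B t w)^2) + ennreal T * ennreal (?B2 w)) \<partial>M)"
 proof (rule nn_integral_mono)
  fix w assume w: "w \<in> space M"
  have "(speed_bound a w t)^2 \<le> 3 * a^2 * (1 + (B t w)^2 + T * ?B2 w)" by (rule speed_bound_square[OF w])
  then have "ennreal ((speed_bound a w t)^2) \<le> ennreal (3 * a^2 * (1 + (B t w)^2 + T * ?B2 w))" by (rule ennreal_leI)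
  also have "\<dots> = ennreal (3 * a^2) * (1 + ennreal ((B t w)^2) + ennreal T * ennreal (?B2 w))"
  proof -
   have "0 \<le> ?B2 w" by (simp add: set_lebesgue_integral_def)
   then show ?thesis using T_pos by (simp add: ennreal_mult ennreal_plus)
  qed
  finally show "ennreal ((speed_bound a w t)^2) \<le> \<dots>" .
 qed
 also have "\<dots> = ennreal (3 * a^2) * (1 + EE (\<lambda>w. (B t w)^2) + ennreal T * EE (\<lambda>w. ?B2 w))"
  unfolding set_lebesgue_integral_def
  by (simp add: nn_integral_cmult nn_integral_add emeasure_space_1)
 also have "\<dots> \<le> ennreal (3 * a^2) * (1 + ennreal T + ennreal T * ennreal (T * T))"
  by (intro mult_left_mono add_mono integral_square_B t B2 order_refl) auto
 also have "\<dots> = ennreal (3 * a^2 * (1 + T + T ^ 3))"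
  using T_pos by (simp add: ennreal_mult ennreal_plus power3_eq_cube mult.assoc)
 finally show ?thesis .
qed

text \<open>The mean of \<open>speed_bound a\<close> is at most \<open>a * mean_speed\<close>, by way of \<open>r \<le> 1 + r\<^sup>2\<close>.\<close>

definition mean_speed :: real where
 "mean_speed = 1 + 3 * (1 + T + T ^ 3)"

lemma speed_bound_first_moment:
 assumes t: "0 \<le> t" "t \<le> T" and a: "a \<ge> 0"
 shows "EE (\<lambda>w. speed_bound a w t) \<le> ennreal (a * mean_speed)"
proof -
 have "EE (\<lambda>w. speed_bound a w t) \<le> (\<integral>\<^sup>+w. ennreal a * (1 + ennreal ((speed_bound 1 w t)^2)) \<partial>M)"
 proof (rule nn_integral_mono)
  fix w
  have "0 \<le> (speed_bound 1 w t - 1 / 2)^2" by simp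
  then have "speed_bound 1 w t \<le> 1 + (speed_bound 1 w t)^2" by (simp add: power2_eq_square algebra_simps)
  then have "speed_bound a w t \<le> a * (1 + (speed_bound 1 w t)^2)" using a by (simp add: speed_bound_def mult_left_mono)
  from ennreal_leI[OF this] show "ennreal (speed_bound a w t) \<le> ennreal a * (1 + ennreal ((speed_bound 1 w t)^2))"
   using a by (simp add: ennreal_mult ennreal_plus)
 qed
 also have "\<dots> = ennreal a * (1 + EE (\<lambda>w. (speed_bound 1 w t)^2))"
  by (simp add: nn_integral_cmult nn_integral_add emeasure_space_1)
 also have "\<dots> \<le> ennreal a * (1 + ennreal (3 * 1^2 * (1 + T + T ^ 3)))"
  by (intro mult_left_mono add_mono speed_bound_second_moment t) auto
 also have "1 + ennreal (3 * 1^2 * (1 + T + T ^ 3)) = ennreal mean_speed"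
  unfolding mean_speed_def ennreal_1[symmetric] using T_pos by (subst ennreal_plus[symmetric]) auto
 also have "ennreal a * ennreal mean_speed = ennreal (a * mean_speed)" using a by (rule ennreal_mult'[symmetric])
 finally show ?thesis .
qed

end

locale mean_field = adapted_BM +
 fixes b bh bt :: "real \<Rightarrow> real \<Rightarrow> real measure \<Rightarrow> real" and K C :: real
 assumes b_split: "\<And>t y \<mu>. t \<in> {0..T} \<Longrightarrow> \<mu> \<in> P1 \<Longrightarrow> b t y \<mu> = bh t y \<mu> + bt t y \<mu>"
  and bh_measurable: "(\<lambda>(t, y, \<mu>). bh t y \<mu>) \<in> borel_measurable (drift_space T)"
  and bh_bounded: "\<And>t y \<mu>. t \<in> {0..T} \<Longrightarrow> \<mu> \<in> P1 \<Longrightarrow> \<bar>bh t y \<mu>\<bar> \<le> K"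
  and C_pos: "C > 0"
  and bt_growth: "\<And>t y \<mu>. t \<in> {0..T} \<Longrightarrow> \<mu> \<in> P1 \<Longrightarrow> \<bar>bt t y \<mu>\<bar> \<le> C * (1 + \<bar>y\<bar> + kantorovich \<mu> (return borel 0))"
  and bt_lipschitz: "\<And>t y1 y2 \<mu>. t \<in> {0..T} \<Longrightarrow> \<mu> \<in> P1 \<Longrightarrow> \<bar>bt t y1 \<mu> - bt t y2 \<mu>\<bar> \<le> C * \<bar>y1 - y2\<bar>"
  and b_lipschitz_law: "\<And>t y \<mu> \<nu>. t \<in> {0..T} \<Longrightarrow> \<mu> \<in> P1 \<Longrightarrow> \<nu> \<in> P1 \<Longrightarrow> \<bar>b t y \<mu> - b t y \<nu>\<bar> \<le> C * kantorovich \<mu> \<nu>"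
begin

abbreviation law :: "(real \<Rightarrow> 'a \<Rightarrow> real) \<Rightarrow> real \<Rightarrow> real measure" where
 "law X t \<equiv> distr M borel (X t)"

text \<open>Continuity and the starting value hold for every outcome, the equation almost surely.\<close>

definition solution :: "real \<Rightarrow> (real \<Rightarrow> 'a \<Rightarrow> real) \<Rightarrow> bool" where
 "solution x X \<longleftrightarrow>
   (\<forall>t\<in>{0..T}. X t \<in> borel_measurable (F t)) \<and> (\<forall>t. X t \<in> borel_measurable M) \<and>
   (\<forall>w\<in>space M. continuous_on UNIV (\<lambda>t. X t w)) \<and> (\<forall>w\<in>space M. X 0 w = x) \<and>
   (\<forall>t\<in>{0..T}. law X t \<in> P1) \<and>
   (AE w in M. set_integrable lborel {0..T} (\<lambda>s. b s (X s w) (law X s)) \<and>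
    (\<forall>t\<in>{0..T}. X t w = x + (LINT s:{0..t}|lborel. b s (X s w) (law X s)) + B t w))"

lemma solutionD:
 assumes "solution x X"
 shows "\<And>t. X t \<in> borel_measurable M" "\<And>w. w \<in> space M \<Longrightarrow> continuous_on UNIV (\<lambda>t. X t w)"
  "\<And>t. t \<in> {0..T} \<Longrightarrow> law X t \<in> P1" "\<And>t. t \<in> {0..T} \<Longrightarrow> integrable M (X t)"
  "AE w in M. set_integrable lborel {0..T} (\<lambda>s. b s (X s w) (law X s)) \<and>
    (\<forall>t\<in>{0..T}. X t w = x + (LINT s:{0..t}|lborel. b s (X s w) (law X s)) + B t w)"
 using assms by (auto simp: solution_def distr_in_P1_iff)

lemma K_nonneg: "0 \<le> K"
 using bh_bounded[OF _ return_in_P1, of 0 0] T_pos by (auto intro: order_trans[OF abs_ge_zero])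

lemma b_space_increment:
 assumes "t \<in> {0..T}" "\<mu> \<in> P1"
 shows "\<bar>b t y1 \<mu> - b t y2 \<mu>\<bar> \<le> 2 * K + C * \<bar>y1 - y2\<bar>"
 using bt_lipschitz[OF assms, of y1 y2] bh_bounded[OF assms, of y1] bh_bounded[OF assms, of y2] b_split[OF assms]
 by simp

lemma b_growth:
 assumes X: "solution x X" and t: "t \<in> {0..T}"
 shows "\<bar>b t y (law X t)\<bar> \<le> K + C * (1 + \<bar>y\<bar> + (\<integral>w. \<bar>X t w\<bar> \<partial>M))"
proof -
 note P = solutionD(3)[OF X t] and [measurable] = solutionD(1)[OF X]
 have r: "distr M borel (\<lambda>_. 0) = return borel (0::real)" by (simp add: distr_const)
 have "kantorovich (law X t) (return borel 0) \<le> (\<integral>w. \<bar>X t w - 0\<bar> \<partial>M)"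
  by (rule kantorovich_distr_le[of "X t" "\<lambda>_. 0", unfolded r]) (simp_all add: P return_in_P1)
 then have "C * (1 + \<bar>y\<bar> + kantorovich (law X t) (return borel 0)) \<le> C * (1 + \<bar>y\<bar> + (\<integral>w. \<bar>X t w\<bar> \<partial>M))"
  using C_pos by (intro mult_left_mono add_left_mono) auto
 then show ?thesis using bt_growth[OF t P, of y] bh_bounded[OF t P, of y] b_split[OF t P, of y] by linarith
qed

text \<open>The factor in \<open>linear_growth_bound\<close>.\<close>

abbreviation growth :: "real \<Rightarrow> real" where
 "growth A \<equiv> 1 + A + C * exp (C * T) * (1 + A * T)"

lemma solution_growth_of_drift_bound:
 assumes X: "solution x X" and q: "set_integrable lborel {0..T} q" and q0: "\<And>s. s \<in> {0..T} \<Longrightarrow> 0 \<le> q s"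
  and bound: "\<And>s w. s \<in> {0..T} \<Longrightarrow> \<bar>b s (X s w) (law X s)\<bar> \<le> q s + C * \<bar>X s w\<bar>"
  and A: "\<bar>x\<bar> + (LINT s:{0..t}|lborel. q s) \<le> A" and t: "t \<in> {0..T}"
 shows "AE w in M. \<forall>s\<in>{0..t}. \<bar>X s w\<bar> \<le> speed_bound (growth A) w s"
 using solutionD(5)[OF X] AE_space
proof eventually_elim
 case (elim w)
 show ?case
 proof
  fix s assume s: "s \<in> {0..t}"
  have "(LINT r:{0..s}|lborel. q r) \<le> (LINT r:{0..t}|lborel. q r)"
   using s t by (intro set_integral_mono_interval[OF q q0]) auto
  then have A': "\<bar>x\<bar> + (LINT r:{0..s}|lborel. q r) \<le> A" using A by linarith
  have c: "continuous_on {0..T} (\<lambda>t. X t w)" "continuous_on {0..T} (\<lambda>t. B t w)"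
   using continuous_on_subset[OF solutionD(2)[OF X elim(2)]] continuous_on_subset[OF B_continuous[OF elim(2)]] by auto
  show "\<bar>X s w\<bar> \<le> speed_bound (growth A) w s"
   unfolding speed_bound_def
   by (rule linear_growth_bound[OF less_imp_le[OF T_pos] less_imp_le[OF C_pos] c conjunct1[OF elim(1)] q bound q0
      bspec[OF conjunct2[OF elim(1)]] A']) (use s t in auto)
 qed
qed

text \<open>The first moments of the laws enter the drift, so they cannot be bounded by a direct Gronwall argument before they are known to
 be locally bounded. The drift along any path differs from the drift along one fixed path by a
 quantity that does not involve these moments.\<close>

lemma solution_growth:
 assumes X: "solution x X"
 obtains a where "a \<ge> 0" "AE w in M. \<forall>t\<in>{0..T}. \<bar>X t w\<bar> \<le> speed_bound a w t"
proof -
 let ?\<beta> = "\<lambda>w s. b s (X s w) (law X s)"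
 have "\<exists>w. w \<in> space M \<and> set_integrable lborel {0..T} (?\<beta> w)"
 proof (rule ccontr)
  assume none: "\<nexists>w. w \<in> space M \<and> set_integrable lborel {0..T} (?\<beta> w)"
  have "AE w in M. False"
   using solutionD(5)[OF X] AE_space by eventually_elim (use none in blast)
  then show False by (simp only: AE_False)
 qed
 then obtain w0 where w0: "w0 \<in> space M" "set_integrable lborel {0..T} (?\<beta> w0)" by blast
 \<comment> \<open>The law enters only through the drift along the reference path \<open>w0\<close>.\<close>
 define q where "q s = \<bar>?\<beta> w0 s\<bar> + (2 * K + C * \<bar>X s w0\<bar>)" for s
 have q: "set_integrable lborel {0..T} q"
  unfolding q_def
  by (intro set_integral_add(1) set_integrable_abs w0(2) set_integral_continuous(1)
    continuous_intros continuous_on_subset[OF solutionD(2)[OF X w0(1)]]) simp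
 have q0: "q s \<ge> 0" for s using K_nonneg C_pos by (simp add: q_def)
 have bound: "\<bar>?\<beta> w s\<bar> \<le> q s + C * \<bar>X s w\<bar>" if "s \<in> {0..T}" for s w
 proof -
  have "C * \<bar>X s w - X s w0\<bar> \<le> C * (\<bar>X s w\<bar> + \<bar>X s w0\<bar>)" using C_pos by (intro mult_left_mono) auto
  then show ?thesis
   using b_space_increment[OF that solutionD(3)[OF X that], of "X s w" "X s w0"]
   by (simp add: q_def distrib_left)
 qed
 define A where "A = \<bar>x\<bar> + (LINT s:{0..T}|lborel. q s)"
 have A0: "A \<ge> 0" using q0 by (simp add: A_def set_lebesgue_integral_def)
 have "AE w in M. \<forall>t\<in>{0..T}. \<bar>X t w\<bar> \<le> speed_bound (growth A) w t"
  using T_pos by (intro solution_growth_of_drift_bound[OF X q q0 bound]) (auto simp: A_def)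
 with A0 C_pos T_pos show ?thesis by (intro that) auto
qed

lemma drift_growth:
 assumes X: "solution x X"
  and m: "\<And>t. t \<in> {0..T} \<Longrightarrow> (\<integral>w. \<bar>X t w\<bar> \<partial>M) \<le> m"
  and A: "\<bar>x\<bar> + (K + C * (1 + m)) * T \<le> A"
 shows "AE w in M. \<forall>t\<in>{0..T}. \<bar>X t w\<bar> \<le> speed_bound (growth A) w t \<and>
  \<bar>b t (X t w) (law X t)\<bar> \<le> speed_bound (K + C * (1 + m) + C * growth A) w t"
proof -
 have "0 \<le> (\<integral>w. \<bar>X 0 w\<bar> \<partial>M)" by simp
 from order_trans[OF this m[of 0]] T_pos have m0: "m \<ge> 0" by simp
 define k where "k = K + C * (1 + m)"
 have k0: "k \<ge> 0" using K_nonneg C_pos m0 by (simp add: k_def)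
 have bound: "\<bar>b s (X s w) (law X s)\<bar> \<le> k + C * \<bar>X s w\<bar>" if s: "s \<in> {0..T}" for s w
 proof -
  have "C * (\<integral>w. \<bar>X s w\<bar> \<partial>M) \<le> C * m" using m[OF s] C_pos by (intro mult_left_mono) auto
  then show ?thesis using b_growth[OF X s, of "X s w"] unfolding k_def by (simp only: distrib_left)
 qed
 have "AE w in M. \<forall>t\<in>{0..T}. \<bar>X t w\<bar> \<le> speed_bound (growth A) w t"
  using T_pos A k0 bound
  by (intro solution_growth_of_drift_bound[OF X, of "\<lambda>_. k"] set_integral_continuous(1))
    (auto simp: set_integral_const k_def mult.commute)
 then show ?thesis
 proof eventually_elim
  case (elim w)
  have "\<bar>b t (X t w) (law X t)\<bar> \<le> speed_bound (k + C * growth A) w t" if t: "t \<in> {0..T}" for t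
  proof -
   have "k * 1 \<le> k * (1 + \<bar>B t w\<bar> + (LINT r:{0..T}|lborel. \<bar>B r w\<bar>))"
    using k0 by (intro mult_left_mono) (auto simp: set_lebesgue_integral_def)
   moreover have "C * \<bar>X t w\<bar> \<le> C * speed_bound (growth A) w t" using elim t C_pos by (intro mult_left_mono) auto
   ultimately show ?thesis using bound[OF t, of w] unfolding speed_bound_def
    by (simp only: distrib_right mult.assoc mult_1_right)
  qed
  then show ?case using elim by (simp add: k_def)
 qed
qed

end

section \<open>Time regularity and uniform growth of solutions\<close>

lemma (in prob_space) ennreal_integral_le:
 fixes f g :: "'a \<Rightarrow> real"
 assumes "integrable M f" "AE w in M. \<bar>f w\<bar> \<le> g w" "EE g \<le> ennreal c" "0 \<le> c"
 shows "(\<integral>w. \<bar>f w\<bar> \<partial>M) \<le> c"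
proof -
 have "ennreal (\<integral>w. \<bar>f w\<bar> \<partial>M) = EE (\<lambda>w. \<bar>f w\<bar>)"
  using assms(1) by (intro nn_integral_eq_integral[symmetric]) auto
 also have "\<dots> \<le> EE g"
  using assms(2) by (intro nn_integral_mono_AE) (auto elim!: eventually_mono intro: ennreal_leI)
 also have "\<dots> \<le> ennreal c" by (rule assms(3))
 finally show ?thesis using assms(4) by simp
qed

context mean_field
begin

lemma path_increment:
 assumes X: "solution x X" and st: "0 \<le> s" "s \<le> t" "t \<le> T"
  and eq: "set_integrable lborel {0..T} (\<lambda>s. b s (X s w) (law X s))"
   "\<And>t. t \<in> {0..T} \<Longrightarrow> X t w = x + (LINT s:{0..t}|lborel. b s (X s w) (law X s)) + B t w"
  and w: "w \<in> space M" and bd: "\<And>t. t \<in> {0..T} \<Longrightarrow> \<bar>b t (X t w) (law X t)\<bar> \<le> speed_bound a w t"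
 shows "\<bar>(X t w - B t w) - (X s w - B s w)\<bar> \<le> (LINT u:{s..t}|lborel. speed_bound a w u)"
proof -
 let ?\<beta> = "\<lambda>s. b s (X s w) (law X s)"
 have i: "set_integrable lborel {p..r} ?\<beta>" if "0 \<le> p" "r \<le> T" for p r
  by (rule set_integrable_subset[OF eq(1)]) (use that in auto)
 have i': "set_integrable lborel {p..<r} ?\<beta>" if "0 \<le> p" "r \<le> T" for p r
  by (rule set_integrable_subset[OF eq(1)]) (use that in auto)
 have "(LINT r:{0..<t}|lborel. ?\<beta> r) = (LINT r:{0..<s} \<union> {s..<t}|lborel. ?\<beta> r)"
  using st by (simp add: ivl_disj_un)
 also have "\<dots> = (LINT r:{0..<s}|lborel. ?\<beta> r) + (LINT r:{s..<t}|lborel. ?\<beta> r)"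
  using st by (intro set_integral_Un i') auto
 finally have "(X t w - B t w) - (X s w - B s w) = (LINT r:{s..t}|lborel. ?\<beta> r)"
  using eq(2)[of s] eq(2)[of t] st by (simp add: set_integral_half_open)
 also have "\<bar>\<dots>\<bar> \<le> (LINT r:{s..t}|lborel. \<bar>?\<beta> r\<bar>)"
  using set_integral_norm_bound[OF i[OF st(1,3)]] by simp
 also have "\<dots> \<le> (LINT u:{s..t}|lborel. speed_bound a w u)"
  using bd st by (intro set_integral_mono set_integrable_abs i set_integral_continuous(1)
    continuous_on_subset[OF continuous_speed_bound[OF w]]) auto
 finally show ?thesis .
qed

lemma nn_integral_speed_bound_time:
 assumes st: "0 \<le> s" "s \<le> t" "t \<le> T" and a: "a \<ge> 0"
 shows "EE (\<lambda>w. LINT u:{s..t}|lborel. speed_bound a w u)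
  \<le> ennreal (a * mean_speed * (t - s))"
 using st a T_pos speed_bound_first_moment[of _ a]
 by (intro EE_interval_integral_le continuous_speed_bound speed_bound_nonneg measurable_speed_bound) (auto simp: mean_speed_def)

text \<open>The increment of the drift part is of order \<open>t - s\<close>, that of the motion of order \<open>sqrt (t - s)\<close>.\<close>

lemma solution_Hoelder:
 assumes X: "solution x X"
 obtains c where "c \<ge> 0" "\<And>s t. s \<in> {0..T} \<Longrightarrow> t \<in> {0..T} \<Longrightarrow> (\<integral>w. \<bar>X t w - X s w\<bar> \<partial>M) \<le> c * sqrt \<bar>t - s\<bar>"
proof -
 obtain a where a: "a \<ge> 0" "AE w in M. \<forall>t\<in>{0..T}. \<bar>X t w\<bar> \<le> speed_bound a w t"
  using solution_growth[OF X] .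
 have ms: "mean_speed \<ge> 0" using T_pos by (simp add: mean_speed_def)
 define m where "m = a * mean_speed"
 have m: "(\<integral>w. \<bar>X t w\<bar> \<partial>M) \<le> m" if t: "t \<in> {0..T}" for t
 proof (rule ennreal_integral_le)
  show "AE w in M. \<bar>X t w\<bar> \<le> speed_bound a w t" using a(2) by eventually_elim (use t in auto)
 qed (use solutionD(4)[OF X] t speed_bound_first_moment[of t a] a ms in \<open>auto simp: m_def\<close>)
 define A where "A = \<bar>x\<bar> + (K + C * (1 + m)) * T"
 define a' where "a' = K + C * (1 + m) + C * growth A"
 have m0: "m \<ge> 0" using a(1) ms by (simp add: m_def)
 have A0: "A \<ge> 0" using K_nonneg C_pos T_pos m0 by (simp add: A_def)
 have a'0: "a' \<ge> 0" using K_nonneg C_pos T_pos m0 A0 by (simp add: a'_def)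
 have bd: "AE w in M. \<forall>t\<in>{0..T}. \<bar>b t (X t w) (law X t)\<bar> \<le> speed_bound a' w t"
 proof -
  have "AE w in M. \<forall>t\<in>{0..T}. \<bar>X t w\<bar> \<le> speed_bound (growth A) w t \<and> \<bar>b t (X t w) (law X t)\<bar> \<le> speed_bound a' w t"
   unfolding a'_def by (rule drift_growth[OF X m]) (auto simp: A_def)
  then show ?thesis by eventually_elim auto
 qed
 define c where "c = a' * mean_speed * sqrt T + 1"
 have c0: "c \<ge> 0" using a'0 ms T_pos by (simp add: c_def)
 have le: "(\<integral>w. \<bar>X t w - X s w\<bar> \<partial>M) \<le> c * sqrt (t - s)" if st: "0 \<le> s" "s < t" "t \<le> T" for s t
 proof (rule ennreal_integral_le)
  let ?I = "\<lambda>w. LINT u:{s..t}|lborel. speed_bound a' w u"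
  have st': "s \<in> {0..T}" "t \<in> {0..T}" using st by auto
  show "integrable M (\<lambda>w. X t w - X s w)" using solutionD(4)[OF X] st' by auto
  show "AE w in M. \<bar>X t w - X s w\<bar> \<le> ?I w + \<bar>B t w - B s w\<bar>"
   using solutionD(5)[OF X] bd AE_space
  proof eventually_elim
   case (elim w)
   have "\<bar>(X t w - B t w) - (X s w - B s w)\<bar> \<le> ?I w"
    using elim st by (intro path_increment[OF X]) auto
   then show ?case by linarith
  qed
  have "EE (\<lambda>w. ?I w + \<bar>B t w - B s w\<bar>) = (\<integral>\<^sup>+w. ennreal (?I w) + ennreal \<bar>B t w - B s w\<bar> \<partial>M)"
   using speed_bound_nonneg[OF a'0]
   by (intro nn_integral_cong ennreal_plus) (auto simp: set_lebesgue_integral_def intro!: Bochner_Integration.integral_nonneg)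
  also have "\<dots> = EE ?I + EE (\<lambda>w. \<bar>B t w - B s w\<bar>)"
  proof -
   note [measurable] = jointly_measurable_continuous[OF measurable_speed_bound continuous_speed_bound]
   show ?thesis unfolding set_lebesgue_integral_def by (rule nn_integral_add) measurable
  qed
  also have "\<dots> \<le> ennreal (a' * mean_speed * (t - s)) + ennreal (sqrt (t - s))"
   using st a'0 by (intro add_mono nn_integral_speed_bound_time integral_abs_increment) auto
  also have "\<dots> = ennreal (a' * mean_speed * (t - s) + sqrt (t - s))"
   using st a'0 ms by (intro ennreal_plus[symmetric]) auto
  also have "\<dots> \<le> ennreal (c * sqrt (t - s))"
  proof (rule ennreal_leI)
   have "t - s = sqrt (t - s) * sqrt (t - s)" using st by simp
   also have "\<dots> \<le> sqrt T * sqrt (t - s)" using st by (intro mult_right_mono) auto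
   finally have "a' * mean_speed * (t - s) \<le> a' * mean_speed * (sqrt T * sqrt (t - s))"
    using a'0 ms by (intro mult_left_mono) auto
   then show "a' * mean_speed * (t - s) + sqrt (t - s) \<le> c * sqrt (t - s)" by (simp add: c_def distrib_right mult.assoc)
  qed
  finally show "EE (\<lambda>w. ?I w + \<bar>B t w - B s w\<bar>) \<le> ennreal (c * sqrt (t - s))" .
  show "0 \<le> c * sqrt (t - s)" using c0 st by simp
 qed
 show ?thesis
 proof (rule that[OF c0])
  show "(\<integral>w. \<bar>X t w - X s w\<bar> \<partial>M) \<le> c * sqrt \<bar>t - s\<bar>" if "s \<in> {0..T}" "t \<in> {0..T}" for s t
   using le[of s t] le[of t s] that by (cases s t rule: linorder_cases) (auto simp: abs_minus_commute)
 qed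
qed

definition mean_distance :: "(real \<Rightarrow> 'a \<Rightarrow> real) \<Rightarrow> (real \<Rightarrow> 'a \<Rightarrow> real) \<Rightarrow> real \<Rightarrow> real" where
 "mean_distance X Y s = (\<integral>w. \<bar>X s w - Y s w\<bar> \<partial>M)"

lemma mean_distance_nonneg: "0 \<le> mean_distance X Y s"
 by (simp add: mean_distance_def)

lemma continuous_mean_distance:
 assumes i: "\<And>t. t \<in> {0..T} \<Longrightarrow> integrable M (X t)" "\<And>t. t \<in> {0..T} \<Longrightarrow> integrable M (Y t)"
  and X: "\<And>s t. s \<in> {0..T} \<Longrightarrow> t \<in> {0..T} \<Longrightarrow> (\<integral>w. \<bar>X t w - X s w\<bar> \<partial>M) \<le> c * sqrt \<bar>t - s\<bar>"
  and Y: "\<And>s t. s \<in> {0..T} \<Longrightarrow> t \<in> {0..T} \<Longrightarrow> (\<integral>w. \<bar>Y t w - Y s w\<bar> \<partial>M) \<le> d * sqrt \<bar>t - s\<bar>"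
 shows "continuous_on {0..T} (mean_distance X Y)"
 unfolding continuous_on_def
proof
 fix t assume t: "t \<in> {0..T}"
 show "(mean_distance X Y \<longlongrightarrow> mean_distance X Y t) (at t within {0..T})"
 proof (rule LIM_zero_cancel, rule Lim_null_comparison)
  have "((\<lambda>s. (c + d) * sqrt \<bar>t - s\<bar>) \<longlongrightarrow> (c + d) * sqrt \<bar>t - t\<bar>) (at t within {0..T})" by (intro tendsto_intros)
  then show "((\<lambda>s. (c + d) * sqrt \<bar>t - s\<bar>) \<longlongrightarrow> 0) (at t within {0..T})" by simp
  have "\<bar>mean_distance X Y s - mean_distance X Y t\<bar> \<le> (c + d) * sqrt \<bar>t - s\<bar>" if s: "s \<in> {0..T}" for s
  proof -
   note i' = i(1)[OF s] i(1)[OF t] i(2)[OF s] i(2)[OF t]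
   have "mean_distance X Y s - mean_distance X Y t = (\<integral>w. \<bar>X s w - Y s w\<bar> - \<bar>X t w - Y t w\<bar> \<partial>M)"
    unfolding mean_distance_def using i' by simp
   also have "\<bar>\<dots>\<bar> \<le> (\<integral>w. \<bar>\<bar>X s w - Y s w\<bar> - \<bar>X t w - Y t w\<bar>\<bar> \<partial>M)" by (rule integral_abs_bound)
   also have "\<dots> \<le> (\<integral>w. \<bar>X t w - X s w\<bar> + \<bar>Y t w - Y s w\<bar> \<partial>M)" using i' by (intro integral_mono) auto
   also have "\<dots> = (\<integral>w. \<bar>X t w - X s w\<bar> \<partial>M) + (\<integral>w. \<bar>Y t w - Y s w\<bar> \<partial>M)" using i' by simp
   also have "\<dots> \<le> (c + d) * sqrt \<bar>t - s\<bar>" using X[OF s t] Y[OF s t] by (simp add: distrib_right)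
   finally show ?thesis .
  qed
  then show "\<forall>\<^sub>F s in at t within {0..T}. norm (mean_distance X Y s - mean_distance X Y t) \<le> (c + d) * sqrt \<bar>t - s\<bar>"
   by (auto simp: eventually_at_filter)
 qed
qed

text \<open>Along a solution the law is a continuous function of time in the Kantorovich metric, by \<open>kantorovich_distr_le\<close>.\<close>

lemma law_measurable:
 assumes X: "solution x X"
 shows "law X \<in> restrict_space borel {0..T} \<rightarrow>\<^sub>M P1_borel"
proof -
 obtain c where c: "c \<ge> 0" "\<And>s t. s \<in> {0..T} \<Longrightarrow> t \<in> {0..T} \<Longrightarrow> (\<integral>w. \<bar>X t w - X s w\<bar> \<partial>M) \<le> c * sqrt \<bar>t - s\<bar>"
  by (rule solution_Hoelder[OF X]) (rule that)
 interpret P1: Metric_space P1 kantorovich by (rule Metric_space_P1)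
 show ?thesis unfolding P1_borel_def
 proof (rule measurable_measure_of)
  show "{G. openin P1.mtopology G} \<subseteq> Pow P1" using openin_subset by fastforce
  show "law X \<in> space (restrict_space borel {0..T}) \<rightarrow> P1"
   using solutionD(3)[OF X] by (auto simp: space_restrict_space)
  fix G assume "G \<in> {G. openin P1.mtopology G}"
  then have G: "openin P1.mtopology G" by simp
  let ?S = "{t\<in>{0..T}. law X t \<in> G}"
  have "openin (top_of_set {0..T}) ?S"
   unfolding openin_euclidean_subtopology_iff
  proof (intro conjI ballI)
   fix t assume "t \<in> ?S"
   then have t: "t \<in> {0..T}" "law X t \<in> G" by auto
   obtain r where r: "r > 0" "P1.mball (law X t) r \<subseteq> G"
    using G t(2) unfolding P1.openin_mtopology by blast
   have "s \<in> ?S" if s: "s \<in> {0..T}" "dist s t < (r / (c + 1))\<^sup>2" for s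
   proof -
    have "kantorovich (law X t) (law X s) \<le> (\<integral>w. \<bar>X t w - X s w\<bar> \<partial>M)"
     using s t solutionD[OF X] by (intro kantorovich_distr_le) auto
    also have "\<dots> \<le> c * sqrt \<bar>t - s\<bar>" by (rule c(2)[OF s(1) t(1)])
    also have "\<dots> \<le> c * (r / (c + 1))"
     using s(2) c(1) r(1) by (intro mult_left_mono real_le_lsqrt) (auto simp: dist_real_def abs_minus_commute)
    also have "\<dots> < r" using c(1) r(1) by (simp add: field_simps)
    finally have "law X s \<in> P1.mball (law X t) r"
     using solutionD(3)[OF X] s t by (simp add: P1.in_mball)
    then show ?thesis using r(2) s(1) by auto
   qed
   moreover have "(r / (c + 1))\<^sup>2 > 0" using r(1) c(1) by simp
   ultimately show "\<exists>e>0. \<forall>s\<in>{0..T}. dist s t < e \<longrightarrow> s \<in> ?S" by blast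
  qed auto
  then obtain O' where O': "open O'" "?S = {0..T} \<inter> O'"
   unfolding openin_open by blast
  have "law X -` G \<inter> space (restrict_space borel {0..T}) = ?S"
   by (auto simp: space_restrict_space)
  also have "\<dots> \<in> sets (restrict_space borel {0..T})"
   unfolding O'(2) using O'(1) by (auto simp: sets_restrict_space)
  finally show "law X -` G \<inter> space (restrict_space borel {0..T}) \<in> sets (restrict_space borel {0..T})" .
 qed
qed

lemma bounded_part_measurable:
 assumes X: "solution x X"
 shows "(\<lambda>(s, y). indicator {0..T} s * bh s y (law X s)) \<in> borel_measurable borel"
proof -
 have [measurable]: "law X \<in> restrict_space borel {0..T} \<rightarrow>\<^sub>M P1_borel" by (rule law_measurable[OF X])
 have [measurable]: "(\<lambda>s. max 0 (min T s)) \<in> borel \<rightarrow>\<^sub>M restrict_space borel {0..T}"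
  using T_pos by (intro measurable_restrict_space2) auto
 have "(\<lambda>p. (max 0 (min T (fst p)), snd p, law X (max 0 (min T (fst p))))) \<in> borel \<Otimes>\<^sub>M borel \<rightarrow>\<^sub>M drift_space T"
  unfolding drift_space_def by measurable
 from measurable_compose[OF this bh_measurable]
 have [measurable]: "(\<lambda>p. bh (max 0 (min T (fst p))) (snd p) (law X (max 0 (min T (fst p))))) \<in> borel_measurable (borel \<Otimes>\<^sub>M borel)"
  by simp
 have "(\<lambda>p. indicator {0..T} (fst p) * bh (max 0 (min T (fst p))) (snd p) (law X (max 0 (min T (fst p)))))
  \<in> borel_measurable (borel \<Otimes>\<^sub>M borel)" by measurable
 moreover have "(\<lambda>p. indicator {0..T} (fst p) * bh (max 0 (min T (fst p))) (snd p) (law X (max 0 (min T (fst p)))))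
  = (\<lambda>(s, y). indicator {0..T} s * bh s y (law X s))" by (auto simp: indicator_def fun_eq_iff)
 ultimately show ?thesis by (simp add: borel_prod)
qed

text \<open>Growth bounds that depend on the starting point only through its size.\<close>

lemma uniform_growth:
 obtains a where "a > 0" "\<And>x X. solution x X \<Longrightarrow> \<bar>x\<bar> \<le> R \<Longrightarrow>
  AE w in M. \<forall>t\<in>{0..T}. \<bar>X t w\<bar> \<le> speed_bound a w t \<and> \<bar>b t (X t w) (law X t)\<bar> \<le> speed_bound a w t"
proof -
 define e where "e = C * exp (C * T)"
 \<comment> \<open>\<open>growth\<close> is affine, so a drift bound that contains an integral \<open>I\<close> of first moments leads to \<open>p + r * I\<close>.\<close>
 define p where "p = mean_speed * growth (\<bar>R\<bar> + (K + C) * T)"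
 define r where "r = mean_speed * ((1 + e * T) * C)"
 define m where "m = p * exp (r * T)"
 define A where "A = R + (K + C * (1 + m)) * T"
 define a where "a = \<bar>growth A\<bar> + \<bar>K + C * (1 + m) + C * growth A\<bar> + 1"
 have e: "e \<ge> 0" using C_pos by (simp add: e_def)
 have pr: "p \<ge> 0" "r \<ge> 0" "mean_speed \<ge> 0"
  using e T_pos C_pos K_nonneg by (auto simp: p_def r_def mean_speed_def)
 show ?thesis
 proof (rule that[of a])
  show "a > 0" by (simp add: a_def add_nonneg_pos)
  fix x X assume X: "solution x X" and x: "\<bar>x\<bar> \<le> R"
  obtain c where c: "c \<ge> 0" "\<And>s t. s \<in> {0..T} \<Longrightarrow> t \<in> {0..T} \<Longrightarrow> (\<integral>w. \<bar>X t w - X s w\<bar> \<partial>M) \<le> c * sqrt \<bar>t - s\<bar>"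
   by (rule solution_Hoelder[OF X]) (rule that)
  define \<mu> where "\<mu> t = (\<integral>w. \<bar>X t w\<bar> \<partial>M)" for t
  have "continuous_on {0..T} (mean_distance X (\<lambda>_ _. 0))"
   by (rule continuous_mean_distance[OF solutionD(4)[OF X] _ c(2), where d = 0]) auto
  then have cont: "continuous_on {0..T} \<mu>" by (simp add: mean_distance_def[abs_def] \<mu>_def[abs_def])
  have \<mu>0: "\<mu> t \<ge> 0" for t by (simp add: \<mu>_def)
  have "\<mu> t \<le> p + r * (LINT s:{0..t}|lborel. \<mu> s)" if t: "t \<in> {0..T}" for t
   unfolding \<mu>_def[of t]
  proof (rule ennreal_integral_le)
   show "integrable M (X t)" using solutionD(4)[OF X t] .
   let ?I = "LINT s:{0..t}|lborel. \<mu> s"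
   let ?q = "\<lambda>s. (K + C) + C * \<mu> s" and ?A = "(\<bar>R\<bar> + (K + C) * T) + C * ?I"
   have I0: "0 \<le> ?I" using \<mu>0 by (simp add: set_lebesgue_integral_def)
   have A0: "growth ?A \<ge> 0" using I0 K_nonneg C_pos T_pos by simp
   have iq: "set_integrable lborel {0..T} ?q"
    by (intro set_integral_continuous(1) continuous_intros cont)
   have "AE w in M. \<forall>s\<in>{0..t}. \<bar>X s w\<bar> \<le> speed_bound (growth ?A) w s"
   proof (rule solution_growth_of_drift_bound[OF X iq _ _ _ t])
    show "0 \<le> ?q s" for s using K_nonneg C_pos \<mu>0[of s] by simp
    show "\<bar>b s (X s w) (law X s)\<bar> \<le> ?q s + C * \<bar>X s w\<bar>" if "s \<in> {0..T}" for s w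
     using b_growth[OF X that, of "X s w"] by (simp add: \<mu>_def distrib_left)
    have i: "set_integrable lborel {0..t} (\<lambda>s. K + C)" "set_integrable lborel {0..t} (\<lambda>s. C * \<mu> s)"
     using t by (intro set_integral_continuous(1) continuous_intros continuous_on_subset[OF cont]; auto)+
    have "(K + C) * t \<le> (K + C) * T" using t K_nonneg C_pos by (intro mult_left_mono) auto
    then show "\<bar>x\<bar> + (LINT s:{0..t}|lborel. ?q s) \<le> ?A"
     unfolding set_integral_add(2)[OF i] using x t by (simp add: set_integral_const mult.commute)
   qed
   then show "AE w in M. \<bar>X t w\<bar> \<le> speed_bound (growth ?A) w t" by eventually_elim (use t in auto)
   have "EE (\<lambda>w. speed_bound (growth ?A) w t) \<le> ennreal (growth ?A * mean_speed)"
    using t A0 by (intro speed_bound_first_moment) auto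
   also have "growth ?A * mean_speed = p + r * ?I" by (simp add: p_def r_def e_def algebra_simps)
   finally show "EE (\<lambda>w. speed_bound (growth ?A) w t) \<le> ennreal (p + r * ?I)" .
   show "0 \<le> p + r * ?I" using pr I0 by simp
  qed
  then have "\<mu> t \<le> p * exp (r * t)" if "t \<in> {0..T}" for t
   using that by (intro Gronwall[OF cont pr(2)])
  moreover have "p * exp (r * t) \<le> m" if "t \<in> {0..T}" for t
   unfolding m_def using that pr by (intro mult_left_mono) (auto intro: mult_left_mono)
  ultimately have m: "(\<integral>w. \<bar>X t w\<bar> \<partial>M) \<le> m" if "t \<in> {0..T}" for t
   using that unfolding \<mu>_def[symmetric] by (blast intro: order_trans)
  have le: "growth A \<le> a" "K + C * (1 + m) + C * growth A \<le> a" by (auto simp: a_def)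
  show "AE w in M. \<forall>t\<in>{0..T}. \<bar>X t w\<bar> \<le> speed_bound a w t \<and> \<bar>b t (X t w) (law X t)\<bar> \<le> speed_bound a w t"
  proof -
   have "AE w in M. \<forall>t\<in>{0..T}. \<bar>X t w\<bar> \<le> speed_bound (growth A) w t \<and>
     \<bar>b t (X t w) (law X t)\<bar> \<le> speed_bound (K + C * (1 + m) + C * growth A) w t"
    using x by (intro drift_growth[OF X m]) (auto simp: A_def)
   then show ?thesis
    by eventually_elim (use speed_bound_mono[OF le(1)] speed_bound_mono[OF le(2)] in \<open>blast intro: order_trans\<close>)
  qed
 qed
qed

end

section \<open>Linearisation of the bounded part of the drift\<close>

lemma
 fixes f :: "real \<Rightarrow> real \<Rightarrow> real"
 assumes f: "continuous_on UNIV (\<lambda>(s, u). f s u)"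
 shows continuous_parametric_set_integral: "continuous_on UNIV (\<lambda>s. LINT u:{c..d}|lborel. f s u)"
  and set_integral_swap_continuous:
   "(LINT s:{a..b}|lborel. LINT u:{c..d}|lborel. f s u) = (LINT u:{c..d}|lborel. LINT s:{a..b}|lborel. f s u)"
proof -
 have c1: "continuous_on S (f s)" for s S
  using continuous_on_compose2[OF f, of S "\<lambda>u. (s, u)"] by (simp add: continuous_on_Pair)
 have c2: "continuous_on S (\<lambda>s. f s u)" for u S
  using continuous_on_compose2[OF f, of S "\<lambda>s. (s, u)"] by (simp add: continuous_on_Pair)
 have i1: "(LINT u:{c..d}|lborel. f s u) = integral (cbox c d) (f s)" for s c d
  by (simp add: set_integral_continuous(2)[OF c1])
 have i2: "(LINT s:{a..b}|lborel. f s u) = integral (cbox a b) (\<lambda>s. f s u)" for u a b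
  by (simp add: set_integral_continuous(2)[OF c2])
 have f': "continuous_on UNIV (\<lambda>(u, s). f s u)"
  using continuous_on_compose2[OF f, of UNIV prod.swap] by (simp add: continuous_on_swap case_prod_unfold)
 have p1: "continuous_on UNIV (\<lambda>s. integral (cbox c d) (f s))" for c d
  by (rule integral_continuous_on_param) (auto intro: continuous_on_subset[OF f])
 have p2: "continuous_on UNIV (\<lambda>u. integral (cbox a b) (\<lambda>s. f s u))" for a b
  by (rule integral_continuous_on_param) (auto intro: continuous_on_subset[OF f'])
 show "continuous_on UNIV (\<lambda>s. LINT u:{c..d}|lborel. f s u)"
  unfolding i1 by (rule p1)
 have "(LINT s:{a..b}|lborel. LINT u:{c..d}|lborel. f s u) = integral (cbox a b) (\<lambda>s. integral (cbox c d) (f s))"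
  unfolding i1
  using set_integral_continuous(2)[OF continuous_on_subset[OF p1[of c d], of "{a..b}"]] by simp
 also have "\<dots> = integral (cbox c d) (\<lambda>u. integral (cbox a b) (\<lambda>s. f s u))"
  by (rule integral_swap_continuous) (rule continuous_on_subset[OF f], simp)
 also have "\<dots> = (LINT u:{c..d}|lborel. LINT s:{a..b}|lborel. f s u)"
  unfolding i2
  using set_integral_continuous(2)[OF continuous_on_subset[OF p2[of a b], of "{c..d}"]] by simp
 finally show "(LINT s:{a..b}|lborel. LINT u:{c..d}|lborel. f s u) = (LINT u:{c..d}|lborel. LINT s:{a..b}|lborel. f s u)" .
qed

lemma measurable_regular_field:
 assumes "regular_field g g' K L" and [measurable]: "f \<in> borel_measurable N" "h \<in> borel_measurable N"
 shows "(\<lambda>x. g (f x) (h x)) \<in> borel_measurable N" "(\<lambda>x. g' (f x) (h x)) \<in> borel_measurable N"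
proof -
 have [measurable]: "(\<lambda>(s, x). g s x) \<in> borel_measurable (borel \<Otimes>\<^sub>M borel)" "(\<lambda>(s, x). g' s x) \<in> borel_measurable (borel \<Otimes>\<^sub>M borel)"
  using assms(1) by (auto simp: regular_field_def borel_prod intro: borel_measurable_continuous_onI)
 show "(\<lambda>x. g (f x) (h x)) \<in> borel_measurable N" "(\<lambda>x. g' (f x) (h x)) \<in> borel_measurable N"
  by measurable
qed

lemma set_integrable_bounded:
 fixes f :: "real \<Rightarrow> real"
 assumes [measurable]: "f \<in> borel_measurable borel" and B: "\<And>s. s \<in> {a..b} \<Longrightarrow> \<bar>f s\<bar> \<le> B"
 shows "set_integrable lborel {a..b} f"
 unfolding set_integrable_def
proof (rule Bochner_Integration.integrable_bound)
 show "integrable lborel (\<lambda>s. B * indicator {a..b} s)"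
  by (intro integrable_mult_right integrable_real_indicator) (auto simp: emeasure_lborel_Icc_eq)
 show "AE s in lborel. norm (indicator {a..b} s *\<^sub>R f s) \<le> norm (B * indicator {a..b} s)"
  using B by (intro AE_I2) (auto simp: indicator_def intro: order_trans[OF _ abs_ge_self])
qed simp

lemma mean_value_integral:
 assumes reg: "regular_field g g' K L"
 shows "(LINT u:{0..1}|lborel. g' s (y + u * (x - y))) * (x - y) = g s x - g s y"
proof -
 have c: "continuous_on UNIV (\<lambda>(s, x). g' s x)" and d: "(g s has_real_derivative g' s z) (at z)" for z
  using reg by (auto simp: regular_field_def)
 have cu: "continuous_on {0..1} (\<lambda>u. g' s (y + u * (x - y)))"
  using continuous_on_compose2[OF c, of "{0..1}" "\<lambda>u. (s, y + u * (x - y))"] by (simp add: continuous_intros)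
 have "((\<lambda>u. g' s (y + u * (x - y)) * (x - y)) has_integral (g s (y + 1 * (x - y)) - g s (y + 0 * (x - y)))) {0..1}"
 proof (rule fundamental_theorem_of_calculus)
  fix u :: real
  have "((\<lambda>u. g s (y + u * (x - y))) has_real_derivative g' s (y + u * (x - y)) * (x - y)) (at u within {0..1})"
   by (rule DERIV_chain2[OF d]) (auto intro!: derivative_eq_intros)
  then show "((\<lambda>u. g s (y + u * (x - y))) has_vector_derivative g' s (y + u * (x - y)) * (x - y)) (at u within {0..1})"
   by (simp add: has_real_derivative_iff_has_vector_derivative)
 qed simp
 from integral_unique[OF this] have "integral {0..1} (\<lambda>u. g' s (y + u * (x - y))) * (x - y) = g s x - g s y" by simp
 then show ?thesis unfolding set_integral_continuous(2)[OF cu] .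
qed

context mean_field
begin

text \<open>The mean of the derivative over the segment between the two solutions.\<close>

definition slope :: "(real \<Rightarrow> real \<Rightarrow> real) \<Rightarrow> (real \<Rightarrow> 'a \<Rightarrow> real) \<Rightarrow> (real \<Rightarrow> 'a \<Rightarrow> real) \<Rightarrow> 'a \<Rightarrow> real \<Rightarrow> real" where
 "slope g' X Y w s = (LINT u:{0..1}|lborel. g' s (Y s w + u * (X s w - Y s w)))"

lemma continuous_slope_integrand:
 assumes reg: "regular_field g g' K L" and X: "solution x X" and Y: "solution y Y" and w: "w \<in> space M"
 shows "continuous_on UNIV (\<lambda>(s, u). g' s (Y s w + u * (X s w - Y s w)))"
proof -
 have c: "continuous_on UNIV (\<lambda>(s, x). g' s x)" using reg by (auto simp: regular_field_def)
 have "continuous_on UNIV (\<lambda>p. Y (fst p) w)" "continuous_on UNIV (\<lambda>p. X (fst p) w)"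
  by (auto intro!: continuous_on_compose2[OF solutionD(2)[OF X w]] continuous_on_compose2[OF solutionD(2)[OF Y w]] continuous_intros)
 then have "continuous_on UNIV (\<lambda>p. (fst p, Y (fst p) w + snd p * (X (fst p) w - Y (fst p) w)))"
  by (intro continuous_intros)
 from continuous_on_compose2[OF c this] show ?thesis by (simp add: case_prod_unfold)
qed

lemma slope_properties:
 assumes reg: "regular_field g g' K L" and X: "solution x X" and Y: "solution y Y"
 shows "w \<in> space M \<Longrightarrow> continuous_on UNIV (slope g' X Y w)"
  and "\<bar>slope g' X Y w s\<bar> \<le> L"
  and "f \<in> measurable N M \<Longrightarrow> h \<in> borel_measurable N \<Longrightarrow> (\<lambda>p. slope g' X Y (f p) (h p)) \<in> borel_measurable N"
proof -
 have b: "\<bar>g' s z\<bar> \<le> L" for s z using reg by (auto simp: regular_field_def)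
 show "w \<in> space M \<Longrightarrow> continuous_on UNIV (slope g' X Y w)"
  unfolding slope_def by (rule continuous_parametric_set_integral[OF continuous_slope_integrand[OF reg X Y]])
 note [measurable] = measurable_regular_field(2)[OF reg] jointly_measurable_continuous[OF solutionD(1,2)[OF X]]
  jointly_measurable_continuous[OF solutionD(1,2)[OF Y]]
 show "(\<lambda>p. slope g' X Y (f p) (h p)) \<in> borel_measurable N"
  if [measurable]: "f \<in> measurable N M" "h \<in> borel_measurable N"
  unfolding slope_def set_lebesgue_integral_def by measurable
 show "\<bar>slope g' X Y w s\<bar> \<le> L"
 proof -
  have m: "(\<lambda>u. g' s (Y s w + u * (X s w - Y s w))) \<in> borel_measurable borel"
   by (rule measurable_regular_field(2)[OF reg]) auto
  have i: "set_integrable lborel {0..1} (\<lambda>u. g' s (Y s w + u * (X s w - Y s w)))"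
   using b by (intro set_integrable_bounded m)
  have "\<bar>slope g' X Y w s\<bar> \<le> (LINT u:{0..1}|lborel. \<bar>g' s (Y s w + u * (X s w - Y s w))\<bar>)"
   unfolding slope_def using set_integral_norm_bound[OF i] by simp
  also have "\<dots> \<le> (LINT u:{0..1::real}|lborel. L)"
   by (intro set_integral_mono set_integrable_abs i set_integral_continuous(1) continuous_on_const b)
  also have "\<dots> = L" by (simp add: set_integral_const)
  finally show ?thesis .
 qed
qed

text \<open>By Jensen's inequality it suffices to consider a fixed point of the segment between the two solutions. There the path is a Brownian
  motion with a slow shift, and the constants depend on the solutions only through \<open>R\<close>.\<close>

lemma exp_slope_integral:
 fixes R :: real
 obtains c where "\<And>p. c p \<ge> 0" "\<And>p x y X Y g g' L t. solution x X \<Longrightarrow> solution y Y \<Longrightarrow> \<bar>x\<bar> \<le> R \<Longrightarrow> \<bar>y\<bar> \<le> R \<Longrightarrow>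
  regular_field g g' K L \<Longrightarrow> 0 \<le> t \<Longrightarrow> t \<le> T \<Longrightarrow>
  EE (\<lambda>w. exp (p * (LINT s:{0..t}|lborel. slope g' X Y w s))) \<le> ennreal (c p)"
proof -
 obtain a where a: "a > 0" "\<And>x X. solution x X \<Longrightarrow> \<bar>x\<bar> \<le> R \<Longrightarrow>
  AE w in M. \<forall>t\<in>{0..T}. \<bar>X t w\<bar> \<le> speed_bound a w t \<and> \<bar>b t (X t w) (law X t)\<bar> \<le> speed_bound a w t"
  by (rule uniform_growth[of R]) (rule that)
 obtain c where c: "\<And>p. c p \<ge> 0" "\<And>g g' L \<phi> z t p. regular_field g g' K L \<Longrightarrow> slow_shift a \<phi> \<Longrightarrow> 0 \<le> t \<Longrightarrow> t \<le> T \<Longrightarrow>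
  EE (\<lambda>w. exp (p * (LINT s:{0..t}|lborel. g' s (z + (\<phi> s w + B s w))))) \<le> ennreal (c p)"
  by (rule exp_integral_derivative_shifted[OF a(1), of K]) (rule that)
 show ?thesis
 proof (rule that[OF c(1)])
  fix p x y X Y g g' L t
  assume X: "solution x X" and Y: "solution y Y" and xy: "\<bar>x\<bar> \<le> R" "\<bar>y\<bar> \<le> R"
   and reg: "regular_field g g' K L" and t: "0 \<le> t" "t \<le> T"
  note [measurable] = measurable_regular_field(2)[OF reg] solutionD(1)[OF X] solutionD(1)[OF Y]
   jointly_measurable_continuous[OF solutionD(1,2)[OF X]] jointly_measurable_continuous[OF solutionD(1,2)[OF Y]]
  define J where "J w u = (LINT s:{0..t}|lborel. g' s (Y s w + u * (X s w - Y s w)))" for w u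
  have J [measurable]: "(\<lambda>p. J (f p) (h p)) \<in> borel_measurable N"
   if [measurable]: "f \<in> measurable N M" "h \<in> borel_measurable N" for f h and N :: "'z measure"
   unfolding J_def set_lebesgue_integral_def by measurable
  have each: "EE (\<lambda>w. exp (p * J w u)) \<le> ennreal (c p)" if u: "u \<in> {0..1}" for u
  proof -
   define z where "z = y + u * (x - y)"
   define \<phi> where "\<phi> s w = Y s w + u * (X s w - Y s w) - z - B s w" for s w
   have "slow_shift a \<phi>"
    unfolding slow_shift_def
   proof (intro conjI ballI allI impI)
    fix s assume s: "0 \<le> s" "s \<le> T"
    have [measurable]: "X s \<in> borel_measurable (F s)" "Y s \<in> borel_measurable (F s)" "B s \<in> borel_measurable (F s)"
     using X Y s B_adapted by (auto simp: solution_def)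
    show "\<phi> s \<in> borel_measurable (F s)" unfolding \<phi>_def by measurable
   next
    fix w assume w: "w \<in> space M"
    show "continuous_on UNIV (\<lambda>s. \<phi> s w)"
     unfolding \<phi>_def by (intro continuous_intros solutionD(2)[OF X w] solutionD(2)[OF Y w] B_continuous[OF w])
    show "\<phi> 0 w = 0" using X Y w by (simp add: \<phi>_def z_def solution_def B_0)
   next
    show "AE w in M. \<forall>s t. 0 \<le> s \<longrightarrow> s \<le> t \<longrightarrow> t \<le> T \<longrightarrow> \<bar>\<phi> t w - \<phi> s w\<bar> \<le> (LINT u:{s..t}|lborel. speed_bound a w u)"
     using solutionD(5)[OF X] solutionD(5)[OF Y] a(2)[OF X xy(1)] a(2)[OF Y xy(2)] AE_space
    proof eventually_elim
     case (elim w)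
     show ?case
     proof (intro allI impI)
      fix s r assume sr: "0 \<le> s" "s \<le> r" "r \<le> T"
      let ?I = "LINT u:{s..r}|lborel. speed_bound a w u"
      let ?x = "(X r w - B r w) - (X s w - B s w)" and ?y = "(Y r w - B r w) - (Y s w - B s w)"
      have 1: "\<bar>?x\<bar> \<le> ?I" by (rule path_increment[OF X sr]) (use elim in auto)
      have 2: "\<bar>?y\<bar> \<le> ?I" by (rule path_increment[OF Y sr]) (use elim in auto)
      have "\<phi> r w - \<phi> s w = u * ?x + (1 - u) * ?y" by (simp add: \<phi>_def algebra_simps)
      also have "\<bar>\<dots>\<bar> \<le> u * \<bar>?x\<bar> + (1 - u) * \<bar>?y\<bar>"
       using u by (intro order_trans[OF abs_triangle_ineq]) (auto simp: abs_mult)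
      also have "\<dots> \<le> u * ?I + (1 - u) * ?I" using 1 2 u by (intro add_mono mult_left_mono) auto
      also have "\<dots> = ?I" by (simp add: algebra_simps)
      finally show "\<bar>\<phi> r w - \<phi> s w\<bar> \<le> ?I" .
     qed
    qed
   qed
   from c(2)[OF reg this t, of p z] show ?thesis by (simp add: \<phi>_def J_def)
  qed
  have paths: "continuous_on UNIV (J w)" "(LINT s:{0..t}|lborel. slope g' X Y w s) = (LINT u:{0..1}|lborel. J w u)"
   if w: "w \<in> space M" for w
  proof -
   note cg = continuous_slope_integrand[OF reg X Y w]
   have cg': "continuous_on UNIV (\<lambda>(u, s). g' s (Y s w + u * (X s w - Y s w)))"
    using continuous_on_compose2[OF cg, of UNIV prod.swap] by (simp add: continuous_on_swap case_prod_unfold)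
   have cJ: "continuous_on UNIV (J w)"
    unfolding J_def by (rule continuous_parametric_set_integral[OF cg'])
   have "(LINT s:{0..t}|lborel. slope g' X Y w s) = (LINT u:{0..1}|lborel. J w u)"
    unfolding slope_def J_def by (rule set_integral_swap_continuous[OF cg])
   with cJ show "continuous_on UNIV (J w)" "(LINT s:{0..t}|lborel. slope g' X Y w s) = (LINT u:{0..1}|lborel. J w u)" .
  qed
  have "EE (\<lambda>w. exp (p * (LINT s:{0..t}|lborel. slope g' X Y w s))) = EE (\<lambda>w. exp (LINT u:{0..1}|lborel. p * J w u))"
   by (intro nn_integral_cong) (simp add: paths(2))
  also have "\<dots> \<le> ennreal (c p)"
   using each c(1)[of p] paths(1) by (intro EE_exp_interval_integral_le continuous_intros) auto
  finally show "EE (\<lambda>w. exp (p * (LINT s:{0..t}|lborel. slope g' X Y w s))) \<le> ennreal (c p)" .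
 qed
qed

abbreviation path_error :: "(real \<Rightarrow> real \<Rightarrow> real) \<Rightarrow> (real \<Rightarrow> real \<Rightarrow> real) \<Rightarrow> (real \<Rightarrow> 'a \<Rightarrow> real) \<Rightarrow> real \<Rightarrow> ennreal" where
 "path_error f g Z s \<equiv> EE (\<lambda>w. \<bar>f s (Z s w) - g s (Z s w)\<bar>)"

text \<open>The two measures to be served are the images of time and probability under \<open>(s, w) \<mapsto> (s, Z s w)\<close> for \<open>Z\<close> among \<open>X\<close> and \<open>Y\<close>.\<close>

lemma bounded_part_approximation:
 assumes X: "solution x X" and Y: "solution y Y" and e: "e > 0"
  and f: "\<And>s z. f s z = indicator {0..T} s * bh s z (law X s)"
 obtains g g' L where "regular_field g g' K L"
  "(\<integral>\<^sup>+s\<in>{0..T}. path_error f g X s \<partial>lborel) \<le> ennreal e" "(\<integral>\<^sup>+s\<in>{0..T}. path_error f g Y s \<partial>lborel) \<le> ennreal e"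
proof -
 let ?N = "density lborel (indicator {0..T}) \<Otimes>\<^sub>M M"
 define m where "m Z = distr ?N borel (\<lambda>p. (fst p, Z (fst p) (snd p)))" for Z :: "real \<Rightarrow> 'a \<Rightarrow> real"
 have f': "case_prod f \<in> borel_measurable borel"
  using bounded_part_measurable[OF X] by (simp add: f case_prod_unfold)
 have fK: "\<bar>case_prod f p\<bar> \<le> K" for p
  using bh_bounded[OF _ solutionD(3)[OF X], of "fst p" "fst p" "snd p"] K_nonneg by (auto simp: f indicator_def split: prod.split)
 have N1: "emeasure (density lborel (indicator {0..T})) UNIV = ennreal T"
  using T_pos by (subst emeasure_density) auto
 interpret D: finite_measure "density lborel (indicator {0..T})"
  by (rule finite_measureI) (simp add: N1)
 interpret N: pair_sigma_finite "density lborel (indicator {0..T})" M by unfold_locales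
 have mZ: "finite_measure (m Z) \<and> sets (m Z) = sets borel \<and>
   (\<forall>g :: real \<Rightarrow> real \<Rightarrow> real. case_prod g \<in> borel_measurable borel \<longrightarrow>
   (\<integral>\<^sup>+z. ennreal \<bar>case_prod f z - case_prod g z\<bar> \<partial>m Z)
    = (\<integral>\<^sup>+s\<in>{0..T}. path_error f g Z s \<partial>lborel))"
  if Z: "solution z Z" for z Z
 proof (intro conjI allI impI)
  note [measurable] = jointly_measurable_continuous[OF solutionD(1,2)[OF Z]]
  have Zm: "(\<lambda>p. (fst p, Z (fst p) (snd p))) \<in> ?N \<rightarrow>\<^sub>M borel"
   unfolding borel_prod[symmetric] by measurable
  show "sets (m Z) = sets borel" by (simp add: m_def)
  show "finite_measure (m Z)"
  proof (rule finite_measureI)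
   have "emeasure (m Z) (space (m Z)) = emeasure ?N (space ?N)"
    unfolding m_def by (subst emeasure_distr[OF Zm]) auto
   also have "\<dots> = ennreal T * 1"
    unfolding space_pair_measure
    by (subst emeasure_pair_measure_Times) (auto simp: N1 emeasure_space_1)
   finally show "emeasure (m Z) (space (m Z)) \<noteq> \<infinity>" by simp
  qed
  fix g :: "real \<Rightarrow> real \<Rightarrow> real" assume g: "case_prod g \<in> borel_measurable borel"
  have [measurable]: "case_prod g \<in> borel_measurable (borel \<Otimes>\<^sub>M borel)" "case_prod f \<in> borel_measurable (borel \<Otimes>\<^sub>M borel)"
   using g f' by (simp_all add: borel_prod)
  have "(\<integral>\<^sup>+z. ennreal \<bar>case_prod f z - case_prod g z\<bar> \<partial>m Z)
   = (\<integral>\<^sup>+p. ennreal \<bar>f (fst p) (Z (fst p) (snd p)) - g (fst p) (Z (fst p) (snd p))\<bar> \<partial>?N)"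
  proof -
   have "(\<lambda>z. ennreal \<bar>case_prod f z - case_prod g z\<bar>) \<in> borel_measurable borel"
    using borel_measurable_diff[OF f' g] by measurable
   then show ?thesis
    unfolding m_def by (subst nn_integral_distr[OF Zm]) (simp_all only: measurable_distr_eq1 fst_conv snd_conv prod.case)
  qed
  also have "\<dots> = (\<integral>\<^sup>+s. path_error f g Z s \<partial>density lborel (indicator {0..T}))"
   by (subst nn_integral_fst[symmetric]) auto
  also have "\<dots> = (\<integral>\<^sup>+s\<in>{0..T}. path_error f g Z s \<partial>lborel)"
   by (subst nn_integral_density) (auto simp: mult.commute)
  finally show "(\<integral>\<^sup>+z. ennreal \<bar>case_prod f z - case_prod g z\<bar> \<partial>m Z)
    = (\<integral>\<^sup>+s\<in>{0..T}. path_error f g Z s \<partial>lborel)" .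
 qed
 obtain g g' L where g: "regular_field g g' K L"
  "\<And>\<mu>. \<mu> \<in> {m X, m Y} \<Longrightarrow> (\<integral>\<^sup>+z. ennreal \<bar>case_prod f z - case_prod g z\<bar> \<partial>\<mu>) \<le> ennreal e"
  by (rule space_smooth_approximation[of "{m X, m Y}", OF _ _ _ f' fK e]) (use mZ[OF X] mZ[OF Y] in auto)
 have "case_prod g \<in> borel_measurable borel"
  using g(1) unfolding regular_field_def by (intro borel_measurable_continuous_onI) blast
 then show ?thesis using mZ[OF X] mZ[OF Y] g(2)[of "m X"] g(2)[of "m Y"] by (intro that[OF g(1)]) auto
qed

end

section \<open>Mean-square dependence on the starting point\<close>

text \<open>The error \<open>\<epsilon>\<close> is small in the mean only, while the exponential weight has moments but no bound that is uniform in the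
  approximation. Young's inequality with parameter \<open>\<eta>\<close> separates the two, and \<open>\<epsilon> \<le> 4 * K\<close> brings \<open>\<epsilon> ^ 4\<close> back to \<open>\<epsilon>\<close>.\<close>

lemma weighted_square_le:
 fixes u v \<epsilon> m \<eta> K :: real
 assumes \<epsilon>: "0 \<le> \<epsilon>" "\<epsilon> \<le> 4 * K" and \<eta>: "\<eta> > 0"
 shows "(exp (u - v) * (\<epsilon> + m))^2
  \<le> \<eta> * (exp (8 * u) + exp (- 8 * v)) + 64 * K ^ 3 / \<eta> * \<epsilon> + 2 * m^2 * (exp (4 * u) + exp (- 4 * v))"
proof -
 define e where "e = exp (2 * (u - v))"
 have e: "(exp (u - v))^2 = e" by (simp add: e_def power2_eq_square flip: exp_add)
 have e0: "e > 0" by (simp add: e_def)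
 have e1: "e \<le> exp (4 * u) + exp (- 4 * v)"
  using exp_convex_combination_le[of "1 / 2" "4 * u" "- 4 * v"] by (simp add: e_def algebra_simps)
 have "e^2 = exp (4 * (u - v))" by (simp add: e_def power2_eq_square flip: exp_add)
 then have e2: "e^2 \<le> exp (8 * u) + exp (- 8 * v)"
  using exp_convex_combination_le[of "1 / 2" "8 * u" "- 8 * v"] by (simp add: algebra_simps)
 have s: "(\<epsilon> + m)^2 \<le> 2 * \<epsilon>^2 + 2 * m^2"
  using sum_squares_bound[of \<epsilon> m] by (simp add: power2_sum)
 have y: "2 * e * \<epsilon>^2 \<le> \<eta> * e^2 + \<epsilon> ^ 4 / \<eta>"
 proof -
  have "0 \<le> (\<eta> * e - \<epsilon>^2)^2 / \<eta>" using \<eta> by simp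
  also have "\<dots> = \<eta> * e^2 - 2 * e * \<epsilon>^2 + \<epsilon> ^ 4 / \<eta>"
   using \<eta> by (simp add: power2_eq_square power4_eq_xxxx field_simps)
  finally show ?thesis by simp
 qed
 have "\<epsilon> ^ 3 \<le> (4 * K) ^ 3" using \<epsilon> by (intro power_mono) auto
 then have "\<epsilon> ^ 3 * \<epsilon> \<le> (4 * K) ^ 3 * \<epsilon>" using \<epsilon> by (intro mult_right_mono) auto
 then have "\<epsilon> ^ 4 \<le> 64 * K ^ 3 * \<epsilon>" by (simp add: power_mult_distrib power4_eq_xxxx power3_eq_cube)
 then have z: "\<epsilon> ^ 4 / \<eta> \<le> 64 * K ^ 3 / \<eta> * \<epsilon>" using \<eta> by (simp add: divide_right_mono)
 have "(exp (u - v) * (\<epsilon> + m))^2 \<le> e * (2 * \<epsilon>^2 + 2 * m^2)"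
  unfolding power_mult_distrib e using s e0 by (intro mult_left_mono) auto
 also have "\<dots> = 2 * e * \<epsilon>^2 + 2 * m^2 * e" by (simp add: algebra_simps)
 also have "\<dots> \<le> (\<eta> * (exp (8 * u) + exp (- 8 * v)) + 64 * K ^ 3 / \<eta> * \<epsilon>) + 2 * m^2 * (exp (4 * u) + exp (- 4 * v))"
 proof (rule add_mono)
  have "\<eta> * e^2 \<le> \<eta> * (exp (8 * u) + exp (- 8 * v))" using e2 \<eta> by (intro mult_left_mono) auto
  then show "2 * e * \<epsilon>^2 \<le> \<eta> * (exp (8 * u) + exp (- 8 * v)) + 64 * K ^ 3 / \<eta> * \<epsilon>" using y z by linarith
  show "2 * m^2 * e \<le> 2 * m^2 * (exp (4 * u) + exp (- 4 * v))" using e1 by (intro mult_left_mono) auto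
 qed
 finally show ?thesis .
qed

context mean_field
begin

lemma mean_distance_properties:
 assumes X: "solution x X" and Y: "solution y Y"
 shows "continuous_on {0..T} (mean_distance X Y)" and "mean_distance X Y \<in> borel_measurable borel"
  and "\<exists>m. \<forall>s\<in>{0..T}. mean_distance X Y s \<le> m"
proof -
 obtain c d where cd: "\<And>s t. s \<in> {0..T} \<Longrightarrow> t \<in> {0..T} \<Longrightarrow> (\<integral>w. \<bar>X t w - X s w\<bar> \<partial>M) \<le> c * sqrt \<bar>t - s\<bar>"
   "\<And>s t. s \<in> {0..T} \<Longrightarrow> t \<in> {0..T} \<Longrightarrow> (\<integral>w. \<bar>Y t w - Y s w\<bar> \<partial>M) \<le> d * sqrt \<bar>t - s\<bar>"
  by (rule solution_Hoelder[OF X], rule solution_Hoelder[OF Y]) (rule that)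
 show c: "continuous_on {0..T} (mean_distance X Y)"
  by (rule continuous_mean_distance[OF solutionD(4)[OF X] solutionD(4)[OF Y] cd])
 note [measurable] = jointly_measurable_continuous[OF solutionD(1,2)[OF X]] jointly_measurable_continuous[OF solutionD(1,2)[OF Y]]
 show "mean_distance X Y \<in> borel_measurable borel"
  unfolding mean_distance_def by measurable
 have "bounded (mean_distance X Y ` {0..T})"
  by (intro compact_imp_bounded compact_continuous_image c) simp
 then obtain m where "\<forall>x\<in>mean_distance X Y ` {0..T}. norm x \<le> m" unfolding bounded_iff by blast
 then show "\<exists>m. \<forall>s\<in>{0..T}. mean_distance X Y s \<le> m" by (intro exI[of _ m]) auto
qed

text \<open>The linear equation for the difference, with coefficient \<open>slope\<close>. The perturbation \<open>p\<close> consists of the errors along both paths and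
  the distance of the laws.\<close>

lemma pathwise_difference:
 assumes X: "solution x X" and Y: "solution y Y" and reg: "regular_field g g' K L"
  and f: "\<And>s z. f s z = indicator {0..T} s * bh s z (law X s)"
  and t: "0 \<le> t" "t \<le> T" and w: "w \<in> space M"
  and eqX: "set_integrable lborel {0..T} (\<lambda>s. b s (X s w) (law X s)) \<and>
    (\<forall>t\<in>{0..T}. X t w = x + (LINT s:{0..t}|lborel. b s (X s w) (law X s)) + B t w)"
  and eqY: "set_integrable lborel {0..T} (\<lambda>s. b s (Y s w) (law Y s)) \<and>
    (\<forall>t\<in>{0..T}. Y t w = y + (LINT s:{0..t}|lborel. b s (Y s w) (law Y s)) + B t w)"
  and p: "\<And>s. p s = (\<bar>f s (X s w) - g s (X s w)\<bar> + \<bar>f s (Y s w) - g s (Y s w)\<bar>) + C * mean_distance X Y s"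
  and ip: "set_integrable lborel {0..t} p"
  and A: "\<And>s. A s = (LINT r:{0..s}|lborel. slope g' X Y w r)"
 shows "\<bar>X t w - Y t w\<bar> \<le> exp (C * t) * (exp (A t) * \<bar>x - y\<bar> + (LINT s:{0..t}|lborel. exp (A t - A s) * p s))"
proof -
 let ?q = "\<lambda>s. b s (X s w) (law X s) - b s (Y s w) (law Y s)"
 have iX: "set_integrable lborel {0..s} (\<lambda>s. b s (X s w) (law X s))" if "s \<le> T" for s
  by (rule set_integrable_subset[OF conjunct1[OF eqX]]) (use that in auto)
 have iY: "set_integrable lborel {0..s} (\<lambda>s. b s (Y s w) (law Y s))" if "s \<le> T" for s
  by (rule set_integrable_subset[OF conjunct1[OF eqY]]) (use that in auto)
 have cX: "continuous_on S (\<lambda>s. X s w)" and cY: "continuous_on S (\<lambda>s. Y s w)" for S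
  by (auto intro: continuous_on_subset[OF solutionD(2)[OF X w]] continuous_on_subset[OF solutionD(2)[OF Y w]])
 show ?thesis
 proof (rule perturbed_linear_ODE_bound[OF t(1) less_imp_le[OF C_pos], where D = "\<lambda>s. X s w - Y s w" and q = ?q
   and a = "slope g' X Y w"])
  show "set_integrable lborel {0..t} ?q" by (intro set_integral_diff(1) iX iY t)
  show "X s w - Y s w = x - y + (LINT r:{0..s}|lborel. ?q r)" if "s \<in> {0..t}" for s
  proof -
   have s: "s \<in> {0..T}" "s \<le> T" using that t by auto
   show ?thesis
    using bspec[OF conjunct2[OF eqX] s(1)] bspec[OF conjunct2[OF eqY] s(1)]
    unfolding set_integral_diff(2)[OF iX[OF s(2)] iY[OF s(2)]] by simp
  qed
  show "continuous_on {0..t} (\<lambda>s. X s w - Y s w)" by (intro continuous_intros cX cY)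
  show "continuous_on {0..t} (slope g' X Y w)"
   by (rule continuous_on_subset[OF slope_properties(1)[OF reg X Y w]]) simp
  show "0 \<le> p r" for r using C_pos mean_distance_nonneg[of X Y r] by (simp add: p)
  show "\<bar>?q r - slope g' X Y w r * (X r w - Y r w)\<bar> \<le> p r + C * \<bar>X r w - Y r w\<bar>" if "r \<in> {0..t}" for r
  proof -
   have r: "r \<in> {0..T}" using that t by auto
   note P = solutionD(3)[OF X r] and Q = solutionD(3)[OF Y r]
   have sl: "slope g' X Y w r * (X r w - Y r w) = g r (X r w) - g r (Y r w)"
    unfolding slope_def by (rule mean_value_integral[OF reg])
   have fX: "f r z = bh r z (law X r)" for z using r by (simp add: f)
   have "kantorovich (law X r) (law Y r) \<le> mean_distance X Y r"
    unfolding mean_distance_def using solutionD(1)[OF X] solutionD(1)[OF Y] P Q by (intro kantorovich_distr_le) auto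
   then have "C * kantorovich (law X r) (law Y r) \<le> C * mean_distance X Y r" using C_pos by (intro mult_left_mono) auto
   then have "\<bar>b r (Y r w) (law X r) - b r (Y r w) (law Y r)\<bar> \<le> C * mean_distance X Y r"
    using b_lipschitz_law[OF r P Q, of "Y r w"] by linarith
   moreover have "\<bar>bt r (X r w) (law X r) - bt r (Y r w) (law X r)\<bar> \<le> C * \<bar>X r w - Y r w\<bar>"
    by (rule bt_lipschitz[OF r P])
   ultimately show ?thesis
    unfolding sl p fX using b_split[OF r P, of "X r w"] b_split[OF r P, of "Y r w"] by linarith
  qed
 qed (use ip A in auto)
qed

text \<open>The constant must not depend on the approximating field. It only involves moments of \<open>exp_slope_integral\<close>; everything that
  does depend on the field is made smaller than a given \<open>\<delta>\<close>.\<close>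

lemma mean_square_difference:
 fixes R :: real
 obtains c where "c \<ge> 0" "\<And>x y X Y t. solution x X \<Longrightarrow> solution y Y \<Longrightarrow> \<bar>x\<bar> \<le> R \<Longrightarrow> \<bar>y\<bar> \<le> R \<Longrightarrow> 0 \<le> t \<Longrightarrow> t \<le> T \<Longrightarrow>
  (EE (\<lambda>w. (X t w - Y t w)^2))
   \<le> ennreal (c * ((x - y)^2 + (LINT s:{0..t}|lborel. (mean_distance X Y s)^2)))"
proof -
 obtain k where k0: "\<And>p. k p \<ge> 0" and k: "\<And>p x y X Y g g' L t. solution x X \<Longrightarrow> solution y Y \<Longrightarrow> \<bar>x\<bar> \<le> R \<Longrightarrow> \<bar>y\<bar> \<le> R \<Longrightarrow>
  regular_field g g' K L \<Longrightarrow> 0 \<le> t \<Longrightarrow> t \<le> T \<Longrightarrow>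
  EE (\<lambda>w. exp (p * (LINT s:{0..t}|lborel. slope g' X Y w s))) \<le> ennreal (k p)"
  by (rule exp_slope_integral[of R]) (rule that)
 define q where "q = k 2 + k 4 + k (- 4) + k 8 + k (- 8)"
 have q: "q \<ge> 0" "k 2 \<le> q" "k 4 \<le> q" "k (- 4) \<le> q" "k 8 \<le> q" "k (- 8) \<le> q"
  using k0[of 2] k0[of 4] k0[of "- 4"] k0[of 8] k0[of "- 8"] by (auto simp: q_def)
 define E where "E = 2 * (exp (C * T))^2"
 have E0: "E > 0" by (simp add: E_def)
 define c where "c = E * q + 4 * E * T * C^2 * q"
 have c0: "c \<ge> 0" using E0 q(1) T_pos by (simp add: c_def)
 show ?thesis
 proof (rule that[OF c0])
  fix x y X Y t
  assume X: "solution x X" and Y: "solution y Y" and xy: "\<bar>x\<bar> \<le> R" "\<bar>y\<bar> \<le> R" and t: "0 \<le> t" "t \<le> T"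
  define m where "m = mean_distance X Y"
  have m0: "m s \<ge> 0" for s by (simp add: m_def mean_distance_nonneg)
  have [measurable]: "m \<in> borel_measurable borel" unfolding m_def by (rule mean_distance_properties(2)[OF X Y])
  obtain mb where mb: "\<And>s. s \<in> {0..T} \<Longrightarrow> m s \<le> mb"
   using mean_distance_properties(3)[OF X Y] unfolding m_def by blast
  have mb0: "mb \<ge> 0" using mb[of 0] m0[of 0] T_pos by simp
  define I where "I = (LINT s:{0..t}|lborel. (m s)^2)"
  have im: "set_integrable lborel {0..t} (\<lambda>s. (m s)^2)"
  proof (rule set_integrable_bounded)
   show "\<bar>(m s)^2\<bar> \<le> mb^2" if "s \<in> {0..t}" for s
    using that t mb[of s] m0[of s] by (simp add: power_mono)
  qed measurable
  have I0: "I \<ge> 0" by (simp add: I_def set_lebesgue_integral_def)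
  define f where "f s z = indicator {0..T} s * bh s z (law X s)" for s z
  have fK: "\<bar>f s z\<bar> \<le> K" for s z
   using bh_bounded[OF _ solutionD(3)[OF X], of s s z] K_nonneg by (auto simp: f_def indicator_def)
  have "EE (\<lambda>w. (X t w - Y t w)^2) \<le> ennreal (c * ((x - y)^2 + I))"
  proof (rule ennreal_le_epsilon)
   fix \<delta> :: real assume \<delta>: "\<delta> > 0"
   define \<eta> where "\<eta> = \<delta> / (4 * E * T^2 * q + 1)"
   have \<eta>: "\<eta> > 0" using \<delta> E0 q(1) by (auto simp: \<eta>_def intro!: divide_pos_pos add_nonneg_pos)
   have \<eta>\<delta>: "2 * E * T^2 * q * \<eta> \<le> \<delta> / 2"
   proof -
    have "2 * (2 * E * T^2 * q) * \<eta> \<le> (4 * E * T^2 * q + 1) * \<eta>" using \<eta> by (intro mult_right_mono) auto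
    also have "\<dots> = \<delta>"
    proof -
     have "4 * E * T^2 * q + 1 > 0" using E0 q(1) by (intro add_nonneg_pos mult_nonneg_nonneg) auto
     then show ?thesis by (simp add: \<eta>_def)
    qed
    finally show ?thesis by linarith
   qed
   define \<kappa> where "\<kappa> = 64 * K ^ 3 / \<eta>"
   have \<kappa>: "\<kappa> \<ge> 0" using \<eta> K_nonneg by (simp add: \<kappa>_def)
   \<comment> \<open>\<open>\<eta>\<close> and then \<open>e\<close> are so small that their contributions to the final estimate are at most \<open>\<delta> / 2\<close> each.\<close>
   define e where "e = \<delta> / (4 * E * T * \<kappa> + 1)"
   have p1: "4 * E * T * \<kappa> + 1 > 0" using E0 T_pos \<kappa> by (intro add_nonneg_pos mult_nonneg_nonneg) auto
   have e: "e > 0" using \<delta> p1 by (simp add: e_def)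
   have e\<delta>: "2 * E * T * \<kappa> * e \<le> \<delta> / 2"
   proof -
    have "2 * (2 * E * T * \<kappa>) * e \<le> (4 * E * T * \<kappa> + 1) * e" using e by (intro mult_right_mono) auto
    also have "\<dots> = \<delta>" using p1 by (simp add: e_def)
    finally show ?thesis by linarith
   qed
   obtain g g' L where reg: "regular_field g g' K L"
    and approxX: "(\<integral>\<^sup>+s\<in>{0..T}. path_error f g X s \<partial>lborel) \<le> ennreal e"
    and approxY: "(\<integral>\<^sup>+s\<in>{0..T}. path_error f g Y s \<partial>lborel) \<le> ennreal e"
    by (rule bounded_part_approximation[OF X Y e f_def]) (rule that)
   have gK: "\<bar>g s z\<bar> \<le> K" for s z using reg by (auto simp: regular_field_def)
   define A where "A s w = (LINT r:{0..s}|lborel. slope g' X Y w r)" for s w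
   define \<epsilon> where "\<epsilon> s w = \<bar>f s (X s w) - g s (X s w)\<bar> + \<bar>f s (Y s w) - g s (Y s w)\<bar>" for s w
   have \<epsilon>: "0 \<le> \<epsilon> s w" "\<epsilon> s w \<le> 4 * K" for s w
    using fK[of s "X s w"] fK[of s "Y s w"] gK[of s "X s w"] gK[of s "Y s w"] by (auto simp: \<epsilon>_def)
   define H where "H s w = \<eta> * (exp (8 * A t w) + exp (- 8 * A s w)) + \<kappa> * \<epsilon> s w
     + 2 * (C * m s)^2 * (exp (4 * A t w) + exp (- 4 * A s w))" for s w
   note [measurable] = measurable_regular_field(1)[OF reg] jointly_measurable_continuous[OF solutionD(1,2)[OF X]]
    jointly_measurable_continuous[OF solutionD(1,2)[OF Y]] slope_properties(3)[OF reg X Y] solutionD(1)[OF X] solutionD(1)[OF Y]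
   have [measurable]: "(\<lambda>(s, z). f s z) \<in> borel_measurable (borel \<Otimes>\<^sub>M borel)"
    using bounded_part_measurable[OF X] by (simp add: f_def borel_prod)
   have A_alt: "A s w = (\<integral>r. (if 0 \<le> r \<and> r \<le> s then slope g' X Y w r else 0) \<partial>lborel)" for s w
    unfolding A_def set_lebesgue_integral_def
    by (intro Bochner_Integration.integral_cong) (auto simp: indicator_def)
   have A_meas [measurable]: "(\<lambda>p. A (h p) (w p)) \<in> borel_measurable N"
    if [measurable]: "h \<in> borel_measurable N" "w \<in> measurable N M" for h w and N :: "'z measure"
    unfolding A_alt by measurable
   have f_meas [measurable]: "(\<lambda>p. f (h p) (w p)) \<in> borel_measurable N"
    if [measurable]: "h \<in> borel_measurable N" "w \<in> borel_measurable N" for h w and N :: "'z measure"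
    by measurable
   have A_bound: "\<bar>A s w\<bar> \<le> L * T" if s: "s \<in> {0..T}" and w: "w \<in> space M" for s w
   proof -
    have L0: "0 \<le> L" using slope_properties(2)[OF reg X Y, of w s] by linarith
    have i: "set_integrable lborel {0..s} (slope g' X Y w)"
     by (intro set_integral_continuous(1) continuous_on_subset[OF slope_properties(1)[OF reg X Y w]]) simp
    have "\<bar>A s w\<bar> \<le> (LINT r:{0..s}|lborel. \<bar>slope g' X Y w r\<bar>)"
     unfolding A_def using set_integral_norm_bound[OF i] by simp
    also have "\<dots> \<le> (LINT r:{0..s}|lborel. L)"
     by (intro set_integral_mono set_integrable_abs i set_integral_continuous(1) continuous_on_const
       slope_properties(2)[OF reg X Y])
    also have "\<dots> = L * s" using s by (simp add: set_integral_const)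
    also have "\<dots> \<le> L * T" using s L0 by (intro mult_left_mono) auto
    finally show ?thesis .
   qed
   have tT: "t \<in> {0..T}" using t by simp
   have point: "AE w in M. ennreal ((X t w - Y t w)^2)
     \<le> ennreal (E * (x - y)^2) * ennreal (exp (2 * A t w)) + ennreal (E * T) * (\<integral>\<^sup>+s\<in>{0..t}. ennreal (H s w) \<partial>lborel)"
    using solutionD(5)[OF X] solutionD(5)[OF Y] AE_space
   proof eventually_elim
    case (elim w)
    note w = elim(3)
    have Am [measurable]: "(\<lambda>s. A s w) \<in> borel_measurable borel" by (rule A_meas) (use w in auto)
    have \<epsilon>m [measurable]: "(\<lambda>s. \<epsilon> s w) \<in> borel_measurable borel"
    proof -
     have [measurable]: "(\<lambda>s. X s w) \<in> borel_measurable borel" "(\<lambda>s. Y s w) \<in> borel_measurable borel"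
      using solutionD(2)[OF X w] solutionD(2)[OF Y w] by (auto intro: borel_measurable_continuous_onI)
     show ?thesis unfolding \<epsilon>_def by measurable
    qed
    define p where "p s = \<epsilon> s w + C * m s" for s
    have p0: "0 \<le> p s" for s using \<epsilon>(1)[of s w] m0[of s] C_pos by (simp add: p_def)
    have pm [measurable]: "p \<in> borel_measurable borel" unfolding p_def by measurable
    have pb: "p s \<le> 4 * K + C * mb" if "s \<in> {0..t}" for s
    proof -
     have "C * m s \<le> C * mb" using mb[of s] that t C_pos by (intro mult_left_mono) auto
     then show ?thesis using \<epsilon>(2)[of s w] by (simp add: p_def)
    qed
    have ip: "set_integrable lborel {0..t} p"
     using p0 pb by (intro set_integrable_bounded[OF pm, where B = "4 * K + C * mb"]) auto
    have Ab: "\<bar>A s w\<bar> \<le> L * T" if "s \<in> {0..t}" for s using A_bound[of s w] that t w by auto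
    have LT: "A t w - A s w \<le> 2 * (L * T)" if "s \<in> {0..t}" for s
     using Ab[OF that] Ab[of t] t by (auto simp: abs_le_iff)
    let ?w = "\<lambda>s. exp (A t w - A s w) * p s"
    have wb: "\<bar>?w s\<bar> \<le> exp (2 * (L * T)) * (4 * K + C * mb)" if "s \<in> {0..t}" for s
     using p0[of s] pb[OF that] LT[OF that] by (simp add: abs_mult) (intro mult_mono, auto)
    have iw: "set_integrable lborel {0..t} ?w"
     by (rule set_integrable_bounded[OF _ wb]) measurable
    have iw2: "set_integrable lborel {0..t} (\<lambda>s. (?w s)^2)"
    proof (rule set_integrable_bounded)
     show "\<bar>(?w s)^2\<bar> \<le> (exp (2 * (L * T)) * (4 * K + C * mb))^2" if "s \<in> {0..t}" for s
      using wb[OF that] power_mono[OF wb[OF that], of 2] by simp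
    qed measurable
    have D: "\<bar>X t w - Y t w\<bar> \<le> exp (C * t) * (exp (A t w) * \<bar>x - y\<bar> + (LINT s:{0..t}|lborel. ?w s))"
     by (rule pathwise_difference[OF X Y reg f_def t w elim(1,2) _ ip]) (auto simp: p_def \<epsilon>_def m_def A_def)
    let ?P = "exp (A t w) * \<bar>x - y\<bar>" and ?J = "LINT s:{0..t}|lborel. ?w s" and ?JJ = "LINT s:{0..t}|lborel. (?w s)^2"
    have J0: "?J \<ge> 0" using p0 by (simp add: set_lebesgue_integral_def)
    have "exp (C * t) * (?P + ?J) \<le> exp (C * T) * (?P + ?J)"
     using t C_pos J0 by (intro mult_right_mono add_nonneg_nonneg) auto
    then have "\<bar>X t w - Y t w\<bar> \<le> exp (C * T) * (?P + ?J)" using D by linarith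
    then have "\<bar>X t w - Y t w\<bar>^2 \<le> (exp (C * T) * (?P + ?J))^2" by (intro power_mono) auto
    also have "\<dots> = (exp (C * T))^2 * (?P + ?J)^2" by (rule power_mult_distrib)
    also have "\<dots> \<le> (exp (C * T))^2 * (2 * ?P^2 + 2 * ?J^2)"
     using sum_squares_bound[of ?P ?J] by (intro mult_left_mono) (simp_all only: power2_sum, simp_all)
    also have "\<dots> = E * (?P^2 + ?J^2)" by (simp add: E_def algebra_simps)
    also have "?P^2 = (x - y)^2 * exp (2 * A t w)"
     by (simp add: power_mult_distrib power2_eq_square[of "exp _"] flip: exp_add)
    also have "?J^2 \<le> T * ?JJ"
    proof -
     have "?J^2 \<le> (t - 0) * ?JJ" by (rule square_set_integral_le[OF iw iw2 t(1)])
     also have "\<dots> \<le> T * ?JJ" using t by (intro mult_right_mono) (auto simp: set_lebesgue_integral_def)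
     finally show ?thesis .
    qed
    finally have "(X t w - Y t w)^2 \<le> E * ((x - y)^2 * exp (2 * A t w) + T * ?JJ)"
     using E0 by simp
    then have "ennreal ((X t w - Y t w)^2) \<le> ennreal (0 + (E * (x - y)^2) * exp (2 * A t w) + (E * T) * ?JJ)"
     by (intro ennreal_leI) (simp add: algebra_simps)
    also have "\<dots> = ennreal 0 + ennreal (E * (x - y)^2) * ennreal (exp (2 * A t w)) + ennreal (E * T) * ennreal ?JJ"
     using E0 T_pos by (intro ennreal_combination[symmetric]) (auto simp: set_lebesgue_integral_def)
    also have "ennreal ?JJ = (\<integral>\<^sup>+s\<in>{0..t}. ennreal ((?w s)^2) \<partial>lborel)"
     by (rule nn_integral_set_integral[symmetric, OF iw2]) simp
    also have "ennreal 0 + ennreal (E * (x - y)^2) * ennreal (exp (2 * A t w)) + ennreal (E * T) * \<dots>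
     \<le> ennreal 0 + ennreal (E * (x - y)^2) * ennreal (exp (2 * A t w)) + ennreal (E * T) * (\<integral>\<^sup>+s\<in>{0..t}. ennreal (H s w) \<partial>lborel)"
     unfolding H_def p_def \<kappa>_def
     by (intro add_left_mono mult_left_mono nn_integral_mono mult_right_mono ennreal_leI weighted_square_le \<epsilon> \<eta>) auto
    finally show ?case by simp
   qed
   have EA: "EE (\<lambda>w. exp (p * A s w)) \<le> ennreal q" if "s \<in> {0..T}" "k p \<le> q" for s p
   proof -
    have "EE (\<lambda>w. exp (p * A s w)) \<le> ennreal (k p)"
     unfolding A_def using that by (intro k[OF X Y xy reg]) auto
    also have "\<dots> \<le> ennreal q" using that by (intro ennreal_leI)
    finally show ?thesis .
   qed
   define \<epsilon>' where "\<epsilon>' s = EE (\<epsilon> s)" for s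
   have \<epsilon>M [measurable]: "(\<lambda>p. \<epsilon> (fst p) (snd p)) \<in> borel_measurable (lborel \<Otimes>\<^sub>M M)" "\<epsilon> s \<in> borel_measurable M" for s
    unfolding \<epsilon>_def by measurable
   have \<epsilon>'m [measurable]: "\<epsilon>' \<in> borel_measurable borel"
    unfolding \<epsilon>'_def \<epsilon>_def by measurable
   have EH: "EE (H s) \<le> ennreal (2 * \<eta> * q + 4 * C^2 * q * (m s)^2) + ennreal \<kappa> * \<epsilon>' s"
    if s: "s \<in> {0..t}" for s
   proof -
    have sT: "s \<in> {0..T}" using s t by auto
    have "EE (H s)
     = (\<integral>\<^sup>+w. (ennreal \<eta> * (ennreal (exp (8 * A t w)) + ennreal (exp (- 8 * A s w))) + ennreal \<kappa> * ennreal (\<epsilon> s w))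
      + ennreal (2 * (C * m s)^2) * (ennreal (exp (4 * A t w)) + ennreal (exp (- 4 * A s w))) \<partial>M)"
     unfolding H_def using \<eta> \<kappa> \<epsilon>
     by (intro nn_integral_cong) (simp add: ennreal_plus ennreal_mult add_nonneg_nonneg)
    also have "\<dots> = (ennreal \<eta> * ((EE (\<lambda>w. exp (8 * A t w))) + EE (\<lambda>w. exp (- 8 * A s w))) + ennreal \<kappa> * \<epsilon>' s)
      + ennreal (2 * (C * m s)^2) * ((EE (\<lambda>w. exp (4 * A t w))) + EE (\<lambda>w. exp (- 4 * A s w)))"
     unfolding \<epsilon>'_def by (simp add: nn_integral_add nn_integral_cmult)
    also have "\<dots> \<le> (ennreal \<eta> * (ennreal q + ennreal q) + ennreal \<kappa> * \<epsilon>' s) + ennreal (2 * (C * m s)^2) * (ennreal q + ennreal q)"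
     by (intro add_mono mult_left_mono EA sT tT q order_refl) auto
    also have "\<dots> = ennreal (2 * \<eta> * q + 4 * C^2 * q * (m s)^2) + ennreal \<kappa> * \<epsilon>' s"
    proof -
     have "ennreal \<eta> * (ennreal q + ennreal q) + ennreal (2 * (C * m s)^2) * (ennreal q + ennreal q)
      = ennreal (\<eta> * (q + q) + 2 * (C * m s)^2 * (q + q))"
      using ennreal_combination[of 0 \<eta> "q + q" "2 * (C * m s)^2" "q + q"] \<eta> q(1)
      by (simp only: ennreal_plus[OF q(1) q(1), symmetric]) simp
     also have "\<eta> * (q + q) + 2 * (C * m s)^2 * (q + q) = 2 * \<eta> * q + 4 * C^2 * q * (m s)^2"
      by (simp add: power_mult_distrib algebra_simps)
     finally show ?thesis by (simp add: add_ac)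
    qed
    finally show ?thesis .
   qed
   have "(\<integral>\<^sup>+s\<in>{0..t}. \<epsilon>' s \<partial>lborel) \<le> ennreal (2 * e)"
   proof -
    have "(\<integral>\<^sup>+s\<in>{0..t}. \<epsilon>' s \<partial>lborel) \<le>
     (\<integral>\<^sup>+s. path_error f g X s * indicator {0..T} s
      + path_error f g Y s * indicator {0..T} s \<partial>lborel)"
    proof (rule nn_integral_mono)
     fix s
     have "\<epsilon>' s = path_error f g X s + path_error f g Y s"
      unfolding \<epsilon>'_def \<epsilon>_def by (simp add: ennreal_plus nn_integral_add)
     then show "\<epsilon>' s * indicator {0..t} s \<le> path_error f g X s * indicator {0..T} s
      + path_error f g Y s * indicator {0..T} s"
      using t by (simp add: indicator_def)
    qed
    also have "\<dots> = (\<integral>\<^sup>+s\<in>{0..T}. path_error f g X s \<partial>lborel)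
      + (\<integral>\<^sup>+s\<in>{0..T}. path_error f g Y s \<partial>lborel)"
     by (rule nn_integral_add) measurable
    also have "\<dots> \<le> ennreal e + ennreal e" by (intro add_mono approxX approxY)
    also have "\<dots> = ennreal (2 * e)" using e by (simp flip: ennreal_plus)
    finally show ?thesis .
   qed
   note \<epsilon>'e = this
   have HH: "(\<integral>\<^sup>+w. (\<integral>\<^sup>+s\<in>{0..t}. ennreal (H s w) \<partial>lborel) \<partial>M)
     \<le> ennreal (2 * \<eta> * q * T + 4 * C^2 * q * I + \<kappa> * (2 * e))"
   proof -
    have ik: "set_integrable lborel {0..t} (\<lambda>s. 2 * \<eta> * q)"
     by (rule set_integral_continuous(1)[OF continuous_on_const])
    have im': "set_integrable lborel {0..t} (\<lambda>s. 4 * C^2 * q * (m s)^2)" using im by simp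
    have "(\<integral>\<^sup>+w. (\<integral>\<^sup>+s\<in>{0..t}. ennreal (H s w) \<partial>lborel) \<partial>M)
     = (\<integral>\<^sup>+s. (\<integral>\<^sup>+w. ennreal (H s w) * indicator {0..t} s \<partial>M) \<partial>lborel)"
    proof -
     interpret pair_sigma_finite lborel M by unfold_locales
     show ?thesis by (rule Fubini') (unfold H_def \<epsilon>_def, measurable)
    qed
    also have "\<dots> \<le> (\<integral>\<^sup>+s. ennreal (2 * \<eta> * q + 4 * C^2 * q * (m s)^2) * indicator {0..t} s + ennreal \<kappa> * (\<epsilon>' s * indicator {0..t} s) \<partial>lborel)"
     using EH by (intro nn_integral_mono) (auto simp: indicator_def)
    also have "\<dots> = (\<integral>\<^sup>+s\<in>{0..t}. ennreal (2 * \<eta> * q + 4 * C^2 * q * (m s)^2) \<partial>lborel)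
      + ennreal \<kappa> * (\<integral>\<^sup>+s\<in>{0..t}. \<epsilon>' s \<partial>lborel)"
     by (subst nn_integral_add) (auto simp: nn_integral_cmult)
    also have "(\<integral>\<^sup>+s\<in>{0..t}. ennreal (2 * \<eta> * q + 4 * C^2 * q * (m s)^2) \<partial>lborel)
     = ennreal (LINT s:{0..t}|lborel. 2 * \<eta> * q + 4 * C^2 * q * (m s)^2)"
     using \<eta> q(1) by (intro nn_integral_set_integral set_integral_add(1)[OF ik im'] add_nonneg_nonneg mult_nonneg_nonneg) auto
    also have "(LINT s:{0..t}|lborel. 2 * \<eta> * q + 4 * C^2 * q * (m s)^2) = 2 * \<eta> * q * t + 4 * C^2 * q * I"
     unfolding set_integral_add(2)[OF ik im'] using t by (simp add: set_integral_const I_def)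
    also have "ennreal (2 * \<eta> * q * t + 4 * C^2 * q * I) + ennreal \<kappa> * (\<integral>\<^sup>+s\<in>{0..t}. \<epsilon>' s \<partial>lborel)
     \<le> ennreal (2 * \<eta> * q * T + 4 * C^2 * q * I) + ennreal \<kappa> * ennreal (2 * e)"
     using t \<eta> q(1) by (intro add_mono mult_left_mono \<epsilon>'e ennreal_leI order_refl) auto
    also have "\<dots> = ennreal (2 * \<eta> * q * T + 4 * C^2 * q * I + \<kappa> * (2 * e))"
     using \<eta> q(1) T_pos I0 \<kappa> e by (simp add: ennreal_plus ennreal_mult add_nonneg_nonneg)
    finally show ?thesis .
   qed
   have "EE (\<lambda>w. (X t w - Y t w)^2)
    \<le> (\<integral>\<^sup>+w. ennreal (E * (x - y)^2) * ennreal (exp (2 * A t w)) + ennreal (E * T) * (\<integral>\<^sup>+s\<in>{0..t}. ennreal (H s w) \<partial>lborel) \<partial>M)"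
    by (rule nn_integral_mono_AE[OF point])
   also have "\<dots> = ennreal (E * (x - y)^2) * EE (\<lambda>w. exp (2 * A t w))
     + ennreal (E * T) * (\<integral>\<^sup>+w. (\<integral>\<^sup>+s\<in>{0..t}. ennreal (H s w) \<partial>lborel) \<partial>M)"
   proof -
    have [measurable]: "(\<lambda>w. \<integral>\<^sup>+s. ennreal (H s w) * indicator {0..t} s \<partial>lborel) \<in> borel_measurable M"
     unfolding H_def \<epsilon>_def by measurable
    show ?thesis by (simp add: nn_integral_add nn_integral_cmult)
   qed
   also have "\<dots> \<le> ennreal (E * (x - y)^2) * ennreal q + ennreal (E * T) * ennreal (2 * \<eta> * q * T + 4 * C^2 * q * I + \<kappa> * (2 * e))"
    by (intro add_mono mult_left_mono EA tT q(2) HH) auto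
   also have "\<dots> = ennreal (0 + (E * (x - y)^2) * q + (E * T) * (2 * \<eta> * q * T + 4 * C^2 * q * I + \<kappa> * (2 * e)))"
    using ennreal_combination[of 0 "E * (x - y)^2" q "E * T" "2 * \<eta> * q * T + 4 * C^2 * q * I + \<kappa> * (2 * e)"]
     E0 q(1) T_pos \<eta> I0 \<kappa> e by (simp add: add_nonneg_nonneg)
   also have "\<dots> \<le> ennreal (c * ((x - y)^2 + I) + \<delta>)"
   proof (rule ennreal_leI)
    have "0 + (E * (x - y)^2) * q + (E * T) * (2 * \<eta> * q * T + 4 * C^2 * q * I + \<kappa> * (2 * e))
     = E * q * (x - y)^2 + 4 * E * T * C^2 * q * I + 2 * E * T^2 * q * \<eta> + 2 * E * T * \<kappa> * e"
     by (simp add: algebra_simps power2_eq_square)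
    also have "\<dots> \<le> E * q * (x - y)^2 + 4 * E * T * C^2 * q * I + \<delta>" using \<eta>\<delta> e\<delta> by linarith
    also have "\<dots> \<le> c * ((x - y)^2 + I) + \<delta>"
    proof -
     have "0 \<le> E * q * I" "0 \<le> 4 * E * T * C^2 * q * (x - y)^2" using E0 q(1) I0 T_pos by auto
     then show ?thesis unfolding c_def by (simp add: distrib_left distrib_right)
    qed
    finally show "0 + (E * (x - y)^2) * q + (E * T) * (2 * \<eta> * q * T + 4 * C^2 * q * I + \<kappa> * (2 * e)) \<le> c * ((x - y)^2 + I) + \<delta>" .
   qed
   also have "\<dots> = ennreal (c * ((x - y)^2 + I)) + ennreal \<delta>"
    using c0 I0 \<delta> by (intro ennreal_plus) auto
   finally show "EE (\<lambda>w. (X t w - Y t w)^2) \<le> ennreal (c * ((x - y)^2 + I)) + ennreal \<delta>" .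
  qed
  then show "EE (\<lambda>w. (X t w - Y t w)^2)
   \<le> ennreal (c * ((x - y)^2 + (LINT s:{0..t}|lborel. (mean_distance X Y s)^2)))"
   by (simp add: I_def m_def)
 qed
qed

text \<open>The squared mean distance is at most the mean of the squared distance, so that Gronwall's inequality applies.\<close>

lemma mean_square_stability:
 fixes R :: real
 obtains c where "c \<ge> 0" "\<And>x y X Y t. solution x X \<Longrightarrow> solution y Y \<Longrightarrow> \<bar>x\<bar> \<le> R \<Longrightarrow> \<bar>y\<bar> \<le> R \<Longrightarrow> t \<in> {0..T} \<Longrightarrow>
  (EE (\<lambda>w. (X t w - Y t w)^2)) \<le> ennreal (c * (x - y)^2)"
proof -
 obtain c where c: "c \<ge> 0" and diff: "\<And>x y X Y t. solution x X \<Longrightarrow> solution y Y \<Longrightarrow> \<bar>x\<bar> \<le> R \<Longrightarrow> \<bar>y\<bar> \<le> R \<Longrightarrow> 0 \<le> t \<Longrightarrow> t \<le> T \<Longrightarrow>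
  (EE (\<lambda>w. (X t w - Y t w)^2))
   \<le> ennreal (c * ((x - y)^2 + (LINT s:{0..t}|lborel. (mean_distance X Y s)^2)))"
  by (rule mean_square_difference[of R]) (rule that, assumption, blast)
 show ?thesis
 proof (rule that[of "c * (1 + T * (c * exp (c * T)))"])
  show "c * (1 + T * (c * exp (c * T))) \<ge> 0" using c T_pos by simp
  fix x y X Y t
  assume X: "solution x X" and Y: "solution y Y" and xy: "\<bar>x\<bar> \<le> R" "\<bar>y\<bar> \<le> R" and t: "t \<in> {0..T}"
  let ?m = "mean_distance X Y"
  have cm: "continuous_on {0..T} (\<lambda>s. (?m s)^2)"
   by (intro continuous_intros mean_distance_properties(1)[OF X Y])
  have I0: "0 \<le> (LINT r:{0..s}|lborel. (?m r)^2)" for s by (simp add: set_lebesgue_integral_def)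
  have m2: "(?m s)^2 \<le> c * (x - y)^2 + c * (LINT r:{0..s}|lborel. (?m r)^2)" if s: "s \<in> {0..T}" for s
  proof -
   let ?c = "c * ((x - y)^2 + (LINT r:{0..s}|lborel. (?m r)^2))"
   have c': "0 \<le> ?c" using c I0 by (intro mult_nonneg_nonneg add_nonneg_nonneg) auto
   note [measurable] = solutionD(1)[OF X] solutionD(1)[OF Y]
   have le: "EE (\<lambda>w. (X s w - Y s w)^2) \<le> ennreal ?c"
    using s by (intro diff[OF X Y xy]) auto
   have i2: "integrable M (\<lambda>w. (X s w - Y s w)^2)"
    using le by (intro integrableI_bounded) (auto intro: le_less_trans)
   have "ennreal (\<integral>w. (X s w - Y s w)^2 \<partial>M) \<le> ennreal ?c"
    using le by (subst nn_integral_eq_integral[OF i2, symmetric]) auto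
   then have "(\<integral>w. \<bar>X s w - Y s w\<bar>^2 \<partial>M) \<le> ?c" using c' by simp
   moreover have "(?m s)^2 \<le> (\<integral>w. \<bar>X s w - Y s w\<bar>^2 \<partial>M)"
   proof -
    have i1: "integrable M (\<lambda>w. \<bar>X s w - Y s w\<bar>)" using solutionD(4)[OF X s] solutionD(4)[OF Y s] by simp
    have "0 \<le> variance (\<lambda>w. \<bar>X s w - Y s w\<bar>)" by (rule variance_positive)
    also have "\<dots> = (\<integral>w. \<bar>X s w - Y s w\<bar>^2 \<partial>M) - (?m s)^2"
     unfolding mean_distance_def using i1 i2 by (intro variance_eq) auto
    finally show ?thesis by simp
   qed
   ultimately show ?thesis by (simp add: distrib_left)
  qed
  have "(?m s)^2 \<le> c * (x - y)^2 * exp (c * T)" if s: "s \<in> {0..T}" for s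
  proof -
   have "(?m s)^2 \<le> c * (x - y)^2 * exp (c * s)" by (rule Gronwall[OF cm c m2 s])
   also have "\<dots> \<le> c * (x - y)^2 * exp (c * T)" using s c by (intro mult_left_mono) (auto intro: mult_left_mono)
   finally show ?thesis .
  qed
  note mb = this
  have "(LINT s:{0..t}|lborel. (?m s)^2) \<le> (LINT s:{0..t}|lborel. c * (x - y)^2 * exp (c * T))"
   using t mb by (intro set_integral_mono set_integral_continuous(1) continuous_on_const
     continuous_on_subset[OF cm]) auto
  also have "\<dots> = c * (x - y)^2 * exp (c * T) * t" using t by (simp add: set_integral_const)
  also have "\<dots> \<le> c * (x - y)^2 * exp (c * T) * T" using t c by (intro mult_left_mono) auto
  finally have "c * ((x - y)^2 + (LINT s:{0..t}|lborel. (?m s)^2)) \<le> c * ((x - y)^2 + c * (x - y)^2 * exp (c * T) * T)"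
   using c by (intro mult_left_mono) auto
  also have "\<dots> = c * (1 + T * (c * exp (c * T))) * (x - y)^2" by (simp add: algebra_simps)
  finally have "ennreal (c * ((x - y)^2 + (LINT s:{0..t}|lborel. (?m s)^2))) \<le> ennreal (c * (1 + T * (c * exp (c * T))) * (x - y)^2)"
   by (rule ennreal_leI)
  with diff[OF X Y xy, of t] t show "EE (\<lambda>w. (X t w - Y t w)^2) \<le> ennreal (c * (1 + T * (c * exp (c * T))) * (x - y)^2)"
   by (auto intro: order_trans)
 qed
qed

lemma solution_square_integrable:
 assumes X: "solution x X" and t: "t \<in> {0..T}"
 shows "integrable M (\<lambda>w. (X t w)^2)"
proof -
 obtain a where a: "a \<ge> 0" "AE w in M. \<forall>t\<in>{0..T}. \<bar>X t w\<bar> \<le> speed_bound a w t"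
  using solution_growth[OF X] .
 have "AE w in M. ennreal ((X t w)^2) \<le> ennreal ((speed_bound a w t)^2)"
  using a(2)
 proof eventually_elim
  case (elim w)
  then have "\<bar>X t w\<bar>^2 \<le> (speed_bound a w t)^2" using t by (intro power_mono) auto
  then show ?case by (simp add: ennreal_leI)
 qed
 then have "EE (\<lambda>w. (X t w)^2) \<le> EE (\<lambda>w. (speed_bound a w t)^2)" by (rule nn_integral_mono_AE)
 also have "\<dots> \<le> ennreal (3 * a^2 * (1 + T + T ^ 3))" using t by (intro speed_bound_second_moment) auto
 also have "\<dots> < \<infinity>" by simp
 finally show ?thesis using solutionD(1)[OF X] by (intro integrableI_bounded) auto
qed

end

section \<open>Test functions and uniqueness of weak derivatives\<close>

text \<open>The functions \<open>poly p (1 / x) * exp (- 1 / x)\<close> of positive \<open>x\<close>, extended by zero, are smooth since they are closed under differentiation.\<close>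

definition flat_exp :: "real poly \<Rightarrow> real \<Rightarrow> real" where
 "flat_exp p x = (if x > 0 then poly p (1 / x) * exp (- (1 / x)) else 0)"

definition flat_exp_deriv :: "real poly \<Rightarrow> real poly" where
 "flat_exp_deriv p = [:0, 0, 1:] * (p - pderiv p)"

lemma poly_times_exp_tendsto_0: "((\<lambda>y. poly p y * exp (- y)) \<longlongrightarrow> (0::real)) at_top"
proof -
 have "((\<lambda>y. \<Sum>i\<le>degree p. coeff p i * (y ^ i / exp y)) \<longlongrightarrow> (\<Sum>i\<le>degree p. coeff p i * 0)) at_top"
  by (intro tendsto_intros tendsto_power_div_exp_0)
 then show ?thesis
  by (simp add: poly_altdef sum_distrib_right sum_divide_distrib exp_minus field_simps)
qed

lemma DERIV_flat_exp: "(flat_exp p has_real_derivative flat_exp (flat_exp_deriv p) x) (at x)"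
proof (cases x "0 :: real" rule: linorder_cases)
 case less
 have "((\<lambda>x. 0) has_real_derivative 0) (at x)" by simp
 then have "(flat_exp p has_real_derivative 0) (at x)"
  by (rule has_field_derivative_transform_within_open[of _ _ _ "{..<0}"]) (use less in \<open>auto simp: flat_exp_def\<close>)
 then show ?thesis using less by (simp add: flat_exp_def)
next
 case greater
 have "((\<lambda>x. poly p (1 / x) * exp (- (1 / x))) has_real_derivative
   (poly (pderiv p) (1 / x) * (- (1 / x^2))) * exp (- (1 / x)) + exp (- (1 / x)) * (1 / x^2) * poly p (1 / x)) (at x)"
 proof (rule DERIV_mult)
  have i: "((\<lambda>x. 1 / x) has_real_derivative - (1 / x^2)) (at x)"
   using greater by (auto intro!: derivative_eq_intros simp: power2_eq_square)
  show "((\<lambda>x. poly p (1 / x)) has_real_derivative poly (pderiv p) (1 / x) * (- (1 / x^2))) (at x)"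
   by (rule DERIV_chain2[OF poly_DERIV i])
  show "((\<lambda>x. exp (- (1 / x))) has_real_derivative exp (- (1 / x)) * (1 / x^2)) (at x)"
   using DERIV_chain2[OF DERIV_exp DERIV_minus[OF i]] by simp
 qed
 also have "(poly (pderiv p) (1 / x) * (- (1 / x^2))) * exp (- (1 / x)) + exp (- (1 / x)) * (1 / x^2) * poly p (1 / x)
   = flat_exp (flat_exp_deriv p) x"
  using greater by (simp add: flat_exp_def flat_exp_deriv_def power2_eq_square algebra_simps)
 finally show ?thesis
  by (rule has_field_derivative_transform_within_open[of _ _ _ "{0<..}"]) (use greater in \<open>auto simp: flat_exp_def\<close>)
next
 case equal
 have "((\<lambda>h. flat_exp p h / h) \<longlongrightarrow> 0) (at 0)"
 proof (rule filterlim_split_at)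
  have "((\<lambda>h. 0 :: real) \<longlongrightarrow> 0) (at_left 0)" by simp
  then show "((\<lambda>h. flat_exp p h / h) \<longlongrightarrow> 0) (at_left 0)"
   by (rule Lim_transform_eventually) (auto simp: flat_exp_def eventually_at_filter)
  have "((\<lambda>h. poly (pCons 0 p) (inverse h) * exp (- inverse h)) \<longlongrightarrow> 0) (at_right 0)"
   by (rule filterlim_compose[OF poly_times_exp_tendsto_0 filterlim_inverse_at_top_right])
  then show "((\<lambda>h. flat_exp p h / h) \<longlongrightarrow> 0) (at_right 0)"
   by (rule Lim_transform_eventually) (auto simp: flat_exp_def eventually_at_filter inverse_eq_divide)
 qed
 then show ?thesis unfolding equal by (simp add: has_field_derivative_iff flat_exp_def)
qed

text \<open>Sums of products of two flat exponentials, one for each end point of the interval, are again closed under differentiation.\<close>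

inductive_set bump_algebra :: "real \<Rightarrow> real \<Rightarrow> real \<Rightarrow> (real \<Rightarrow> real) set" for n a b where
 base: "(\<lambda>x. c * (flat_exp p (n * (x - a)) * flat_exp q (n * (b - x)))) \<in> bump_algebra n a b"
| add: "f \<in> bump_algebra n a b \<Longrightarrow> g \<in> bump_algebra n a b \<Longrightarrow> (\<lambda>x. f x + g x) \<in> bump_algebra n a b"

lemma bump_algebra_derivative:
 "f \<in> bump_algebra n a b \<Longrightarrow> \<exists>f'\<in>bump_algebra n a b. \<forall>x. (f has_real_derivative f' x) (at x)"
proof (induction rule: bump_algebra.induct)
 case (base c p q)
 let ?f' = "\<lambda>x. (c * n) * (flat_exp (flat_exp_deriv p) (n * (x - a)) * flat_exp q (n * (b - x)))
   + (- c * n) * (flat_exp p (n * (x - a)) * flat_exp (flat_exp_deriv q) (n * (b - x)))"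
 have "?f' \<in> bump_algebra n a b" by (intro bump_algebra.intros)
 moreover have "((\<lambda>x. c * (flat_exp p (n * (x - a)) * flat_exp q (n * (b - x)))) has_real_derivative ?f' x) (at x)" for x
  by (auto intro!: derivative_eq_intros DERIV_chain2[OF DERIV_flat_exp] simp: algebra_simps)
 ultimately show ?case by (intro bexI[of _ ?f'] allI)
next
 case (add f g)
 then obtain f' g' where "f' \<in> bump_algebra n a b" "g' \<in> bump_algebra n a b"
  "\<forall>x. (f has_real_derivative f' x) (at x)" "\<forall>x. (g has_real_derivative g' x) (at x)" by blast
 then show ?case
  by (intro bexI[of _ "\<lambda>x. f' x + g' x"]) (auto intro: bump_algebra.add DERIV_add)
qed

lemma bump_algebra_smooth:
 assumes "f \<in> bump_algebra n a b"
 shows "(deriv ^^ k) f differentiable at x"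
proof -
 have "(deriv ^^ k) f \<in> bump_algebra n a b"
 proof (induction k)
  case (Suc k)
  then obtain f' where f': "f' \<in> bump_algebra n a b" "\<forall>x. ((deriv ^^ k) f has_real_derivative f' x) (at x)"
   using bump_algebra_derivative by blast
  then have "deriv ((deriv ^^ k) f) = f'" by (intro ext DERIV_imp_deriv) auto
  then show ?case using f' by simp
 qed (use assms in simp)
 then show ?thesis
  using bump_algebra_derivative real_differentiable_def by blast
qed

text \<open>The scaling makes the bumps converge to the indicator of the open interval.\<close>

definition bump :: "nat \<Rightarrow> real \<Rightarrow> real \<Rightarrow> real \<Rightarrow> real" where
 "bump n a b x = flat_exp 1 (real (Suc n) * (x - a)) * flat_exp 1 (real (Suc n) * (b - x))"

lemma bump_eq_0: "x \<notin> {a<..<b} \<Longrightarrow> bump n a b x = 0"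
 by (auto simp: bump_def flat_exp_def zero_less_mult_iff not_less)

lemma bump_bounds: "0 \<le> bump n a b x" "bump n a b x \<le> 1"
proof -
 have "0 \<le> flat_exp 1 y \<and> flat_exp 1 y \<le> 1" for y by (simp add: flat_exp_def)
 then show "0 \<le> bump n a b x" "bump n a b x \<le> 1"
  unfolding bump_def by (auto intro: mult_le_one)
qed

lemma bump_tendsto: "(\<lambda>n. bump n a b x) \<longlonglongrightarrow> indicator {a<..<b} x"
proof (cases "x \<in> {a<..<b}")
 case True
 have *: "(\<lambda>n. exp (- (1 / (real (Suc n) * y)))) \<longlonglongrightarrow> 1" for y :: real
 proof -
  have "(\<lambda>n. exp (- ((1 / y) / real (Suc n)))) \<longlonglongrightarrow> exp (- 0)"
   by (intro tendsto_intros LIMSEQ_Suc[OF lim_const_over_n])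
  then show ?thesis by (simp add: mult.commute)
 qed
 have "bump n a b x = exp (- (1 / (real (Suc n) * (x - a)))) * exp (- (1 / (real (Suc n) * (b - x))))" for n
  using True by (simp add: bump_def flat_exp_def zero_less_mult_iff del: of_nat_Suc)
 then show ?thesis using True tendsto_mult[OF * *] by simp
next
 case False
 then show ?thesis by (simp add: bump_eq_0)
qed

lemma continuous_bump: "continuous_on UNIV (bump n a b)"
proof -
 have c: "continuous_on UNIV (flat_exp p)" for p
  by (rule DERIV_continuous_on) (use DERIV_flat_exp in \<open>auto intro: has_field_derivative_at_within\<close>)
 show ?thesis unfolding bump_def
  by (intro continuous_intros continuous_on_compose2[OF c]) auto
qed

lemma test_function_bump:
 assumes "{a..b} \<subseteq> U"
 shows "test_function U (bump n a b)"
 unfolding test_function_def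
proof (intro conjI allI)
 have "bump n a b = (\<lambda>x. 1 * (flat_exp 1 (real (Suc n) * (x - a)) * flat_exp 1 (real (Suc n) * (b - x))))"
  by (simp add: bump_def fun_eq_iff)
 then have "bump n a b \<in> bump_algebra (real (Suc n)) a b"
  using bump_algebra.base[of 1 1 "real (Suc n)" a 1 b] by (simp only:)
 then show "(deriv ^^ k) (bump n a b) differentiable at x" for k x by (rule bump_algebra_smooth)
 have sub: "closure {x. bump n a b x \<noteq> 0} \<subseteq> {a..b}"
 proof (rule closure_minimal)
  have "x \<in> {a..b}" if "bump n a b x \<noteq> 0" for x
   using that bump_eq_0[of x a b n] by (cases "x \<in> {a<..<b}") auto
  then show "{x. bump n a b x \<noteq> 0} \<subseteq> {a..b}" by blast
 qed simp
 then show "closure {x. bump n a b x \<noteq> 0} \<subseteq> U" using assms by blast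
 show "compact (closure {x. bump n a b x \<noteq> 0})"
  using bounded_subset[OF _ sub] by (simp add: compact_eq_bounded_closed)
qed

text \<open>The intervals are a generator that is stable under intersections, so all Borel sets have integral zero.\<close>

lemma AE_zero_of_interval_integrals:
 fixes v :: "real \<Rightarrow> real"
 assumes v: "set_integrable lebesgue {c<..<d} v"
  and zero: "\<And>a b. c \<le> a \<Longrightarrow> b \<le> d \<Longrightarrow> (LINT x:{a<..<b}|lebesgue. v x) = 0"
 shows "AE x in lebesgue. x \<in> {c<..<d} \<longrightarrow> v x = 0"
proof -
 let ?w = "\<lambda>x. indicator {c<..<d} x * v x"
 have w: "integrable lebesgue ?w" using v by (simp add: set_integrable_def)
 have z: "(\<integral>x. indicator A x * ?w x \<partial>lebesgue) = 0" if "A \<in> sets borel" for A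
 proof -
  have gen: "A \<in> sigma_sets UNIV (range atMost)" using that by (simp add: borel_eq_atMost)
  have "Int_stable (range (atMost :: real \<Rightarrow> _))" by (auto simp: Int_stable_def)
  moreover have "range (atMost :: real \<Rightarrow> _) \<subseteq> Pow UNIV" by simp
  ultimately show ?thesis using gen
  proof (induction rule: sigma_sets_induct_disjoint)
   case (basic A)
   then obtain a where A: "A = {..a}" by auto
   have "(\<integral>x. indicator A x * ?w x \<partial>lebesgue) = (\<integral>x. indicator {c<..<min a d} x * v x \<partial>lebesgue)"
    by (rule integral_discrete_difference[where X = "{a}"]) (auto simp: A indicator_def)
   also have "\<dots> = (LINT x:{c<..<min a d}|lebesgue. v x)" by (simp add: set_lebesgue_integral_def)
   also have "\<dots> = 0" by (rule zero) auto
   finally show ?case .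
  next
   case empty
   show ?case by simp
  next
   case (compl A)
   have "A \<in> sets borel" using compl.hyps by (simp add: borel_eq_atMost)
   then have A: "A \<in> sets lebesgue" by simp
   have "(\<integral>x. indicator (UNIV - A) x * ?w x \<partial>lebesgue) = (\<integral>x. ?w x - indicator A x * ?w x \<partial>lebesgue)"
    by (intro Bochner_Integration.integral_cong) (auto simp: indicator_def)
   also have "\<dots> = (\<integral>x. ?w x \<partial>lebesgue) - (\<integral>x. indicator A x * ?w x \<partial>lebesgue)"
   proof (rule Bochner_Integration.integral_diff[OF w])
    show "integrable lebesgue (\<lambda>x. indicator A x * ?w x)"
     using integrable_real_mult_indicator[OF A w] by (simp only: mult.commute)
   qed
   also have "(\<integral>x. ?w x \<partial>lebesgue) = (LINT x:{c<..<d}|lebesgue. v x)" by (simp add: set_lebesgue_integral_def)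
   finally show ?case using compl.IH zero[of c d] by simp
  next
   case (union A)
   have "A i \<in> sets borel" for i using union.hyps by (auto simp: borel_eq_atMost image_subset_iff)
   then have A: "A i \<in> sets lebesgue" for i by simp
   have "set_integrable lebesgue (\<Union>i. A i) ?w"
    using w A unfolding set_integrable_def real_scaleR_def
    by (subst mult.commute) (intro integrable_real_mult_indicator, auto)
   then have "(LINT x:(\<Union>i. A i)|lebesgue. ?w x) = (\<Sum>i. (LINT x:A i|lebesgue. ?w x))"
    using A union.hyps(1) by (intro lebesgue_integral_countable_add) (auto simp: disjoint_family_on_def)
   then show ?case using union.IH by (simp add: set_lebesgue_integral_def)
  qed
 qed
 have "AE x in lebesgue. ?w x = 0"
 proof (rule density_unique_real[OF w integrable_zero])
  fix A :: "real set" assume A: "A \<in> sets lebesgue"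
  obtain S N N' where SN: "S \<in> sets lborel" "A = S \<union> N" "N \<subseteq> N'" "N' \<in> null_sets lborel"
   using A by (auto elim: sets_completionE)
  have "AE x in lebesgue. x \<notin> N'" using SN(4) by (intro AE_completion AE_not_in)
  then have "AE x in lebesgue. indicator A x * ?w x = indicator S x * ?w x"
   by eventually_elim (use SN in \<open>auto simp: indicator_def\<close>)
  then have "(\<integral>x. indicator A x * ?w x \<partial>lebesgue) = (\<integral>x. indicator S x * ?w x \<partial>lebesgue)"
   using A SN(1) by (intro integral_cong_AE borel_measurable_times[OF _ borel_measurable_integrable[OF w]]
     borel_measurable_indicator) auto
  then show "(LINT x:A|lebesgue. ?w x) = (LINT x:A|lebesgue. 0)" using z[of S] SN(1) by (simp add: set_lebesgue_integral_def)
 qed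
 then show ?thesis by eventually_elim auto
qed

lemma abs_le_weighted_square:
 assumes "c > 0"
 shows "\<bar>y\<bar> \<le> 1 / c + c * (y^2 :: real)"
proof -
 have "0 \<le> (1 - c * \<bar>y\<bar>)^2 / c" using assms by simp
 also have "\<dots> = 1 / c + c * y^2 - 2 * \<bar>y\<bar>"
  using assms by (simp add: power2_eq_square field_simps)
 finally show ?thesis by simp
qed

lemma L2_on_integrable:
 assumes U: "open U" "bounded U" and v: "L2_on U v"
 shows "integrable (lebesgue_on U) v"
proof -
 have Us: "U \<in> sets lebesgue" "emeasure lebesgue U < \<infinity>"
  using U emeasure_bounded_finite[OF U(2)] by auto
 have "integrable (lebesgue_on U) (\<lambda>x. 1 + (v x)^2)"
  using v Us by (intro Bochner_Integration.integrable_add) (auto simp: L2_on_def integrable_restrict_space set_integrable_def)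
 then show ?thesis
 proof (rule Bochner_Integration.integrable_bound)
  show "v \<in> borel_measurable (lebesgue_on U)" using v by (simp add: L2_on_def)
  have "\<bar>y\<bar> \<le> 1 + y^2" for y :: real using abs_le_weighted_square[of 1 y] by simp
  then show "AE x in lebesgue_on U. norm (v x) \<le> norm (1 + (v x)^2)" by (auto intro: order_trans[OF _ abs_ge_self])
 qed
qed

text \<open>Bump functions are test functions and converge boundedly to indicators of intervals.\<close>

lemma fundamental_lemma:
 assumes U: "open U" "bounded U" and v: "integrable (lebesgue_on U) v"
  and orth: "\<And>\<phi>. test_function U \<phi> \<Longrightarrow> (\<integral>x. v x * \<phi> x \<partial>lebesgue_on U) = 0"
 shows "AE x in lebesgue_on U. v x = 0"
proof -
 have Us: "U \<in> sets lebesgue" using U by auto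
 define w where "w x = indicator U x * v x" for x
 have w: "integrable lebesgue w"
  unfolding w_def using v Us by (simp add: integrable_restrict_space set_integrable_def)
 have zero: "(LINT x:{a<..<b}|lebesgue. w x) = 0" if ab: "{a..b} \<subseteq> U" for a b
 proof -
  have "(\<lambda>n. \<integral>x. bump n a b x * w x \<partial>lebesgue) \<longlonglongrightarrow> (\<integral>x. indicator {a<..<b} x * w x \<partial>lebesgue)"
  proof (rule integral_dominated_convergence[where w = "\<lambda>x. \<bar>w x\<bar>"])
   have "bump n a b \<in> borel_measurable lebesgue" for n
    using continuous_bump[of n a b] by (intro measurable_completion) (auto intro: borel_measurable_continuous_onI)
   then show "(\<lambda>x. bump n a b x * w x) \<in> borel_measurable lebesgue" for n
    by (rule borel_measurable_times[OF _ borel_measurable_integrable[OF w]])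
   show "AE x in lebesgue. (\<lambda>n. bump n a b x * w x) \<longlonglongrightarrow> indicator {a<..<b} x * w x"
    by (intro AE_I2 tendsto_mult_right bump_tendsto)
   show "AE x in lebesgue. norm (bump n a b x * w x) \<le> \<bar>w x\<bar>" for n
    using bump_bounds by (intro AE_I2) (auto simp: abs_mult intro!: mult_left_le_one_le)
  qed (use w in \<open>auto intro!: borel_measurable_times borel_measurable_indicator\<close>)
  moreover have "(\<integral>x. bump n a b x * w x \<partial>lebesgue) = 0" for n
   using orth[OF test_function_bump[OF ab, of n]] Us by (simp add: integral_restrict_space w_def mult_ac)
  ultimately show ?thesis by (simp add: set_lebesgue_integral_def LIMSEQ_const_iff)
 qed
 \<comment> \<open>The open set is a countable union of intervals with rational endpoints.\<close>
 let ?I = "{(c, d). c \<in> \<rat> \<and> d \<in> \<rat> \<and> {c..d} \<subseteq> U}"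
 have "countable ?I"
  by (rule countable_subset[of _ "\<rat> \<times> \<rat>"]) (auto simp: countable_rat)
 moreover have "AE x in lebesgue. x \<in> {c<..<d} \<longrightarrow> w x = 0" if "{c..d} \<subseteq> U" for c d
 proof (rule AE_zero_of_interval_integrals)
  have "set_integrable lebesgue UNIV w" using w by (simp add: set_integrable_def)
  then show "set_integrable lebesgue {c<..<d} w" by (rule set_integrable_subset) auto
  show "(LINT x:{a<..<b}|lebesgue. w x) = 0" if "c \<le> a" "b \<le> d" for a b
   by (rule zero, rule order_trans[OF _ \<open>{c..d} \<subseteq> U\<close>]) (use that in auto)
 qed
 ultimately have "AE x in lebesgue. \<forall>p\<in>?I. x \<in> {fst p<..<snd p} \<longrightarrow> w x = 0"
  by (subst AE_ball_countable) (auto simp del: greaterThanLessThan_iff)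
 then have "AE x in lebesgue. x \<in> U \<longrightarrow> v x = 0"
 proof eventually_elim
  case (elim x)
  show ?case
  proof
   assume "x \<in> U"
   then obtain e where e: "e > 0" "ball x e \<subseteq> U" using U(1) open_contains_ball by blast
   obtain c where c: "c \<in> \<rat>" "x - e < c" "c < x" using Rats_dense_in_real[of "x - e" x] e by auto
   obtain d where d: "d \<in> \<rat>" "x < d" "d < x + e" using Rats_dense_in_real[of x "x + e"] e by auto
   have "{c..d} \<subseteq> U" using c d e(2) by (auto simp: ball_def dist_real_def subset_iff)
   then show "v x = 0" using elim[THEN bspec, of "(c, d)"] c d \<open>x \<in> U\<close> by (auto simp: w_def)
  qed
 qed
 then show ?thesis using Us by (simp add: AE_restrict_space_iff)
qed

section \<open>Square-integrable functions on an interval\<close>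

text \<open>Along a subsequence with mean distances of order \<open>2 powr (- k)\<close> the functions converge almost everywhere.\<close>

lemma L2_Cauchy_converges:
 fixes f :: "nat \<Rightarrow> 'a \<Rightarrow> real"
 assumes M: "finite_measure M" and [measurable]: "\<And>n. f n \<in> borel_measurable M"
  and Cauchy: "\<And>m n. n \<le> m \<Longrightarrow> (\<integral>\<^sup>+x. ennreal ((f m x - f n x)^2) \<partial>M) \<le> ennreal (e n)" and e: "e \<longlonglongrightarrow> 0"
 obtains g where "g \<in> borel_measurable M" "\<And>n. (\<integral>\<^sup>+x. ennreal ((g x - f n x)^2) \<partial>M) \<le> ennreal (e n)"
proof -
 interpret finite_measure M by fact
 have "\<forall>k. \<exists>n. \<forall>m\<ge>n. e m \<le> (1 / 4) ^ k"
 proof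
  fix k
  have "\<forall>\<^sub>F n in sequentially. e n < (1 / 4) ^ k" by (rule order_tendstoD(2)[OF e]) simp
  then show "\<exists>n. \<forall>m\<ge>n. e m \<le> (1 / 4) ^ k" by (auto simp: eventually_sequentially intro: less_imp_le)
 qed
 then obtain N where N: "\<And>k m. N k \<le> m \<Longrightarrow> e m \<le> (1 / 4) ^ k" by metis
 define r where "r k = (\<Sum>j\<le>k. N j) + k" for k
 have rN: "N k \<le> r k" for k using member_le_sum[of k "{..k}" N] by (simp add: r_def)
 have r_le: "r k \<le> r (Suc k)" for k by (simp add: r_def)
 have r_ge: "k \<le> r k" for k by (simp add: r_def)
 define d where "d k x = \<bar>f (r (Suc k)) x - f (r k) x\<bar>" for k x
 have [measurable]: "d k \<in> borel_measurable M" for k unfolding d_def by measurable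
 have d: "(\<integral>\<^sup>+x. ennreal (d k x) \<partial>M) \<le> ennreal ((measure M (space M) + 1) * (1 / 2) ^ k)" for k
 proof -
  have "(\<integral>\<^sup>+x. ennreal (d k x) \<partial>M) \<le> (\<integral>\<^sup>+x. ennreal ((1 / 2) ^ k) + ennreal (2 ^ k) * ennreal ((f (r (Suc k)) x - f (r k) x)^2) \<partial>M)"
  proof (rule nn_integral_mono)
   fix x
   let ?y = "f (r (Suc k)) x - f (r k) x"
   have "\<bar>?y\<bar> \<le> (1 / 2) ^ k + 2 ^ k * ?y^2"
    using abs_le_weighted_square[of "2 ^ k" ?y] by (simp add: power_one_over)
   then show "ennreal (d k x) \<le> ennreal ((1 / 2) ^ k) + ennreal (2 ^ k) * ennreal (?y^2)"
    by (simp add: d_def ennreal_leI flip: ennreal_plus ennreal_mult)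
  qed
  also have "\<dots> = ennreal ((1 / 2) ^ k) * emeasure M (space M) + ennreal (2 ^ k) * (\<integral>\<^sup>+x. ennreal ((f (r (Suc k)) x - f (r k) x)^2) \<partial>M)"
   by (simp add: nn_integral_add nn_integral_cmult)
  also have "\<dots> \<le> ennreal ((1 / 2) ^ k) * emeasure M (space M) + ennreal (2 ^ k) * ennreal ((1 / 4) ^ k)"
   using N[OF rN, of k] by (intro add_mono mult_left_mono order_trans[OF Cauchy[OF r_le]] ennreal_leI order_refl) auto
  also have "\<dots> = ennreal ((1 / 2) ^ k * measure M (space M) + 2 ^ k * (1 / 4) ^ k)"
   by (simp add: emeasure_eq_measure flip: ennreal_plus ennreal_mult)
  also have "2 ^ k * (1 / 4) ^ k = (1 / 2 :: real) ^ k" by (simp flip: power_mult_distrib)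
  also have "(1 / 2) ^ k * measure M (space M) + (1 / 2) ^ k = (measure M (space M) + 1) * (1 / 2) ^ k"
   by (simp add: algebra_simps)
  finally show ?thesis .
 qed
 have "(\<integral>\<^sup>+x. (\<Sum>k. ennreal (d k x)) \<partial>M) = (\<Sum>k. \<integral>\<^sup>+x. ennreal (d k x) \<partial>M)"
  by (rule nn_integral_suminf) measurable
 also have "\<dots> \<le> (\<Sum>k. ennreal ((measure M (space M) + 1) * (1 / 2) ^ k))"
  by (intro suminf_le d) auto
 also have "\<dots> < \<infinity>"
 proof -
  have "summable (\<lambda>k. (measure M (space M) + 1) * (1 / 2 :: real) ^ k)"
   by (intro summable_mult summable_geometric) auto
  then have "(\<Sum>k. ennreal ((measure M (space M) + 1) * (1 / 2) ^ k)) = ennreal (\<Sum>k. (measure M (space M) + 1) * (1 / 2) ^ k)"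
   by (intro suminf_ennreal2) auto
  then show ?thesis by simp
 qed
 finally have "AE x in M. (\<Sum>k. ennreal (d k x)) \<noteq> \<infinity>"
  by (intro nn_integral_PInf_AE) auto
 then have conv: "AE x in M. convergent (\<lambda>k. f (r k) x)"
 proof eventually_elim
  case (elim x)
  have "0 \<le> d k x" for k by (simp add: d_def)
  moreover from elim have "(\<Sum>k. ennreal (d k x)) \<noteq> top" by simp
  ultimately have "summable (\<lambda>k. d k x)" by (rule summable_suminf_not_top)
  then have "summable (\<lambda>k. f (r (Suc k)) x - f (r k) x)"
   unfolding d_def by (rule summable_rabs_cancel)
  then have "convergent (\<lambda>n. \<Sum>k<n. f (r (Suc k)) x - f (r k) x)" by (simp add: summable_iff_convergent)
  then have "convergent (\<lambda>n. f (r n) x - f (r 0) x)" by (simp only: sum_lessThan_telescope[of "\<lambda>k. f (r k) x"])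
  then have "convergent (\<lambda>n. (f (r n) x - f (r 0) x) + f (r 0) x)" by (intro convergent_add convergent_const)
  then show ?case by simp
 qed
 define g where "g x = lim (\<lambda>k. f (r k) x)" for x
 have gm [measurable]: "g \<in> borel_measurable M" unfolding g_def by measurable
 have "(\<integral>\<^sup>+x. ennreal ((g x - f n x)^2) \<partial>M) \<le> ennreal (e n)" for n
 proof (rule nn_integral_limit_le[where f = "\<lambda>k x. (f (r k) x - f n x)^2" and c = "\<lambda>_. ennreal (e n)"])
  show "AE x in M. (\<lambda>k. (f (r k) x - f n x)^2) \<longlonglongrightarrow> (g x - f n x)^2"
   using conv by eventually_elim (auto simp: g_def convergent_LIMSEQ_iff intro!: tendsto_intros)
  show "\<forall>\<^sub>F k in sequentially. (\<integral>\<^sup>+x. ennreal ((f (r k) x - f n x)^2) \<partial>M) \<le> ennreal (e n)"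
   using eventually_ge_at_top[of n] by eventually_elim (intro Cauchy order_trans[OF _ r_ge])
 qed auto
 with gm show ?thesis by (rule that)
qed

lemma test_function_properties:
 assumes \<phi>: "test_function U \<phi>"
 shows test_function_has_derivative: "(\<phi> has_real_derivative deriv \<phi> x) (at x)"
  and continuous_test_function: "continuous_on S \<phi>"
  and continuous_test_function_deriv: "continuous_on S (deriv \<phi>)"
  and test_function_outside: "x \<notin> U \<Longrightarrow> \<phi> x = 0"
  and test_function_deriv_outside: "x \<notin> U \<Longrightarrow> deriv \<phi> x = 0"
  and test_function_bounded: "\<exists>k. \<forall>x\<in>{a..b}. \<bar>\<phi> x\<bar> \<le> k"
proof -
 let ?S = "closure {x. \<phi> x \<noteq> 0}"
 have "\<forall>k x. (deriv ^^ k) \<phi> differentiable at x" and S: "?S \<subseteq> U" using \<phi> unfolding test_function_def by blast+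
 then have "(deriv ^^ 0) \<phi> differentiable at x" "(deriv ^^ Suc 0) \<phi> differentiable at x" for x by blast+
 then have d: "(\<phi> has_real_derivative deriv \<phi> x) (at x)" "(deriv \<phi> has_real_derivative deriv (deriv \<phi>) x) (at x)" for x
  by (simp_all add: DERIV_deriv_iff_real_differentiable)
 show "(\<phi> has_real_derivative deriv \<phi> x) (at x)" by (rule d)
 show c: "continuous_on S \<phi>" and "continuous_on S (deriv \<phi>)" for S
  by (rule DERIV_continuous_on, rule has_field_derivative_at_within, rule d)+
 show "\<phi> x = 0" if "x \<notin> U" using that S closure_subset[of "{x. \<phi> x \<noteq> 0}"] by blast
 show "deriv \<phi> x = 0" if "x \<notin> U"
 proof (rule DERIV_imp_deriv)
  have x: "x \<in> - ?S" using S that by blast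
  show "(\<phi> has_real_derivative 0) (at x)"
   by (rule has_field_derivative_transform_within_open[OF DERIV_const[of 0] _ x])
     (use closure_subset[of "{x. \<phi> x \<noteq> 0}"] in auto)
 qed
 have "bounded (\<phi> ` {a..b})" by (intro compact_imp_bounded compact_continuous_image c) simp
 then obtain k where "\<forall>y\<in>\<phi> ` {a..b}. norm y \<le> k" unfolding bounded_iff by blast
 then show "\<exists>k. \<forall>x\<in>{a..b}. \<bar>\<phi> x\<bar> \<le> k" by auto
qed

locale interval =
 fixes R :: real
 assumes R_pos: "R > 0"
begin

definition L2 :: "(real \<Rightarrow> real) \<Rightarrow> bool" where
 "L2 v \<longleftrightarrow> v \<in> borel_measurable borel \<and> set_integrable lborel {-R..R} (\<lambda>x. (v x)^2)"

definition energy :: "(real \<Rightarrow> real) \<Rightarrow> real" where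
 "energy v = (LINT x:{-R..R}|lborel. (v x)^2)"

definition primitive :: "real \<Rightarrow> (real \<Rightarrow> real) \<Rightarrow> real \<Rightarrow> real" where
 "primitive c v x = c + (LINT y:{-R..x}|lborel. v y)"

lemma energy_nonneg: "0 \<le> energy v"
 by (simp add: energy_def set_lebesgue_integral_def)

lemma set_integrable_const: "set_integrable lborel {a..b :: real} (\<lambda>_. c :: real)"
 by (rule set_integral_continuous(1)[OF continuous_on_const])

lemma L2_integrable:
 assumes "L2 v"
 shows "set_integrable lborel {-R..R} v"
proof (rule set_integrable_bound[OF set_integral_add(1)[OF set_integrable_const[of _ _ 1]]])
 show "set_integrable lborel {-R..R} (\<lambda>x. (v x)^2)" using assms by (simp add: L2_def)
 show "set_borel_measurable lborel {-R..R} v"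
  using assms by (auto simp: L2_def set_borel_measurable_def)
 have "\<bar>y\<bar> \<le> 1 + y^2" for y :: real using abs_le_weighted_square[of 1 y] by simp
 then show "AE x in lborel. x \<in> {-R..R} \<longrightarrow> norm (v x) \<le> norm (1 + (v x)^2)" by (auto intro: order_trans[OF _ abs_ge_self])
qed

lemma L2_diff:
 assumes "L2 v" "L2 w"
 shows "L2 (\<lambda>x. v x - w x)"
 unfolding L2_def
proof
 have [measurable]: "v \<in> borel_measurable borel" "w \<in> borel_measurable borel" using assms by (auto simp: L2_def)
 show "(\<lambda>x. v x - w x) \<in> borel_measurable borel" by measurable
 have i: "set_integrable lborel {-R..R} (\<lambda>x. 2 * (v x)^2)" "set_integrable lborel {-R..R} (\<lambda>x. 2 * (w x)^2)"
  using assms by (auto simp: L2_def)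
 show "set_integrable lborel {-R..R} (\<lambda>x. (v x - w x)^2)"
 proof (rule set_integrable_bound[OF set_integral_add(1)[OF i]])
  show "set_borel_measurable lborel {-R..R} (\<lambda>x. (v x - w x)^2)" unfolding set_borel_measurable_def by measurable
  have "(a - b)^2 \<le> 2 * a^2 + 2 * b^2" for a b :: real
   using sum_squares_bound[of a "- b"] by (simp add: power2_diff)
  then show "AE x in lborel. x \<in> {-R..R} \<longrightarrow> norm ((v x - w x)^2) \<le> norm (2 * (v x)^2 + 2 * (w x)^2)"
   by (auto intro: order_trans[OF _ abs_ge_self])
 qed
qed

lemma L2_bounded:
 assumes "v \<in> borel_measurable borel" "\<And>x. \<bar>v x\<bar> \<le> b"
 shows "L2 v"
 unfolding L2_def
proof (intro conjI assms(1) set_integrable_bounded)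
 have [measurable]: "v \<in> borel_measurable borel" by fact
 show "(\<lambda>x. (v x)^2) \<in> borel_measurable borel" by measurable
 show "\<bar>(v x)^2\<bar> \<le> b^2" for x using power_mono[OF assms(2)[of x], of 2] by simp
qed

lemma L2_add: "L2 v \<Longrightarrow> L2 w \<Longrightarrow> L2 (\<lambda>y. v y + w y)"
 using L2_diff[of v "\<lambda>y. 0 - w y"] L2_diff[of "\<lambda>_. 0" w] L2_bounded[of "\<lambda>_. 0" 0] by simp

lemma energy_add_le:
 assumes v: "L2 v" and w: "L2 w"
 shows "energy (\<lambda>y. v y + w y) \<le> 2 * energy v + 2 * energy w"
proof -
 have i: "set_integrable lborel {-R..R} (\<lambda>y. 2 * (v y)^2)" "set_integrable lborel {-R..R} (\<lambda>y. 2 * (w y)^2)"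
  using v w by (auto simp: L2_def)
 have "energy (\<lambda>y. v y + w y) \<le> (LINT y:{-R..R}|lborel. 2 * (v y)^2 + 2 * (w y)^2)"
  unfolding energy_def
 proof (rule set_integral_mono)
  show "set_integrable lborel {-R..R} (\<lambda>y. (v y + w y)^2)" using L2_add[OF v w] by (simp add: L2_def)
  show "set_integrable lborel {-R..R} (\<lambda>y. 2 * (v y)^2 + 2 * (w y)^2)" by (rule set_integral_add(1)[OF i])
  show "(v y + w y)^2 \<le> 2 * (v y)^2 + 2 * (w y)^2" for y
   using sum_squares_bound[of "v y" "w y"] by (simp add: power2_sum)
 qed
 then show ?thesis unfolding set_integral_add(2)[OF i] by (simp add: energy_def)
qed

lemma primitive_diff:
 assumes "L2 v" "L2 w" "x \<in> {-R..R}"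
 shows "primitive c v x - primitive d w x = primitive (c - d) (\<lambda>y. v y - w y) x"
proof -
 have "set_integrable lborel {-R..x} v" "set_integrable lborel {-R..x} w"
  using assms by (auto intro!: set_integrable_subset[OF L2_integrable])
 from set_integral_diff(2)[OF this] show ?thesis by (simp add: primitive_def)
qed

lemma primitive_increment:
 assumes v: "L2 v" and xy: "-R \<le> x" "x \<le> y" "y \<le> R"
 shows "(primitive c v y - primitive c v x)^2 \<le> (y - x) * energy v"
proof -
 have i: "set_integrable lborel {a..b} v" "set_integrable lborel {a..<b} v" if "-R \<le> a" "b \<le> R" for a b
  using that by (auto intro!: set_integrable_subset[OF L2_integrable[OF v]])
 have i2: "set_integrable lborel {x..y} (\<lambda>x. (v x)^2)" "set_integrable lborel {-R..R} (\<lambda>x. (v x)^2)"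
  using v xy by (auto simp: L2_def intro!: set_integrable_subset[of lborel "{-R..R}"])
 have "(LINT z:{-R..<y}|lborel. v z) = (LINT z:{-R..<x} \<union> {x..<y}|lborel. v z)"
  using xy by (simp add: ivl_disj_un)
 also have "\<dots> = (LINT z:{-R..<x}|lborel. v z) + (LINT z:{x..<y}|lborel. v z)"
  using xy by (intro set_integral_Un i) auto
 finally have "primitive c v y - primitive c v x = (LINT z:{x..y}|lborel. v z)"
  by (simp add: primitive_def set_integral_half_open)
 also have "\<dots>^2 \<le> (y - x) * (LINT z:{x..y}|lborel. (v z)^2)"
  using xy by (intro square_set_integral_le i i2) auto
 also have "\<dots> \<le> (y - x) * energy v"
  unfolding energy_def set_lebesgue_integral_def using xy i2
  by (intro mult_left_mono integral_mono) (auto simp: indicator_def set_integrable_def)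
 finally show ?thesis .
qed

lemma primitive_bound:
 assumes v: "L2 v" and x: "x \<in> {-R..R}"
 shows "(primitive c v x)^2 \<le> 2 * c^2 + 4 * R * energy v"
proof -
 have 0: "primitive c v (-R) = c"
  unfolding primitive_def set_integral_half_open[symmetric] by (simp add: set_lebesgue_integral_def)
 have "(primitive c v x - c)^2 \<le> (x - (-R)) * energy v"
  using primitive_increment[OF v, of "-R" x c] x by (simp add: 0)
 also have "\<dots> \<le> (2 * R) * energy v" using x energy_nonneg by (intro mult_right_mono) auto
 finally have "(primitive c v x - c)^2 \<le> 2 * R * energy v" .
 moreover have "(primitive c v x)^2 \<le> 2 * c^2 + 2 * (primitive c v x - c)^2"
 proof -
  have "0 \<le> (primitive c v x - 2 * c)^2" by simp
  then show ?thesis by (simp add: power2_eq_square algebra_simps)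
 qed
 ultimately show ?thesis by linarith
qed

lemma continuous_primitive:
 assumes v: "L2 v"
 shows "continuous_on {-R..R} (primitive c v)"
proof (rule continuous_onI)
 fix x and e :: real assume x: "x \<in> {-R..R}" "e > 0"
 define d where "d = e^2 / (energy v + 1)"
 have d: "d > 0" using x energy_nonneg[of v] by (simp add: d_def)
 have "dist (primitive c v y) (primitive c v x) \<le> e" if y: "y \<in> {-R..R}" "dist y x < d" for y
 proof -
  have "(primitive c v y - primitive c v x)^2 \<le> \<bar>y - x\<bar> * energy v"
   using primitive_increment[OF v, of x y c] primitive_increment[OF v, of y x c] x y
   by (cases x y rule: le_cases) (auto simp: power2_commute)
  also have "\<dots> \<le> d * energy v"
   using y energy_nonneg by (intro mult_right_mono) (auto simp: dist_real_def)
  also have "\<dots> \<le> e^2"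
  proof -
   have "d * energy v \<le> d * (energy v + 1)" using d by (intro mult_left_mono) auto
   also have "\<dots> = e^2" using energy_nonneg[of v] by (simp add: d_def)
   finally show ?thesis .
  qed
  finally have "\<bar>primitive c v y - primitive c v x\<bar> \<le> \<bar>e\<bar>" by (simp add: abs_le_square_iff)
  then show ?thesis using x by (simp add: dist_real_def)
 qed
 then show "\<exists>d>0. \<forall>y\<in>{-R..R}. dist y x < d \<longrightarrow> dist (primitive c v y) (primitive c v x) \<le> e" using d by blast
qed

end

locale sobolev = interval +
 fixes U :: "real set"
 assumes U_open: "open U" and U_subset: "U \<subseteq> {-R<..<R}"
begin

lemma U_bounded: "bounded U"
 using U_subset bounded_subset[of "{-R<..<R}"] by auto

text \<open>Sobolev functions are only Lebesgue measurable; the computations are made with Borel functions.\<close>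

lemma integral_on_U:
 fixes f :: "real \<Rightarrow> real"
 assumes f: "(\<lambda>x. indicator U x * f x) \<in> borel_measurable borel"
 shows "(\<integral>x. f x \<partial>lebesgue_on U) = (LINT x:U|lborel. f x)"
  and "integrable (lebesgue_on U) f \<longleftrightarrow> set_integrable lborel U f"
proof -
 have U: "U \<in> sets lebesgue" using U_open by auto
 show "(\<integral>x. f x \<partial>lebesgue_on U) = (LINT x:U|lborel. f x)"
  using U f by (simp add: integral_restrict_space set_lebesgue_integral_def integral_completion)
 show "integrable (lebesgue_on U) f \<longleftrightarrow> set_integrable lborel U f"
  using U f by (simp add: integrable_restrict_space set_integrable_def integrable_completion)
qed

lemma L2_on_L2:
 assumes v: "L2 v"
 shows "L2_on U v" "(L2_norm U v)^2 \<le> energy v"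
proof -
 have [measurable]: "v \<in> borel_measurable borel" "U \<in> sets borel" using v U_open by (auto simp: L2_def)
 have m: "(\<lambda>x. indicator U x * (v x)^2) \<in> borel_measurable borel" by measurable
 have J: "set_integrable lborel {-R..R} (\<lambda>x. (v x)^2)" using v by (simp add: L2_def)
 have i: "set_integrable lborel U (\<lambda>x. (v x)^2)"
  by (rule set_integrable_subset[OF J]) (use U_subset in auto)
 have vm: "v \<in> borel_measurable (lebesgue_on U)"
  by (intro measurable_restrict_space1 measurable_completion) simp
 show "L2_on U v" unfolding L2_on_def using vm i by (simp add: integral_on_U(2)[OF m])
 have "(LINT x:U|lborel. (v x)^2) \<le> energy v"
  unfolding energy_def set_lebesgue_integral_def using i J U_subset
  by (intro integral_mono) (auto simp: indicator_def set_integrable_def)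
 then show "(L2_norm U v)^2 \<le> energy v"
  unfolding L2_norm_def integral_on_U(1)[OF m] by (simp add: set_lebesgue_integral_def)
qed

lemma measurable_primitive:
 assumes v: "L2 v"
 shows "(\<lambda>x. indicator U x * primitive c v x) \<in> borel_measurable borel"
proof -
 have "(\<lambda>x. indicator {-R..R} x *\<^sub>R primitive c v x) \<in> borel_measurable borel"
  by (rule borel_measurable_continuous_on_indicator[OF _ continuous_primitive[OF v]]) simp
 moreover have [measurable]: "U \<in> sets borel" using U_open by simp
 ultimately have "(\<lambda>x. indicator U x * (indicator {-R..R} x *\<^sub>R primitive c v x)) \<in> borel_measurable borel" by measurable
 moreover have "indicator U x * (indicator {-R..R} x *\<^sub>R primitive c v x) = indicator U x * primitive c v x" for x
  using U_subset by (auto simp: indicator_def)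
 ultimately show ?thesis by (simp only:)
qed

lemma L2_on_primitive:
 assumes v: "L2 v"
 shows "L2_on U (primitive c v)" "(L2_norm U (primitive c v))^2 \<le> 2 * R * (2 * c^2 + 4 * R * energy v)"
proof -
 note [measurable] = measurable_primitive[OF v]
 have U [measurable]: "U \<in> sets borel" "U \<in> sets lebesgue" using U_open by auto
 have m: "(\<lambda>x. indicator U x * (primitive c v x)^2) \<in> borel_measurable borel"
 proof -
  have "(\<lambda>x. (indicator U x * primitive c v x)^2) \<in> borel_measurable borel"
   using measurable_primitive[OF v] by measurable
  moreover have "(indicator U x * primitive c v x)^2 = indicator U x * (primitive c v x)^2" for x
   by (simp add: indicator_def)
  ultimately show ?thesis by simp
 qed
 let ?b = "2 * c^2 + 4 * R * energy v"
 have b: "\<bar>indicator U x * (primitive c v x)^2\<bar> \<le> indicator {-R..R} x * ?b" for x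
  using primitive_bound[OF v, of x c] U_subset R_pos energy_nonneg[of v] by (auto simp: indicator_def)
 have ib: "integrable lborel (\<lambda>x. indicator {-R..R} x * ?b)"
  using set_integrable_const[of "-R" R ?b] by (simp add: set_integrable_def)
 have i: "set_integrable lborel U (\<lambda>x. (primitive c v x)^2)"
  unfolding set_integrable_def real_scaleR_def
  by (rule Bochner_Integration.integrable_bound[OF ib]) (use m b in \<open>auto intro: order_trans[OF _ abs_ge_self]\<close>)
 have "primitive c v \<in> borel_measurable (lebesgue_on U)"
 proof -
  have "(\<lambda>x. indicator U x *\<^sub>R primitive c v x) \<in> borel_measurable lebesgue"
   using measurable_primitive[OF v] by (intro measurable_completion) simp
  then show ?thesis using U by (subst borel_measurable_restrict_space_iff) auto
 qed
 then show "L2_on U (primitive c v)" unfolding L2_on_def using i by (simp add: integral_on_U(2)[OF m])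
 have "(LINT x:U|lborel. (primitive c v x)^2) \<le> (\<integral>x. indicator {-R..R} x * ?b \<partial>lborel)"
  unfolding set_lebesgue_integral_def using i ib b
  by (intro integral_mono) (auto simp: set_integrable_def intro: order_trans[OF abs_ge_self])
 also have "\<dots> = 2 * R * ?b" using R_pos by simp
 finally show "(L2_norm U (primitive c v))^2 \<le> 2 * R * ?b"
  unfolding L2_norm_def integral_on_U(1)[OF m] by (simp add: set_lebesgue_integral_def)
qed

text \<open>A test function is the primitive of its derivative and vanishes at \<open>- R\<close> and \<open>R\<close>, so \<open>absolutely_continuous_product\<close> applies
  on the whole interval even if \<open>U\<close> is not connected.\<close>

lemma L2_weak_deriv_primitive:
 assumes v: "L2 v"
 shows "L2_weak_deriv U (primitive c v) v"
 unfolding L2_weak_deriv_def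
proof (intro conjI allI impI L2_on_L2(1)[OF v])
 fix \<phi> assume \<phi>: "test_function U \<phi>"
 note d = test_function_has_derivative[OF \<phi>] and z = test_function_outside[OF \<phi>]
  and z' = test_function_deriv_outside[OF \<phi>]
  and c\<phi> = continuous_test_function[OF \<phi>] continuous_test_function_deriv[OF \<phi>]
 note [measurable] = borel_measurable_continuous_onI[OF c\<phi>(1)] borel_measurable_continuous_onI[OF c\<phi>(2)]
 have FTC: "\<phi> x = \<phi> (-R) + (LINT y:{-R..x}|lborel. deriv \<phi> y)" if "x \<in> {-R..R}" for x
 proof -
  have "(deriv \<phi> has_integral (\<phi> x - \<phi> (-R))) {-R..x}"
   using that d by (intro fundamental_theorem_of_calculus)
    (auto simp: has_real_derivative_iff_has_vector_derivative[symmetric] intro: has_field_derivative_at_within)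
  then show ?thesis by (simp add: set_integral_continuous(2)[OF c\<phi>(2)] integral_unique)
 qed
 have id: "set_integrable lborel {-R..R} (deriv \<phi>)" by (rule set_integral_continuous(1)[OF c\<phi>(2)])
 have "-R \<notin> U" "R \<notin> U" using U_subset by auto
 then have 0: "\<phi> (-R) = 0" "\<phi> R = 0" using z by auto
 have le: "-R \<le> R" using R_pos by simp
 note AC = absolutely_continuous_product[OF le L2_integrable[OF v] id primitive_def FTC]
 have AC1: "set_integrable lborel {-R..R} (\<lambda>x. v x * \<phi> x + primitive c v x * deriv \<phi> x)"
  and AC2: "primitive c v R * \<phi> R = c * \<phi> (-R) + (LINT x:{-R..R}|lborel. v x * \<phi> x + primitive c v x * deriv \<phi> x)"
  by (rule AC, assumption)+
 have [measurable]: "v \<in> borel_measurable borel" "U \<in> sets borel" using v U_open by (auto simp: L2_def)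
 obtain k where k: "\<And>x. x \<in> {-R..R} \<Longrightarrow> \<bar>\<phi> x\<bar> \<le> k" using test_function_bounded[OF \<phi>] by blast
 have i1: "set_integrable lborel {-R..R} (\<lambda>x. v x * \<phi> x)"
 proof (rule set_integrable_bound)
  show "set_integrable lborel {-R..R} (\<lambda>x. k * v x)" using L2_integrable[OF v] by simp
  show "set_borel_measurable lborel {-R..R} (\<lambda>x. v x * \<phi> x)" unfolding set_borel_measurable_def by measurable
  show "AE x in lborel. x \<in> {-R..R} \<longrightarrow> norm (v x * \<phi> x) \<le> norm (k * v x)"
   using k by (intro AE_I2) (auto simp: abs_mult mult.commute[of k] intro!: mult_left_mono intro: order_trans[OF _ abs_ge_self])
 qed
 have i2: "set_integrable lborel {-R..R} (\<lambda>x. primitive c v x * deriv \<phi> x)"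
  using set_integral_diff(1)[OF AC1 i1] by simp
 have "0 = (LINT x:{-R..R}|lborel. v x * \<phi> x) + (LINT x:{-R..R}|lborel. primitive c v x * deriv \<phi> x)"
  using AC2 0 unfolding set_integral_add(2)[OF i1 i2] by simp
 moreover have "(LINT x:{-R..R}|lborel. f x) = (\<integral>x. f x \<partial>lebesgue_on U)"
  if "\<And>x. x \<notin> U \<Longrightarrow> f x = 0" "(\<lambda>x. indicator U x * f x) \<in> borel_measurable borel" for f :: "real \<Rightarrow> real"
  unfolding integral_on_U(1)[OF that(2)] set_lebesgue_integral_def using that(1) U_subset
  by (intro Bochner_Integration.integral_cong) (auto simp: indicator_def)
 moreover have "(\<lambda>x. indicator U x * (primitive c v x * deriv \<phi> x)) \<in> borel_measurable borel"
 proof -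
  have "(\<lambda>x. (indicator U x * primitive c v x) * deriv \<phi> x) \<in> borel_measurable borel"
   using measurable_primitive[OF v] by measurable
  then show ?thesis by (simp add: mult.assoc)
 qed
 ultimately show "(\<integral>x. primitive c v x * deriv \<phi> x \<partial>lebesgue_on U) = - (\<integral>x. v x * \<phi> x \<partial>lebesgue_on U)"
  using z z' by simp
qed

lemma L2_weak_deriv_unique:
 assumes v: "L2_weak_deriv U u v" and w: "L2_weak_deriv U u w"
 shows "AE x in lebesgue_on U. v x = w x"
proof -
 have i: "integrable (lebesgue_on U) v" "integrable (lebesgue_on U) w"
  using v w L2_on_integrable[OF U_open U_bounded] by (auto simp: L2_weak_deriv_def)
 have "AE x in lebesgue_on U. v x - w x = 0"
 proof (rule fundamental_lemma[OF U_open U_bounded])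
  show "integrable (lebesgue_on U) (\<lambda>x. v x - w x)" using i by simp
  fix \<phi> assume \<phi>: "test_function U \<phi>"
  obtain k where k: "\<And>x. x \<in> {-R..R} \<Longrightarrow> \<bar>\<phi> x\<bar> \<le> k" using test_function_bounded[OF \<phi>] by blast
  have \<phi>m: "\<phi> \<in> borel_measurable (lebesgue_on U)"
   using borel_measurable_continuous_onI[OF continuous_test_function[OF \<phi>]] by (intro measurable_restrict_space1 measurable_completion) simp
  have ip: "integrable (lebesgue_on U) (\<lambda>x. f x * \<phi> x)" if f: "integrable (lebesgue_on U) f" for f
  proof (rule Bochner_Integration.integrable_bound)
   show "integrable (lebesgue_on U) (\<lambda>x. k * f x)" using f by simp
   show "(\<lambda>x. f x * \<phi> x) \<in> borel_measurable (lebesgue_on U)" using f \<phi>m by measurable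
   show "AE x in lebesgue_on U. norm (f x * \<phi> x) \<le> norm (k * f x)"
   proof (intro AE_I2)
    fix x assume "x \<in> space (lebesgue_on U)"
    then have "\<bar>\<phi> x\<bar> \<le> \<bar>k\<bar>" using k[of x] U_subset by (auto simp: space_restrict_space)
    then show "norm (f x * \<phi> x) \<le> norm (k * f x)" by (simp add: abs_mult mult.commute[of "\<bar>k\<bar>"] mult_left_mono)
   qed
  qed
  have "(\<integral>x. (v x - w x) * \<phi> x \<partial>lebesgue_on U) = (\<integral>x. v x * \<phi> x \<partial>lebesgue_on U) - (\<integral>x. w x * \<phi> x \<partial>lebesgue_on U)"
   using ip[OF i(1)] ip[OF i(2)] by (simp add: left_diff_distrib)
  then show "(\<integral>x. (v x - w x) * \<phi> x \<partial>lebesgue_on U) = 0"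
   using v w \<phi> unfolding L2_weak_deriv_def by force
 qed
 then show ?thesis by eventually_elim simp
qed

text \<open>The Sobolev norm is defined through a chosen weak derivative, which agrees with the given one almost everywhere.\<close>

lemma W12_norm_eq:
 assumes v: "L2_weak_deriv U u v"
 shows "W12_norm U u = L2_norm U u + L2_norm U v"
proof -
 let ?w = "SOME v. L2_weak_deriv U u v"
 have w: "L2_weak_deriv U u ?w" by (rule someI[of "L2_weak_deriv U u", OF v])
 have "(\<integral>x. (?w x)^2 \<partial>lebesgue_on U) = (\<integral>x. (v x)^2 \<partial>lebesgue_on U)"
 proof (rule integral_cong_AE)
  show "(\<lambda>x. (?w x)^2) \<in> borel_measurable (lebesgue_on U)" "(\<lambda>x. (v x)^2) \<in> borel_measurable (lebesgue_on U)"
   using v w by (auto simp: L2_weak_deriv_def L2_on_def)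
  show "AE x in lebesgue_on U. (?w x)^2 = (v x)^2"
   using L2_weak_deriv_unique[OF w v] by eventually_elim simp
 qed
 then show ?thesis by (simp add: W12_norm_def L2_norm_def)
qed

lemma L2_norm_cong:
 "(\<And>x. x \<in> U \<Longrightarrow> f x = g x) \<Longrightarrow> L2_norm U f = L2_norm U g"
 unfolding L2_norm_def by (intro arg_cong[of _ _ sqrt] Bochner_Integration.integral_cong) auto

lemma W12_primitive:
 assumes v: "L2 v" and u: "\<And>x. x \<in> U \<Longrightarrow> u x = primitive c v x"
 shows "u \<in> W12 U" "W12_norm U u = L2_norm U (primitive c v) + L2_norm U v"
  "(W12_norm U u)^2 \<le> 8 * R * c^2 + (16 * R^2 + 2) * energy v"
proof -
 have int: "(\<integral>x. u x * deriv \<phi> x \<partial>lebesgue_on U) = (\<integral>x. primitive c v x * deriv \<phi> x \<partial>lebesgue_on U)" for \<phi>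
  using u by (intro Bochner_Integration.integral_cong) auto
 have wd: "L2_weak_deriv U u v" using L2_weak_deriv_primitive[OF v, of c] unfolding L2_weak_deriv_def int .
 have "L2_on U u"
 proof -
  have p: "L2_on U (primitive c v)" by (rule L2_on_primitive(1)[OF v])
  have "u \<in> borel_measurable (lebesgue_on U) \<longleftrightarrow> primitive c v \<in> borel_measurable (lebesgue_on U)"
   using u by (intro measurable_cong) auto
  moreover have "integrable (lebesgue_on U) (\<lambda>x. (u x)^2) \<longleftrightarrow> integrable (lebesgue_on U) (\<lambda>x. (primitive c v x)^2)"
   using u by (intro Bochner_Integration.integrable_cong) auto
  ultimately show ?thesis using p by (simp add: L2_on_def)
 qed
 then show "u \<in> W12 U" using wd by (auto simp: W12_def)
 show eq: "W12_norm U u = L2_norm U (primitive c v) + L2_norm U v"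
  unfolding W12_norm_eq[OF wd] using L2_norm_cong[OF u] by simp
 have "(W12_norm U u)^2 \<le> 2 * (L2_norm U (primitive c v))^2 + 2 * (L2_norm U v)^2"
  unfolding eq using sum_squares_bound[of "L2_norm U (primitive c v)" "L2_norm U v"] by (simp add: power2_sum)
 also have "\<dots> \<le> 2 * (2 * R * (2 * c^2 + 4 * R * energy v)) + 2 * energy v"
  by (intro add_mono mult_left_mono L2_on_primitive(2) L2_on_L2(2) v) auto
 also have "\<dots> = 8 * R * c^2 + (16 * R^2 + 2) * energy v" by (simp add: power2_eq_square algebra_simps)
 finally show "(W12_norm U u)^2 \<le> 8 * R * c^2 + (16 * R^2 + 2) * energy v" .
qed

end

section \<open>Dyadic slopes\<close>

context interval
begin

lemma nn_integral_energy: "L2 v \<Longrightarrow> (\<integral>\<^sup>+x\<in>{-R..R}. ennreal ((v x)^2) \<partial>lborel) = ennreal (energy v)"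
 unfolding energy_def L2_def by (intro nn_integral_set_integral) auto

lemma energy_le:
 assumes [measurable]: "v \<in> borel_measurable borel" and e: "0 \<le> e"
  and le: "(\<integral>\<^sup>+x\<in>{-R..R}. ennreal ((v x)^2) \<partial>lborel) \<le> ennreal e"
 shows "L2 v" "energy v \<le> e"
proof -
 have "set_integrable lborel {-R..R} (\<lambda>x. (v x)^2)"
  unfolding set_integrable_def
 proof (rule integrableI_bounded)
  have "(\<integral>\<^sup>+x. ennreal (norm (indicator {-R..R} x *\<^sub>R (v x)^2)) \<partial>lborel) = (\<integral>\<^sup>+x\<in>{-R..R}. ennreal ((v x)^2) \<partial>lborel)"
   by (intro nn_integral_cong) (auto simp: indicator_def)
  also have "\<dots> < \<infinity>" using le by (rule le_less_trans) simp
  finally show "(\<integral>\<^sup>+x. ennreal (norm (indicator {-R..R} x *\<^sub>R (v x)^2)) \<partial>lborel) < \<infinity>" .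
 qed measurable
 then show v: "L2 v" by (simp add: L2_def)
 show "energy v \<le> e" using le e unfolding nn_integral_energy[OF v] by simp
qed

text \<open>The left end point is written as in the lemmas on step functions over \<open>{a..<b}\<close>.\<close>

definition mesh :: "nat \<Rightarrow> real" where
 "mesh n = (R - - R) / real (2 ^ n)"

definition node :: "nat \<Rightarrow> nat \<Rightarrow> real" where
 "node n k = - R + real k * mesh n"

definition cell :: "nat \<Rightarrow> real \<Rightarrow> nat" where
 "cell n y = cell_index (- R) (mesh n) y"

definition slope :: "nat \<Rightarrow> (real \<Rightarrow> real) \<Rightarrow> nat \<Rightarrow> real" where
 "slope n u k = (if k < 2 ^ n then (u (node n (Suc k)) - u (node n k)) / mesh n else 0)"

definition dyadic_energy :: "nat \<Rightarrow> (real \<Rightarrow> real) \<Rightarrow> real" where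
 "dyadic_energy n u = mesh n * (\<Sum>k<2 ^ n. (slope n u k)^2)"

lemma mesh_pos: "mesh n > 0" using R_pos by (simp add: mesh_def)

lemma mesh_refine: "n \<le> m \<Longrightarrow> mesh n = real (2 ^ (m - n)) * mesh m"
 using power_add[of "2 :: real" n "m - n"] by (simp add: mesh_def)

lemma node_refine: "n \<le> m \<Longrightarrow> node n k = node m (k * 2 ^ (m - n))"
 unfolding node_def by (subst mesh_refine[of n m]) auto

lemma cell_refine:
 assumes "n \<le> m"
 shows "cell n y = cell m y div 2 ^ (m - n)"
proof -
 have "(y - - R) / mesh n = (y - - R) / mesh m / real_of_int (2 ^ (m - n))"
  using mesh_refine[OF assms] by (simp add: field_simps)
 then have "\<lfloor>(y - - R) / mesh n\<rfloor> = \<lfloor>(y - - R) / mesh m\<rfloor> div 2 ^ (m - n)"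
  by (simp only: floor_divide_real_eq_div zero_le_numeral zero_le_power)
 then have eq: "cell n y = nat (\<lfloor>(y - - R) / mesh m\<rfloor> div 2 ^ (m - n))" by (simp only: cell_def)
 show ?thesis
 proof (cases "0 \<le> \<lfloor>(y - - R) / mesh m\<rfloor>")
  case True
  then show ?thesis unfolding eq by (simp add: cell_def nat_div_distrib nat_power_eq)
 next
  case False
  then have "\<lfloor>(y - - R) / mesh m\<rfloor> div 2 ^ (m - n) < 0" by (intro div_neg_pos_less0) auto
  then show ?thesis using False unfolding eq by (simp add: cell_def)
 qed
qed

lemma L2_step:
 assumes "\<And>k. k \<ge> N \<Longrightarrow> c k = 0"
 shows "L2 (\<lambda>y. c (cell n y))"
proof (rule L2_bounded)
 have [measurable]: "cell n \<in> measurable borel (count_space UNIV)" unfolding cell_def[abs_def] by measurable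
 show "(\<lambda>y. c (cell n y)) \<in> borel_measurable borel" by measurable
 have "\<bar>c k\<bar> \<le> (\<Sum>i<N. \<bar>c i\<bar>)" for k
  using assms[of k] by (cases "k < N") (auto intro: member_le_sum sum_nonneg)
 then show "\<bar>c (cell n y)\<bar> \<le> (\<Sum>i<N. \<bar>c i\<bar>)" for y .
qed

lemma energy_step: "energy (\<lambda>y. c (cell n y)) = mesh n * (\<Sum>k<2 ^ n. (c k)^2)"
 unfolding energy_def set_integral_half_open[symmetric] cell_def
 by (rule set_integral_step[where c = "\<lambda>k. (c k)^2"]) (use R_pos in \<open>auto simp: mesh_def\<close>)

lemma sum_slope:
 assumes "a + N \<le> 2 ^ n"
 shows "(\<Sum>l<N. slope n u (l + a)) = (u (node n (a + N)) - u (node n a)) / mesh n"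
proof -
 have "(\<Sum>l<N. slope n u (l + a)) = (\<Sum>l<N. u (node n (Suc l + a)) - u (node n (l + a))) / mesh n"
  unfolding sum_divide_distrib using assms by (intro sum.cong) (auto simp: slope_def)
 then show ?thesis by (simp add: sum_lessThan_telescope[of "\<lambda>l. u (node n (l + a))", simplified] add.commute)
qed

lemma L2_slope: "L2 (\<lambda>y. slope n u (cell n y))"
 by (rule L2_step[of "2 ^ n"]) (simp add: slope_def)

lemma energy_slope: "energy (\<lambda>y. slope n u (cell n y)) = dyadic_energy n u"
 by (simp add: energy_step dyadic_energy_def)

text \<open>Each dyadic slope is the mean of the slopes on the cells into which its cell is divided, so the
 step functions of slopes form a martingale and their differences are orthogonal to the coarser ones.\<close>

lemma energy_slope_diff:
 assumes nm: "n \<le> m"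
 shows "energy (\<lambda>y. slope m u (cell m y) - slope n u (cell n y)) = dyadic_energy m u - dyadic_energy n u"
proof -
 define p where "p = (2 :: nat) ^ (m - n)"
 have p: "2 ^ n * p = (2 :: nat) ^ m" "p > 0" using nm by (auto simp: p_def simp flip: power_add)
 have mesh: "mesh n = real p * mesh m" unfolding p_def by (rule mesh_refine[OF nm])
 have mean: "(\<Sum>l<p. slope m u (l + i * p)) = real p * slope n u i" if i: "i < 2 ^ n" for i
 proof -
  have "i * p + p \<le> 2 ^ m"
   using mult_le_mono1[of "Suc i" "2 ^ n" p] i p by simp
  then have "(\<Sum>l<p. slope m u (l + i * p)) = (u (node m (i * p + p)) - u (node m (i * p))) / mesh m"
   by (rule sum_slope)
  also have "node m (i * p + p) = node n (Suc i)" by (simp add: node_refine[OF nm] p_def add.commute)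
  also have "node m (i * p) = node n i" by (simp add: node_refine[OF nm] p_def)
  finally show ?thesis using i p(2) mesh_pos[of m] by (simp add: slope_def mesh)
 qed
 have inner: "(\<Sum>l<p. (slope m u (l + i * p) - slope n u i)^2) = (\<Sum>l<p. (slope m u (l + i * p))^2) - real p * (slope n u i)^2"
  if i: "i < 2 ^ n" for i
 proof -
  have "(\<Sum>l<p. (slope m u (l + i * p) - slope n u i)^2) =
    (\<Sum>l<p. (slope m u (l + i * p))^2) + real p * (slope n u i)^2 - 2 * slope n u i * (\<Sum>l<p. slope m u (l + i * p))"
   by (simp add: power2_diff sum.distrib sum_subtractf sum_distrib_left mult_ac)
  then show ?thesis by (simp add: mean[OF i] power2_eq_square)
 qed
 have "energy (\<lambda>y. slope m u (cell m y) - slope n u (cell n y)) = mesh m * (\<Sum>k<2 ^ m. (slope m u k - slope n u (k div p))^2)"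
  unfolding cell_refine[OF nm] p_def by (rule energy_step[where c = "\<lambda>k. slope m u k - slope n u (k div 2 ^ (m - n))"])
 also have "(\<Sum>k<2 ^ m. (slope m u k - slope n u (k div p))^2) = (\<Sum>i<2 ^ n. \<Sum>l<p. (slope m u (l + i * p) - slope n u i)^2)"
  unfolding p(1)[symmetric] sum_mult_product using p(2) by (intro sum.cong) auto
 also have "\<dots> = (\<Sum>i<2 ^ n. (\<Sum>l<p. (slope m u (l + i * p))^2) - real p * (slope n u i)^2)"
  by (intro sum.cong refl inner) simp
 also have "\<dots> = (\<Sum>k<2 ^ m. (slope m u k)^2) - real p * (\<Sum>i<2 ^ n. (slope n u i)^2)"
  unfolding p(1)[symmetric] sum_mult_product by (simp add: sum_subtractf sum_distrib_left)
 finally show ?thesis by (simp add: dyadic_energy_def mesh right_diff_distrib mult_ac)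
qed

lemma dyadic_energy_mono: "n \<le> m \<Longrightarrow> dyadic_energy n u \<le> dyadic_energy m u"
 using energy_slope_diff[of n m u] energy_nonneg[of "\<lambda>y. slope m u (cell m y) - slope n u (cell n y)"] by simp

lemma primitive_slope_node:
 assumes k: "k \<le> 2 ^ n"
 shows "primitive (u (- R)) (\<lambda>y. slope n u (cell n y)) (node n k) = u (node n k)"
proof (cases "k = 0")
 case True
 then show ?thesis unfolding primitive_def set_integral_half_open[symmetric] by (simp add: node_def set_lebesgue_integral_def)
next
 case False
 have "(LINT y:{-R..node n k}|lborel. slope n u (cell n y)) = mesh n * (\<Sum>l<k. slope n u l)"
  unfolding set_integral_half_open[symmetric] cell_def
  by (rule set_integral_step) (use False mesh_pos[of n] in \<open>auto simp: node_def\<close>)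
 then show ?thesis
  using sum_slope[of 0 k n u] k mesh_pos[of n] by (simp add: primitive_def node_def)
qed

text \<open>By orthogonality the squared distance of two slope functions is the difference of their energies, and these converge.\<close>

lemma dyadic_limit:
 assumes bound: "\<And>n. dyadic_energy n u \<le> b"
 obtains v where "L2 v" "(\<lambda>n. energy (\<lambda>y. v y - slope n u (cell n y))) \<longlonglongrightarrow> 0"
  "energy v \<le> 2 * lim (\<lambda>n. dyadic_energy n u)"
proof -
 let ?h = "\<lambda>n. dyadic_energy n u" and ?f = "\<lambda>n y. slope n u (cell n y)"
 let ?M = "restrict_space lborel {-R..R}"
 have inc: "incseq ?h" using dyadic_energy_mono by (auto simp: incseq_def)
 obtain H where H: "?h \<longlonglongrightarrow> H" "\<And>n. ?h n \<le> H" using incseq_convergent[OF inc, of b] bound by blast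
 have fm [measurable]: "?f n \<in> borel_measurable borel" for n using L2_slope[of n u] by (simp add: L2_def)
 have nn: "(\<integral>\<^sup>+y. ennreal ((g y)^2) \<partial>?M) = (\<integral>\<^sup>+y\<in>{-R..R}. ennreal ((g y)^2) \<partial>lborel)" for g :: "real \<Rightarrow> real"
  by (rule nn_integral_restrict_space) simp
 obtain g where g: "g \<in> borel_measurable ?M" "\<And>n. (\<integral>\<^sup>+y. ennreal ((g y - ?f n y)^2) \<partial>?M) \<le> ennreal (H - ?h n)"
 proof (rule L2_Cauchy_converges[of ?M ?f "\<lambda>n. H - ?h n"])
  show "finite_measure ?M" by (intro finite_measureI) (use R_pos in \<open>simp add: emeasure_restrict_space\<close>)
  show "?f n \<in> borel_measurable ?M" for n by (rule measurable_restrict_space1) simp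
  show "(\<lambda>n. H - ?h n) \<longlonglongrightarrow> 0" using tendsto_diff[OF tendsto_const H(1), of H] by simp
  show "(\<integral>\<^sup>+y. ennreal ((?f m y - ?f n y)^2) \<partial>?M) \<le> ennreal (H - ?h n)" if "n \<le> m" for m n
   unfolding nn nn_integral_energy[OF L2_diff[OF L2_slope L2_slope]] energy_slope_diff[OF that]
   using H(2)[of m] by (intro ennreal_leI) simp
 qed (rule that)
 define v where "v y = indicator {-R..R} y *\<^sub>R g y" for y
 have vm [measurable]: "v \<in> borel_measurable borel"
  using g(1) unfolding v_def[abs_def] by (subst (asm) borel_measurable_restrict_space_iff) auto
 have "(\<integral>\<^sup>+y\<in>{-R..R}. ennreal ((v y - ?f n y)^2) \<partial>lborel) \<le> ennreal (H - ?h n)" for n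
 proof -
  have "(\<integral>\<^sup>+y\<in>{-R..R}. ennreal ((v y - ?f n y)^2) \<partial>lborel) = (\<integral>\<^sup>+y. ennreal ((g y - ?f n y)^2) \<partial>?M)"
   unfolding nn by (intro nn_integral_cong) (auto simp: v_def indicator_def)
  then show ?thesis using g(2)[of n] by simp
 qed
 moreover have dm: "(\<lambda>y. v y - ?f n y) \<in> borel_measurable borel" for n by measurable
 ultimately have d: "L2 (\<lambda>y. v y - ?f n y)" "energy (\<lambda>y. v y - ?f n y) \<le> H - ?h n" for n
  using H(2)[of n] energy_le[of "\<lambda>y. v y - ?f n y" "H - ?h n"] dm by simp_all
 have "L2 v" "energy v \<le> 2 * H"
  using L2_add[OF d(1) L2_slope, of 0 0 u] energy_add_le[OF d(1) L2_slope, of 0 0 u] d(2)[of 0] by (simp_all add: energy_slope)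
 moreover have "(\<lambda>n. energy (\<lambda>y. v y - ?f n y)) \<longlonglongrightarrow> 0"
 proof (rule real_tendsto_sandwich[OF _ _ tendsto_const])
  show "(\<lambda>n. H - ?h n) \<longlonglongrightarrow> 0" using tendsto_diff[OF tendsto_const H(1), of H] by simp
 qed (use d(2) energy_nonneg in auto)
 ultimately show ?thesis using that limI[OF H(1)] by simp
qed

end

section \<open>Rounded slopes and simple functions\<close>

text \<open>Rounding takes finitely many values, in order to obtain simple functions; large arguments are discarded.\<close>

definition round_to :: "nat \<Rightarrow> real \<Rightarrow> real" where
 "round_to n y = (if \<bar>y\<bar> \<le> 4 ^ n then of_int \<lfloor>4 ^ n * y\<rfloor> / 4 ^ n else 0)"

lemma round_to_error:
 assumes "\<bar>y\<bar> \<le> 4 ^ n"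
 shows "\<bar>round_to n y - y\<bar> \<le> (1 / 4) ^ n"
proof -
 have "round_to n y - y = (of_int \<lfloor>4 ^ n * y\<rfloor> - 4 ^ n * y) / 4 ^ n"
  using assms by (simp add: round_to_def diff_divide_distrib)
 moreover have "\<bar>of_int \<lfloor>4 ^ n * y\<rfloor> - 4 ^ n * y\<bar> \<le> 1" by linarith
 ultimately show ?thesis by (simp add: abs_divide power_one_over divide_right_mono)
qed

lemma simple_function_round_to:
 assumes [measurable]: "f \<in> borel_measurable M"
 shows "simple_function M (\<lambda>w. round_to n (f w))"
proof (rule simple_function_borel_measurable)
 show "(\<lambda>w. round_to n (f w)) \<in> borel_measurable M" unfolding round_to_def by measurable
 let ?A = "insert 0 ((\<lambda>i::int. of_int i / 4 ^ n) ` {- (16 ^ n) .. 16 ^ n}) :: real set"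
 have "round_to n y \<in> ?A" for y
 proof (cases "\<bar>y\<bar> \<le> 4 ^ n")
  case True
  have "\<bar>4 ^ n * y\<bar> \<le> 4 ^ n * 4 ^ n" using True by (simp add: abs_mult)
  also have "\<dots> = (16 :: real) ^ n" by (simp flip: power_mult_distrib)
  finally have "\<lfloor>4 ^ n * y\<rfloor> \<in> {- (16 ^ n) .. 16 ^ n}" by (auto simp: le_floor_iff floor_le_iff abs_le_iff)
  then show ?thesis using True by (simp add: round_to_def)
 qed (simp add: round_to_def)
 then have "(\<lambda>w. round_to n (f w)) ` space M \<subseteq> ?A" by blast
 then show "finite ((\<lambda>w. round_to n (f w)) ` space M)" by (rule finite_subset) auto
qed

lemma simple_function_family:
 assumes "\<And>k. simple_function M (g k)"
 shows "simple_function M (\<lambda>w k. if k < (N::nat) then g k w else 0)"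
proof (induction N)
 case (Suc N)
 have "(\<lambda>k. if k < Suc N then g k w else 0) = (\<lambda>k. if k < N then g k w else 0)(N := g N w)" for w
  by (auto simp: less_Suc_eq)
 then show ?case using simple_function_compose2[OF Suc assms[of N], of "\<lambda>f y. f(N := y)"] by simp
qed simp

context interval
begin

lemma mesh_tendsto: "mesh \<longlonglongrightarrow> 0"
proof -
 have "(\<lambda>n. 2 * R * (1 / 2) ^ n) \<longlonglongrightarrow> 0" by (intro tendsto_mult_right_zero LIMSEQ_power_zero) simp
 then show ?thesis by (simp add: mesh_def[abs_def] power_one_over)
qed

lemma cell_node:
 assumes x: "x \<in> {-R..R}"
 shows "cell n x \<le> 2 ^ n" "-R \<le> node n (cell n x)" "node n (cell n x) \<le> x" "x - node n (cell n x) \<le> mesh n"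
proof -
 have b: "node n (cell n x) \<le> x" "x < node n (Suc (cell n x))"
  using cell_index_bounds[OF mesh_pos[of n], of "- R" x] x unfolding node_def cell_def by auto
 show "-R \<le> node n (cell n x)" using mesh_pos[of n] by (simp add: node_def)
 show "node n (cell n x) \<le> x" by fact
 show "x - node n (cell n x) \<le> mesh n" using b(2) by (simp add: node_def algebra_simps)
 have "real (cell n x) * mesh n \<le> real (2 ^ n) * mesh n" using b(1) x by (simp add: node_def mesh_def)
 then show "cell n x \<le> 2 ^ n" using mesh_pos[of n] by (simp only: mult_le_cancel_right_pos of_nat_le_iff)
qed

lemma node_values_tendsto:
 assumes v: "L2 v" and e: "(\<lambda>n. energy (\<lambda>y. v y - slope n u (cell n y))) \<longlonglongrightarrow> 0" and x: "x \<in> {-R..R}"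
 shows "(\<lambda>n. u (node n (cell n x))) \<longlonglongrightarrow> primitive (u (- R)) v x"
proof (rule LIM_zero_cancel, rule Lim_null_comparison)
 let ?e = "\<lambda>n. energy (\<lambda>y. v y - slope n u (cell n y))" and ?z = "\<lambda>n. node n (cell n x)" and ?P = "primitive (u (- R))"
 have "(\<lambda>n. sqrt (4 * R * ?e n) + sqrt (mesh n * energy v)) \<longlonglongrightarrow> sqrt (4 * R * 0) + sqrt (0 * energy v)"
  by (intro tendsto_intros e mesh_tendsto)
 then show "(\<lambda>n. sqrt (4 * R * ?e n) + sqrt (mesh n * energy v)) \<longlonglongrightarrow> 0" by simp
 show "\<forall>\<^sub>F n in sequentially. norm (u (?z n) - ?P v x) \<le> sqrt (4 * R * ?e n) + sqrt (mesh n * energy v)"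
 proof (intro always_eventually allI)
  fix n
  note z = cell_node[OF x, of n]
  have zi: "?z n \<in> {-R..R}" using z x by simp
  have "?P v (?z n) - u (?z n) = primitive 0 (\<lambda>y. v y - slope n u (cell n y)) (?z n)"
   using primitive_diff[OF v L2_slope zi, of "u (- R)" "u (- R)" n u] primitive_slope_node[OF z(1), of u] by simp
  then have "(?P v (?z n) - u (?z n))^2 \<le> 4 * R * ?e n"
   using primitive_bound[OF L2_diff[OF v L2_slope] zi, of 0 n u] by simp
  then have 1: "\<bar>?P v (?z n) - u (?z n)\<bar> \<le> sqrt (4 * R * ?e n)" by (rule real_le_rsqrt[of "\<bar>_\<bar>", unfolded power2_abs])
  have "(?P v x - ?P v (?z n))^2 \<le> (x - ?z n) * energy v" using z x by (intro primitive_increment v) auto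
  also have "\<dots> \<le> mesh n * energy v" using z energy_nonneg by (intro mult_right_mono) auto
  finally have "\<bar>?P v x - ?P v (?z n)\<bar> \<le> sqrt (mesh n * energy v)" by (rule real_le_rsqrt[of "\<bar>_\<bar>", unfolded power2_abs])
  with 1 show "norm (u (?z n) - ?P v x) \<le> sqrt (4 * R * ?e n) + sqrt (mesh n * energy v)"
   unfolding real_norm_def by linarith
 qed
qed

lemma L2_round_slope: "L2 (\<lambda>y. round_to n (slope n u (cell n y)))"
 by (rule L2_step[of "2 ^ n"]) (simp add: slope_def round_to_def)

text \<open>The energy bound \<open>b\<close> limits a slope on a cell of length \<open>mesh n\<close> to at most \<open>4 ^ n\<close> for large \<open>n\<close>, so that no slope is discarded.\<close>

lemma rounded_slopes_tendsto:
 assumes v: "L2 v" and e: "(\<lambda>n. energy (\<lambda>y. v y - slope n u (cell n y))) \<longlonglongrightarrow> 0"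
  and b: "\<And>n. dyadic_energy n u \<le> b"
 shows "(\<lambda>n. energy (\<lambda>y. round_to n (slope n u (cell n y)) - v y)) \<longlonglongrightarrow> 0"
proof (rule Lim_null_comparison)
 let ?f = "\<lambda>n y. slope n u (cell n y)" and ?g = "\<lambda>n y. round_to n (slope n u (cell n y))"
 have "(\<lambda>n. 2 * (2 * R * ((1 / 4) ^ n)^2) + 2 * energy (\<lambda>y. v y - ?f n y)) \<longlonglongrightarrow> 2 * (2 * R * 0^2) + 2 * 0"
  by (intro tendsto_intros e LIMSEQ_power_zero) simp
 then show "(\<lambda>n. 2 * (2 * R * ((1 / 4) ^ n)^2) + 2 * energy (\<lambda>y. v y - ?f n y)) \<longlonglongrightarrow> 0" by simp
 have "(\<lambda>n. b / (2 * R) * (1 / 8) ^ n) \<longlonglongrightarrow> 0" by (intro tendsto_mult_right_zero LIMSEQ_power_zero) simp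
 then have "\<forall>\<^sub>F n in sequentially. b / (2 * R) * (1 / 8) ^ n < 1" by (rule order_tendstoD) simp
 then show "\<forall>\<^sub>F n in sequentially. norm (energy (\<lambda>y. ?g n y - v y)) \<le> 2 * (2 * R * ((1 / 4) ^ n)^2) + 2 * energy (\<lambda>y. v y - ?f n y)"
 proof eventually_elim
  case (elim n)
  have small: "\<bar>slope n u k\<bar> \<le> 4 ^ n" if k: "k < 2 ^ n" for k
  proof -
   have "mesh n * (slope n u k)^2 \<le> b"
   proof -
    have "mesh n * (slope n u k)^2 \<le> dyadic_energy n u"
     unfolding dyadic_energy_def using k mesh_pos[of n] by (intro mult_left_mono member_le_sum) auto
    then show ?thesis using b[of n] by simp
   qed
   also have "b \<le> 2 * R * 8 ^ n" using elim R_pos by (simp add: field_simps power_one_over)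
   also have "\<dots> = mesh n * (4 ^ n)^2"
   proof -
    have "(4 ^ n)^2 = 2 ^ n * (8 :: real) ^ n" by (simp add: power2_eq_square flip: power_mult_distrib)
    then show ?thesis by (simp add: mesh_def)
   qed
   finally have "(slope n u k)^2 \<le> (4 ^ n)^2" using mesh_pos[of n] by simp
   then show ?thesis by (simp add: abs_le_square_iff[symmetric])
  qed
  have i: "L2 (\<lambda>y. ?g n y - ?f n y)" "L2 (\<lambda>y. ?f n y - v y)" by (intro L2_diff L2_round_slope L2_slope v)+
  have "energy (\<lambda>y. ?g n y - v y) \<le> 2 * energy (\<lambda>y. ?g n y - ?f n y) + 2 * energy (\<lambda>y. ?f n y - v y)"
   using energy_add_le[OF i] by simp
  also have "energy (\<lambda>y. ?g n y - ?f n y) = mesh n * (\<Sum>k<2 ^ n. (round_to n (slope n u k) - slope n u k)^2)"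
   by (rule energy_step[where c = "\<lambda>k. round_to n (slope n u k) - slope n u k"])
  also have "mesh n * (\<Sum>k<2 ^ n. (round_to n (slope n u k) - slope n u k)^2) \<le> mesh n * (\<Sum>k<(2::nat) ^ n. ((1 / 4) ^ n)^2)"
   using round_to_error[OF small] mesh_pos[of n]
   by (intro mult_left_mono sum_mono) (auto simp: abs_le_square_iff[symmetric])
  also have "mesh n * (\<Sum>k<(2::nat) ^ n. ((1 / 4) ^ n)^2) = 2 * R * ((1 / 4) ^ n)^2" by (simp add: mesh_def)
  also have "energy (\<lambda>y. ?f n y - v y) = energy (\<lambda>y. v y - ?f n y)"
   unfolding energy_def by (simp add: power2_commute)
  finally show ?case using energy_nonneg by simp
 qed
qed

end

context sobolev
begin

text \<open>For \<open>p, q > 0\<close> the square \<open>(a + b)\<^sup>2\<close> is at most \<open>(1 + q / p) * a\<^sup>2 + (1 + p / q) * b\<^sup>2\<close>, with equality if \<open>q * a = p * b\<close>.\<close>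

lemma L2_norm_triangle:
 assumes f: "L2_on U f" and g: "L2_on U g"
 shows "L2_norm U f \<le> L2_norm U g + L2_norm U (\<lambda>x. f x - g x)"
proof (rule field_le_epsilon)
 fix e :: real assume e: "e > 0"
 let ?I = "\<lambda>f. \<integral>x. (f x)^2 \<partial>lebesgue_on U" and ?d = "\<lambda>x. f x - g x"
 define p where "p = L2_norm U g + e / 2"
 define q where "q = L2_norm U ?d + e / 2"
 have pq: "p > 0" "q > 0" "?I g \<le> p^2" "?I ?d \<le> q^2"
  using e unfolding p_def q_def L2_norm_def by (auto simp: add_nonneg_pos power2_sum)
 have [measurable]: "f \<in> borel_measurable (lebesgue_on U)" "g \<in> borel_measurable (lebesgue_on U)"
  and i: "integrable (lebesgue_on U) (\<lambda>x. (f x)^2)" "integrable (lebesgue_on U) (\<lambda>x. (g x)^2)"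
  using f g by (auto simp: L2_on_def)
 have d: "integrable (lebesgue_on U) (\<lambda>x. (?d x)^2)"
 proof (rule Bochner_Integration.integrable_bound)
  show "integrable (lebesgue_on U) (\<lambda>x. 2 * (f x)^2 + 2 * (g x)^2)" using i by simp
  have "(a - b)^2 \<le> 2 * a^2 + 2 * b^2" for a b :: real
   using sum_squares_bound[of a "- b"] by (simp add: power2_diff)
  then show "AE x in lebesgue_on U. norm ((?d x)^2) \<le> norm (2 * (f x)^2 + 2 * (g x)^2)" by simp
 qed measurable
 have "?I f \<le> (\<integral>x. (1 + q / p) * (g x)^2 + (1 + p / q) * (?d x)^2 \<partial>lebesgue_on U)"
 proof (rule integral_mono)
  fix x
  have "0 \<le> (q * g x - p * ?d x)^2 / (p * q)" using pq by simp
  also have "\<dots> = q / p * (g x)^2 + p / q * (?d x)^2 - 2 * g x * ?d x"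
   using pq by (simp add: power2_eq_square field_simps)
  finally show "(f x)^2 \<le> (1 + q / p) * (g x)^2 + (1 + p / q) * (?d x)^2"
   by (simp add: power2_eq_square algebra_simps)
 qed (use i d in auto)
 also have "\<dots> = (1 + q / p) * ?I g + (1 + p / q) * ?I ?d" using i d by simp
 also have "\<dots> \<le> (1 + q / p) * p^2 + (1 + p / q) * q^2" using pq by (intro add_mono mult_left_mono) auto
 also have "\<dots> = (p + q)^2" using pq by (simp add: power2_eq_square field_simps)
 finally have "L2_norm U f \<le> p + q" unfolding L2_norm_def using pq by (intro real_le_lsqrt) auto
 then show "L2_norm U f \<le> L2_norm U g + L2_norm U ?d + e" by (simp add: p_def q_def)
qed

lemma W12_norm_triangle:
 assumes v: "L2 v" and w: "L2 w" and f: "\<And>x. x \<in> U \<Longrightarrow> f x = primitive c v x" and g: "\<And>x. x \<in> U \<Longrightarrow> g x = primitive d w x"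
 shows "W12_norm U f \<le> W12_norm U g + W12_norm U (\<lambda>x. f x - g x)"
proof -
 have fg: "f x - g x = primitive (c - d) (\<lambda>y. v y - w y) x" if "x \<in> U" for x
  using that U_subset f g primitive_diff[OF v w, of x c d] by fastforce
 have "L2_norm U (primitive (c - d) (\<lambda>y. v y - w y)) = L2_norm U (\<lambda>x. primitive c v x - primitive d w x)"
  using f g fg by (intro L2_norm_cong) simp
 then show ?thesis
  using L2_norm_triangle[OF L2_on_primitive(1)[OF v, of c] L2_on_primitive(1)[OF w, of d]]
   L2_norm_triangle[OF L2_on_L2(1)[OF v] L2_on_L2(1)[OF w]]
   W12_primitive(2)[OF v, of f c] f W12_primitive(2)[OF w, of g d] g
   W12_primitive(2)[OF L2_diff[OF v w], of "\<lambda>x. f x - g x" "c - d"] fg by simp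
qed

lemma W12_norm_nonneg: "0 \<le> W12_norm U u"
 by (simp add: W12_norm_def L2_norm_def)

end

section \<open>Fields that are Lipschitz in mean square\<close>

context sobolev
begin

lemma W12_norm_minus_commute:
 assumes v: "L2 v" and w: "L2 w" and f: "\<And>x. x \<in> U \<Longrightarrow> f x = primitive c v x" and g: "\<And>x. x \<in> U \<Longrightarrow> g x = primitive d w x"
 shows "W12_norm U (\<lambda>x. f x - g x) = W12_norm U (\<lambda>x. g x - f x)"
proof -
 have d: "f x - g x = primitive (c - d) (\<lambda>y. v y - w y) x" "g x - f x = primitive (d - c) (\<lambda>y. w y - v y) x"
  if "x \<in> U" for x
  using that U_subset f g primitive_diff[OF v w, of x c d] primitive_diff[OF w v, of x d c] by fastforce+
 have neg: "L2_norm U (\<lambda>x. p x - q x) = L2_norm U (\<lambda>x. q x - p x)" for p q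
  by (simp add: L2_norm_def power2_commute)
 have "L2_norm U (primitive (c - d) (\<lambda>y. v y - w y)) = L2_norm U (\<lambda>x. f x - g x)"
  "L2_norm U (primitive (d - c) (\<lambda>y. w y - v y)) = L2_norm U (\<lambda>x. g x - f x)"
  using d by (auto intro!: L2_norm_cong)
 then show ?thesis
  using W12_primitive(2)[OF L2_diff[OF v w], of "\<lambda>x. f x - g x" "c - d"] W12_primitive(2)[OF L2_diff[OF w v], of "\<lambda>x. g x - f x" "d - c"]
   d neg[of f g] neg[of v w] by simp
qed

lemma W12_norm_rounded_tendsto:
 assumes v: "L2 v" and e: "(\<lambda>n. energy (\<lambda>y. v y - slope n u (cell n y))) \<longlonglongrightarrow> 0"
  and b: "\<And>n. dyadic_energy n u \<le> b" and z: "\<And>x. x \<in> U \<Longrightarrow> z x = primitive (u (- R)) v x"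
 shows "(\<lambda>n. W12_norm U (\<lambda>x. primitive (round_to n (u (- R))) (\<lambda>y. round_to n (slope n u (cell n y))) x - z x)) \<longlonglongrightarrow> 0"
  (is "(\<lambda>n. W12_norm U (?d n)) \<longlonglongrightarrow> 0")
proof (rule Lim_null_comparison)
 let ?c = "u (- R)" and ?g = "\<lambda>n y. round_to n (slope n u (cell n y))"
 let ?b = "\<lambda>n. sqrt (8 * R * (round_to n ?c - ?c)^2 + (16 * R^2 + 2) * energy (\<lambda>y. ?g n y - v y))"
 have "(\<lambda>n. round_to n ?c - ?c) \<longlonglongrightarrow> 0"
 proof (rule Lim_null_comparison)
  show "(\<lambda>n. (1 / 4 :: real) ^ n) \<longlonglongrightarrow> 0" by (rule LIMSEQ_power_zero) simp
  have "(\<lambda>n. \<bar>?c\<bar> * (1 / 4) ^ n) \<longlonglongrightarrow> 0" by (intro tendsto_mult_right_zero LIMSEQ_power_zero) simp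
  then have "\<forall>\<^sub>F n in sequentially. \<bar>?c\<bar> * (1 / 4) ^ n < 1" by (rule order_tendstoD) simp
  then show "\<forall>\<^sub>F n in sequentially. norm (round_to n ?c - ?c) \<le> (1 / 4) ^ n"
  proof eventually_elim
   case (elim n)
   then have "\<bar>?c\<bar> \<le> 4 ^ n" by (simp add: power_one_over field_simps)
   then show ?case unfolding real_norm_def by (rule round_to_error)
  qed
 qed
 then have "?b \<longlonglongrightarrow> sqrt (8 * R * 0^2 + (16 * R^2 + 2) * 0)"
  by (intro tendsto_intros rounded_slopes_tendsto[OF v e b])
 then show "?b \<longlonglongrightarrow> 0" by simp
 show "\<forall>\<^sub>F n in sequentially. norm (W12_norm U (?d n)) \<le> ?b n"
 proof (intro always_eventually allI)
  fix n
  have "?d n x = primitive (round_to n ?c - ?c) (\<lambda>y. ?g n y - v y) x" if "x \<in> U" for x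
   using primitive_diff[OF L2_round_slope v, where x = x] z[OF that] that U_subset by auto
  from W12_primitive(3)[OF L2_diff[OF L2_round_slope v] this]
  show "norm (W12_norm U (?d n)) \<le> ?b n" using W12_norm_nonneg by (simp add: real_le_rsqrt)
 qed
qed

text \<open>The expected energies of the dyadic interpolations are bounded, so the energies of almost every
 path are bounded. Setting the field to zero on the other paths makes every path a primitive.\<close>

lemma field_in_L2_W12I:
 fixes Y :: "real \<Rightarrow> 'w \<Rightarrow> real"
 assumes M: "prob_space M" and Ym [measurable]: "\<And>x. Y x \<in> borel_measurable M"
  and Y: "\<And>x y. x \<in> {-R..R} \<Longrightarrow> y \<in> {-R..R} \<Longrightarrow> (\<integral>\<^sup>+w. ennreal ((Y x w - Y y w)^2) \<partial>M) \<le> ennreal (c * (x - y)^2)"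
  and Y2: "integrable M (\<lambda>w. (Y (- R) w)^2)" and c: "c \<ge> 0"
 shows "field_in_L2_W12 M U Y"
proof -
 interpret prob_space M by fact
 let ?h = "\<lambda>n w. dyadic_energy n (\<lambda>x. Y x w)"
 have hm [measurable]: "?h n \<in> borel_measurable M" for n unfolding dyadic_energy_def slope_def by measurable
 have h0: "0 \<le> dyadic_energy n u" for n u using mesh_pos[of n] by (simp add: dyadic_energy_def sum_nonneg)
 have Eh: "(\<integral>\<^sup>+w. ennreal (?h n w) \<partial>M) \<le> ennreal (2 * R * c)" for n
 proof -
  have "(\<integral>\<^sup>+w. ennreal (?h n w) \<partial>M)
   = (\<integral>\<^sup>+w. (\<Sum>k<2 ^ n. ennreal (1 / mesh n) * ennreal ((Y (node n (Suc k)) w - Y (node n k) w)^2)) \<partial>M)"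
  proof (rule nn_integral_cong)
   fix w
   have "?h n w = (\<Sum>k<2 ^ n. 1 / mesh n * (Y (node n (Suc k)) w - Y (node n k) w)^2)"
    unfolding dyadic_energy_def sum_distrib_left using mesh_pos[of n]
    by (intro sum.cong) (auto simp: slope_def power2_eq_square)
   then have "ennreal (?h n w) = (\<Sum>k<2 ^ n. ennreal (1 / mesh n * (Y (node n (Suc k)) w - Y (node n k) w)^2))"
    using mesh_pos[of n] by (simp only:, subst sum_ennreal) (auto intro: less_imp_le)
   also have "\<dots> = (\<Sum>k<2 ^ n. ennreal (1 / mesh n) * ennreal ((Y (node n (Suc k)) w - Y (node n k) w)^2))"
    using mesh_pos[of n] by (intro sum.cong refl ennreal_mult) (auto intro: less_imp_le)
   finally show "ennreal (?h n w) = \<dots>" .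
  qed
  also have "\<dots> = (\<Sum>k<2 ^ n. ennreal (1 / mesh n) * (\<integral>\<^sup>+w. ennreal ((Y (node n (Suc k)) w - Y (node n k) w)^2) \<partial>M))"
   by (simp add: nn_integral_sum nn_integral_cmult)
  also have "\<dots> \<le> (\<Sum>k<(2::nat) ^ n. ennreal (1 / mesh n) * ennreal (c * (mesh n)^2))"
  proof (intro sum_mono mult_left_mono)
   fix k :: nat assume "k \<in> {..<2 ^ n}"
   then have k: "real (Suc k) \<le> real (2 ^ n)" unfolding of_nat_le_iff by simp
   have "node n i \<in> {-R..R}" if "real i \<le> real (2 ^ n)" for i
    using mult_right_mono[OF that less_imp_le[OF mesh_pos[of n]]] mesh_pos[of n] R_pos by (simp add: node_def mesh_def)
   moreover have "node n (Suc k) - node n k = mesh n" by (simp add: node_def algebra_simps)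
   ultimately show "(\<integral>\<^sup>+w. ennreal ((Y (node n (Suc k)) w - Y (node n k) w)^2) \<partial>M) \<le> ennreal (c * (mesh n)^2)"
    using Y[of "node n (Suc k)" "node n k"] k by simp
  qed simp
  also have "\<dots> = ennreal (\<Sum>k<(2::nat) ^ n. 1 / mesh n * (c * (mesh n)^2))"
  proof -
   have "ennreal (1 / mesh n) * ennreal (c * (mesh n)^2) = ennreal (1 / mesh n * (c * (mesh n)^2))"
    using mesh_pos[of n] c by (intro ennreal_mult[symmetric]) (auto intro: less_imp_le)
   then show ?thesis using mesh_pos[of n] c by (simp only:, intro sum_ennreal) (auto intro: less_imp_le)
  qed
  also have "(\<Sum>k<(2::nat) ^ n. 1 / mesh n * (c * (mesh n)^2)) = 2 * R * c"
   using R_pos by (simp add: mesh_def power2_eq_square)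
  finally show ?thesis .
 qed
 \<comment> \<open>The outcomes with bounded energies.\<close>
 define G where "G = {w \<in> space M. \<exists>b::nat. \<forall>n. ?h n w \<le> real b}"
 have G [measurable]: "G \<in> sets M" unfolding G_def by measurable
 have AE_G: "AE w in M. w \<in> G"
 proof -
  have "(\<integral>\<^sup>+w. (SUP n. ennreal (?h n w)) \<partial>M) = (SUP n. \<integral>\<^sup>+w. ennreal (?h n w) \<partial>M)"
   by (rule nn_integral_monotone_convergence_SUP)
     (auto simp: incseq_def le_fun_def intro!: ennreal_leI dyadic_energy_mono)
  also have "\<dots> \<le> ennreal (2 * R * c)" by (rule SUP_least) (rule Eh)
  also have "\<dots> < \<infinity>" by simp
  finally have "AE w in M. (SUP n. ennreal (?h n w)) \<noteq> \<infinity>" by (intro nn_integral_PInf_AE) auto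
  then show ?thesis using AE_space
  proof eventually_elim
   case (elim w)
   then obtain r where r: "0 \<le> r" "(SUP n. ennreal (?h n w)) = ennreal r"
    by (cases "SUP n. ennreal (?h n w)") auto
   have "?h n w \<le> real (nat \<lceil>r\<rceil>)" for n
   proof -
    have "ennreal (?h n w) \<le> ennreal r" unfolding r(2)[symmetric] by (rule SUP_upper) simp
    then have "?h n w \<le> r" using r(1) by simp
    then show ?thesis by linarith
   qed
   then show "w \<in> G" using elim by (auto simp: G_def)
  qed
 qed
 define W where "W w x = indicator G w * Y x w" for w x
 have Wm [measurable]: "(\<lambda>w. W w x) \<in> borel_measurable M" for x unfolding W_def by measurable
 have W_G: "W w = (if w \<in> G then (\<lambda>x. Y x w) else (\<lambda>x. 0))" for w by (auto simp: W_def fun_eq_iff)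
 have hW: "dyadic_energy n (W w) \<le> ?h n w" for n w
  using h0[of n "\<lambda>x. Y x w"] by (cases "w \<in> G") (simp_all add: W_G dyadic_energy_def[of n "\<lambda>_. 0"] slope_def)
 have bound: "\<exists>b. \<forall>n. dyadic_energy n (W w) \<le> b" for w
 proof (cases "w \<in> G")
  case True
  then show ?thesis by (auto simp: W_G G_def)
 next
  case False
  then have "\<forall>n. dyadic_energy n (W w) \<le> 0" by (simp add: W_G dyadic_energy_def slope_def)
  then show ?thesis by blast
 qed
 have "\<forall>w. \<exists>v. L2 v \<and> (\<lambda>n. energy (\<lambda>y. v y - slope n (W w) (cell n y))) \<longlonglongrightarrow> 0 \<and>
   energy v \<le> 2 * lim (\<lambda>n. dyadic_energy n (W w))"
 proof
  fix w
  obtain b where b: "\<And>n. dyadic_energy n (W w) \<le> b" using bound by blast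
  show "\<exists>v. L2 v \<and> (\<lambda>n. energy (\<lambda>y. v y - slope n (W w) (cell n y))) \<longlonglongrightarrow> 0 \<and>
   energy v \<le> 2 * lim (\<lambda>n. dyadic_energy n (W w))"
   by (rule dyadic_limit[of "W w" b]) (rule b, intro exI conjI)
 qed
 from choice[OF this] obtain v where "\<forall>w. L2 (v w) \<and> (\<lambda>n. energy (\<lambda>y. v w y - slope n (W w) (cell n y))) \<longlonglongrightarrow> 0 \<and>
   energy (v w) \<le> 2 * lim (\<lambda>n. dyadic_energy n (W w))" ..
 then have v: "\<And>w. L2 (v w)" "\<And>w. (\<lambda>n. energy (\<lambda>y. v w y - slope n (W w) (cell n y))) \<longlonglongrightarrow> 0"
   "\<And>w. energy (v w) \<le> 2 * lim (\<lambda>n. dyadic_energy n (W w))" by simp_all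
 \<comment> \<open>The argument is clamped so that the paths are continuous on the whole line.\<close>
 define Z where "Z w x = primitive (W w (- R)) (v w) (max (- R) (min R x))" for w x
 have ZU: "Z w x = primitive (W w (- R)) (v w) x" if "x \<in> {-R..R}" for w x
  using that by (simp add: Z_def)
 have UR: "U \<subseteq> {-R..R}" using U_subset by auto
 have nodes: "(\<lambda>n. W w (node n (cell n x))) \<longlonglongrightarrow> Z w x" if "x \<in> {-R..R}" for x w
  unfolding ZU[OF that] by (rule node_values_tendsto[OF v(1,2) that])
 have Zm [measurable]: "(\<lambda>w. Z w x) \<in> borel_measurable M" for x
 proof -
  have x: "max (- R) (min R x) \<in> {-R..R}" using R_pos by simp
  have "(\<lambda>w. Z w (max (- R) (min R x))) \<in> borel_measurable M"
   by (rule borel_measurable_LIMSEQ_real, rule nodes[OF x], rule Wm)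
  moreover have "Z w (max (- R) (min R x)) = Z w x" for w using R_pos by (simp add: Z_def)
  ultimately show ?thesis by simp
 qed
 have Zc: "continuous_on UNIV (Z w)" for w
 proof -
  have "continuous_on UNIV (primitive (W w (- R)) (v w) \<circ> (\<lambda>x. max (- R) (min R x)))"
   by (intro continuous_on_compose continuous_intros continuous_on_subset[OF continuous_primitive[OF v(1)]])
     (use R_pos in auto)
  then show ?thesis by (simp add: Z_def[abs_def] comp_def)
 qed
 have joint: "(\<lambda>(w, x). Z w x) \<in> borel_measurable (M \<Otimes>\<^sub>M restrict_space borel U)"
 proof -
  have "(\<lambda>p. Z (fst p) (snd p)) \<in> borel_measurable (M \<Otimes>\<^sub>M restrict_space borel U)"
  proof (rule jointly_measurable_continuous[where X = "\<lambda>x w. Z w x"])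
   show "snd \<in> borel_measurable (M \<Otimes>\<^sub>M restrict_space borel U)"
    by (rule measurable_compose[OF measurable_snd]) (simp add: measurable_restrict_space1)
  qed (use Zc in auto)
  then show ?thesis by (simp add: case_prod_unfold)
 qed
 have version: "AE w in M. Z w x = Y x w" if x: "x \<in> {-R..R}" for x
 proof -
  have "(\<integral>\<^sup>+w. ennreal ((Z w x - Y x w)^2) \<partial>M) \<le> 0"
  proof (rule nn_integral_limit_le[where f = "\<lambda>n w. (Y (node n (cell n x)) w - Y x w)^2" and c = "\<lambda>n. ennreal (c * (mesh n)^2)"])
   show "AE w in M. (\<lambda>n. (Y (node n (cell n x)) w - Y x w)^2) \<longlonglongrightarrow> (Z w x - Y x w)^2"
    using AE_G
   proof eventually_elim
    case (elim w)
    then show ?case using nodes[OF x, of w] by (intro tendsto_intros) (simp add: W_G)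
   qed
   have "(\<integral>\<^sup>+w. ennreal ((Y (node n (cell n x)) w - Y x w)^2) \<partial>M) \<le> ennreal (c * (mesh n)^2)" for n
   proof -
    note z = cell_node[OF x, of n]
    have "(node n (cell n x) - x)^2 \<le> (mesh n)^2" using z by (simp add: abs_le_square_iff[symmetric])
    then have "c * (node n (cell n x) - x)^2 \<le> c * (mesh n)^2" using c by (rule mult_left_mono)
    then show ?thesis using z x by (intro order_trans[OF Y ennreal_leI]) auto
   qed
   then show "\<forall>\<^sub>F n in sequentially. (\<integral>\<^sup>+w. ennreal ((Y (node n (cell n x)) w - Y x w)^2) \<partial>M) \<le> ennreal (c * (mesh n)^2)" by simp
   have "(\<lambda>n. ennreal (c * (mesh n)^2)) \<longlonglongrightarrow> ennreal (c * 0^2)" by (intro tendsto_ennrealI tendsto_intros mesh_tendsto)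
   then show "(\<lambda>n. ennreal (c * (mesh n)^2)) \<longlonglongrightarrow> 0" by simp
  qed measurable
  then have "(\<integral>\<^sup>+w. ennreal ((Z w x - Y x w)^2) \<partial>M) = 0" by simp
  then have "AE w in M. ennreal ((Z w x - Y x w)^2) = 0" by (subst (asm) nn_integral_0_iff_AE) auto
  then show ?thesis by eventually_elim simp
 qed
 \<comment> \<open>The simple functions required by strong measurability.\<close>
 define S where "S n w = primitive (round_to n (W w (- R))) (\<lambda>y. round_to n (slope n (W w) (cell n y)))" for n w
 have simple: "simple_function M (S n)" for n
 proof -
  have sm: "(\<lambda>w. slope n (W w) k) \<in> borel_measurable M" for k unfolding slope_def by measurable
  have "simple_function M (\<lambda>w k. if k < 2 ^ n then round_to n (slope n (W w) k) else 0)"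
   by (intro simple_function_family simple_function_round_to sm)
  moreover have "(\<lambda>k. if k < 2 ^ n then round_to n (slope n (W w) k) else 0) = (\<lambda>k. round_to n (slope n (W w) k))" for w
   by (auto simp: slope_def round_to_def)
  ultimately have "simple_function M (\<lambda>w k. round_to n (slope n (W w) k))" by simp
  from simple_function_compose2[OF simple_function_round_to[OF Wm] this, of "\<lambda>c f. primitive c (\<lambda>y. f (cell n y))"]
  show ?thesis by (simp add: S_def[abs_def])
 qed
 have SW: "S n w \<in> W12 U" for n w
  unfolding S_def by (rule W12_primitive(1)[OF L2_round_slope]) simp
 have ZW: "Z w \<in> W12 U" for w by (rule W12_primitive(1)[OF v(1)]) (use ZU UR in blast)
 have lim: "(\<lambda>n. W12_norm U (\<lambda>x. S n w x - Z w x)) \<longlonglongrightarrow> 0" for w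
 proof -
  obtain b where b: "\<And>n. dyadic_energy n (W w) \<le> b" using bound by blast
  show ?thesis unfolding S_def
   by (rule W12_norm_rounded_tendsto[OF v(1,2) b]) (use ZU UR in blast)
 qed
 have norm_lim: "(\<lambda>n. W12_norm U (S n w)) \<longlonglongrightarrow> W12_norm U (Z w)" for w
 proof (rule LIM_zero_cancel, rule Lim_null_comparison[OF _ lim], intro always_eventually allI)
  fix n
  have Zx: "x \<in> U \<Longrightarrow> Z w x = primitive (W w (- R)) (v w) x" for x using ZU UR by blast
  have "W12_norm U (S n w) \<le> W12_norm U (Z w) + W12_norm U (\<lambda>x. S n w x - Z w x)"
   by (rule W12_norm_triangle[OF L2_round_slope v(1)]) (simp_all add: S_def Zx)
  moreover have "W12_norm U (Z w) \<le> W12_norm U (S n w) + W12_norm U (\<lambda>x. Z w x - S n w x)"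
   by (rule W12_norm_triangle[OF v(1) L2_round_slope]) (simp_all add: S_def Zx)
  moreover have "W12_norm U (\<lambda>x. Z w x - S n w x) = W12_norm U (\<lambda>x. S n w x - Z w x)"
   by (rule W12_norm_minus_commute[OF v(1) L2_round_slope]) (simp_all add: S_def Zx)
  ultimately show "norm (W12_norm U (S n w) - W12_norm U (Z w)) \<le> W12_norm U (\<lambda>x. S n w x - Z w x)"
   by simp
 qed
 have Wn [measurable]: "(\<lambda>w. W12_norm U (Z w)) \<in> borel_measurable M"
  by (rule borel_measurable_LIMSEQ_real[OF norm_lim])
    (intro borel_measurable_simple_function simple_function_compose1[OF simple])
 have "integrable M (\<lambda>w. (W12_norm U (Z w))^2)"
 proof (rule integrableI_bounded)
  let ?H = "\<lambda>w. lim (\<lambda>n. dyadic_energy n (W w))" and ?k = "16 * R^2 + 2"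
  have dm [measurable]: "(\<lambda>w. dyadic_energy n (W w)) \<in> borel_measurable M" for n unfolding dyadic_energy_def slope_def by measurable
  have Hl: "(\<lambda>n. dyadic_energy n (W w)) \<longlonglongrightarrow> ?H w" for w
  proof -
   obtain b where b: "\<And>n. dyadic_energy n (W w) \<le> b" using bound by blast
   have "incseq (\<lambda>n. dyadic_energy n (W w))" using dyadic_energy_mono by (auto simp: incseq_def)
   from incseq_convergent[OF this, of b] b show ?thesis unfolding convergent_LIMSEQ_iff[symmetric] convergent_def by blast
  qed
  have [measurable]: "?H \<in> borel_measurable M" by measurable
  have H0: "0 \<le> ?H w" for w by (rule LIMSEQ_le_const[OF Hl]) (use h0 in auto)
  have EH: "(\<integral>\<^sup>+w. ennreal (?H w) \<partial>M) \<le> ennreal (2 * R * c)"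
   by (rule nn_integral_limit_le[where c = "\<lambda>_. ennreal (2 * R * c)", OF dm AE_I2[OF Hl]])
     (auto intro!: always_eventually order_trans[OF nn_integral_mono[OF ennreal_leI[OF hW]] Eh])
  have "(\<integral>\<^sup>+w. ennreal (norm ((W12_norm U (Z w))^2)) \<partial>M)
   \<le> (\<integral>\<^sup>+w. ennreal (8 * R) * ennreal ((Y (- R) w)^2) + ennreal (?k * 2) * ennreal (?H w) \<partial>M)"
  proof (rule nn_integral_mono)
   fix w
   have "(W12_norm U (Z w))^2 \<le> 8 * R * (W w (- R))^2 + ?k * energy (v w)"
    by (rule W12_primitive(3)[OF v(1)]) (use ZU UR in blast)
   also have "\<dots> \<le> 8 * R * (Y (- R) w)^2 + ?k * (2 * ?H w)"
    using R_pos by (intro add_mono mult_left_mono v(3)) (auto simp: W_def indicator_def)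
   finally have "(W12_norm U (Z w))^2 \<le> 8 * R * (Y (- R) w)^2 + ?k * 2 * ?H w" by (simp only: mult.assoc)
   then show "ennreal (norm ((W12_norm U (Z w))^2)) \<le> ennreal (8 * R) * ennreal ((Y (- R) w)^2) + ennreal (?k * 2) * ennreal (?H w)"
    using R_pos H0[of w] by (simp add: ennreal_mult[symmetric] ennreal_plus[symmetric] ennreal_leI del: ennreal_plus)
  qed
  also have "\<dots> = ennreal (8 * R) * (\<integral>\<^sup>+w. ennreal ((Y (- R) w)^2) \<partial>M) + ennreal (?k * 2) * (\<integral>\<^sup>+w. ennreal (?H w) \<partial>M)"
   by (simp add: nn_integral_add nn_integral_cmult)
  also have "\<dots> < \<infinity>"
  proof -
   have "(\<integral>\<^sup>+w. ennreal ((Y (- R) w)^2) \<partial>M) < \<infinity>" using Y2 by (simp add: nn_integral_eq_integral)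
   then show ?thesis using EH by (auto simp: ennreal_mult_less_top top_unique intro: le_less_trans)
  qed
  finally show "(\<integral>\<^sup>+w. ennreal (norm ((W12_norm U (Z w))^2)) \<partial>M) < \<infinity>" .
 qed measurable
 then show ?thesis
  unfolding field_in_L2_W12_def bochner_L2_W12_def
  using joint version UR ZW simple SW lim by (intro exI[of _ Z]) (auto intro!: exI[of _ S])
qed

end

section \<open>Independence of the Brownian increments from the past\<close>

text \<open>A generator of the unaugmented past that is stable under intersections.\<close>

definition cylinders :: "'w measure \<Rightarrow> (real \<Rightarrow> 'w \<Rightarrow> real) \<Rightarrow> real \<Rightarrow> 'w set set" where
 "cylinders M B s = {{w \<in> space M. \<forall>u\<in>I. B u w \<in> A u} | I A. finite I \<and> I \<subseteq> {0..s} \<and> (\<forall>u. A u \<in> sets borel)}"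

lemma Int_stable_cylinders: "Int_stable (cylinders M B s)"
proof (rule Int_stableI)
 fix a a' assume "a \<in> cylinders M B s" "a' \<in> cylinders M B s"
 then obtain I A J A' where a: "a = {w \<in> space M. \<forall>u\<in>I. B u w \<in> A u}" "finite I" "I \<subseteq> {0..s}" "\<forall>u. A u \<in> sets borel"
  and a': "a' = {w \<in> space M. \<forall>u\<in>J. B u w \<in> A' u}" "finite J" "J \<subseteq> {0..s}" "\<forall>u. A' u \<in> sets borel"
  unfolding cylinders_def by blast
 let ?A = "\<lambda>u. (if u \<in> I then A u else UNIV) \<inter> (if u \<in> J then A' u else UNIV)"
 have eq: "a \<inter> a' = {w \<in> space M. \<forall>u\<in>I \<union> J. B u w \<in> ?A u}" by (auto simp: a(1) a'(1))
 have "\<forall>u. ?A u \<in> sets borel" using a(4) a'(4) by simp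
 then show "a \<inter> a' \<in> cylinders M B s"
  unfolding cylinders_def eq using a(2,3) a'(2,3)
  by (intro CollectI exI[of _ "I \<union> J"] exI[of _ ?A] conjI refl) auto
qed

text \<open>Independence is given for the increments over consecutive times, so the times of a cylinder are listed in order, together with 0, \<open>s\<close> and \<open>t\<close>.\<close>

lemma finite_times_enumeration:
 fixes s :: real
 assumes I: "finite I" "I \<subseteq> {0..s}" and s: "0 \<le> s" "s < t"
 obtains m \<tau> where "mono_on {..Suc m} \<tau>" "\<tau> ` {..Suc m} \<subseteq> {0..t}" "\<tau> 0 = 0" "\<tau> m = s" "\<tau> (Suc m) = t" "I \<subseteq> \<tau> ` {..m}"
proof -
 \<comment> \<open>The last time \<open>t\<close> is appended as number \<open>Suc m\<close>.\<close>
 define xs where "xs = sorted_list_of_set (insert 0 (insert s I))"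
 have set: "set xs = insert 0 (insert s I)" and sorted: "sorted xs"
  unfolding xs_def using I by (simp_all only: set_sorted_list_of_set finite_insert sorted_sorted_list_of_set)
 then have ne: "xs \<noteq> []" by auto
 have mem: "x \<in> {0..s}" if "x \<in> set xs" for x using that I s by (auto simp: set)
 define m where "m = length xs - 1"
 have m: "Suc m = length xs" using ne by (simp add: m_def)
 have nth: "xs ! i \<le> xs ! j" if "i \<le> j" "j \<le> m" for i j using sorted_nth_mono[OF sorted] that m by simp
 have idx: "\<exists>i\<le>m. xs ! i = x" if "x \<in> set xs" for x
  using that m unfolding in_set_conv_nth by (auto simp: less_Suc_eq_le[symmetric])
 have nmem: "xs ! i \<in> {0..s}" if "i \<le> m" for i using that m by (intro mem nth_mem) simp
 define \<tau> where "\<tau> i = (if i \<le> m then xs ! i else t)" for i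
 have "xs ! 0 = 0"
 proof -
  obtain i where "i \<le> m" "xs ! i = 0" using idx[of 0] set by auto
  then show ?thesis using nth[of 0 i] nmem[of 0] by simp
 qed
 moreover have "xs ! m = s"
 proof -
  obtain i where "i \<le> m" "xs ! i = s" using idx[of s] set by auto
  then show ?thesis using nth[of i m] nmem[of m] by simp
 qed
 moreover have "I \<subseteq> \<tau> ` {..m}"
 proof
  fix x assume "x \<in> I"
  then obtain i where "i \<le> m" "xs ! i = x" using idx[of x] set by auto
  then show "x \<in> \<tau> ` {..m}" by (intro image_eqI[of _ _ i]) (auto simp: \<tau>_def)
 qed
 moreover have "mono_on {..Suc m} \<tau>"
 proof (rule mono_onI)
  fix i j assume "i \<le> j" "j \<in> {..Suc m}"
  then show "\<tau> i \<le> \<tau> j" using nth[of i j] nmem[of i] s by (auto simp: \<tau>_def)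
 qed
 moreover have "\<tau> ` {..Suc m} \<subseteq> {0..t}" using nmem s by (force simp: \<tau>_def)
 ultimately show ?thesis using that[of m \<tau>] by (simp add: \<tau>_def)
qed

lemma sets_augmented_filtration:
 "sets (augmented_filtration M B t) = sigma_sets (space M)
   ({B s -` A \<inter> space M | s A. 0 \<le> s \<and> s \<le> t \<and> A \<in> sets borel} \<union> null_sets M)"
 unfolding augmented_filtration_def
 by (rule sets_measure_of) (auto dest: sets.sets_into_space null_setsD2)

lemma space_augmented_filtration [simp]: "space (augmented_filtration M B t) = space M"
 by (simp add: augmented_filtration_def space_measure_of_conv)

text \<open>The events with this property form a sigma algebra that contains the generators, null sets included.\<close>

lemma augmented_filtration_AE_eq:
 assumes "a \<in> sets (augmented_filtration M B s)"
 shows "\<exists>a0\<in>sigma_sets (space M) (cylinders M B s). AE w in M. w \<in> a \<longleftrightarrow> w \<in> a0"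
 using assms unfolding sets_augmented_filtration
proof (induction rule: sigma_sets.induct)
 case (Basic a)
 show ?case
 proof (cases "a \<in> null_sets M")
  case True
  then show ?thesis by (intro bexI[of _ "{}"] sigma_sets.Empty) (simp add: AE_not_in)
 next
  case False
  then obtain u A where a: "a = B u -` A \<inter> space M" "0 \<le> u" "u \<le> s" "A \<in> sets borel" using Basic by blast
  then have "a = {w \<in> space M. \<forall>v\<in>{u}. B v w \<in> A}" by auto
  then have "a \<in> cylinders M B s" using a unfolding cylinders_def
   by (intro CollectI exI[of _ "{u}"] exI[of _ "\<lambda>_. A"]) simp
  then show ?thesis by (intro bexI[of _ a] sigma_sets.Basic) auto
 qed
next
 case Empty
 show ?case by (intro bexI[of _ "{}"] sigma_sets.Empty) simp
next
 case (Compl a)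
 then obtain a0 where a0: "a0 \<in> sigma_sets (space M) (cylinders M B s)" "AE w in M. w \<in> a \<longleftrightarrow> w \<in> a0" by blast
 from a0(2) have "AE w in M. w \<in> space M - a \<longleftrightarrow> w \<in> space M - a0" by eventually_elim simp
 then show ?case by (intro bexI[of _ "space M - a0"] sigma_sets.Compl a0(1))
next
 case (Union a)
 then have "\<forall>i. \<exists>c. c \<in> sigma_sets (space M) (cylinders M B s) \<and> (AE w in M. w \<in> a i \<longleftrightarrow> w \<in> c)" by blast
 from choice[OF this] obtain c where c: "\<And>i. c i \<in> sigma_sets (space M) (cylinders M B s)" "\<And>i. AE w in M. w \<in> a i \<longleftrightarrow> w \<in> c i"
  by blast
 from c(2) have "AE w in M. \<forall>i. w \<in> a i \<longleftrightarrow> w \<in> c i" by (simp add: AE_all_countable)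
 then have "AE w in M. w \<in> (\<Union>i. a i) \<longleftrightarrow> w \<in> (\<Union>i. c i)" by eventually_elim simp
 then show ?case by (intro bexI[of _ "\<Union>i. c i"] sigma_sets.Union c(1))
qed

text \<open>On a cylinder the values of the motion are sums of increments up to \<open>s\<close>, which are independent of the increment after \<open>s\<close>.\<close>

lemma brownian_increment_independent_of_past:
 assumes M: "prob_space M" and B: "brownian_motion M T B" and st: "0 \<le> s" "s < t" "t \<le> T"
  and a: "a \<in> sets (augmented_filtration M B s)" and C: "C \<in> sets borel"
 shows "a \<in> sets M \<longrightarrow> measure M (a \<inter> ((\<lambda>w. B t w - B s w) -` C \<inter> space M)) =
  measure M a * measure M ((\<lambda>w. B t w - B s w) -` C \<inter> space M)"
proof -
 interpret prob_space M by fact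
 let ?D = "\<lambda>w. B t w - B s w"
 have Bm: "B u \<in> borel_measurable M" if "u \<in> {0..T}" for u using B that by (simp add: brownian_motion_def)
 have B0: "AE w in M. B 0 w = 0" using B by (simp add: brownian_motion_def)
 have Dm [measurable]: "?D \<in> borel_measurable M" using st by (intro borel_measurable_diff Bm) auto
 have cylM: "cylinders M B s \<subseteq> events"
 proof
  fix h assume "h \<in> cylinders M B s"
  then obtain I A where h: "h = {w \<in> space M. \<forall>u\<in>I. B u w \<in> A u}" "finite I" "I \<subseteq> {0..s}" "\<And>u. A u \<in> sets borel"
   unfolding cylinders_def by blast
  show "h \<in> events" unfolding h(1)
  proof (rule sets.sets_Collect_finite_All[OF _ h(2)])
   fix u assume "u \<in> I"
   then have "B u \<in> borel_measurable M" using h(3) st by (intro Bm) auto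
   from measurable_sets[OF this h(4)[of u]] show "{w \<in> space M. B u w \<in> A u} \<in> events" by (simp add: vimage_def Int_def conj_commute)
  qed
 qed
 have "indep_set (cylinders M B s) {?D -` C \<inter> space M | C. C \<in> sets borel}"
 proof (rule indep_setI[OF cylM])
  show "{?D -` C \<inter> space M | C. C \<in> sets borel} \<subseteq> events" by auto
  fix h d assume "h \<in> cylinders M B s" and "d \<in> {?D -` C \<inter> space M | C. C \<in> sets borel}"
  then obtain I A C where h: "h = {w \<in> space M. \<forall>u\<in>I. B u w \<in> A u}" "finite I" "I \<subseteq> {0..s}" "\<And>u. A u \<in> sets borel"
   and d: "d = ?D -` C \<inter> space M" "C \<in> sets borel"
   unfolding cylinders_def by blast
  obtain m \<tau> where \<tau>: "mono_on {..Suc m} \<tau>" "\<tau> ` {..Suc m} \<subseteq> {0..t}" "\<tau> 0 = 0" "\<tau> m = s" "\<tau> (Suc m) = t" "I \<subseteq> \<tau> ` {..m}"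
   by (rule finite_times_enumeration[OF h(2,3) st(1,2)]) (rule that)
  have "\<forall>u\<in>I. \<exists>j\<le>m. \<tau> j = u" using \<tau>(6) by fastforce
  from bchoice[OF this] obtain j where j: "\<And>u. u \<in> I \<Longrightarrow> j u \<le> m" "\<And>u. u \<in> I \<Longrightarrow> \<tau> (j u) = u" by blast
  let ?\<Delta> = "\<lambda>i w. B (\<tau> (Suc i)) w - B (\<tau> i) w"
  have ind: "indep_vars (\<lambda>_. borel) ?\<Delta> {..<Suc m}"
  proof -
   have "\<tau> ` {..Suc m} \<subseteq> {0..T}" using \<tau>(2) st(3) by fastforce
   with \<tau>(1) B show ?thesis unfolding brownian_motion_def by blast
  qed
  let ?P = "\<lambda>J. PiM J (\<lambda>_. borel :: real measure)"
  let ?f = "\<lambda>w. restrict (\<lambda>i. ?\<Delta> i w) {..<m}" and ?g = "\<lambda>w. restrict (\<lambda>i. ?\<Delta> i w) {m}"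
  have iv: "indep_var (?P {..<m}) ?f (?P {m}) ?g" by (rule indep_var_restrict[OF ind]) auto
  define Xa where "Xa = {f \<in> space (?P {..<m}). \<forall>u\<in>I. (\<Sum>i<j u. f i) \<in> A u}"
  define Xb where "Xb = {f \<in> space (?P {m}). f m \<in> C}"
  have Xa: "Xa \<in> sets (?P {..<m})" unfolding Xa_def
  proof (rule sets.sets_Collect_finite_All[OF _ h(2)])
   fix u assume u: "u \<in> I"
   have "(\<lambda>f. \<Sum>i<j u. f i) \<in> borel_measurable (?P {..<m})"
    using j(1)[OF u] by (intro borel_measurable_sum measurable_component_singleton) auto
   from measurable_sets[OF this h(4)[of u]] show "{f \<in> space (?P {..<m}). (\<Sum>i<j u. f i) \<in> A u} \<in> sets (?P {..<m})"
    by (simp add: vimage_def Int_def conj_commute)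
  qed
  have Xb: "Xb \<in> sets (?P {m})"
  proof -
   have "(\<lambda>f. f m) \<in> borel_measurable (?P {m})" by (intro measurable_component_singleton) auto
   from measurable_sets[OF this d(2)] show ?thesis by (simp add: Xb_def vimage_def Int_def conj_commute)
  qed
  have fa: "?f -` Xa \<inter> space M \<in> events" using measurable_sets[OF indep_var_rv1[OF iv] Xa] .
  have gb: "?g -` Xb \<inter> space M = d"
   using \<tau>(4,5) by (auto simp: Xb_def d space_PiM)
  \<comment> \<open>Almost surely only, since the motion starts at 0 almost surely.\<close>
  have AEh: "AE w in M. w \<in> ?f -` Xa \<inter> space M \<longleftrightarrow> w \<in> h"
   using B0
  proof eventually_elim
   case (elim w)
   have "(\<Sum>i<j u. ?f w i) = B u w" if u: "u \<in> I" for u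
   proof -
    have "(\<Sum>i<j u. ?f w i) = (\<Sum>i<j u. ?\<Delta> i w)" using j(1)[OF u] by (intro sum.cong) auto
    also have "\<dots> = B (\<tau> (j u)) w - B (\<tau> 0) w" by (rule sum_lessThan_telescope)
    finally show ?thesis using elim \<tau>(3) j(2)[OF u] by simp
   qed
   moreover have "?f w \<in> space (?P {..<m})" by (simp add: space_PiM)
   ultimately show ?case by (auto simp: Xa_def h)
  qed
  have hM: "h \<in> events" using cylM \<open>h \<in> cylinders M B s\<close> by blast
  have dM: "d \<in> events" using d by auto
  have "prob (h \<inter> d) = prob ((?f -` Xa \<inter> space M) \<inter> (?g -` Xb \<inter> space M))"
   unfolding gb using fa hM dM AEh by (intro measure_eq_AE) auto
  also have "\<dots> = prob ((\<lambda>w. (?f w, ?g w)) -` (Xa \<times> Xb) \<inter> space M)" by (intro arg_cong[of _ _ prob]) auto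
  also have "\<dots> = prob (?f -` Xa \<inter> space M) * prob (?g -` Xb \<inter> space M)" by (rule indep_varD[OF iv Xa Xb])
  also have "prob (?f -` Xa \<inter> space M) = prob h" using fa hM AEh by (intro measure_eq_AE) auto
  finally show "prob (h \<inter> d) = prob h * prob d" unfolding gb .
 qed
 moreover have "Int_stable {?D -` C \<inter> space M | C. C \<in> sets borel}"
 proof (rule Int_stableI, clarify)
  fix C C' :: "real set" assume "C \<in> sets borel" "C' \<in> sets borel"
  then show "\<exists>C''. (?D -` C \<inter> space M) \<inter> (?D -` C' \<inter> space M) = ?D -` C'' \<inter> space M \<and> C'' \<in> sets borel"
   by (intro exI[of _ "C \<inter> C'"]) auto
 qed
 ultimately have ind: "indep_set (sigma_sets (space M) (cylinders M B s)) (sigma_sets (space M) {?D -` C \<inter> space M | C. C \<in> sets borel})"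
  by (intro indep_set_sigma_sets Int_stable_cylinders)
 obtain a0 where a0: "a0 \<in> sigma_sets (space M) (cylinders M B s)" "AE w in M. w \<in> a \<longleftrightarrow> w \<in> a0"
  using augmented_filtration_AE_eq[OF a] by blast
 have d: "?D -` C \<inter> space M \<in> sigma_sets (space M) {?D -` C \<inter> space M | C. C \<in> sets borel}"
  using C by (intro sigma_sets.Basic) blast
 have a0M: "a0 \<in> events" using indep_setD_ev1[OF ind] a0(1) by blast
 show ?thesis
 proof
  assume aM: "a \<in> sets M"
  have "prob (a \<inter> (?D -` C \<inter> space M)) = prob (a0 \<inter> (?D -` C \<inter> space M))"
   using a0(2) aM a0M C by (intro measure_eq_AE) auto
  also have "\<dots> = prob a0 * prob (?D -` C \<inter> space M)" by (rule indep_setD[OF ind a0(1) d])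
  also have "prob a0 = prob a" using a0(2) aM a0M by (intro measure_eq_AE) auto
  finally show "prob (a \<inter> (?D -` C \<inter> space M)) = prob a * prob (?D -` C \<inter> space M)" .
 qed
qed

section \<open>Reduction to continuous processes\<close>

lemma AE_null_set:
 assumes "AE w in M. P w"
 obtains N where "N \<in> null_sets M" "\<And>w. w \<in> space M - N \<Longrightarrow> P w"
 using AE_E3[OF assms] by blast

lemma null_set_in_augmented: "N \<in> null_sets M \<Longrightarrow> N \<in> sets (augmented_filtration M B t)"
 unfolding sets_augmented_filtration by (rule sigma_sets.Basic) simp

text \<open>Redefinition on a null set, and freezing outside the time interval, turns an almost surely
 continuous process into a continuous one. Adaptedness survives since the null sets belong to the filtration.\<close>

lemma redefined_process:
 fixes X :: "real \<Rightarrow> 'w \<Rightarrow> real" and x :: real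
 assumes T: "T > 0" and N: "N \<in> null_sets M" and F: "\<forall>t\<in>{0..T}. sets (augmented_filtration M B t) \<subseteq> sets M"
  and X: "\<forall>t\<in>{0..T}. X t \<in> borel_measurable (augmented_filtration M B t)"
  and cont: "\<forall>w\<in>space M - N. continuous_on {0..T} (\<lambda>t. X t w)"
 defines "X' \<equiv> \<lambda>t w. if w \<in> N then x else X (max 0 (min T t)) w"
 shows "\<And>t. t \<in> {0..T} \<Longrightarrow> X' t \<in> borel_measurable (augmented_filtration M B t)"
  and "\<And>t. X' t \<in> borel_measurable M"
  and "\<And>w. w \<in> space M \<Longrightarrow> continuous_on UNIV (\<lambda>t. X' t w)"
  and "\<And>t. t \<in> {0..T} \<Longrightarrow> AE w in M. X' t w = X t w"
proof -
 let ?F = "augmented_filtration M B"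
 have NM: "N \<inter> space M = N" using sets.sets_into_space[OF null_setsD2[OF N]] by blast
 have "X' t = (\<lambda>w. if w \<in> N then x else X t w)" if "t \<in> {0..T}" for t using that by (simp add: X'_def fun_eq_iff)
 moreover have "(\<lambda>w. if w \<in> N then x else X t w) \<in> borel_measurable (?F t)" if t: "t \<in> {0..T}" for t
  by (rule measurable_If_set) (use bspec[OF X t] null_set_in_augmented[OF N] in \<open>auto simp: NM\<close>)
 ultimately show m: "X' t \<in> borel_measurable (?F t)" if "t \<in> {0..T}" for t using that by simp
 show "X' t \<in> borel_measurable M" for t
 proof -
  let ?t = "max 0 (min T t)"
  have t: "?t \<in> {0..T}" using T by auto
  then have "X' ?t \<in> borel_measurable M"
   using m[OF t] measurable_mono[OF order_refl refl bspec[OF F t], of borel] by auto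
  moreover have "X' ?t = X' t" using T by (auto simp: X'_def fun_eq_iff)
  ultimately show ?thesis by simp
 qed
 show "continuous_on UNIV (\<lambda>t. X' t w)" if "w \<in> space M" for w
 proof (cases "w \<in> N")
  case False
  have "continuous_on UNIV ((\<lambda>t. X t w) \<circ> (\<lambda>t. max 0 (min T t)))"
   by (intro continuous_on_compose continuous_intros continuous_on_subset[OF bspec[OF cont]]) (use T False that in auto)
  then show ?thesis using False by (simp add: X'_def comp_def)
 qed (simp add: X'_def)
 show "AE w in M. X' t w = X t w" if "t \<in> {0..T}" for t
  using AE_not_in[OF N] by eventually_elim (use that in \<open>simp add: X'_def\<close>)
qed

lemma continuous_brownian_motion:
 assumes T: "T > 0" and M: "prob_space M" and B: "brownian_motion M T B"
 obtains B' where "adapted_BM M T B' (augmented_filtration M B)" "AE w in M. \<forall>t\<in>{0..T}. B' t w = B t w"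
  "\<forall>t\<in>{0..T}. sets (augmented_filtration M B t) \<subseteq> sets M"
proof -
 interpret prob_space M by fact
 let ?F = "augmented_filtration M B"
 have Bm: "B u \<in> borel_measurable M" if "u \<in> {0..T}" for u using B that by (simp add: brownian_motion_def)
 have F: "\<forall>t\<in>{0..T}. sets (?F t) \<subseteq> sets M"
  unfolding sets_augmented_filtration
 proof (intro ballI, rule sets.sigma_sets_subset, rule Un_least)
  fix t assume t: "t \<in> {0..T}"
  show "{B s -` A \<inter> space M | s A. 0 \<le> s \<and> s \<le> t \<and> A \<in> sets borel} \<subseteq> sets M"
  proof clarify
   fix s and A :: "real set" assume "0 \<le> s" "s \<le> t" "A \<in> sets borel"
   then show "B s -` A \<inter> space M \<in> sets M" using t by (intro measurable_sets[OF Bm]) auto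
  qed
  show "null_sets M \<subseteq> sets M" by blast
 qed
 have Fmono: "sets (?F s) \<subseteq> sets (?F t)" if "s \<le> t" for s t
  unfolding sets_augmented_filtration by (rule sigma_sets_mono') (use that in \<open>blast intro: order_trans\<close>)
 have Bad: "\<forall>t\<in>{0..T}. B t \<in> borel_measurable (?F t)"
 proof (intro ballI measurableI)
  fix t and A :: "real set" assume "t \<in> {0..T}" "A \<in> sets borel"
  then show "B t -` A \<inter> space (?F t) \<in> sets (?F t)"
   unfolding sets_augmented_filtration space_augmented_filtration by (intro sigma_sets.Basic UnI1 CollectI exI[of _ t] exI[of _ A]) auto
 qed simp
 have "AE w in M. B 0 w = 0 \<and> continuous_on {0..T} (\<lambda>t. B t w)"
  using B by (simp add: brownian_motion_def)
 then obtain N where N: "N \<in> null_sets M" "\<And>w. w \<in> space M - N \<Longrightarrow> B 0 w = 0 \<and> continuous_on {0..T} (\<lambda>t. B t w)"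
  by (rule AE_null_set) (rule that)
 define B' where "B' t w = (if w \<in> N then 0 else B (max 0 (min T t)) w)" for t w
 have cont: "\<forall>w\<in>space M - N. continuous_on {0..T} (\<lambda>t. B t w)" using N(2) by blast
 note R = redefined_process[OF T N(1) F Bad cont, where x = 0, folded B'_def]
 have B': "AE w in M. \<forall>t\<in>{0..T}. B' t w = B t w"
  using AE_not_in[OF N(1)] by eventually_elim (simp add: B'_def)
 have B'0: "B' 0 w = 0" if "w \<in> space M" for w using N(2)[of w] T that by (simp add: B'_def)
 have "adapted_BM M T B' ?F"
 proof
  show "distr M (?F s \<Otimes>\<^sub>M borel) (\<lambda>w. (w, B' t w - B' s w)) = distr M (?F s) (\<lambda>w. w) \<Otimes>\<^sub>M gauss (t - s)"
   if st: "0 \<le> s" "s < t" "t \<le> T" for s t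
  proof (rule pair_measure_eqI[symmetric])
   let ?D = "\<lambda>w. B t w - B s w"
   have id: "(\<lambda>w. w) \<in> measurable M (?F s)"
    using bspec[OF F, of s] st by (intro measurableI) (auto dest: sets.sets_into_space intro: sets.Int)
   interpret d: prob_space "distr M (?F s) (\<lambda>w. w)" by (rule prob_space_distr[OF id])
   interpret g: prob_space "gauss (t - s)" using st by (intro prob_space_gauss) simp
   show "sigma_finite_measure (distr M (?F s) (\<lambda>w. w))" "sigma_finite_measure (gauss (t - s))"
    by unfold_locales
   show "sets (distr M (?F s) (\<lambda>w. w) \<Otimes>\<^sub>M gauss (t - s)) = sets (distr M (?F s \<Otimes>\<^sub>M borel) (\<lambda>w. (w, B' t w - B' s w)))"
    by (simp cong: sets_pair_measure_cong)
   fix a C assume "a \<in> sets (distr M (?F s) (\<lambda>w. w))" "C \<in> sets (gauss (t - s))"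
   then have a: "a \<in> sets (?F s)" and C [measurable]: "C \<in> sets borel" by auto
   have aM: "a \<in> sets M" using bspec[OF F, of s] a st by auto
   have Dm: "?D \<in> borel_measurable M" using st by (intro borel_measurable_diff Bm) auto
   have D'm: "(\<lambda>w. B' t w - B' s w) \<in> borel_measurable M" by (intro borel_measurable_diff R(2))
   have D: "?D -` C \<inter> space M \<in> sets M" "(\<lambda>w. B' t w - B' s w) -` C \<inter> space M \<in> sets M"
    by (rule measurable_sets[OF Dm C], rule measurable_sets[OF D'm C])
   have "emeasure (gauss (t - s)) C = emeasure (distr M lborel ?D) C"
   proof -
    have "distributed M lborel ?D (normal_density 0 (sqrt (t - s)))" using B st by (simp add: brownian_motion_def)
    then show ?thesis by (simp add: distributed_distr_eq_density gauss_def)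
   qed
   also have "\<dots> = emeasure M (?D -` C \<inter> space M)" using Dm by (intro emeasure_distr) auto
   finally have gC: "emeasure (gauss (t - s)) C = emeasure M (?D -` C \<inter> space M)" .
   have "emeasure (distr M (?F s) (\<lambda>w. w)) a * emeasure (gauss (t - s)) C = emeasure M a * emeasure M (?D -` C \<inter> space M)"
    using aM sets.sets_into_space[OF aM] unfolding gC by (subst emeasure_distr[OF id a]) (simp add: Int_absorb2)
   also have "\<dots> = emeasure M (a \<inter> (?D -` C \<inter> space M))"
    using brownian_increment_independent_of_past[OF M B st a C] aM
    by (simp add: emeasure_eq_measure ennreal_mult[symmetric])
   also have "\<dots> = emeasure M (a \<inter> ((\<lambda>w. B' t w - B' s w) -` C \<inter> space M))"
   proof (rule emeasure_eq_AE)
    show "AE w in M. w \<in> a \<inter> (?D -` C \<inter> space M) \<longleftrightarrow> w \<in> a \<inter> ((\<lambda>w. B' t w - B' s w) -` C \<inter> space M)"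
     using B' by eventually_elim (use st in auto)
   qed (use aM D in auto)
   also have "\<dots> = emeasure (distr M (?F s \<Otimes>\<^sub>M borel) (\<lambda>w. (w, B' t w - B' s w))) (a \<times> C)"
   proof -
    have "(\<lambda>w. (w, B' t w - B' s w)) \<in> measurable M (?F s \<Otimes>\<^sub>M borel)" by (intro measurable_Pair id D'm)
    from emeasure_distr[OF this, of "a \<times> C"] a C show ?thesis
     by (simp add: Int_def vimage_def conj_ac)
   qed
   finally show "emeasure (distr M (?F s) (\<lambda>w. w)) a * emeasure (gauss (t - s)) C = \<dots>" .
  qed
 qed (use T F Fmono R B'0 in auto)
 then show ?thesis using B' F by (rule that)
qed

text \<open>Motion and solutions are redefined on null sets. The constants of the two Lipschitz conditions are replaced by their maximum.\<close>

lemma adapted_mean_field: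
 assumes T: "T > 0" and M: "prob_space M" and B: "brownian_motion M T B" and d: "decomposable T b" and l: "lipschitz_in_law T b"
  and X: "\<And>x. strong_solution M T B b x (X x)"
 obtains B' bh bt K C X' where "mean_field M T B' (augmented_filtration M B) b bh bt K C"
  "\<And>x. mean_field.solution M T B' (augmented_filtration M B) b x (X' x)" "\<And>x t. t \<in> {0..T} \<Longrightarrow> AE w in M. X' x t w = X x t w"
proof -
 let ?F = "augmented_filtration M B"
 obtain B' where BM: "adapted_BM M T B' ?F" and B': "AE w in M. \<forall>t\<in>{0..T}. B' t w = B t w"
  and F: "\<forall>t\<in>{0..T}. sets (?F t) \<subseteq> sets M"
  by (rule continuous_brownian_motion[OF T M B]) (rule that)
 obtain bh bt K C1 where bd: "\<forall>t\<in>{0..T}. \<forall>y. \<forall>\<mu>\<in>P1. b t y \<mu> = bh t y \<mu> + bt t y \<mu>"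
   "(\<lambda>(t, y, \<mu>). bh t y \<mu>) \<in> borel_measurable (drift_space T)" "\<forall>t\<in>{0..T}. \<forall>y. \<forall>\<mu>\<in>P1. \<bar>bh t y \<mu>\<bar> \<le> K" "C1 > 0"
   "\<forall>t\<in>{0..T}. \<forall>y. \<forall>\<mu>\<in>P1. \<bar>bt t y \<mu>\<bar> \<le> C1 * (1 + \<bar>y\<bar> + kantorovich \<mu> (return borel 0))"
   "\<forall>t\<in>{0..T}. \<forall>y1 y2. \<forall>\<mu>\<in>P1. \<bar>bt t y1 \<mu> - bt t y2 \<mu>\<bar> \<le> C1 * \<bar>y1 - y2\<bar>"
  using d unfolding decomposable_def by blast
 obtain C2 where C2: "\<forall>t\<in>{0..T}. \<forall>y. \<forall>\<mu>\<in>P1. \<forall>\<nu>\<in>P1. \<bar>b t y \<mu> - b t y \<nu>\<bar> \<le> C2 * kantorovich \<mu> \<nu>"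
  using l unfolding lipschitz_in_law_def by blast
 have k0: "0 \<le> kantorovich \<mu> \<nu>" for \<mu> \<nu> by (rule Metric_space.nonneg[OF Metric_space_P1])
 define C where "C = max C1 C2"
 have C: "C1 * z \<le> C * z" "C2 * z \<le> C * z" if "0 \<le> z" for z using that by (auto simp: C_def intro: mult_right_mono)
 interpret adapted_BM M T B' ?F by fact
 interpret mean_field M T B' ?F b bh bt K C
 proof
  fix t y y1 y2 and \<mu> \<nu> :: "real measure" assume t: "t \<in> {0..T}" and \<mu>: "\<mu> \<in> P1"
  show "b t y \<mu> = bh t y \<mu> + bt t y \<mu>" "\<bar>bh t y \<mu>\<bar> \<le> K" using bd(1,3) t \<mu> by auto
  show "\<bar>bt t y \<mu>\<bar> \<le> C * (1 + \<bar>y\<bar> + kantorovich \<mu> (return borel 0))"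
   using bd(5) t \<mu> k0 by (intro order_trans[OF _ C(1)]) auto
  show "\<bar>bt t y1 \<mu> - bt t y2 \<mu>\<bar> \<le> C * \<bar>y1 - y2\<bar>" using bd(6) t \<mu> by (intro order_trans[OF _ C(1)]) auto
  show "\<bar>b t y \<mu> - b t y \<nu>\<bar> \<le> C * kantorovich \<mu> \<nu>" if "\<nu> \<in> P1"
   using C2 t \<mu> that k0 by (intro order_trans[OF _ C(2)]) auto
 qed (use bd(2,4) in \<open>auto simp: C_def\<close>)
 have ex: "\<exists>X'. solution x X' \<and> (\<forall>t\<in>{0..T}. AE w in M. X' t w = X x t w)" for x
 proof -
  let ?X = "X x" and ?eq = "\<lambda>w. set_integrable lborel {0..T} (\<lambda>s. b s (X x s w) (distr M borel (X x s))) \<and>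
    (\<forall>t\<in>{0..T}. X x t w = x + (LINT s:{0..t}|lborel. b s (X x s w) (distr M borel (X x s))) + B t w)"
  have XF: "\<forall>t\<in>{0..T}. ?X t \<in> borel_measurable (?F t)" "\<forall>t\<in>{0..T}. distr M borel (?X t) \<in> P1"
   using X[of x] by (auto simp: strong_solution_def)
  have "AE w in M. continuous_on {0..T} (\<lambda>t. ?X t w)" "AE w in M. ?eq w"
   using X[of x] by (auto simp: strong_solution_def)
  with B' have "AE w in M. continuous_on {0..T} (\<lambda>t. ?X t w) \<and> ?eq w \<and> (\<forall>t\<in>{0..T}. B' t w = B t w)"
   by eventually_elim blast
  then obtain N where N: "N \<in> null_sets M" "\<forall>w\<in>space M - N. continuous_on {0..T} (\<lambda>t. ?X t w)"
    "\<And>w. w \<in> space M - N \<Longrightarrow> ?eq w" "\<And>w t. w \<in> space M - N \<Longrightarrow> t \<in> {0..T} \<Longrightarrow> B' t w = B t w"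
   by (rule AE_null_set) (rule that, assumption, blast+)
  define X' where "X' t w = (if w \<in> N then x else ?X (max 0 (min T t)) w)" for t w
  note R = redefined_process[OF T N(1) F XF(1) N(2), where x = x, folded X'_def]
  have Rl: "law X' t = law ?X t" if "t \<in> {0..T}" for t
  proof -
   have "?X t \<in> borel_measurable M"
    using bspec[OF XF(1) that] measurable_mono[OF order_refl refl bspec[OF F that], of borel] by auto
   then show ?thesis using R(4)[OF that] R(2) by (intro distr_cong_AE) auto
  qed
  have "solution x X'"
   unfolding solution_def
  proof (intro conjI ballI allI)
   show "X' t \<in> borel_measurable (?F t)" if "t \<in> {0..T}" for t using R(1)[OF that] .
   show "X' t \<in> borel_measurable M" for t by (rule R(2))
   show "continuous_on UNIV (\<lambda>t. X' t w)" if "w \<in> space M" for w using R(3)[OF that] .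
   show "law X' t \<in> P1" if "t \<in> {0..T}" for t using bspec[OF XF(2) that] Rl[OF that] by simp
   show "X' 0 w = x" if "w \<in> space M" for w
   proof (cases "w \<in> N")
    case False
    then have w: "w \<in> space M - N" using that by simp
    have "?X 0 w = x + (LINT s:{0..0}|lborel. b s (?X s w) (law ?X s)) + B' 0 w"
     using N(3)[OF w] N(4)[OF w, of 0] T by auto
    moreover have "(LINT s:{0..0}|lborel. b s (?X s w) (law ?X s)) = 0"
     unfolding set_integral_half_open[symmetric] by (simp add: set_lebesgue_integral_def)
    ultimately show ?thesis using False T B_0[OF that] by (simp add: X'_def)
   qed (simp add: X'_def)
   show "AE w in M. set_integrable lborel {0..T} (\<lambda>s. b s (X' s w) (law X' s)) \<and>
    (\<forall>t\<in>{0..T}. X' t w = x + (LINT s:{0..t}|lborel. b s (X' s w) (law X' s)) + B' t w)"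
    using AE_not_in[OF N(1)] AE_space
   proof eventually_elim
    case (elim w)
    then have w: "w \<in> space M - N" by simp
    have b: "b s (X' s w) (law X' s) = b s (?X s w) (law ?X s)" if "s \<in> {0..T}" for s
     using that elim Rl[OF that] by (simp add: X'_def)
    have "set_integrable lborel {0..T} (\<lambda>s. b s (X' s w) (law X' s)) = set_integrable lborel {0..T} (\<lambda>s. b s (?X s w) (law ?X s))"
     by (rule set_integrable_cong) (use b in auto)
    moreover have "(LINT s:{0..t}|lborel. b s (X' s w) (law X' s)) = (LINT s:{0..t}|lborel. b s (?X s w) (law ?X s))" if "t \<in> {0..T}" for t
     by (rule set_lebesgue_integral_cong) (use b that in auto)
    ultimately show ?case using N(3)[OF w] N(4)[OF w] elim by (auto simp: X'_def)
   qed
  qed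
  then show ?thesis using R(4) by blast
 qed
 have "\<forall>x. \<exists>X'. solution x X' \<and> (\<forall>t\<in>{0..T}. AE w in M. X' t w = X x t w)" using ex by blast
 from choice[OF this] obtain X' where "\<forall>x. solution x (X' x) \<and> (\<forall>t\<in>{0..T}. AE w in M. X' x t w = X x t w)" ..
 then show ?thesis by (intro that[OF mean_field_axioms, of X']) auto
qed

section \<open>Sobolev regularity in the starting point\<close>

theorem theorem3p9:
  fixes T :: real
    and M :: "'w measure"
    and B :: "real \<Rightarrow> 'w \<Rightarrow> real"
    and b :: "real \<Rightarrow> real \<Rightarrow> real measure \<Rightarrow> real"
    and X :: "real \<Rightarrow> real \<Rightarrow> 'w \<Rightarrow> real"
    and U :: "real set"
  assumes "T > 0"
    and "prob_space M" and "complete_measure M"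
    and "brownian_motion M T B"
    and "decomposable T b"
    and "lipschitz_in_law T b"
    and "\<And>x. strong_solution M T B b x (X x)"
    and "open U" and "bounded U"
  shows "\<forall>t\<in>{0..T}. field_in_L2_W12 M U (\<lambda>x. X x t)"
proof
 fix t assume t: "t \<in> {0..T}"
 obtain B' bh bt K C X' where mf: "mean_field M T B' (augmented_filtration M B) b bh bt K C"
  and sol: "\<And>x. mean_field.solution M T B' (augmented_filtration M B) b x (X' x)"
  and eq: "\<And>x t. t \<in> {0..T} \<Longrightarrow> AE w in M. X' x t w = X x t w"
  by (rule adapted_mean_field[OF assms(1,2,4-7)]) (rule that)
 interpret mean_field M T B' "augmented_filtration M B" b bh bt K C by (rule mf)
 obtain r where r: "U \<subseteq> ball 0 r" "r > 0" using bounded_subset_ballD[OF assms(9), of 0] by blast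
 interpret U: sobolev r U
  by unfold_locales (use r assms(8) in \<open>auto simp: ball_eq_greaterThanLessThan\<close>)
 obtain c where c: "c \<ge> 0" "\<And>x y X Y t. solution x X \<Longrightarrow> solution y Y \<Longrightarrow> \<bar>x\<bar> \<le> r \<Longrightarrow> \<bar>y\<bar> \<le> r \<Longrightarrow> t \<in> {0..T} \<Longrightarrow>
  (\<integral>\<^sup>+w. ennreal ((X t w - Y t w)^2) \<partial>M) \<le> ennreal (c * (x - y)^2)"
  by (rule mean_square_stability[of r]) (rule that, assumption, blast)
 have "field_in_L2_W12 M U (\<lambda>x. X' x t)"
 proof (rule U.field_in_L2_W12I)
  show "prob_space M" by fact
  show "X' x t \<in> borel_measurable M" for x by (rule solutionD(1)[OF sol])
  show "integrable M (\<lambda>w. (X' (- r) t w)^2)" by (rule solution_square_integrable[OF sol t])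
  show "(\<integral>\<^sup>+w. ennreal ((X' x t w - X' y t w)^2) \<partial>M) \<le> ennreal (c * (x - y)^2)"
   if "x \<in> {-r..r}" "y \<in> {-r..r}" for x y
   by (rule c(2)[OF sol sol _ _ t]) (use that in auto)
 qed (rule c(1))
 then obtain Z where Z: "(\<lambda>(w, x). Z w x) \<in> borel_measurable (M \<Otimes>\<^sub>M restrict_space borel U)"
   "\<forall>x\<in>U. AE w in M. Z w x = X' x t w" "bochner_L2_W12 M U Z"
  unfolding field_in_L2_W12_def by blast
 have "AE w in M. Z w x = X x t w" if "x \<in> U" for x
  using Z(2)[rule_format, OF that] eq[OF t, of x] by eventually_elim simp
 with Z show "field_in_L2_W12 M U (\<lambda>x. X x t)" unfolding field_in_L2_W12_def by blast
qed

end
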